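(* Let $\Gamma$ be a finite simplicial graph and let $G$ be a subgroup of the right-angled Coxeter group $W_\Gamma$. Then the following hold. (1) $G$ is quasiconvex in $W_\Gamma$ if and only if $G$ is finitely generated and every (equivalently, some) standard completion for $G$ is finite. (2) (a) If $\Omega$ is a resolved completion of $G$, then $G$ has finite index in $W_\Gamma$ if and only if $\Omega$ is finite and has full valence. (b) If $(\Omega,B)$ is a completion of $G$, then $G$ has torsion if and only if there is a loop in $\Omega$ (not necessarily passing through $B$) whose label is a reduced word representing a nontrivial element of a finite special subgroup of $W_\Gamma$. (c) Let $(\Omega,B)$ be a completion of $G$ and let $\Delta=\{s\in V(\Gamma) \mid s \text{ commutes with every element of } G\}$. Then $G$ is normal in $W_\Gamma$ if and only if: (N1) for every $s\in V(\Gamma)\setminus\Delta$ there is an edge of $\Omega$ incident to $B$ with label $s$; and (N2) for every vertex $v$ of $\Omega$ there is a label-preserving graph isomorphism from the core graph $C(\Omega,B)$ to the core graph $C(\Omega,v)$ taking $B$ to $v$. (3) If $G$ is torsion-free, then any completion of $G$ is non-positively curved and has fundamental group isomorphic to $G$.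
   Context: For a finite simplicial graph $\Gamma$, the right-angled Coxeter group (RACG) is $W_\Gamma=\langle V(\Gamma)\mid s^2=1 \ (s\in V(\Gamma)),\ st=ts \text{ if } s,t \text{ are adjacent}\rangle$. A word is a finite (possibly empty) sequence of letters in $V(\Gamma)$; it is reduced if it has minimal length among words representing the same element. For $s \in V(\Gamma)$, $\mathrm{star}(s)$ is $s$ together with all vertices adjacent to $s$. A special subgroup is the subgroup generated by a subset of $V(\Gamma)$ (it is finite iff the subset spans a clique). A subgroup $G<W_\Gamma$ is quasiconvex if for some $M\ge 0$ every geodesic with endpoints in $G$ in the Cayley graph of $W_\Gamma$ with respect to $V(\Gamma)$ lies in the $M$-neighborhood of $G$. A $\Gamma$-labeled cube complex is a cube complex (cells are Euclidean unit cubes; graph-loops, i.e. edges joining a vertex to itself, and multiple edges are allowed) each of whose edges is labeled by a vertex of $\Gamma$, such that edges of a cube dual to a common midcube have the same label, and the edges of a cube incident to a common vertex of that cube have pairwise distinct labels that span a clique in $\Gamma$. Paths are simplicial paths in the $1$-skeleton; a loop is a closed path (backtracking allowed); the label of a path is the word formed by the labels of its consecutive edges. The complex is folded if no two distinct edges with the same label are incident to a common vertex, and no two distinct $i$-cubes ($i\ge 2$) have the same boundary. It is cube-full if, whenever $i$ edges are incident to a common vertex and their labels form an $i$-clique in $\Gamma$, there is an $i$-cube whose boundary contains these $i$ edges. It is non-positively curved if the link of each vertex is a flag simplicial complex. A completion of a subgroup $G<W_\Gamma$ is a connected $\Gamma$-labeled cube complex $\Omega$ with base vertex $B$ such that: (i)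 $\Omega$ is folded and cube-full; (ii) the label of every loop based at $B$ represents an element of $G$; (iii) every reduced word representing an element of $G$ is the label of some loop based at $B$. Operations on a $\Gamma$-labeled complex: a fold identifies two distinct edges $e_1,e_2$ with the same label and a common endpoint $v$, the identification respecting orientations starting at $v$ (chosen arbitrarily for a graph-loop); a cube identification identifies a collection of two or more distinct $i$-cubes ($i\ge2$) having equal boundaries to a single cube (the $1$-skeleton does not change); a cube attachment glues a labeled $i$-cube along edges $e_1,\dots,e_i$ incident to a common vertex whose labels form an $i$-clique in $\Gamma$, by identifying $i$ edges of the cube at one of its corners with $e_1,\dots,e_i$, the new edges receiving the labels induced by the midcubes. A completion of a finite connected $\Gamma$-labeled complex $X$ is the direct limit $\Omega$ of a finite or infinite sequence $X=\Omega_0\to\Omega_1\to\cdots$ of such operations, provided $\Omega$ is folded and cube-full. If $G$ is generated by a finite set of words $S_G$, let $(X(S_G),B)$ be the wedge at $B$ of one circle for each word $w \in S_G$, subdivided into $|w|$ edges labeled successively, starting at $B$, by the letters of $w$. A standard completion of $G$ is a completion of $X(S_G)$ for some finite generating set of words $S_G$ of $G$, based at the image of $B$. A completion is resolved if for every $s\in V(\Gamma)$ with $\mathrm{star}(s)=V(\Gamma)$ some edge of $\Omega$ is labeled $s$. A complex has full valence if every vertex is incident, for each $s\in V(\Gamma)$, to an edge labeled $s$. The core graph $C(\Omega,v)$ is the union of all loops in $\Omega$ based at $v$ whose labels are reduced words. *)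

theory Defs
  imports "Graph_Theory.Pair_Digraph" "HOL-Library.Infinite_Typeclass" "HOL-Algebra.Generated_Groups"
begin

section \<open>Right-angled Coxeter groups\<close>

text \<open>
  A finite simplicial graph is a \<^locale>\<open>pair_graph\<close>: a finite vertex set with a finite, symmetric,
  irreflexive set of arcs.
\<close>

definition clique :: "'v pair_pre_digraph \<Rightarrow> 'v set \<Rightarrow> bool" where
  "clique \<Gamma> K \<longleftrightarrow> K \<subseteq> pverts \<Gamma> \<and> (\<forall>s\<in>K. \<forall>t\<in>K. s \<noteq> t \<longrightarrow> (s, t) \<in> parcs \<Gamma>)"

definition star :: "'v pair_pre_digraph \<Rightarrow> 'v \<Rightarrow> 'v set" where
  "star \<Gamma> s = insert s {t. (s, t) \<in> parcs \<Gamma>}"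

text \<open>
  The generators are involutions, so no formal inverses are needed and the group with the given
  presentation is the quotient of the free monoid of words by the congruence generated by the
  relations.
\<close>

inductive word_eq :: "'v pair_pre_digraph \<Rightarrow> 'v list \<Rightarrow> 'v list \<Rightarrow> bool" for \<Gamma> where
  refl: "w \<in> lists (pverts \<Gamma>) \<Longrightarrow> word_eq \<Gamma> w w"
| sym: "word_eq \<Gamma> u w \<Longrightarrow> word_eq \<Gamma> w u"
| trans: "word_eq \<Gamma> u w \<Longrightarrow> word_eq \<Gamma> w x \<Longrightarrow> word_eq \<Gamma> u x"
| square: "u \<in> lists (pverts \<Gamma>) \<Longrightarrow> w \<in> lists (pverts \<Gamma>) \<Longrightarrow> s \<in> pverts \<Gamma> \<Longrightarrow>
    word_eq \<Gamma> (u @ [s, s] @ w) (u @ w)"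
| swap: "u \<in> lists (pverts \<Gamma>) \<Longrightarrow> w \<in> lists (pverts \<Gamma>) \<Longrightarrow> (s, t) \<in> parcs \<Gamma> \<Longrightarrow>
    word_eq \<Gamma> (u @ [s, t] @ w) (u @ [t, s] @ w)"

definition word_elem :: "'v pair_pre_digraph \<Rightarrow> 'v list \<Rightarrow> 'v list set" where
  "word_elem \<Gamma> w = {u. word_eq \<Gamma> w u}"

definition racg :: "'v pair_pre_digraph \<Rightarrow> 'v list set monoid" where
  "racg \<Gamma> = \<lparr>carrier = word_elem \<Gamma> ` lists (pverts \<Gamma>),
            mult = (\<lambda>g h. \<Union>u\<in>g. \<Union>w\<in>h. word_elem \<Gamma> (u @ w)),
            one = word_elem \<Gamma> []\<rparr>"

definition reduced :: "'v pair_pre_digraph \<Rightarrow> 'v list \<Rightarrow> bool" where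
  "reduced \<Gamma> w \<longleftrightarrow> w \<in> lists (pverts \<Gamma>) \<and>
     (\<forall>u\<in>lists (pverts \<Gamma>). word_elem \<Gamma> u = word_elem \<Gamma> w \<longrightarrow> length w \<le> length u)"

definition gens :: "'v pair_pre_digraph \<Rightarrow> 'v set \<Rightarrow> 'v list set set" where
  "gens \<Gamma> T = (\<lambda>s. word_elem \<Gamma> [s]) ` T"

definition special_subgroup :: "'v pair_pre_digraph \<Rightarrow> 'v set \<Rightarrow> 'v list set set" where
  "special_subgroup \<Gamma> T = generate (racg \<Gamma>) (gens \<Gamma> T)"


section \<open>Properties of subgroups\<close>

definition finitely_generated :: "('g, 'b) monoid_scheme \<Rightarrow> 'g set \<Rightarrow> bool" where
  "finitely_generated H G \<longleftrightarrow> (\<exists>S. finite S \<and> S \<subseteq> carrier H \<and> generate H S = G)"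

definition has_torsion :: "('g, 'b) monoid_scheme \<Rightarrow> 'g set \<Rightarrow> bool" where
  "has_torsion H G \<longleftrightarrow> (\<exists>g\<in>G. g \<noteq> \<one>\<^bsub>H\<^esub> \<and> (\<exists>n>0. g [^]\<^bsub>H\<^esub> (n::nat) = \<one>\<^bsub>H\<^esub>))"

text \<open>
  Edge paths, distance and geodesics in the Cayley graph of \<open>H\<close> with respect to \<open>S\<close>; a path is given
  by its list of vertices.
\<close>

definition cayley_path :: "('g, 'b) monoid_scheme \<Rightarrow> 'g set \<Rightarrow> 'g list \<Rightarrow> bool" where
  "cayley_path H S p \<longleftrightarrow> p \<noteq> [] \<and> set p \<subseteq> carrier H \<and>
     successively (\<lambda>g h. \<exists>s\<in>S. h = g \<otimes>\<^bsub>H\<^esub> s \<or> g = h \<otimes>\<^bsub>H\<^esub> s) p"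

definition cayley_dist :: "('g, 'b) monoid_scheme \<Rightarrow> 'g set \<Rightarrow> 'g \<Rightarrow> 'g \<Rightarrow> nat" where
  "cayley_dist H S g h =
     (LEAST n. \<exists>p. cayley_path H S p \<and> hd p = g \<and> last p = h \<and> length p = Suc n)"

definition cayley_geodesic :: "('g, 'b) monoid_scheme \<Rightarrow> 'g set \<Rightarrow> 'g list \<Rightarrow> bool" where
  "cayley_geodesic H S p \<longleftrightarrow>
     cayley_path H S p \<and> length p = Suc (cayley_dist H S (hd p) (last p))"

definition quasiconvex :: "('g, 'b) monoid_scheme \<Rightarrow> 'g set \<Rightarrow> 'g set \<Rightarrow> bool" where
  "quasiconvex H S G \<longleftrightarrow>
     (\<exists>M. \<forall>p. cayley_geodesic H S p \<and> hd p \<in> G \<and> last p \<in> G \<longrightarrow>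
        (\<forall>x\<in>set p. \<exists>g\<in>G. cayley_dist H S x g \<le> M))"


section \<open>Labeled cube complexes\<close>

text \<open>
  In a labeled cube complex the directions of a cube carry distinct labels that form a clique \<open>K\<close>, and
  parallel edges of the cube have the same label.  Hence the characteristic maps of the cube, up to
  reversing directions, are canonically maps from \<open>[0,1]\<^sup>K\<close>.  A complex is recorded through
  its set \<^term>\<open>cubes X\<close> of all these \<^emph>\<open>parametrized\<close> cubes: a geometric cube labeled by \<open>K\<close>
  corresponds to \<open>2 ^ card K\<close> elements, one for each choice of the corner placed at \<open>0\<close>.

  Corners of \<open>[0,1]\<^sup>K\<close> are subsets of \<open>K\<close>.  For \<open>L \<subseteq> K\<close> and \<open>A \<subseteq> K\<close>, the cube \<open>face X L A c\<close> is the
  restriction of the parametrized \<open>K\<close>-cube \<open>c\<close> along the map from \<open>[0,1]\<^sup>L\<close> to \<open>[0,1]\<^sup>K\<close>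
  that sends a corner \<open>Y \<subseteq> L\<close> to the symmetric difference of \<open>Y\<close> and \<open>A\<close>: outside \<open>L\<close> the set \<open>A\<close>
  says which coordinates are fixed to \<open>1\<close>, inside \<open>L\<close> it says which coordinates are reversed.

  Elements with label set \<open>{}\<close> are the vertices.  Elements with a one-element label set are the oriented
  edges (each geometric edge occurs in its two orientations, which are distinct also when the edge
  is a graph-loop).
\<close>

record ('v, 'c) labeled_complex =
  cubes :: "'c set"
  labels :: "'c \<Rightarrow> 'v set"
  face :: "'v set \<Rightarrow> 'v set \<Rightarrow> 'c \<Rightarrow> 'c"

text \<open>The last condition says that distinct parametrizations of a geometric cube are distinct.\<close>

definition labeled_cube_complex ::
    "'v pair_pre_digraph \<Rightarrow> ('v, 'c) labeled_complex \<Rightarrow> bool" where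
  "labeled_cube_complex \<Gamma> X \<longleftrightarrow> (\<forall>c\<in>cubes X.
     clique \<Gamma> (labels X c) \<and>
     (\<forall>L\<subseteq>labels X c. \<forall>A\<subseteq>labels X c. face X L A c \<in> cubes X \<and> labels X (face X L A c) = L) \<and>
     face X (labels X c) {} c = c \<and>
     (\<forall>L\<subseteq>labels X c. \<forall>A\<subseteq>labels X c. \<forall>M\<subseteq>L. \<forall>B\<subseteq>L.
        face X M B (face X L A c) = face X M (sym_diff A B) c) \<and>
     (\<forall>A\<subseteq>labels X c. face X (labels X c) A c = c \<longrightarrow> A = {}))"

definition vertices :: "('v, 'c) labeled_complex \<Rightarrow> 'c set" where
  "vertices X = {v \<in> cubes X. labels X v = {}}"

definition edges :: "('v, 'c) labeled_complex \<Rightarrow> 'c set" where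
  "edges X = {e \<in> cubes X. \<exists>s. labels X e = {s}}"

definition edge_label :: "('v, 'c) labeled_complex \<Rightarrow> 'c \<Rightarrow> 'v" where
  "edge_label X e = the_elem (labels X e)"

definition edge_start :: "('v, 'c) labeled_complex \<Rightarrow> 'c \<Rightarrow> 'c" where
  "edge_start X e = face X {} {} e"

definition edge_end :: "('v, 'c) labeled_complex \<Rightarrow> 'c \<Rightarrow> 'c" where
  "edge_end X e = face X {} (labels X e) e"

definition edge_rev :: "('v, 'c) labeled_complex \<Rightarrow> 'c \<Rightarrow> 'c" where
  "edge_rev X e = face X (labels X e) (labels X e) e"

definition faces :: "('v, 'c) labeled_complex \<Rightarrow> 'c \<Rightarrow> 'c set" where
  "faces X c = {face X L A c | L A. L \<subseteq> labels X c \<and> A \<subseteq> labels X c}"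

definition same_geometric_cube :: "('v, 'c) labeled_complex \<Rightarrow> 'c \<Rightarrow> 'c \<Rightarrow> bool" where
  "same_geometric_cube X c d \<longleftrightarrow> (\<exists>A\<subseteq>labels X c. d = face X (labels X c) A c)"

text \<open>
  Two parametrized cubes agree on the boundary.  Geometric cubes have the same boundary if this holds
  for some choice of parametrizations, that is, if their attaching maps agree.
\<close>

definition same_boundary :: "('v, 'c) labeled_complex \<Rightarrow> 'c \<Rightarrow> 'c \<Rightarrow> bool" where
  "same_boundary X c d \<longleftrightarrow> labels X c = labels X d \<and>
     (\<forall>L\<subset>labels X c. \<forall>A\<subseteq>labels X c. face X L A c = face X L A d)"

definition folded :: "('v, 'c) labeled_complex \<Rightarrow> bool" where
  "folded X \<longleftrightarrow>
     (\<forall>e\<in>edges X. \<forall>e'\<in>edges X. labels X e = labels X e' \<and> edge_start X e = edge_start X e' \<longrightarrow>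
        same_geometric_cube X e e') \<and>
     (\<forall>c\<in>cubes X. \<forall>d\<in>cubes X. 2 \<le> card (labels X c) \<and> same_boundary X c d \<longrightarrow>
        same_geometric_cube X c d)"

definition cube_full :: "'v pair_pre_digraph \<Rightarrow> ('v, 'c) labeled_complex \<Rightarrow> bool" where
  "cube_full \<Gamma> X \<longleftrightarrow>
     (\<forall>v\<in>vertices X. \<forall>K e. K \<noteq> {} \<and> clique \<Gamma> K \<and>
        (\<forall>s\<in>K. e s \<in> edges X \<and> labels X (e s) = {s} \<and> edge_start X (e s) = v) \<longrightarrow>
        (\<exists>c\<in>cubes X. labels X c = K \<and> (\<forall>s\<in>K. e s \<in> faces X c)))"

definition full_valence :: "'v pair_pre_digraph \<Rightarrow> ('v, 'c) labeled_complex \<Rightarrow> bool" where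
  "full_valence \<Gamma> X \<longleftrightarrow> (\<forall>v\<in>vertices X. \<forall>s\<in>pverts \<Gamma>.
     \<exists>e\<in>edges X. labels X e = {s} \<and> edge_start X e = v)"

definition resolved :: "'v pair_pre_digraph \<Rightarrow> ('v, 'c) labeled_complex \<Rightarrow> bool" where
  "resolved \<Gamma> X \<longleftrightarrow>
     (\<forall>s\<in>pverts \<Gamma>. star \<Gamma> s = pverts \<Gamma> \<longrightarrow> (\<exists>e\<in>edges X. labels X e = {s}))"

text \<open>
  The simplices of the link of \<open>v\<close> are the pairs of a positive-dimensional geometric cube and one of its
  corners lying at \<open>v\<close>, equivalently the parametrized cubes whose corner \<open>0\<close> is \<open>v\<close>.  The vertices of
  such a simplex are the edges of the cube at that corner, oriented away from \<open>v\<close>.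
\<close>

definition link_simplices :: "('v, 'c) labeled_complex \<Rightarrow> 'c \<Rightarrow> 'c set" where
  "link_simplices X v = {c \<in> cubes X. labels X c \<noteq> {} \<and> face X {} {} c = v}"

definition simplex_vertices :: "('v, 'c) labeled_complex \<Rightarrow> 'c \<Rightarrow> 'c set" where
  "simplex_vertices X c = (\<lambda>s. face X {s} {} c) ` labels X c"

definition link_simplicial :: "('v, 'c) labeled_complex \<Rightarrow> 'c \<Rightarrow> bool" where
  "link_simplicial X v \<longleftrightarrow>
     (\<forall>c\<in>link_simplices X v. card (simplex_vertices X c) = card (labels X c)) \<and>
     inj_on (simplex_vertices X) (link_simplices X v)"

definition link_flag :: "('v, 'c) labeled_complex \<Rightarrow> 'c \<Rightarrow> bool" where
  "link_flag X v \<longleftrightarrow>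
     (\<forall>S. finite S \<and> S \<noteq> {} \<and> S \<subseteq> {e \<in> edges X. edge_start X e = v} \<and>
        (\<forall>e\<in>S. \<forall>e'\<in>S. e \<noteq> e' \<longrightarrow> {e, e'} \<in> simplex_vertices X ` link_simplices X v) \<longrightarrow>
        S \<in> simplex_vertices X ` link_simplices X v)"

definition nonpositively_curved :: "('v, 'c) labeled_complex \<Rightarrow> bool" where
  "nonpositively_curved X \<longleftrightarrow> (\<forall>v\<in>vertices X. link_simplicial X v \<and> link_flag X v)"


section \<open>Paths, core graphs and the fundamental group\<close>

fun edge_path :: "('v, 'c) labeled_complex \<Rightarrow> 'c \<Rightarrow> 'c list \<Rightarrow> 'c \<Rightarrow> bool" where
  "edge_path X u [] v \<longleftrightarrow> u \<in> vertices X \<and> u = v"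
| "edge_path X u (e # p) v \<longleftrightarrow>
     e \<in> edges X \<and> edge_start X e = u \<and> edge_path X (edge_end X e) p v"

abbreviation edge_loop :: "('v, 'c) labeled_complex \<Rightarrow> 'c \<Rightarrow> 'c list \<Rightarrow> bool" where
  "edge_loop X v p \<equiv> edge_path X v p v"

definition path_label :: "('v, 'c) labeled_complex \<Rightarrow> 'c list \<Rightarrow> 'v list" where
  "path_label X p = map (edge_label X) p"

definition path_connected_complex :: "('v, 'c) labeled_complex \<Rightarrow> bool" where
  "path_connected_complex X \<longleftrightarrow>
     vertices X \<noteq> {} \<and> (\<forall>u\<in>vertices X. \<forall>v\<in>vertices X. \<exists>p. edge_path X u p v)"

text \<open>
  The empty path has the reduced label \<open>[]\<close>, so \<open>v\<close> belongs to its core graph.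
\<close>

definition core_graph ::
    "'v pair_pre_digraph \<Rightarrow> ('v, 'c) labeled_complex \<Rightarrow> 'c \<Rightarrow> ('v, 'c) labeled_complex" where
  "core_graph \<Gamma> X v =
     X\<lparr>cubes := {v} \<union> (\<Union>p\<in>{p. edge_loop X v p \<and> reduced \<Gamma> (path_label X p)}. \<Union>e\<in>set p. faces X e)\<rparr>"

text \<open>
  Fundamental group of a complex as the edge-path group: edge loops at \<open>B\<close> modulo insertion and
  deletion of backtracks and of boundary cycles of squares.
\<close>

definition square_boundary :: "('v, 'c) labeled_complex \<Rightarrow> 'v \<Rightarrow> 'v \<Rightarrow> 'c \<Rightarrow> 'c list" where
  "square_boundary X s t c =
     [face X {s} {} c, face X {t} {s} c, face X {s} {s, t} c, face X {t} {t} c]"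

inductive homotopic_loops :: "('v, 'c) labeled_complex \<Rightarrow> 'c \<Rightarrow> 'c list \<Rightarrow> 'c list \<Rightarrow> bool"
  for X B where
  refl: "edge_loop X B p \<Longrightarrow> homotopic_loops X B p p"
| sym: "homotopic_loops X B p q \<Longrightarrow> homotopic_loops X B q p"
| trans: "homotopic_loops X B p q \<Longrightarrow> homotopic_loops X B q r \<Longrightarrow> homotopic_loops X B p r"
| backtrack: "edge_loop X B (p @ [e, edge_rev X e] @ q) \<Longrightarrow>
    homotopic_loops X B (p @ [e, edge_rev X e] @ q) (p @ q)"
| square: "c \<in> cubes X \<Longrightarrow> labels X c = {s, t} \<Longrightarrow> s \<noteq> t \<Longrightarrow>
    edge_loop X B (p @ square_boundary X s t c @ q) \<Longrightarrow>
    homotopic_loops X B (p @ square_boundary X s t c @ q) (p @ q)"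

definition loop_class :: "('v, 'c) labeled_complex \<Rightarrow> 'c \<Rightarrow> 'c list \<Rightarrow> 'c list set" where
  "loop_class X B p = {q. homotopic_loops X B p q}"

definition fundamental_group :: "('v, 'c) labeled_complex \<Rightarrow> 'c \<Rightarrow> 'c list set monoid" where
  "fundamental_group X B =
     \<lparr>carrier = loop_class X B ` {p. edge_loop X B p},
      mult = (\<lambda>g h. \<Union>p\<in>g. \<Union>q\<in>h. loop_class X B (p @ q)),
      one = loop_class X B []\<rparr>"


section \<open>Morphisms and operations\<close>

definition labeled_hom ::
    "('c \<Rightarrow> 'd) \<Rightarrow> ('v, 'c) labeled_complex \<Rightarrow> ('v, 'd) labeled_complex \<Rightarrow> bool" where
  "labeled_hom f X Y \<longleftrightarrow> (\<forall>c\<in>cubes X. f c \<in> cubes Y \<and> labels Y (f c) = labels X c \<and>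
     (\<forall>L\<subseteq>labels X c. \<forall>A\<subseteq>labels X c. f (face X L A c) = face Y L A (f c)))"

definition labeled_iso ::
    "('c \<Rightarrow> 'd) \<Rightarrow> ('v, 'c) labeled_complex \<Rightarrow> ('v, 'd) labeled_complex \<Rightarrow> bool" where
  "labeled_iso f X Y \<longleftrightarrow> labeled_hom f X Y \<and> bij_betw f (cubes X) (cubes Y)"

text \<open>
  Each operation is described by the map \<open>f\<close> from the old complex \<open>X\<close> to the new complex \<open>Y\<close>, which
  determines \<open>Y\<close> up to isomorphism.
\<close>

definition fold_operation ::
    "('c \<Rightarrow> 'c) \<Rightarrow> ('v, 'c) labeled_complex \<Rightarrow> ('v, 'c) labeled_complex \<Rightarrow> bool" where
  "fold_operation f X Y \<longleftrightarrow> labeled_hom f X Y \<and> f ` cubes X = cubes Y \<and>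
     (\<exists>e1\<in>edges X. \<exists>e2\<in>edges X.
        labels X e1 = labels X e2 \<and> edge_start X e1 = edge_start X e2 \<and>
        \<not> same_geometric_cube X e1 e2 \<and>
        (\<forall>x\<in>cubes X. \<forall>y\<in>cubes X. f x = f y \<longleftrightarrow>
           x = y \<or> {x, y} = {e1, e2} \<or> {x, y} = {edge_rev X e1, edge_rev X e2} \<or>
           {x, y} = {edge_end X e1, edge_end X e2}))"

text \<open>
  \<open>P\<close> contains one parametrization for each of the cubes to be identified, chosen so that they agree on
  the boundary.
\<close>

definition cube_identification ::
    "('c \<Rightarrow> 'c) \<Rightarrow> ('v, 'c) labeled_complex \<Rightarrow> ('v, 'c) labeled_complex \<Rightarrow> bool" where
  "cube_identification f X Y \<longleftrightarrow> labeled_hom f X Y \<and> f ` cubes X = cubes Y \<and>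
     (\<exists>P\<subseteq>cubes X. \<exists>K. 2 \<le> card K \<and> (\<exists>p\<in>P. \<exists>q\<in>P. p \<noteq> q) \<and>
        (\<forall>p\<in>P. labels X p = K) \<and>
        (\<forall>p\<in>P. \<forall>q\<in>P. p \<noteq> q \<longrightarrow> same_boundary X p q \<and> \<not> same_geometric_cube X p q) \<and>
        (\<forall>x\<in>cubes X. \<forall>y\<in>cubes X. f x = f y \<longleftrightarrow>
           x = y \<or> (\<exists>p\<in>P. \<exists>q\<in>P. \<exists>A\<subseteq>K. x = face X K A p \<and> y = face X K A q)))"

text \<open>
  A \<open>K\<close>-cube \<open>c\<close> is glued along its edges at the corner \<open>0\<close> to the oriented edges \<open>e s\<close>.  The glued part
  of \<open>[0,1]\<^sup>K\<close> consists of the parametrized faces \<open>(L, A)\<close> with \<open>L \<union> A \<subseteq> {s}\<close> for some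
  \<open>s\<close>; all other faces are new, and no identifications take place among them.
\<close>

definition cube_attachment :: "'v pair_pre_digraph \<Rightarrow>
    ('c \<Rightarrow> 'c) \<Rightarrow> ('v, 'c) labeled_complex \<Rightarrow> ('v, 'c) labeled_complex \<Rightarrow> bool" where
  "cube_attachment \<Gamma> f X Y \<longleftrightarrow> labeled_hom f X Y \<and> inj_on f (cubes X) \<and>
     (\<exists>v\<in>vertices X. \<exists>K e. \<exists>c\<in>cubes Y. clique \<Gamma> K \<and> 2 \<le> card K \<and>
        (\<forall>s\<in>K. e s \<in> edges X \<and> labels X (e s) = {s} \<and> edge_start X (e s) = v) \<and>
        labels Y c = K \<and> (\<forall>s\<in>K. face Y {s} {} c = f (e s)) \<and>
        (let N = {(L, A). L \<subseteq> K \<and> A \<subseteq> K \<and> \<not> (\<exists>s\<in>K. L \<union> A \<subseteq> {s})};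
             new = (\<lambda>(L, A). face Y L A c)
         in inj_on new N \<and> new ` N \<inter> f ` cubes X = {} \<and> cubes Y = f ` cubes X \<union> new ` N))"

definition operation :: "'v pair_pre_digraph \<Rightarrow>
    ('c \<Rightarrow> 'c) \<Rightarrow> ('v, 'c) labeled_complex \<Rightarrow> ('v, 'c) labeled_complex \<Rightarrow> bool" where
  "operation \<Gamma> f X Y \<longleftrightarrow>
     fold_operation f X Y \<or> cube_identification f X Y \<or> cube_attachment \<Gamma> f X Y"

text \<open>Identity steps are admitted so that finite sequences are covered as well.\<close>

definition operation_sequence :: "'v pair_pre_digraph \<Rightarrow>
    (nat \<Rightarrow> ('v, 'c) labeled_complex) \<Rightarrow> (nat \<Rightarrow> 'c \<Rightarrow> 'c) \<Rightarrow> bool" where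
  "operation_sequence \<Gamma> \<Omega> f \<longleftrightarrow> (\<forall>n. labeled_cube_complex \<Gamma> (\<Omega> n) \<and>
     (operation \<Gamma> (f n) (\<Omega> n) (\<Omega> (Suc n)) \<or> \<Omega> (Suc n) = \<Omega> n \<and> f n = id))"

fun composite :: "(nat \<Rightarrow> 'c \<Rightarrow> 'c) \<Rightarrow> nat \<Rightarrow> nat \<Rightarrow> 'c \<Rightarrow> 'c" where
  "composite f n 0 = id"
| "composite f n (Suc k) = f (n + k) \<circ> composite f n k"

definition direct_limit :: "(nat \<Rightarrow> ('v, 'c) labeled_complex) \<Rightarrow> (nat \<Rightarrow> 'c \<Rightarrow> 'c) \<Rightarrow>
    ('v, 'c) labeled_complex \<Rightarrow> (nat \<Rightarrow> 'c \<Rightarrow> 'c) \<Rightarrow> bool" where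
  "direct_limit \<Omega> f L g \<longleftrightarrow>
     (\<forall>n. labeled_hom (g n) (\<Omega> n) L) \<and>
     (\<forall>n. \<forall>x\<in>cubes (\<Omega> n). g (Suc n) (f n x) = g n x) \<and>
     cubes L = (\<Union>n. g n ` cubes (\<Omega> n)) \<and>
     (\<forall>n. \<forall>x\<in>cubes (\<Omega> n). \<forall>y\<in>cubes (\<Omega> n).
        g n x = g n y \<longrightarrow> (\<exists>k. composite f n k x = composite f n k y))"


section \<open>Completions\<close>

text \<open>\<open>h\<close> is the canonical map from \<open>X\<close> to its completion \<open>\<Omega>\<close>.\<close>

definition completion_of_complex :: "'v pair_pre_digraph \<Rightarrow> ('v, 'a) labeled_complex \<Rightarrow>
    ('v, 'c) labeled_complex \<Rightarrow> ('a \<Rightarrow> 'c) \<Rightarrow> bool" where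
  "completion_of_complex \<Gamma> X \<Omega> h \<longleftrightarrow>
     labeled_cube_complex \<Gamma> X \<and> finite (cubes X) \<and> path_connected_complex X \<and>
     labeled_cube_complex \<Gamma> \<Omega> \<and> folded \<Omega> \<and> cube_full \<Gamma> \<Omega> \<and>
     (\<exists>\<Omega>s f g i. operation_sequence \<Gamma> \<Omega>s f \<and> labeled_iso i X (\<Omega>s 0) \<and>
        direct_limit \<Omega>s f \<Omega> g \<and> h = g 0 \<circ> i)"

text \<open>
  The wedge of subdivided circles: \<open>Knot w i\<close> is the \<open>i\<close>-th interior vertex of the circle for the
  word \<open>w\<close>, and \<open>Seg w i r\<close> is its \<open>i\<close>-th edge, reversed if \<open>r\<close> holds.  The empty word contributes
  no cells.
\<close>

datatype 'v rose_cell = Hub | Knot "'v list" nat | Seg "'v list" nat bool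

definition rose_vertex :: "'v list \<Rightarrow> nat \<Rightarrow> 'v rose_cell" where
  "rose_vertex w i = (if i = 0 \<or> i = length w then Hub else Knot w i)"

fun rose_labels :: "'v rose_cell \<Rightarrow> 'v set" where
  "rose_labels (Seg w i r) = {w ! i}"
| "rose_labels _ = {}"

fun rose_face :: "'v set \<Rightarrow> 'v set \<Rightarrow> 'v rose_cell \<Rightarrow> 'v rose_cell" where
  "rose_face L A (Seg w i r) =
     (if L = {} then rose_vertex w (if r = (A = {}) then Suc i else i)
      else Seg w i (r \<noteq> (A \<noteq> {})))"
| "rose_face L A c = c"

definition rose :: "'v list set \<Rightarrow> ('v, 'v rose_cell) labeled_complex" where
  "rose S = \<lparr>cubes = {Hub} \<union> {Knot w i | w i. w \<in> S \<and> 0 < i \<and> i < length w}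
                      \<union> {Seg w i r | w i r. w \<in> S \<and> i < length w},
             labels = rose_labels,
             face = rose_face\<rparr>"

definition standard_completion :: "'v pair_pre_digraph \<Rightarrow> 'v list set set \<Rightarrow>
    ('v, 'c) labeled_complex \<Rightarrow> 'c \<Rightarrow> bool" where
  "standard_completion \<Gamma> G \<Omega> B \<longleftrightarrow>
     (\<exists>S h. finite S \<and> S \<subseteq> lists (pverts \<Gamma>) \<and> generate (racg \<Gamma>) (word_elem \<Gamma> ` S) = G \<and>
        completion_of_complex \<Gamma> (rose S) \<Omega> h \<and> B = h Hub)"

definition completion :: "'v pair_pre_digraph \<Rightarrow> 'v list set set \<Rightarrow>
    ('v, 'c) labeled_complex \<Rightarrow> 'c \<Rightarrow> bool" where
  "completion \<Gamma> G \<Omega> B \<longleftrightarrow>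
     labeled_cube_complex \<Gamma> \<Omega> \<and> path_connected_complex \<Omega> \<and> B \<in> vertices \<Omega> \<and>
     folded \<Omega> \<and> cube_full \<Gamma> \<Omega> \<and>
     (\<forall>p. edge_loop \<Omega> B p \<longrightarrow> word_elem \<Gamma> (path_label \<Omega> p) \<in> G) \<and>
     (\<forall>w. reduced \<Gamma> w \<and> word_elem \<Gamma> w \<in> G \<longrightarrow> (\<exists>p. edge_loop \<Omega> B p \<and> path_label \<Omega> p = w))"

end

theory Submission
  imports Defs
begin

text \<open>
  A word is reduced iff no two equal letters can be shuffled next to each other, and two reduced words
  for the same element differ by shuffling commuting letters.  In a folded, cube-full complex shuffling
  and cancelling can be carried out along paths with fixed end points, so the end point of a path from
  the base vertex depends only on the group element spelled by its label.  Hence the vertices of a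
  completion correspond to the cosets \<open>G x\<close> with \<open>x\<close> in a convex \<open>G\<close>-invariant subset of the
  group, and index, torsion and normality are read off from labels of loops.

  If \<open>G\<close> is torsion-free, no loop has a nontrivial clique as its label.  Hence cubes embed and are
  determined by their labels and one corner, and homotopy of loops is equality of the spelled elements.

  Loop labels of a standard completion lie in \<open>G\<close> because a label-preserving map to the Schreier graph
  of \<open>G\<close> extends over each operation.  For quasiconvex \<open>G\<close> the convex subset lies in the hull, cut out
  by walls, of finitely many cosets of \<open>G\<close>.  If \<open>y\<close> is a point of these cosets closest to a point \<open>z\<close> of
  the hull, then every wall between \<open>y\<close> and \<open>z\<close> also separates \<open>y\<close> from a third point of the cosets.
  The median of the three points shows that the wall is crossed by a path of bounded length from \<open>y\<close>.
  So there are boundedly many such walls, the hull is close to \<open>G\<close>, and the completion is finite.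
\<close>

section \<open>Words\<close>

text \<open>These rules make \<open>auto\<close> rewrite membership of words to membership of letters.\<close>

declare in_listsD [rule del] in_listsI [rule del]

text \<open>Two obstacles shape the proof. A vertex may lack edges, so an unreduced word need not be
  readable from it even if a reduced word for the same element is; the passage from a group element
  to a path therefore goes through \<open>nf\<close>. Graph-loops are allowed, and such a loop and
  its reverse start at the same vertex with the same label; folding thus determines an edge only up
  to reversal, but its end point completely. This is why most arguments use \<open>walk\<close>,
  which forgets the edges; individual edges have to be followed for core graphs and for homotopies.

  A hull cut out by walls is used because it survives cube attachment: every wall crossed on the way
  to the far corner of a cube is crossed by one of the glued edges.

  Existence of standard completions has to be proved as well, since without it the statement that
  all of them are finite could hold vacuously. Attachments may call for new folds and further
  attachments without end, so the tasks are scheduled fairly and the result is a direct limit, whose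
  cells need room in an infinite type.\<close>

locale right_angled =
  fixes \<Gamma> :: "'v pair_pre_digraph"
  assumes graph: "pair_graph \<Gamma>"
begin

abbreviation adj :: "'v \<Rightarrow> 'v \<Rightarrow> bool" where
  "adj s t \<equiv> (s, t) \<in> parcs \<Gamma>"

abbreviation words :: "'v list set" where
  "words \<equiv> lists (pverts \<Gamma>)"

abbreviation eq :: "'v list \<Rightarrow> 'v list \<Rightarrow> bool" (infix "\<approx>" 50) where
  "u \<approx> w \<equiv> word_eq \<Gamma> u w"

lemma adj_sym: "adj s t \<Longrightarrow> adj t s"
proof -
  assume a: "adj s t"
  interpret pair_graph \<Gamma> by (rule graph)
  show "adj t s" using pair_sym_arcs a by (simp add: symmetric_def sym_def)
qed

lemma adj_irrefl [simp]: "\<not> adj s s"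
proof
  assume a: "adj s s"
  interpret pair_graph \<Gamma> by (rule graph)
  show False using pair_no_loops[OF a] by simp
qed

lemma adj_in: "adj s t \<Longrightarrow> s \<in> pverts \<Gamma> \<and> t \<in> pverts \<Gamma>"
proof -
  assume a: "adj s t"
  interpret pair_graph \<Gamma> by (rule graph)
  show ?thesis using in_arcsD1[OF a] in_arcsD2[OF a] by simp
qed

lemma finite_pverts [simp]: "finite (pverts \<Gamma>)"
proof -
  interpret pair_graph \<Gamma> by (rule graph)
  show ?thesis by (rule pair_finite_verts)
qed

lemma eq_in: "u \<approx> w \<Longrightarrow> u \<in> words \<and> w \<in> words"
  by (induction rule: word_eq.induct) (auto dest: adj_in)

lemma eq_context: "u \<approx> w \<Longrightarrow> x \<in> words \<Longrightarrow> y \<in> words \<Longrightarrow> x @ u @ y \<approx> x @ w @ y"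
proof (induction rule: word_eq.induct)
  case (refl w)
  then show ?case by (intro word_eq.refl) auto
next
  case (sym u w)
  then show ?case by (blast intro: word_eq.sym)
next
  case (trans u w x)
  then show ?case by (blast intro: word_eq.trans)
next
  case (square u w s)
  then show ?case using word_eq.square[of "x @ u" \<Gamma> "w @ y" s] by simp
next
  case (swap u w s t)
  then show ?case using word_eq.swap[of "x @ u" \<Gamma> "w @ y" s t] by simp
qed

lemma eq_append: "u \<approx> u' \<Longrightarrow> w \<approx> w' \<Longrightarrow> u @ w \<approx> u' @ w'"
proof -
  assume a: "u \<approx> u'" "w \<approx> w'"
  have "[] @ u @ w \<approx> [] @ u' @ w" using a eq_in by (intro eq_context) auto
  moreover have "u' @ w @ [] \<approx> u' @ w' @ []" using a eq_in by (intro eq_context) auto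
  ultimately show ?thesis by (auto intro: word_eq.trans)
qed

lemma eq_refl [simp, intro]: "w \<in> words \<Longrightarrow> w \<approx> w"
  by (rule word_eq.refl)

lemma eq_sym: "u \<approx> w \<Longrightarrow> w \<approx> u"
  by (rule word_eq.sym)

lemma eq_trans [trans]: "u \<approx> w \<Longrightarrow> w \<approx> x \<Longrightarrow> u \<approx> x"
  by (rule word_eq.trans)

lemma rev_in [simp]: "rev w \<in> words \<longleftrightarrow> w \<in> words"
  by (auto simp: in_lists_conv_set)

lemma rev_right: "w \<in> words \<Longrightarrow> w @ rev w \<approx> []"
proof (induction w)
  case (Cons s w)
  have "[s] @ (w @ rev w) @ [s] \<approx> [s] @ [] @ [s]"
    using Cons by (intro eq_context) auto
  also have "[s] @ [] @ [s] \<approx> []"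
    using word_eq.square[of "[]" \<Gamma> "[]" s] Cons by simp
  finally show ?case by simp
qed auto

lemma rev_left: "w \<in> words \<Longrightarrow> rev w @ w \<approx> []"
  using rev_right[of "rev w"] by simp

lemma eq_rev: "u \<approx> w \<Longrightarrow> rev u \<approx> rev w"
proof (induction rule: word_eq.induct)
  case (square u w s)
  then show ?case using word_eq.square[of "rev w" \<Gamma> "rev u" s] by simp
next
  case (swap u w s t)
  then show ?case using word_eq.swap[of "rev w" \<Gamma> "rev u" t s] by (simp add: adj_sym)
qed (auto intro: word_eq.sym word_eq.trans)

lemma eq_cancel_left: "x \<in> words \<Longrightarrow> u \<in> words \<Longrightarrow> w \<in> words \<Longrightarrow> x @ u \<approx> x @ w \<longleftrightarrow> u \<approx> w"
proof
  assume a: "x \<in> words" "u \<in> words" "w \<in> words" "x @ u \<approx> x @ w"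
  have "u \<approx> (rev x @ x) @ u"
    using a eq_append[OF rev_left[of x] eq_refl[of u]] by (simp add: eq_sym)
  also have "(rev x @ x) @ u \<approx> (rev x @ x) @ w" using eq_append[of "rev x" "rev x", OF _ a(4)] a by simp
  also have "(rev x @ x) @ w \<approx> w" 
    using a eq_append[OF rev_left[of x] eq_refl[of w]] by simp
  finally show "u \<approx> w" .
qed (auto intro: eq_append)

lemma eq_cancel_right: "x \<in> words \<Longrightarrow> u \<in> words \<Longrightarrow> w \<in> words \<Longrightarrow> u @ x \<approx> w @ x \<longleftrightarrow> u \<approx> w"
  using eq_cancel_left[of "rev x" "rev u" "rev w"] eq_rev[of "u @ x" "w @ x"] eq_rev[of "rev u" "rev w"]
  by (auto intro: eq_append)

lemma eq_move_left: "x \<in> words \<Longrightarrow> u \<in> words \<Longrightarrow> w \<in> words \<Longrightarrow> rev x @ u \<approx> w \<longleftrightarrow> u \<approx> x @ w"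
proof -
  assume a: "x \<in> words" "u \<in> words" "w \<in> words"
  have "rev x @ u \<approx> w \<longleftrightarrow> x @ (rev x @ u) \<approx> x @ w"
    using a by (intro eq_cancel_left[symmetric]) auto
  moreover have "x @ (rev x @ u) \<approx> u"
    using a eq_append[OF rev_right[of x] eq_refl[of u]] by simp
  ultimately show ?thesis by (meson eq_sym eq_trans)
qed

lemma eq_move_right: "x \<in> words \<Longrightarrow> u \<in> words \<Longrightarrow> w \<in> words \<Longrightarrow> u @ rev x \<approx> w \<longleftrightarrow> u \<approx> w @ x"
proof -
  assume a: "x \<in> words" "u \<in> words" "w \<in> words"
  have "u @ rev x \<approx> w \<longleftrightarrow> (u @ rev x) @ x \<approx> w @ x"
    using a by (intro eq_cancel_right[symmetric]) auto
  moreover have "(u @ rev x) @ x \<approx> u"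
    using a eq_append[OF eq_refl[of u] rev_left[of x]] by simp
  ultimately show ?thesis by (meson eq_sym eq_trans)
qed


subsection \<open>Normal forms up to commutation\<close>

inductive swap_eq :: "'v list \<Rightarrow> 'v list \<Rightarrow> bool" (infix "\<sim>" 50) where
  refl: "w \<sim> w"
| step: "u \<sim> x @ [s, t] @ y \<Longrightarrow> adj s t \<Longrightarrow> u \<sim> x @ [t, s] @ y"

lemma swap_trans [trans]: "u \<sim> w \<Longrightarrow> w \<sim> x \<Longrightarrow> u \<sim> x"
proof (rotate_tac 1, induction rule: swap_eq.induct)
  case (step w x s t y)
  then show ?case by (blast intro: swap_eq.step)
qed

lemma swap_single: "adj s t \<Longrightarrow> x @ [s, t] @ y \<sim> x @ [t, s] @ y"
  by (blast intro: swap_eq.intros)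

lemma swap_sym: "u \<sim> w \<Longrightarrow> w \<sim> u"
  by (induction rule: swap_eq.induct) (blast intro: swap_eq.refl swap_trans swap_single adj_sym)+

lemma swap_context: "u \<sim> w \<Longrightarrow> x @ u @ y \<sim> x @ w @ y"
proof (induction rule: swap_eq.induct)
  case (step u a s t b)
  then show ?case using swap_eq.step[of "x @ u @ y" "x @ a" s t "b @ y"] by simp
qed (rule swap_eq.refl)

lemma swap_append: "u \<sim> u' \<Longrightarrow> w \<sim> w' \<Longrightarrow> u @ w \<sim> u' @ w'"
  using swap_context[of u u' "[]" w] swap_context[of w w' u' "[]"] by (auto intro: swap_trans)

lemma swap_Cons: "u \<sim> w \<Longrightarrow> s # u \<sim> s # w"
  using swap_context[of u w "[s]" "[]"] by simp

lemma swap_rev: "u \<sim> w \<Longrightarrow> rev u \<sim> rev w"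
proof (induction rule: swap_eq.induct)
  case (step u a s t b)
  then show ?case using swap_eq.step[of "rev u" "rev b" t s "rev a"] by (simp add: adj_sym)
qed (rule swap_eq.refl)

lemma swap_set: "u \<sim> w \<Longrightarrow> set u = set w"
  by (induction rule: swap_eq.induct) auto

lemma swap_length: "u \<sim> w \<Longrightarrow> length u = length w"
  by (induction rule: swap_eq.induct) auto

lemma swap_imp_eq: "u \<sim> w \<Longrightarrow> u \<in> words \<Longrightarrow> u \<approx> w"
proof (induction rule: swap_eq.induct)
  case (step u x s t y)
  then have "u \<approx> x @ [s, t] @ y" by simp
  moreover from this have "x @ [s, t] @ y \<in> words" using eq_in by blast
  ultimately show ?case using step word_eq.swap[of x \<Gamma> y s t] by (auto intro: eq_trans)
qed auto

definition commutes :: "'v \<Rightarrow> 'v list \<Rightarrow> bool" where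
  "commutes s w \<longleftrightarrow> (\<forall>x\<in>set w. adj s x)"

lemma commutes_simps [simp]:
  "commutes s []" "commutes s (x # w) \<longleftrightarrow> adj s x \<and> commutes s w"
  "commutes s (u @ w) \<longleftrightarrow> commutes s u \<and> commutes s w" "commutes s (rev w) \<longleftrightarrow> commutes s w"
  by (auto simp: commutes_def)

text \<open>\<open>front s w\<close> and \<open>rear s w\<close>: some letter \<open>s\<close> of \<open>w\<close> can be shuffled to the front or to the back.\<close>

fun front :: "'v \<Rightarrow> 'v list \<Rightarrow> bool" where
  "front s [] \<longleftrightarrow> False"
| "front s (x # w) \<longleftrightarrow> x = s \<or> adj s x \<and> front s w"

abbreviation rear :: "'v \<Rightarrow> 'v list \<Rightarrow> bool" where
  "rear s w \<equiv> front s (rev w)"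

lemma front_append: "front s (u @ w) \<longleftrightarrow> front s u \<or> commutes s u \<and> front s w"
  by (induction u) auto

lemma front_set: "front s w \<Longrightarrow> s \<in> set w"
  by (induction w) auto

lemma commutes_swap: "commutes s w \<Longrightarrow> s # w \<sim> w @ [s]"
proof (induction w)
  case (Cons x w)
  then have "s # x # w \<sim> x # s # w" using swap_single[of s x "[]" w] by simp
  also have "x # s # w \<sim> x # w @ [s]" using Cons by (intro swap_Cons) auto
  finally show ?case by simp
qed (auto intro: swap_eq.refl)

text \<open>\<open>remove1\<close> deletes the first occurrence of \<open>s\<close>, and this is the
  one that \<open>front\<close> finds: a letter passed over is adjacent to \<open>s\<close>, hence
  different from it.\<close>

lemma front_swap: "front s w \<Longrightarrow> w \<sim> s # remove1 s w"
proof (induction w)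
  case (Cons x w)
  show ?case
  proof (cases "x = s")
    case False
    then have "x # w \<sim> x # s # remove1 s w" using Cons by (intro swap_Cons) auto
    also have "x # s # remove1 s w \<sim> s # x # remove1 s w"
      using False Cons swap_single[of x s "[]"] by (simp add: adj_sym)
    finally show ?thesis using False by simp
  qed (auto intro: swap_eq.refl)
qed auto

lemma front_cong: "u \<sim> w \<Longrightarrow> front s u \<longleftrightarrow> front s w"
  by (induction rule: swap_eq.induct) (auto simp: front_append adj_sym)

lemma rear_cong: "u \<sim> w \<Longrightarrow> rear s u \<longleftrightarrow> rear s w"
  by (rule front_cong[OF swap_rev])

lemma remove1_cong: "u \<sim> w \<Longrightarrow> remove1 s u \<sim> remove1 s w"
proof (induction rule: swap_eq.induct)
  case (step u x a b y)
  note step(3)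
  also have "remove1 s (x @ [a, b] @ y) \<sim> remove1 s (x @ [b, a] @ y)"
    using swap_single[OF step(2)] step(2) by (auto simp: remove1_append intro: swap_eq.refl)
  finally show ?case .
qed (rule swap_eq.refl)

text \<open>No two equal letters can be shuffled next to each other.\<close>

fun cred :: "'v list \<Rightarrow> bool" where
  "cred [] \<longleftrightarrow> True"
| "cred (s # w) \<longleftrightarrow> \<not> front s w \<and> cred w"

text \<open>A cancelling pair with one letter in each factor arises exactly when the first letter
  can be shuffled to the end of \<open>u\<close> and the second to the beginning of
  \<open>w\<close>.\<close>

lemma cred_append: "cred (u @ w) \<longleftrightarrow> cred u \<and> cred w \<and> (\<forall>s. \<not> (rear s u \<and> front s w))"
  by (induction u) (auto simp: front_append)

lemma cred_cong: "u \<sim> w \<Longrightarrow> cred u \<longleftrightarrow> cred w"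
proof (induction rule: swap_eq.induct)
  case (step u x a b y)
  have *: "rear s (x @ [a, b]) = rear s (x @ [b, a])" for s
    using rear_cong[OF swap_single[OF step(2), of x "[]"], of s] by simp
  have "cred (x @ [a, b]) = cred (x @ [b, a])"
    using step(2) by (auto simp: cred_append adj_sym)
  then have "cred ((x @ [a, b]) @ y) = cred ((x @ [b, a]) @ y)"
    unfolding cred_append * by blast
  with step show ?case by simp
qed simp

lemma cred_rev: "cred (rev w) \<longleftrightarrow> cred w"
  by (induction w) (auto simp: cred_append)

text \<open>Left multiplication by a generator, carried out on reduced words. On shuffle classes of
  reduced words the generators act in this way; the relations are respected by
  \<open>push_push\<close> and \<open>push_commute\<close>, and this action is what solves the word
  problem.\<close>

definition push :: "'v \<Rightarrow> 'v list \<Rightarrow> 'v list" where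
  "push s w = (if front s w then remove1 s w else s # w)"

fun nf :: "'v list \<Rightarrow> 'v list" where
  "nf [] = []"
| "nf (s # w) = push s (nf w)"

lemma cred_remove1: "cred w \<Longrightarrow> front s w \<Longrightarrow> cred (remove1 s w) \<and> \<not> front s (remove1 s w)"
  using cred_cong[OF front_swap] by auto

lemma cred_push: "cred w \<Longrightarrow> cred (push s w)"
  by (auto simp: push_def cred_remove1)

lemma cred_nf: "cred (nf w)"
  by (induction w) (auto intro: cred_push)

lemma push_cong: "u \<sim> w \<Longrightarrow> push s u \<sim> push s w"
  by (auto simp: push_def front_cong remove1_cong swap_Cons)

lemma push_push: "cred w \<Longrightarrow> push s (push s w) \<sim> w"
  using cred_remove1[of w s] swap_sym[OF front_swap[of s w]] by (auto simp: push_def intro: swap_eq.refl)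

lemma front_remove1: "adj s t \<Longrightarrow> front t w \<Longrightarrow> front s (remove1 t w) = front s w"
  using front_cong[OF front_swap, of t w s] by auto

lemma push_commute: "adj s t \<Longrightarrow> push s (push t w) \<sim> push t (push s w)"
  using swap_single[of s t "[]" w] front_remove1[of s t w] front_remove1[of t s w]
  by (auto simp: push_def adj_sym remove1_commute intro: swap_eq.refl)

lemma nf_append_cong: "nf u \<sim> nf w \<Longrightarrow> nf (x @ u) \<sim> nf (x @ w)"
  by (induction x) (auto intro: push_cong)

text \<open>\<open>nf\<close> lets the letters act one after the other on the empty word, so it is
  enough that both relations act trivially on shuffle classes; the letters in front of the relation
  are handled by \<open>nf_append_cong\<close>.\<close>

lemma eq_imp_nf: "u \<approx> w \<Longrightarrow> nf u \<sim> nf w"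
proof (induction rule: word_eq.induct)
  case (square u w s)
  show ?case by (rule nf_append_cong) (simp add: push_push cred_nf)
next
  case (swap u w s t)
  show ?case by (rule nf_append_cong) (simp add: push_commute swap)
qed (auto intro: swap_eq.refl swap_sym swap_trans)

lemma nf_cred: "cred w \<Longrightarrow> nf w = w"
  by (induction w) (auto simp: push_def)

lemma length_push: "length (push s w) \<le> Suc (length w)"
  by (auto simp: push_def length_remove1)

lemma length_nf: "length (nf w) \<le> length w"
  by (induction w) (auto intro: order_trans[OF length_push])

lemma set_push: "set (push s w) \<subseteq> insert s (set w)"
  using set_remove1_subset[of s w] by (auto simp: push_def)

lemma set_nf: "set (nf w) \<subseteq> set w"
proof (induction w)
  case (Cons s w)
  then show ?case using set_push[of s "nf w"] by auto
qed auto

lemma nf_in: "w \<in> words \<Longrightarrow> nf w \<in> words"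
  using set_nf[of w] by (auto simp: in_lists_conv_set)

lemma push_eq: "w \<in> words \<Longrightarrow> s \<in> pverts \<Gamma> \<Longrightarrow> push s w \<approx> s # w"
proof (cases "front s w")
  case True
  assume a: "w \<in> words" "s \<in> pverts \<Gamma>"
  have r: "remove1 s w \<in> words" using a set_remove1_subset[of s w] by (auto simp: in_lists_conv_set)
  have "[s] @ w @ [] \<approx> [s] @ (s # remove1 s w) @ []"
    using a front_swap[OF True] by (intro eq_context swap_imp_eq) auto
  also have "[s] @ (s # remove1 s w) @ [] \<approx> remove1 s w"
    using word_eq.square[of "[]" \<Gamma> "remove1 s w" s] r a by simp
  finally show ?thesis using True by (simp add: push_def eq_sym)
qed (auto simp: push_def)

lemma nf_eq: "w \<in> words \<Longrightarrow> nf w \<approx> w"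
proof (induction w)
  case (Cons s w)
  then have w: "w \<in> words" "s \<in> pverts \<Gamma>" by auto
  then have "nf (s # w) \<approx> s # nf w" using push_eq[OF nf_in[OF w(1)] w(2)] by simp
  also have "s # nf w \<approx> s # w" using eq_context[of "nf w" w "[s]" "[]"] Cons.IH w by auto
  finally show ?case by simp
qed auto

lemma cred_eq_swap: "cred u \<Longrightarrow> cred w \<Longrightarrow> u \<approx> w \<Longrightarrow> u \<sim> w"
  using eq_imp_nf[of u w] by (simp add: nf_cred)

lemma elem_eq_iff: "u \<in> words \<Longrightarrow> word_elem \<Gamma> u = word_elem \<Gamma> w \<longleftrightarrow> u \<approx> w"
  unfolding word_elem_def by (auto intro: eq_sym eq_trans)

lemma cred_length_le: "cred w \<Longrightarrow> u \<approx> w \<Longrightarrow> length w \<le> length u"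
  using eq_imp_nf[of u w] length_nf[of u] by (auto simp: nf_cred dest: swap_length)

text \<open>Every letter lengthens the normal form by at most one, and the first letter from the
  right at which \<open>cred\<close> fails cancels instead.\<close>

lemma not_cred_shorter: "\<not> cred w \<Longrightarrow> length (nf w) < length w"
proof (induction w)
  case (Cons s w)
  show ?case
  proof (cases "cred w")
    case True
    then have "front s w" using Cons by auto
    then have "length (remove1 s w) < length (s # w)"
      using length_remove1[of s w] by (auto split: if_splits)
    then show ?thesis using True \<open>front s w\<close> by (simp add: nf_cred push_def)
  next
    case False
    then show ?thesis using Cons length_push[of s "nf w"] by simp
  qed
qed auto

text \<open>The bridge from minimal length to shuffling. A word that is not \<open>cred\<close> is
  longer than its normal form. A \<open>cred\<close> word is its own normal form, hence a shuffle of
  the normal form of any equal word, which is at most as long as that word.\<close>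

lemma reduced_iff: "reduced \<Gamma> w \<longleftrightarrow> w \<in> words \<and> cred w"
proof
  assume r: "reduced \<Gamma> w"
  then have w: "w \<in> words" by (simp add: reduced_def)
  have "length w \<le> length (nf w)"
    using r w nf_in[OF w] nf_eq[OF w] by (simp add: reduced_def elem_eq_iff)
  then show "w \<in> words \<and> cred w" using not_cred_shorter[of w] w by linarith
next
  assume "w \<in> words \<and> cred w"
  then show "reduced \<Gamma> w" using cred_length_le by (auto simp: reduced_def elem_eq_iff)
qed

lemma cred_length_eq: "cred u \<Longrightarrow> cred w \<Longrightarrow> u \<approx> w \<Longrightarrow> length u = length w"
  by (meson cred_eq_swap swap_length)

lemma front_split: "front s w \<Longrightarrow> cred w \<Longrightarrow> \<exists>w'. w \<sim> s # w' \<and> cred w' \<and> \<not> front s w' \<and> length w = Suc (length w')"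
  using front_swap[of s w] cred_remove1[of w s] swap_length by fastforce

lemma rear_split: "rear s w \<Longrightarrow> cred w \<Longrightarrow> \<exists>w'. w \<sim> w' @ [s] \<and> cred w' \<and> \<not> rear s w' \<and> length w = Suc (length w')"
  using front_split[of s "rev w"] swap_rev[of "rev w"]
  by (metis cred_rev length_rev rev.simps(2) rev_rev_ident)


section \<open>The group\<close>

lemma elem_in_carrier [simp]: "w \<in> words \<Longrightarrow> word_elem \<Gamma> w \<in> carrier (racg \<Gamma>)"
  by (simp add: racg_def)

lemma carrier_racg: "carrier (racg \<Gamma>) = word_elem \<Gamma> ` words"
  by (simp add: racg_def)

lemma in_word_elem: "x \<in> word_elem \<Gamma> w \<longleftrightarrow> w \<approx> x"
  by (simp add: word_elem_def)

lemma mult_elem [simp]: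
  assumes "u \<in> words" "w \<in> words"
  shows "word_elem \<Gamma> u \<otimes>\<^bsub>racg \<Gamma>\<^esub> word_elem \<Gamma> w = word_elem \<Gamma> (u @ w)"
proof -
  have "word_elem \<Gamma> (x @ y) = word_elem \<Gamma> (u @ w)" if "x \<in> word_elem \<Gamma> u" "y \<in> word_elem \<Gamma> w" for x y
  proof -
    have "u @ w \<approx> x @ y" using that by (auto simp: in_word_elem intro: eq_append)
    then show ?thesis using eq_in elem_eq_iff by (metis eq_sym)
  qed
  moreover have "u \<in> word_elem \<Gamma> u" "w \<in> word_elem \<Gamma> w" using assms by (simp_all add: in_word_elem)
  ultimately have "(\<Union>x\<in>word_elem \<Gamma> u. \<Union>y\<in>word_elem \<Gamma> w. word_elem \<Gamma> (x @ y)) = word_elem \<Gamma> (u @ w)"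
    by blast
  then show ?thesis by (simp add: racg_def)
qed

lemma one_elem: "\<one>\<^bsub>racg \<Gamma>\<^esub> = word_elem \<Gamma> []"
  by (simp add: racg_def)

lemma elem_one_iff: "w \<in> words \<Longrightarrow> word_elem \<Gamma> w = \<one>\<^bsub>racg \<Gamma>\<^esub> \<longleftrightarrow> w \<approx> []"
  by (simp add: one_elem elem_eq_iff)

lemma group_racg: "group (racg \<Gamma>)"
proof (rule groupI)
  fix x assume "x \<in> carrier (racg \<Gamma>)"
  then obtain w where w: "w \<in> words" "x = word_elem \<Gamma> w" by (auto simp: carrier_racg)
  have "word_elem \<Gamma> (rev w @ w) = word_elem \<Gamma> []"
    using w rev_left[of w] elem_eq_iff[of "rev w @ w"] by simp
  then show "\<exists>y\<in>carrier (racg \<Gamma>). y \<otimes>\<^bsub>racg \<Gamma>\<^esub> x = \<one>\<^bsub>racg \<Gamma>\<^esub>"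
    using w by (intro bexI[of _ "word_elem \<Gamma> (rev w)"]) (simp_all add: one_elem)
qed (auto simp: carrier_racg one_elem)

lemma inv_elem: "w \<in> words \<Longrightarrow> inv\<^bsub>racg \<Gamma>\<^esub> (word_elem \<Gamma> w) = word_elem \<Gamma> (rev w)"
proof -
  assume w: "w \<in> words"
  have "word_elem \<Gamma> (rev w) \<otimes>\<^bsub>racg \<Gamma>\<^esub> word_elem \<Gamma> w = \<one>\<^bsub>racg \<Gamma>\<^esub>"
    using w rev_left[of w] elem_eq_iff[of "rev w @ w"] by (simp add: one_elem)
  then show ?thesis using w by (intro group.inv_equality[OF group_racg]) auto
qed

definition wpow :: "'v list \<Rightarrow> nat \<Rightarrow> 'v list" where
  "wpow w n = concat (replicate n w)"

lemma wpow_simps [simp]: "wpow w 0 = []" "wpow w (Suc n) = w @ wpow w n"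
  by (auto simp: wpow_def)

lemma wpow_in [simp]: "w \<in> words \<Longrightarrow> wpow w n \<in> words"
  by (induction n) auto

lemma wpow_add: "wpow w (m + n) = wpow w m @ wpow w n"
  by (induction m) auto

lemma wpow_cong: "u \<approx> w \<Longrightarrow> wpow u n \<approx> wpow w n"
  by (induction n) (auto intro: eq_append)

lemma wpow_snoc: "wpow w n @ w = w @ wpow w n"
  by (induction n) auto

lemma elem_pow: "w \<in> words \<Longrightarrow> word_elem \<Gamma> w [^]\<^bsub>racg \<Gamma>\<^esub> n = word_elem \<Gamma> (wpow w n)"
proof (induction n)
  case 0
  then show ?case by (simp add: one_elem)
next
  case (Suc n)
  then show ?case by (simp add: nat_pow_def wpow_snoc)
qed

lemma wpow_conj:
  assumes "w \<in> words" "x \<in> words"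
  shows "wpow (x @ w @ rev x) n \<approx> x @ wpow w n @ rev x"
proof (induction n)
  case 0
  then show ?case using rev_right[OF assms(2)] by (simp add: eq_sym)
next
  case (Suc n)
  have "wpow (x @ w @ rev x) (Suc n) \<approx> (x @ w @ rev x) @ (x @ wpow w n @ rev x)"
    using eq_append[OF eq_refl Suc, of "x @ w @ rev x"] assms by simp
  also have "(x @ w @ rev x) @ (x @ wpow w n @ rev x) = (x @ w) @ (rev x @ x) @ (wpow w n @ rev x)"
    by simp
  also have "(x @ w) @ (rev x @ x) @ (wpow w n @ rev x) \<approx> (x @ w) @ [] @ (wpow w n @ rev x)"
    using assms by (intro eq_context rev_left) auto
  finally show ?case by simp
qed

lemma conj_eq_Nil: 
  assumes "w \<in> words" "x \<in> words"
  shows "x @ w @ rev x \<approx> [] \<longleftrightarrow> w \<approx> []"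
proof -
  have "(x @ w) @ rev x \<approx> [] \<longleftrightarrow> x @ w \<approx> [] @ x" using assms by (intro eq_move_right) auto
  also have "\<dots> \<longleftrightarrow> x @ w \<approx> x @ []" by simp
  also have "\<dots> \<longleftrightarrow> w \<approx> []" using assms by (intro eq_cancel_left) auto
  finally show ?thesis by simp
qed


subsection \<open>Elements of finite order\<close>

lemma commute_words: "(\<And>s. s \<in> set u \<Longrightarrow> commutes s k) \<Longrightarrow> u @ k \<sim> k @ u"
proof (induction u)
  case (Cons s u)
  have "s # u @ k \<sim> s # k @ u" using Cons by (intro swap_Cons) auto
  also have "s # k @ u \<sim> k @ s # u"
    using swap_append[OF commutes_swap[of s k] swap_eq.refl[of u]] Cons by simp
  finally show ?case by simp
qed (auto intro: swap_eq.refl)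

lemma swap_partition:
  "(\<And>s t. s \<in> set w \<Longrightarrow> t \<in> set w \<Longrightarrow> P s \<Longrightarrow> \<not> P t \<Longrightarrow> adj s t) \<Longrightarrow>
    w \<sim> filter P w @ filter (\<lambda>s. \<not> P s) w"
proof (induction w)
  case (Cons x w)
  let ?k = "filter P w" and ?u = "filter (\<lambda>s. \<not> P s) w"
  have *: "x # w \<sim> x # ?k @ ?u" using Cons by (intro swap_Cons) auto
  show ?case
  proof (cases "P x")
    case False
    then have "commutes x ?k" using Cons.prems by (auto simp: commutes_def intro: adj_sym)
    then have "x # ?k @ ?u \<sim> ?k @ x # ?u"
      using swap_append[OF commutes_swap swap_eq.refl, of x ?k ?u] by simp
    with * have "x # w \<sim> ?k @ x # ?u" by (rule swap_trans)
    with False show ?thesis by simp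
  qed (use * in simp)
qed (auto intro: swap_eq.refl)

text \<open>A letter that can be shuffled to the front of a power of \<open>u\<close> can be
  shuffled to the front of \<open>u\<close> itself, so a cancellation between two copies of
  \<open>u\<close> would need a letter that is both front and rear in \<open>u\<close>.\<close>

lemma cred_wpow:
  assumes "cred u" "\<And>s. front s u \<Longrightarrow> \<not> rear s u"
  shows "cred (wpow u n)"
proof -
  have *: "front s u" if "front s (wpow u n)" for s n
    using that by (induction n) (auto simp: front_append)
  show ?thesis
    by (induction n) (use assms * in \<open>auto simp: cred_append\<close>)
qed

lemma set_wpow: "set (wpow w n) = (if n = 0 then {} else set w)"
  by (induction n) auto

text \<open>Split \<open>w\<close> into the part \<open>k\<close> of the letters that commute with
  all other letters of \<open>w\<close>, and the rest \<open>u\<close>. Then \<open>k\<close> and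
  \<open>u\<close> commute and share no letter, and no power of \<open>u\<close> has a cancellation.
  Finite order therefore leaves no room for \<open>u\<close>, and \<open>w\<close> consists of
  commuting letters.\<close>

lemma cyclically_reduced_finite_order:
  assumes w: "w \<in> words" "cred w" and n: "n > 0" "wpow w n \<approx> []"
    and cyc: "\<And>s w'. \<not> w \<sim> s # w' @ [s]"
  shows "\<forall>s\<in>set w. \<forall>t\<in>set w. s = t \<or> adj s t"
proof -
  define P where "P s \<longleftrightarrow> (\<forall>t\<in>set w. s = t \<or> adj s t)" for s
  define k u where "k = filter P w" and "u = filter (\<lambda>s. \<not> P s) w"
  have wku: "w \<sim> k @ u" unfolding k_def u_def
    by (rule swap_partition) (metis P_def)
  have ku_comm: "commutes s k" if "s \<in> set u" for s
    unfolding commutes_def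
  proof
    fix x assume "x \<in> set k"
    then have "P x" "\<not> P s" "s \<in> set w" using that by (auto simp: k_def u_def)
    then have "adj x s" unfolding P_def by metis
    then show "adj s x" by (rule adj_sym)
  qed
  have ku: "k \<in> words" "u \<in> words" using w by (auto simp: k_def u_def in_lists_conv_set)
  have cku: "cred (k @ u)" using cred_cong[OF wku] w by simp
  then have "cred u" by (simp add: cred_append)
  \<comment> \<open>Some letter \<open>t\<close> of \<open>u\<close> does not commute with
    \<open>s\<close>. The \<open>s\<close> shuffled to the front and the one shuffled to the rear
    are therefore different occurrences, one on each side of \<open>t\<close>. Both can be moved out
    of \<open>k @ u\<close>, against \<open>cyc\<close>.\<close>
  have "\<not> rear s u" if s: "front s u" for s
  proof
    assume b: "rear s u"
    from front_split[OF s \<open>cred u\<close>] obtain u' where u': "u \<sim> s # u'" "cred u'" by blast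
    have "s \<in> set u" using front_set[OF s] .
    then obtain t where t: "t \<in> set w" "s \<noteq> t" "\<not> adj s t" by (auto simp: u_def P_def)
    then have "\<not> P t" using \<open>s \<in> set u\<close> by (auto simp: P_def u_def dest: adj_sym)
    then have "t \<in> set u" using t by (simp add: u_def)
    then have "t \<in> set u'" using swap_set[OF u'(1)] t by auto
    then have "\<not> commutes s u'" using t by (auto simp: commutes_def)
    moreover have "rear s (s # u')" using b rear_cong[OF u'(1)] by simp
    ultimately have "rear s u'" by (auto simp: front_append)
    from rear_split[OF this u'(2)] obtain u'' where u'': "u' \<sim> u'' @ [s]" by blast
    have "u \<sim> s # u'' @ [s]" using u'(1) swap_Cons[OF u''] by (rule swap_trans)
    then have "k @ u \<sim> k @ s # u'' @ [s]" by (intro swap_append swap_eq.refl)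
    also have "k @ s # u'' @ [s] \<sim> s # k @ u'' @ [s]"
      using swap_append[OF swap_sym[OF commutes_swap[OF ku_comm[OF \<open>s \<in> set u\<close>]]] swap_eq.refl[of "u'' @ [s]"]]
      by simp
    finally have "w \<sim> s # (k @ u'') @ [s]" using wku by (auto intro: swap_trans)
    then show False using cyc by blast
  qed
  with \<open>cred u\<close> have cu: "cred (wpow u n)" by (intro cred_wpow) auto
  have pow: "wpow (k @ u) m \<approx> wpow k m @ wpow u m" for m
  proof (induction m)
    case (Suc m)
    have "wpow (k @ u) (Suc m) \<approx> (k @ u) @ wpow k m @ wpow u m"
      using Suc ku by (auto intro!: eq_append[of k, OF _ eq_append[of u]])
    also have "\<dots> = k @ (u @ wpow k m) @ wpow u m" by simp
    also have "k @ (u @ wpow k m) @ wpow u m \<approx> k @ (wpow k m @ u) @ wpow u m"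
      using ku ku_comm by (intro eq_context swap_imp_eq commute_words) (auto simp: commutes_def set_wpow)
    finally show ?case by simp
  qed auto
  have "[] \<approx> wpow k n @ wpow u n"
    using n(2) wpow_cong[OF swap_imp_eq[OF wku w(1)], of n] pow[of n] by (meson eq_sym eq_trans)
  then have "wpow u n \<approx> rev (wpow k n) @ []"
    using eq_move_left[of "rev (wpow k n)" "wpow u n" "[]"] eq_move_left[of "wpow k n" "[]" "wpow u n"] ku 
    by (metis append_Nil2 eq_sym lists.Nil rev_rev_ident rev_in wpow_in)
  then have "wpow u n \<sim> nf (rev (wpow k n))"
    using eq_imp_nf nf_cred[OF cu] by (metis append_Nil2)
  \<comment> \<open>A power of \<open>u\<close> has been equated with a power of the inverse of
    \<open>k\<close>. Shuffling preserves the set of letters and \<open>nf\<close> adds none, so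
    letters of \<open>u\<close> would be letters of \<open>k\<close>, and the two sets are
    disjoint.\<close>
  then have "set (wpow u n) \<subseteq> set k"
    using swap_set[of "wpow u n"] set_nf[of "rev (wpow k n)"] by (auto simp: set_wpow split: if_splits)
  then have "u = []" using n(1) by (cases u) (auto simp: set_wpow k_def u_def dest!: filter_eq_ConsD)
  then have "\<forall>s\<in>set w. P s" by (auto simp: u_def filter_empty_conv)
  then show ?thesis by (auto simp: P_def)
qed


subsection \<open>Generated subgroups\<close>

lemma generate_words:
  assumes "S \<subseteq> words"
  shows "generate (racg \<Gamma>) (word_elem \<Gamma> ` S) = word_elem \<Gamma> ` (concat ` lists (S \<union> rev ` S))" (is "_ = ?R")
proof
  have c: "concat ws \<in> words" if "ws \<in> lists (S \<union> rev ` S)" for ws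
    using that assms by (induction ws) auto
  show "generate (racg \<Gamma>) (word_elem \<Gamma> ` S) \<subseteq> ?R"
  proof
    fix g assume "g \<in> generate (racg \<Gamma>) (word_elem \<Gamma> ` S)"
    then show "g \<in> ?R"
    proof (induction rule: generate.induct)
      case one
      then show ?case by (auto simp: one_elem intro!: image_eqI[of _ _ "[]"])
    next
      case (incl h)
      then obtain w where "w \<in> S" "h = word_elem \<Gamma> w" by auto
      then have "h = word_elem \<Gamma> (concat [w])" "[w] \<in> lists (S \<union> rev ` S)" by auto
      then show ?case by blast
    next
      case (inv h)
      then obtain w where "w \<in> S" "h = word_elem \<Gamma> w" by auto
      then have "inv\<^bsub>racg \<Gamma>\<^esub> h = word_elem \<Gamma> (concat [rev w])" "[rev w] \<in> lists (S \<union> rev ` S)"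
        using assms inv_elem[of w] by auto
      then show ?case by blast
    next
      case (eng h1 h2)
      then obtain u w where "u \<in> lists (S \<union> rev ` S)" "w \<in> lists (S \<union> rev ` S)"
        "h1 = word_elem \<Gamma> (concat u)" "h2 = word_elem \<Gamma> (concat w)" by auto
      then have "h1 \<otimes>\<^bsub>racg \<Gamma>\<^esub> h2 = word_elem \<Gamma> (concat (u @ w))" "u @ w \<in> lists (S \<union> rev ` S)"
        using c by auto
      then show ?case by blast
    qed
  qed
  have "word_elem \<Gamma> (concat ws) \<in> generate (racg \<Gamma>) (word_elem \<Gamma> ` S)" if "ws \<in> lists (S \<union> rev ` S)" for ws
    using that
  proof (induction ws)
    case Nil
    then show ?case using generate.one[of "racg \<Gamma>"] by (simp add: one_elem)
  next
    case (Cons w ws)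
    have "word_elem \<Gamma> w \<in> generate (racg \<Gamma>) (word_elem \<Gamma> ` S)"
    proof (cases "w \<in> S")
      case False
      then obtain w' where w': "w' \<in> S" "w = rev w'" using Cons by auto
      then have "word_elem \<Gamma> w = inv\<^bsub>racg \<Gamma>\<^esub> word_elem \<Gamma> w'"
        using inv_elem[of w'] subsetD[OF assms] by simp
      then show ?thesis using generate.inv[OF imageI[OF w'(1)]] by simp
    qed (auto intro: generate.incl)
    moreover have "w \<in> words" using Cons assms by auto
    ultimately show ?case using Cons generate.eng[of "word_elem \<Gamma> w" "racg \<Gamma>" _ "word_elem \<Gamma> (concat ws)"] c[of ws]
      by simp
  qed
  then show "?R \<subseteq> generate (racg \<Gamma>) (word_elem \<Gamma> ` S)"
    unfolding image_image by (rule image_subsetI)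
qed

lemma special_subgroup_words:
  assumes "T \<subseteq> pverts \<Gamma>"
  shows "special_subgroup \<Gamma> T = word_elem \<Gamma> ` lists T"
proof -
  let ?S = "(\<lambda>s. [s]) ` T"
  have r: "?S \<union> rev ` ?S = ?S" by auto
  have "w \<in> concat ` lists ?S" if "w \<in> lists T" for w
    using that by (intro image_eqI[of _ _ "map (\<lambda>s. [s]) w"]) (auto simp: in_lists_conv_set)
  moreover have "concat ws \<in> lists T" if "ws \<in> lists ?S" for ws
    using that by (induction ws) auto
  ultimately have "concat ` lists ?S = lists T" by (intro equalityI subsetI) auto
  moreover have "gens \<Gamma> T = word_elem \<Gamma> ` ?S" by (auto simp: gens_def)
  ultimately show ?thesis
    using generate_words[of ?S] assms unfolding special_subgroup_def r by (simp add: image_subset_iff subset_eq)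
qed

text \<open>In a word over a clique every letter can be shuffled to the front, so a second copy of a
  letter would cancel the first.\<close>

lemma clique_cred_distinct: "cred w \<Longrightarrow> clique \<Gamma> (set w) \<Longrightarrow> distinct w"
proof (induction w)
  case (Cons s w)
  have "s \<notin> set w"
  proof
    assume "s \<in> set w"
    have "front s w" if "s \<in> set w" "clique \<Gamma> (insert s (set w))" for w
      using that by (induction w) (auto simp: clique_def)
    then show False using Cons \<open>s \<in> set w\<close> by auto
  qed
  then show ?case using Cons by (auto simp: clique_def)
qed auto

lemma distinct_clique_cred: "distinct w \<Longrightarrow> cred w"
  by (induction w) (auto dest: front_set)

text \<open>Normal forms over a clique are free of repetitions, hence no longer than the clique is
  large.\<close>

lemma finite_special_subgroup:
  assumes "clique \<Gamma> T"
  shows "finite (special_subgroup \<Gamma> T)"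
proof -
  have T: "T \<subseteq> pverts \<Gamma>" using assms by (simp add: clique_def)
  then have "finite T" by (rule finite_subset) simp
  have "word_elem \<Gamma> w \<in> word_elem \<Gamma> ` {u. set u \<subseteq> T \<and> length u \<le> card T}" if "w \<in> lists T" for w
  proof (rule image_eqI)
    have w: "w \<in> words" using that T lists_mono[OF T] by auto
    show "word_elem \<Gamma> w = word_elem \<Gamma> (nf w)" using elem_eq_iff[of "nf w" w] nf_in[OF w] nf_eq[OF w] by simp
    have s: "set (nf w) \<subseteq> T" using set_nf[of w] that by (auto simp: in_lists_conv_set)
    then have "distinct (nf w)" using assms cred_nf[of w] by (intro clique_cred_distinct) (auto simp: clique_def)
    then have "length (nf w) \<le> card T" using s \<open>finite T\<close> by (metis card_mono distinct_card)
    with s show "nf w \<in> {u. set u \<subseteq> T \<and> length u \<le> card T}" by simp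
  qed
  then have "word_elem \<Gamma> ` lists T \<subseteq> word_elem \<Gamma> ` {u. set u \<subseteq> T \<and> length u \<le> card T}"
    by (rule image_subsetI)
  then show ?thesis unfolding special_subgroup_words[OF T]
    by (rule finite_subset) (intro finite_imageI finite_lists_length_le \<open>finite T\<close>)
qed

text \<open>Pigeonhole on the powers. They are taken of a representative \<open>u\<close> written in
  the letters of \<open>T\<close>, so that all of them visibly stay in the finite subgroup.\<close>

lemma finite_special_subgroup_order:
  assumes "T \<subseteq> pverts \<Gamma>" "finite (special_subgroup \<Gamma> T)" "w \<in> words" "word_elem \<Gamma> w \<in> special_subgroup \<Gamma> T"
  shows "\<exists>n>0. wpow w n \<approx> []"
proof -
  obtain u where u: "u \<in> lists T" "word_elem \<Gamma> w = word_elem \<Gamma> u"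
    using assms by (auto simp: special_subgroup_words)
  then have uw: "w \<approx> u" using assms elem_eq_iff by blast
  have "word_elem \<Gamma> (wpow u n) \<in> special_subgroup \<Gamma> T" for n
  proof -
    have "wpow u n \<in> lists T" using u by (induction n) auto
    then show ?thesis using assms by (auto simp: special_subgroup_words)
  qed
  then have "\<not> inj (\<lambda>n. word_elem \<Gamma> (wpow u n))"
    using assms(2) finite_subset[of "range (\<lambda>n. word_elem \<Gamma> (wpow u n))"] finite_imageD by blast
  then obtain i j where ij: "i < j" "word_elem \<Gamma> (wpow u i) = word_elem \<Gamma> (wpow u j)"
    by (metis injI linorder_neqE_nat)
  have uin: "u \<in> words" using eq_in uw by blast
  then have "wpow u i @ [] \<approx> wpow u (i + (j - i))" using ij elem_eq_iff[of "wpow u i" "wpow u j"] by simp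
  then have "[] \<approx> wpow u (j - i)" unfolding wpow_add using uin by (subst (asm) eq_cancel_left) auto
  then have "wpow w (j - i) \<approx> []" using wpow_cong[OF uw, of "j - i"] by (blast intro: eq_sym eq_trans)
  with ij show ?thesis by (intro exI[of _ "j - i"]) auto
qed

end


locale racg_subgroup = right_angled \<Gamma> for \<Gamma> :: "'v pair_pre_digraph" +
  fixes G :: "'v list set set"
  assumes subgroup: "subgroup G (racg \<Gamma>)"
begin

text \<open>The subgroup is handled through the set of all words that spell its elements. This set
  is closed under concatenation, reversal and \<open>\<approx>\<close>, and it turns statements on
  cosets and conjugates into statements on lists.\<close>

definition GW :: "'v list set" where
  "GW = {w \<in> words. word_elem \<Gamma> w \<in> G}"

lemma GW_words: "w \<in> GW \<Longrightarrow> w \<in> words"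
  by (simp add: GW_def)

lemma G_eq: "G = word_elem \<Gamma> ` GW"
  using subgroup.subset[OF subgroup] by (auto simp: GW_def carrier_racg)

lemma Nil_GW [simp]: "[] \<in> GW"
  using subgroup.one_closed[OF subgroup] by (simp add: GW_def one_elem)

lemma append_GW: "u \<in> GW \<Longrightarrow> w \<in> GW \<Longrightarrow> u @ w \<in> GW"
  using subgroup.m_closed[OF subgroup, of "word_elem \<Gamma> u" "word_elem \<Gamma> w"] by (auto simp: GW_def)

lemma rev_GW: "u \<in> GW \<Longrightarrow> rev u \<in> GW"
  using subgroup.m_inv_closed[OF subgroup, of "word_elem \<Gamma> u"] by (auto simp: GW_def inv_elem)

lemma eq_GW: "u \<in> GW \<Longrightarrow> u \<approx> w \<Longrightarrow> w \<in> GW"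
  using eq_in[of u w] elem_eq_iff[of u w] by (auto simp: GW_def)

lemma nf_GW: "w \<in> GW \<Longrightarrow> nf w \<in> GW"
  using eq_GW[OF _ eq_sym[OF nf_eq]] by (auto simp: GW_words)

lemma append_GW_iff: "u \<in> GW \<Longrightarrow> w \<in> words \<Longrightarrow> u @ w \<in> GW \<longleftrightarrow> w \<in> GW"
proof
  assume a: "u \<in> GW" "w \<in> words" "u @ w \<in> GW"
  have "rev u @ u @ w \<approx> w" using eq_append[OF rev_left[of u] eq_refl[of w]] a GW_words[of u] by auto
  moreover have "rev u @ u @ w \<in> GW" using append_GW[OF rev_GW[OF a(1)] a(3)] .
  ultimately show "w \<in> GW" using eq_GW by blast
qed (rule append_GW)

lemma has_torsion_words:
  "has_torsion (racg \<Gamma>) G \<longleftrightarrow> (\<exists>w\<in>GW. \<not> w \<approx> [] \<and> (\<exists>n>0. wpow w n \<approx> []))"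
  unfolding has_torsion_def by (subst G_eq) (auto simp: elem_one_iff elem_pow GW_words)

end


section \<open>Paths in labeled complexes\<close>

text \<open>Steps and walks keep only labels and end points. A graph-loop and its reverse give the
  same step, and so steps become deterministic in a folded complex although edges do not.\<close>

definition edge_step :: "('v, 'c) labeled_complex \<Rightarrow> 'c \<Rightarrow> 'v \<Rightarrow> 'c \<Rightarrow> bool" where
  "edge_step X x s y \<longleftrightarrow> (\<exists>e\<in>edges X. labels X e = {s} \<and> edge_start X e = x \<and> edge_end X e = y)"

definition walk :: "('v, 'c) labeled_complex \<Rightarrow> 'c \<Rightarrow> 'v list \<Rightarrow> 'c \<Rightarrow> bool" where
  "walk X x w y \<longleftrightarrow> (\<exists>p. edge_path X x p y \<and> path_label X p = w)"

lemma finite_fibres: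
  assumes "finite (f ` A)" "\<And>b. b \<in> f ` A \<Longrightarrow> finite {a \<in> A. f a = b}"
  shows "finite A"
proof -
  have "A = (\<Union>b\<in>f ` A. {a \<in> A. f a = b})" by auto
  moreover have "finite (\<Union>b\<in>f ` A. {a \<in> A. f a = b})" using assms by (intro finite_UN_I)
  ultimately show ?thesis by simp
qed

lemma edgeI: "e \<in> cubes X \<Longrightarrow> labels X e = {s} \<Longrightarrow> e \<in> edges X"
  by (auto simp: edges_def)

lemma edge_cube: "e \<in> edges X \<Longrightarrow> e \<in> cubes X"
  by (simp add: edges_def)

lemma edge_labels: "e \<in> edges X \<Longrightarrow> labels X e = {edge_label X e}"
  unfolding edges_def edge_label_def by clarsimp

lemma walk_Nil [simp]: "walk X x [] y \<longleftrightarrow> x \<in> vertices X \<and> x = y"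
  by (auto simp: walk_def path_label_def)

lemma walk_Cons [simp]: "walk X x (s # w) y \<longleftrightarrow> (\<exists>z. edge_step X x s z \<and> walk X z w y)"
proof
  assume "walk X x (s # w) y"
  then obtain p where "edge_path X x p y" "path_label X p = s # w" by (auto simp: walk_def)
  then show "\<exists>z. edge_step X x s z \<and> walk X z w y"
    by (cases p) (auto simp: walk_def edge_step_def path_label_def edge_labels)
next
  assume "\<exists>z. edge_step X x s z \<and> walk X z w y"
  then obtain e p where "e \<in> edges X" "labels X e = {s}" "edge_start X e = x"
    "edge_path X (edge_end X e) p y" "path_label X p = w" by (auto simp: walk_def edge_step_def)
  then show "walk X x (s # w) y"
    unfolding walk_def by (intro exI[of _ "e # p"]) (auto simp: path_label_def edge_label_def)
qed

section \<open>Cells and walks in a labeled cube complex\<close>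

locale lcc = right_angled \<Gamma> for \<Gamma> :: "'v pair_pre_digraph" +
  fixes X :: "('v, 'c) labeled_complex"
  assumes lcc: "labeled_cube_complex \<Gamma> X"
begin

lemma lccD: "c \<in> cubes X \<Longrightarrow> clique \<Gamma> (labels X c) \<and>
     (\<forall>L\<subseteq>labels X c. \<forall>A\<subseteq>labels X c. face X L A c \<in> cubes X \<and> labels X (face X L A c) = L) \<and>
     face X (labels X c) {} c = c \<and>
     (\<forall>L\<subseteq>labels X c. \<forall>A\<subseteq>labels X c. \<forall>M\<subseteq>L. \<forall>C\<subseteq>L.
        face X M C (face X L A c) = face X M (sym_diff A C) c) \<and>
     (\<forall>A\<subseteq>labels X c. face X (labels X c) A c = c \<longrightarrow> A = {})"
  using lcc by (simp add: labeled_cube_complex_def)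

lemma label_clique: "c \<in> cubes X \<Longrightarrow> clique \<Gamma> (labels X c)"
  by (drule lccD) simp

lemma finite_labels: "c \<in> cubes X \<Longrightarrow> finite (labels X c)"
  using label_clique[of c] finite_subset[OF _ finite_pverts] by (auto simp: clique_def)

lemma face_cube: "c \<in> cubes X \<Longrightarrow> L \<subseteq> labels X c \<Longrightarrow> A \<subseteq> labels X c \<Longrightarrow> face X L A c \<in> cubes X"
  and face_labels: "c \<in> cubes X \<Longrightarrow> L \<subseteq> labels X c \<Longrightarrow> A \<subseteq> labels X c \<Longrightarrow> labels X (face X L A c) = L"
  by (drule lccD, simp)+

lemma face_full: "c \<in> cubes X \<Longrightarrow> face X (labels X c) {} c = c"
  by (drule lccD) simp

lemma face_face: "c \<in> cubes X \<Longrightarrow> L \<subseteq> labels X c \<Longrightarrow> A \<subseteq> labels X c \<Longrightarrow> M \<subseteq> L \<Longrightarrow> C \<subseteq> L \<Longrightarrow>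
    face X M C (face X L A c) = face X M (sym_diff A C) c"
  by (drule lccD) simp

lemma face_free: "c \<in> cubes X \<Longrightarrow> A \<subseteq> labels X c \<Longrightarrow> face X (labels X c) A c = c \<Longrightarrow> A = {}"
  by (drule lccD) simp

lemma corner_vertex: "c \<in> cubes X \<Longrightarrow> A \<subseteq> labels X c \<Longrightarrow> face X {} A c \<in> vertices X"
  by (simp add: vertices_def face_cube face_labels)

lemma vertex_face: "v \<in> vertices X \<Longrightarrow> face X {} {} v = v"
  using face_full[of v] by (simp add: vertices_def)

lemma edge_rev_props:
  assumes "e \<in> edges X"
  shows "edge_rev X e \<in> edges X" "labels X (edge_rev X e) = labels X e"
    "edge_start X (edge_rev X e) = edge_end X e" "edge_end X (edge_rev X e) = edge_start X e"
    "edge_rev X (edge_rev X e) = e" "edge_start X e \<in> vertices X" "edge_end X e \<in> vertices X"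
    "edge_rev X e \<noteq> e"
proof -
  have c: "e \<in> cubes X" using assms by (rule edge_cube)
  show l: "labels X (edge_rev X e) = labels X e" by (simp add: edge_rev_def face_labels c)
  show "edge_rev X e \<in> edges X" using c l assms by (auto simp: edges_def edge_rev_def face_cube)
  show "edge_start X (edge_rev X e) = edge_end X e" "edge_end X (edge_rev X e) = edge_start X e"
    "edge_rev X (edge_rev X e) = e"
    using c l face_full[OF c] unfolding edge_start_def edge_end_def edge_rev_def
    by (simp_all add: face_face face_labels)
  show "edge_start X e \<in> vertices X" "edge_end X e \<in> vertices X"
    using c by (auto simp: edge_start_def edge_end_def corner_vertex)
  show "edge_rev X e \<noteq> e"
    using face_free[OF c, of "labels X e"] edge_labels[OF assms] by (auto simp: edge_rev_def)
qed

lemma edge_step_sym: "edge_step X x s y \<Longrightarrow> edge_step X y s x"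
  unfolding edge_step_def using edge_rev_props by metis

lemma edge_step_in: "edge_step X x s y \<Longrightarrow> s \<in> pverts \<Gamma> \<and> x \<in> vertices X \<and> y \<in> vertices X"
proof -
  assume "edge_step X x s y"
  then obtain e where "e \<in> edges X" "labels X e = {s}" "edge_start X e = x" "edge_end X e = y"
    by (auto simp: edge_step_def)
  then show ?thesis using label_clique[OF edge_cube, of e] edge_rev_props[of e] by (auto simp: clique_def)
qed

lemma walk_in: "walk X x w y \<Longrightarrow> w \<in> words \<and> x \<in> vertices X \<and> y \<in> vertices X"
  by (induction w arbitrary: x) (auto dest: edge_step_in)

lemma walk_append: "walk X x (u @ w) y \<longleftrightarrow> (\<exists>z. walk X x u z \<and> walk X z w y)"
  by (induction u arbitrary: x) (auto dest: walk_in edge_step_in)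

lemma walk_rev: "walk X x w y \<Longrightarrow> walk X y (rev w) x"
proof (induction w arbitrary: x)
  case (Cons s w)
  then obtain z where z: "edge_step X x s z" "walk X z w y" by auto
  then have "walk X y (rev w) z" "walk X z [s] x"
    using Cons.IH edge_step_sym[OF z(1)] edge_step_in[OF z(1)] by auto
  then show ?case by (auto simp: walk_append)
qed auto

lemma cube_edge:
  assumes "c \<in> cubes X" "A \<subseteq> labels X c" "s \<in> labels X c"
  shows "face X {s} A c \<in> edges X" "labels X (face X {s} A c) = {s}"
    "edge_start X (face X {s} A c) = face X {} A c"
    "edge_end X (face X {s} A c) = face X {} (sym_diff A {s}) c"
    "edge_rev X (face X {s} A c) = face X {s} (sym_diff A {s}) c"
proof -
  show l: "labels X (face X {s} A c) = {s}" using assms by (intro face_labels) auto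
  show "face X {s} A c \<in> edges X" using assms by (intro edgeI[OF _ l] face_cube) auto
  show "edge_start X (face X {s} A c) = face X {} A c"
    unfolding edge_start_def using face_face[of c "{s}" A "{}" "{}"] assms by simp
  show "edge_end X (face X {s} A c) = face X {} (sym_diff A {s}) c"
    unfolding edge_end_def l using assms by (intro face_face) auto
  show "edge_rev X (face X {s} A c) = face X {s} (sym_diff A {s}) c"
    unfolding edge_rev_def l using assms by (intro face_face) auto
qed

lemma cube_step:
  "c \<in> cubes X \<Longrightarrow> A \<subseteq> labels X c \<Longrightarrow> s \<in> labels X c \<Longrightarrow>
    edge_step X (face X {} A c) s (face X {} (sym_diff A {s}) c)"
  unfolding edge_step_def using cube_edge[of c A s] by (intro bexI[of _ "face X {s} A c"]) simp_all

text \<open>Crossing an edge in direction \<open>s\<close> flips the coordinate \<open>s\<close> of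
  the corner, so a word without repetitions flips exactly the coordinates that it lists.\<close>

lemma cube_walk:
  "c \<in> cubes X \<Longrightarrow> A \<subseteq> labels X c \<Longrightarrow> set w \<subseteq> labels X c \<Longrightarrow> distinct w \<Longrightarrow>
    walk X (face X {} A c) w (face X {} (sym_diff A (set w)) c)"
proof (induction w arbitrary: A)
  case Nil
  then show ?case by (simp add: corner_vertex)
next
  case (Cons s w)
  have "sym_diff (sym_diff A {s}) (set w) = sym_diff A (set (s # w))" using Cons.prems by auto
  moreover have "walk X (face X {} (sym_diff A {s}) c) w (face X {} (sym_diff (sym_diff A {s}) (set w)) c)"
    using Cons.prems by (intro Cons.IH) auto
  ultimately show ?case using cube_step[of c A s] Cons.prems unfolding walk_Cons by (metis insert_subset list.simps(15))
qed

text \<open>Supplies the coordinates of an oriented edge inside a cube: \<open>A\<close> is the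
  corner from which the edge leaves.\<close>

lemma faces_at_edge:
  assumes "c \<in> cubes X" "e \<in> edges X" "labels X e = {s}" "e \<in> faces X c"
  obtains A where "A \<subseteq> labels X c" "s \<in> labels X c" "e = face X {s} A c" "face X {} A c = edge_start X e"
proof -
  obtain L A where L: "L \<subseteq> labels X c" "A \<subseteq> labels X c" "e = face X L A c"
    using assms by (auto simp: faces_def)
  then have "L = {s}" using assms face_labels[of c L A] by simp
  with L assms(1) show thesis using that[of A] cube_edge(3)[of c A s] by simp
qed

end

section \<open>Folded complexes\<close>

locale folded_complex = lcc \<Gamma> X for \<Gamma> :: "'v pair_pre_digraph" and X :: "('v, 'c) labeled_complex" +
  assumes folded: "folded X"
begin

text \<open>The second alternative does occur, at graph-loops. In that case start and end coincide,
  so the end point of the step is determined all the same.\<close>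

lemma folded_edges:
  assumes "e \<in> edges X" "e' \<in> edges X" "labels X e = labels X e'" "edge_start X e = edge_start X e'"
  shows "e' = e \<or> e' = edge_rev X e"
proof -
  have "same_geometric_cube X e e'" using assms folded by (auto simp: folded_def)
  then obtain A where "A \<subseteq> labels X e" "e' = face X (labels X e) A e" by (auto simp: same_geometric_cube_def)
  moreover from this have "A = {} \<or> A = labels X e" using edge_labels[OF assms(1)] by auto
  ultimately show ?thesis using face_full[OF edge_cube[OF assms(1)]] by (auto simp: edge_rev_def)
qed

lemma edge_step_det: "edge_step X x s y \<Longrightarrow> edge_step X x s z \<Longrightarrow> y = z"
  unfolding edge_step_def using folded_edges edge_rev_props by metis

lemma walk_det: "walk X x w y \<Longrightarrow> walk X x w z \<Longrightarrow> y = z"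
  by (induction w arbitrary: x) (auto dest: edge_step_det)

text \<open>Induction over the label set. An edge is given up to reversal by its label and start, a
  higher cube up to reparametrization by its boundary, and the boundary is a function from finitely
  many proper faces to the finitely many cells with smaller label set.\<close>

lemma finite_cubes:
  assumes "finite (vertices X)"
  shows "finite (cubes X)"
proof -
  have K: "finite {c \<in> cubes X. labels X c = K}" if "finite K" for K
    using that
  proof (induction K rule: finite_psubset_induct)
    case (psubset K)
    let ?C = "{c \<in> cubes X. labels X c = K}"
    have orbit: "finite {d. same_geometric_cube X c d}" if "c \<in> ?C" for c
    proof -
      have "{d. same_geometric_cube X c d} = (\<lambda>A. face X K A c) ` Pow K"
        using that by (auto simp: same_geometric_cube_def)
      then show ?thesis using psubset by simp
    qed
    consider "K = {}" | s where "K = {s}" | "2 \<le> card K"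
    proof -
      have "card K = 0 \<or> card K = 1 \<or> 2 \<le> card K" by linarith
      then show thesis using that psubset(1) by (auto simp: card_1_singleton_iff)
    qed
    then show ?case
    proof cases
      case 1
      then show ?thesis using assms by (simp add: vertices_def)
    next
      case 2
      then have e: "?C \<subseteq> edges X" by (auto simp: edges_def)
      have "edge_start X ` ?C \<subseteq> vertices X" using e edge_rev_props(6) by blast
      then have "finite (edge_start X ` ?C)" using assms by (rule finite_subset)
      moreover have "finite {d \<in> ?C. edge_start X d = v}" if "v \<in> edge_start X ` ?C" for v
      proof -
        from that obtain c where c: "c \<in> ?C" "edge_start X c = v" by auto
        have "{d \<in> ?C. edge_start X d = v} \<subseteq> {c, edge_rev X c}"
        proof
          fix d assume d: "d \<in> {d \<in> ?C. edge_start X d = v}"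
          then have "d \<in> edges X" "c \<in> edges X" using e c(1) by auto
          then show "d \<in> {c, edge_rev X c}" using folded_edges[of c d] c d by auto
        qed
        then show ?thesis by (rule finite_subset) simp
      qed
      ultimately show ?thesis by (rule finite_fibres)
    next
      case 3
      define D where "D = (\<Union>L\<in>{L. L \<subset> K}. {c \<in> cubes X. labels X c = L})"
      have "{L. L \<subset> K} \<subseteq> Pow K" by (rule subsetI) (simp add: less_le)
      then have finL: "finite {L. L \<subset> K}" by (rule finite_subset) (simp add: psubset(1))
      have finD: "finite D" unfolding D_def by (intro finite_UN_I finL) (simp add: psubset(2))
      \<comment> \<open>The boundary as a restricted function, so that it lies in a finite set of
        the form \<open>PiE\<close>.\<close>
      define bd where "bd c = (\<lambda>(L, A)\<in>{L. L \<subset> K} \<times> Pow K. face X L A c)" for c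
      have fin: "finite (bd ` ?C)"
      proof (rule finite_subset)
        show "bd ` ?C \<subseteq> PiE ({L. L \<subset> K} \<times> Pow K) (\<lambda>_. D)"
        proof (intro image_subsetI PiE_I)
          fix c p assume c: "c \<in> ?C" and "p \<in> {L. L \<subset> K} \<times> Pow K"
          then obtain L A where p: "p = (L, A)" "L \<subset> K" "A \<subseteq> K" by blast
          then have "face X L A c \<in> cubes X" "labels X (face X L A c) = L"
            using c by (simp_all add: face_cube face_labels psubset_imp_subset)
          then show "bd c p \<in> D" using p by (simp add: bd_def D_def)
        qed (simp add: bd_def)
        show "finite (PiE ({L. L \<subset> K} \<times> Pow K) (\<lambda>_. D))"
          using psubset(1) finD finL by (intro finite_PiE) auto
      qed
      have "finite {d \<in> ?C. bd d = b}" if "b \<in> bd ` ?C" for b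
      proof -
        from that obtain c where c: "c \<in> ?C" "bd c = b" by auto
        have "{d \<in> ?C. bd d = b} \<subseteq> {d. same_geometric_cube X c d}"
        proof
          fix d assume d: "d \<in> {d \<in> ?C. bd d = b}"
          then have "bd c = bd d" using c by simp
          then have "face X L A c = face X L A d" if "L \<subset> K" "A \<subseteq> K" for L A
          proof -
            have "bd c (L, A) = bd d (L, A)" using \<open>bd c = bd d\<close> by simp
            then show ?thesis using that by (simp add: bd_def)
          qed
          then have "same_boundary X c d" using c d by (auto simp: same_boundary_def)
          then show "d \<in> {d. same_geometric_cube X c d}" using folded c d 3 by (auto simp: folded_def)
        qed
        then show ?thesis using orbit[OF c(1)] by (rule finite_subset)
      qed
      with fin show ?thesis by (rule finite_fibres)
    qed
  qed
  have "cubes X \<subseteq> (\<Union>K\<in>Pow (pverts \<Gamma>). {c \<in> cubes X. labels X c = K})"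
    using label_clique by (auto simp: clique_def)
  moreover have "finite (\<Union>K\<in>Pow (pverts \<Gamma>). {c \<in> cubes X. labels X c = K})"
    using K finite_subset[OF _ finite_pverts] by (intro finite_UN_I) auto
  ultimately show ?thesis by (rule finite_subset)
qed

end

section \<open>Shuffling and cancelling along walks\<close>

locale full_complex = folded_complex \<Gamma> X for \<Gamma> :: "'v pair_pre_digraph" and X :: "('v, 'c) labeled_complex" +
  assumes cube_full: "cube_full \<Gamma> X"
begin

lemma cube_fullD:
  assumes "K \<noteq> {}" "clique \<Gamma> K" "v \<in> vertices X"
    and "\<And>s. s \<in> K \<Longrightarrow> e s \<in> edges X \<and> labels X (e s) = {s} \<and> edge_start X (e s) = v"
  obtains c where "c \<in> cubes X" "labels X c = K" "\<And>s. s \<in> K \<Longrightarrow> e s \<in> faces X c"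
  using cube_full assms unfolding cube_full_def by metis

lemma adj_clique: "adj s t \<Longrightarrow> clique \<Gamma> {s, t}"
  using adj_in[of s t] adj_sym[of s t] by (auto simp: clique_def)

lemma square:
  assumes "edge_step X y s x" "edge_step X y t z" "adj s t"
  shows "\<exists>w. edge_step X x t w \<and> edge_step X z s w"
proof -
  obtain e where e: "e \<in> edges X" "labels X e = {s}" "edge_start X e = y" "edge_end X e = x"
    using assms by (auto simp: edge_step_def)
  obtain f where f: "f \<in> edges X" "labels X f = {t}" "edge_start X f = y" "edge_end X f = z"
    using assms by (auto simp: edge_step_def)
  have st: "s \<noteq> t" using assms(3) by auto
  define h where "h r = (if r = s then e else f)" for r
  obtain c where c: "c \<in> cubes X" "labels X c = {s, t}" "\<And>r. r \<in> {s, t} \<Longrightarrow> h r \<in> faces X c"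
    by (rule cube_fullD[of "{s, t}" y h]) (use e f st assms adj_clique edge_step_in in \<open>auto simp: h_def\<close>)
  have "e \<in> faces X c" using c(3)[of s] by (simp add: h_def)
  then obtain A where A: "A \<subseteq> {s, t}" "e = face X {s} A c" "face X {} A c = y"
    using faces_at_edge[OF c(1) e(1,2)] c(2) e(3) by metis
  have x: "x = face X {} (sym_diff A {s}) c"
    using cube_edge[of c A s] c A e by simp
  have z: "z = face X {} (sym_diff A {t}) c"
    using edge_step_det[OF assms(2)] cube_step[of c A t] c A by simp
  have "sym_diff (sym_diff A {s}) {t} = sym_diff (sym_diff A {t}) {s}" using st by auto
  then show ?thesis
    using cube_step[of c "sym_diff A {s}" t] cube_step[of c "sym_diff A {t}" s] c A(1) x z
    by (intro exI[of _ "face X {} (sym_diff (sym_diff A {s}) {t}) c"]) auto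
qed

text \<open>The square is spanned at the middle vertex \<open>q\<close> of the two edges, by the
  first edge reversed and the second edge; its fourth corner is the middle vertex for the other
  order of the letters.\<close>

lemma walk_swap: "u \<sim> w \<Longrightarrow> walk X x u y \<Longrightarrow> walk X x w y"
proof (induction rule: swap_eq.induct)
  case (step u a s t b)
  then have "walk X x (a @ [s, t] @ b) y" by simp
  then obtain p q r where "walk X x a p" "edge_step X p s q" "edge_step X q t r" "walk X r b y"
    by (auto simp: walk_append)
  moreover from this obtain q' where "edge_step X p t q'" "edge_step X q' s r"
    using square[OF edge_step_sym, of p s q t r] edge_step_sym[of r s] step by blast
  ultimately show ?case by (auto simp: walk_append)
qed

lemma walk_push: "walk X x (s # w) y \<Longrightarrow> walk X x (push s w) y"
proof (cases "front s w")
  case True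
  assume "walk X x (s # w) y"
  then obtain z where z: "edge_step X x s z" "walk X z w y" by auto
  then have "walk X z (s # remove1 s w) y" using walk_swap[OF front_swap[OF True]] by blast
  then obtain x' where x': "edge_step X z s x'" "walk X x' (remove1 s w) y" by auto
  then have "x' = x" using edge_step_det[OF edge_step_sym[OF z(1)]] by blast
  with x' True show ?thesis by (simp add: push_def)
qed (simp add: push_def)

lemma walk_nf: "walk X x w y \<Longrightarrow> walk X x (nf w) y"
proof (induction w arbitrary: x)
  case (Cons s w)
  then obtain z where "edge_step X x s z" "walk X z w y" by auto
  then have "walk X x (s # nf w) y" using Cons by auto
  then show ?case using walk_push by simp
qed auto

text \<open>Only reduced representatives are guaranteed to be readable: a longer word for the same
  element may ask for edges that do not exist.\<close>

lemma walk_reduced: "walk X x u y \<Longrightarrow> u \<approx> w \<Longrightarrow> cred w \<Longrightarrow> walk X x w y"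
  using walk_nf[of x u y] eq_imp_nf[of u w] walk_swap[of "nf u" w] by (simp add: nf_cred)

text \<open>Both walks can be replaced by walks along the normal forms, which are shuffles of each
  other, and then determinism applies.\<close>

lemma walk_eq_end: "walk X x u y \<Longrightarrow> walk X x w z \<Longrightarrow> u \<approx> w \<Longrightarrow> y = z"
  using walk_nf[of x u y] walk_nf[of x w z] eq_imp_nf[of u w] walk_swap[of "nf u" "nf w" x y] walk_det
  by blast

end

section \<open>Vertices of a completion as cosets\<close>

locale completion_of = racg_subgroup \<Gamma> G for \<Gamma> :: "'v pair_pre_digraph" and G +
  fixes X :: "('v, 'c) labeled_complex" and B :: 'c
  assumes completion: "completion \<Gamma> G X B"
begin

sublocale full_complex \<Gamma> X
  using completion by unfold_locales (auto simp: completion_def)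

lemma B_vertex: "B \<in> vertices X"
  using completion by (simp add: completion_def)

lemma walk_loop: "walk X B w B \<Longrightarrow> w \<in> GW"
  using completion walk_in[of B w B] by (auto simp: completion_def GW_def walk_def)

lemma loop_walk: "w \<in> GW \<Longrightarrow> cred w \<Longrightarrow> walk X B w B"
  using completion by (auto simp: completion_def GW_def walk_def reduced_iff)

lemma walk_exists: "v \<in> vertices X \<Longrightarrow> \<exists>w. walk X B w v"
  using completion B_vertex by (auto simp: completion_def walk_def path_connected_complex_def)

lemma GW_walk: "g \<in> GW \<Longrightarrow> walk X B w v \<Longrightarrow> walk X B (nf (g @ w)) v"
proof -
  assume g: "g \<in> GW" and w: "walk X B w v"
  have "walk X B (nf g @ w) v" using loop_walk[OF nf_GW[OF g] cred_nf] w by (auto simp: walk_append)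
  moreover have "nf g @ w \<approx> nf (g @ w)"
  proof -
    have gw: "g \<in> words" "w \<in> words" using g w walk_in GW_words by auto
    have "nf g @ w \<approx> g @ w" using gw by (intro eq_append nf_eq eq_refl)
    also have "g @ w \<approx> nf (g @ w)" using nf_eq[of "g @ w"] gw by (simp add: eq_sym)
    finally show ?thesis .
  qed
  ultimately show ?thesis by (rule walk_reduced) (rule cred_nf)
qed

text \<open>Since \<open>u @ rev w \<in> GW\<close> says that \<open>u\<close> and \<open>w\<close>
  lie in one right coset of the subgroup, this is the well-defined and injective map from vertices
  to right cosets.\<close>

lemma same_end_iff:
  assumes u: "walk X B u y" and w: "walk X B w z"
  shows "y = z \<longleftrightarrow> u @ rev w \<in> GW"
proof
  assume "y = z"
  then have "walk X B (u @ rev w) B" using u walk_rev[OF w] by (auto simp: walk_append)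
  then show "u @ rev w \<in> GW" by (rule walk_loop)
next
  assume g: "u @ rev w \<in> GW"
  have uw: "u \<in> words" "w \<in> words" using u w walk_in by auto
  have "nf ((u @ rev w) @ w) \<approx> (u @ rev w) @ w" using uw by (intro nf_eq) auto
  also have "(u @ rev w) @ w \<approx> u" using uw eq_append[OF eq_refl rev_left, of u w] by simp
  finally have "nf ((u @ rev w) @ w) \<approx> u" .
  then show "y = z" using walk_eq_end[OF u GW_walk[OF g w]] by (blast intro: eq_sym)
qed

text \<open>The loops at \<open>v\<close> spell elements of the conjugate of the subgroup by
  \<open>x\<close>. In the second part the loop is found by going back to \<open>B\<close>, around
  the loop for \<open>x @ w @ rev x\<close> and out again; the resulting word is then reduced to
  \<open>w\<close>.\<close>

lemma walk_loop_at:
  assumes x: "walk X B x v" and w: "w \<in> words"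
  shows "walk X v w v \<Longrightarrow> x @ w @ rev x \<in> GW"
    and "x @ w @ rev x \<in> GW \<Longrightarrow> cred w \<Longrightarrow> walk X v w v"
proof -
  assume "walk X v w v"
  then have "walk X B (x @ w @ rev x) B" using x walk_rev[OF x] by (auto simp: walk_append)
  then show "x @ w @ rev x \<in> GW" by (rule walk_loop)
next
  assume g: "x @ w @ rev x \<in> GW" and c: "cred w"
  have xw: "x \<in> words" using x walk_in by auto
  have "walk X B (nf (x @ w @ rev x)) B" by (intro loop_walk nf_GW g cred_nf)
  then have "walk X v (rev x @ nf (x @ w @ rev x) @ x) v" using x walk_rev[OF x] by (auto simp: walk_append)
  moreover have "rev x @ nf (x @ w @ rev x) @ x \<approx> w"
  proof -
    have "rev x @ nf (x @ w @ rev x) @ x \<approx> rev x @ (x @ w @ rev x) @ x"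
      using xw w by (intro eq_context nf_eq) auto
    also have "\<dots> = (rev x @ x) @ w @ (rev x @ x)" by simp
    also have "(rev x @ x) @ w @ (rev x @ x) \<approx> [] @ w @ []"
      using xw w by (intro eq_append rev_left eq_refl) auto
    finally show ?thesis by simp
  qed
  ultimately show "walk X v w v" using c by (rule walk_reduced)
qed

end


section \<open>Finite index, torsion and normality\<close>

context right_angled
begin

lemma cred_Nil: "cred w \<Longrightarrow> w \<approx> [] \<Longrightarrow> w = []"
  using cred_length_eq[of w "[]"] by simp

lemma front_nf_set:
  assumes "\<And>t. t \<in> pverts \<Gamma> \<Longrightarrow> t \<noteq> s \<Longrightarrow> adj s t" "w \<in> words"
  shows "s \<in> set w \<Longrightarrow> front s w"
  using assms(2) by (induction w) (use assms(1) in auto)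

end

context racg_subgroup
begin

lemma G_word: "g \<in> G \<Longrightarrow> \<exists>w\<in>GW. g = word_elem \<Gamma> w"
  by (subst (asm) G_eq) auto

lemma carrier_word: "g \<in> carrier (racg \<Gamma>) \<Longrightarrow> \<exists>w\<in>words. g = word_elem \<Gamma> w"
  by (auto simp: carrier_racg)

lemma rcoset_eq_iff:
  assumes "u \<in> words" "w \<in> words"
  shows "G #>\<^bsub>racg \<Gamma>\<^esub> word_elem \<Gamma> u = G #>\<^bsub>racg \<Gamma>\<^esub> word_elem \<Gamma> w \<longleftrightarrow> u @ rev w \<in> GW"
proof
  assume "G #>\<^bsub>racg \<Gamma>\<^esub> word_elem \<Gamma> u = G #>\<^bsub>racg \<Gamma>\<^esub> word_elem \<Gamma> w"
  then have "word_elem \<Gamma> u \<in> G #>\<^bsub>racg \<Gamma>\<^esub> word_elem \<Gamma> w"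
    using group.rcos_self[OF group_racg elem_in_carrier subgroup] assms by blast
  then obtain h where h: "h \<in> G" "word_elem \<Gamma> u = h \<otimes>\<^bsub>racg \<Gamma>\<^esub> word_elem \<Gamma> w" by (auto simp: r_coset_def)
  then obtain g where g: "g \<in> GW" "h = word_elem \<Gamma> g" using G_word by blast
  then have "u \<approx> g @ w" using h assms GW_words[of g] elem_eq_iff[of u] by simp
  then have "u @ rev w \<approx> g" using eq_move_right[of w u g] assms g GW_words[of g] by simp
  then show "u @ rev w \<in> GW" using eq_GW[OF g(1)] eq_sym by blast
next
  assume g: "u @ rev w \<in> GW"
  have "(u @ rev w) @ w \<approx> u" using eq_append[OF eq_refl rev_left, of u w] assms by simp
  then have "word_elem \<Gamma> u = word_elem \<Gamma> (u @ rev w) \<otimes>\<^bsub>racg \<Gamma>\<^esub> word_elem \<Gamma> w"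
    using assms elem_eq_iff[of "(u @ rev w) @ w" u] by simp
  then have "word_elem \<Gamma> u \<in> G #>\<^bsub>racg \<Gamma>\<^esub> word_elem \<Gamma> w" using g unfolding r_coset_def GW_def by blast
  then show "G #>\<^bsub>racg \<Gamma>\<^esub> word_elem \<Gamma> u = G #>\<^bsub>racg \<Gamma>\<^esub> word_elem \<Gamma> w"
    using group.repr_independence[OF group_racg _ elem_in_carrier subgroup] assms by metis
qed

lemma rcosets_words: "rcosets\<^bsub>racg \<Gamma>\<^esub> G = (\<lambda>w. G #>\<^bsub>racg \<Gamma>\<^esub> word_elem \<Gamma> w) ` words"
  by (auto simp: RCOSETS_def carrier_racg)

text \<open>Conjugation by a word is done letter by letter. Letters are their own inverses, so the
  conjugation by \<open>rev x\<close> in the second part reverses the one by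
  \<open>x\<close>.\<close>

lemma normal_words: "G \<lhd> racg \<Gamma> \<longleftrightarrow> (\<forall>s\<in>pverts \<Gamma>. \<forall>w\<in>GW. [s] @ w @ [s] \<in> GW)"
  and normal_conj: "G \<lhd> racg \<Gamma> \<Longrightarrow> x \<in> words \<Longrightarrow> w \<in> words \<Longrightarrow> x @ w @ rev x \<in> GW \<longleftrightarrow> w \<in> GW"
proof -
  have c: "x \<otimes>\<^bsub>racg \<Gamma>\<^esub> h \<otimes>\<^bsub>racg \<Gamma>\<^esub> inv\<^bsub>racg \<Gamma>\<^esub> x \<in> G \<longleftrightarrow> u @ w @ rev u \<in> GW"
    if "x = word_elem \<Gamma> u" "h = word_elem \<Gamma> w" "u \<in> words" "w \<in> words" for x h u w
    using that by (simp add: inv_elem GW_def)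
  have n: "G \<lhd> racg \<Gamma> \<longleftrightarrow> (\<forall>u\<in>words. \<forall>w\<in>GW. u @ w @ rev u \<in> GW)"
  proof
    assume a: "G \<lhd> racg \<Gamma>"
    show "\<forall>u\<in>words. \<forall>w\<in>GW. u @ w @ rev u \<in> GW"
    proof (intro ballI)
      fix u w assume uw: "u \<in> words" "w \<in> GW"
      then have "word_elem \<Gamma> u \<in> carrier (racg \<Gamma>)" "word_elem \<Gamma> w \<in> G" by (simp_all add: GW_def)
      then have "word_elem \<Gamma> u \<otimes>\<^bsub>racg \<Gamma>\<^esub> word_elem \<Gamma> w \<otimes>\<^bsub>racg \<Gamma>\<^esub> inv\<^bsub>racg \<Gamma>\<^esub> word_elem \<Gamma> u \<in> G"
        using a unfolding group.normal_inv_iff[OF group_racg] by simp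
      then show "u @ w @ rev u \<in> GW" using c[OF HOL.refl HOL.refl uw(1) GW_words[OF uw(2)]] by blast
    qed
  next
    assume a: "\<forall>u\<in>words. \<forall>w\<in>GW. u @ w @ rev u \<in> GW"
    show "G \<lhd> racg \<Gamma>"
      unfolding group.normal_inv_iff[OF group_racg]
    proof (intro conjI ballI subgroup)
      fix x h assume "x \<in> carrier (racg \<Gamma>)" "h \<in> G"
      then obtain u w where "u \<in> words" "x = word_elem \<Gamma> u" "w \<in> GW" "h = word_elem \<Gamma> w"
        using G_word carrier_word by metis
      then show "x \<otimes>\<^bsub>racg \<Gamma>\<^esub> h \<otimes>\<^bsub>racg \<Gamma>\<^esub> inv\<^bsub>racg \<Gamma>\<^esub> x \<in> G"
        using c a GW_words by simp
    qed
  qed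
  show "G \<lhd> racg \<Gamma> \<longleftrightarrow> (\<forall>s\<in>pverts \<Gamma>. \<forall>w\<in>GW. [s] @ w @ [s] \<in> GW)"
  proof
    assume a: "\<forall>s\<in>pverts \<Gamma>. \<forall>w\<in>GW. [s] @ w @ [s] \<in> GW"
    have "u @ w @ rev u \<in> GW" if "u \<in> words" "w \<in> GW" for u w
      using that
    proof (induction u)
      case (Cons s u)
      then show ?case using a[rule_format, of s "u @ w @ rev u"] by simp
    qed simp
    then show "G \<lhd> racg \<Gamma>" using n by blast
  next
    assume a: "G \<lhd> racg \<Gamma>"
    show "\<forall>s\<in>pverts \<Gamma>. \<forall>w\<in>GW. [s] @ w @ [s] \<in> GW"
    proof (intro ballI)
      fix s w assume "s \<in> pverts \<Gamma>" "w \<in> GW"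
      then have "[s] @ w @ rev [s] \<in> GW" using a n by (metis Cons_in_lists_iff lists.Nil)
      then show "[s] @ w @ [s] \<in> GW" by simp
    qed
  qed
  assume a: "G \<lhd> racg \<Gamma>" and x: "x \<in> words" and w: "w \<in> words"
  show "x @ w @ rev x \<in> GW \<longleftrightarrow> w \<in> GW"
  proof
    assume "x @ w @ rev x \<in> GW"
    then have "rev x @ (x @ w @ rev x) @ rev (rev x) \<in> GW" using a n x rev_in by blast
    moreover have "rev x @ (x @ w @ rev x) @ rev (rev x) \<approx> w"
      using eq_append[OF rev_left[OF x] eq_append[OF eq_refl[OF w] rev_left[OF x]]] by simp
    ultimately show "w \<in> GW" by (rule eq_GW)
  qed (use a n x in blast)
qed

end

section \<open>Finite index\<close>

context completion_of
begin

text \<open>A chosen label of a path from \<open>B\<close>, in other words a representative of the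
  coset that belongs to the vertex.\<close>

definition addr :: "'c \<Rightarrow> 'v list" where
  "addr v = (SOME w. walk X B w v)"

lemma addr: "v \<in> vertices X \<Longrightarrow> walk X B (addr v) v"
  unfolding addr_def using walk_exists by (rule someI_ex)

text \<open>With full valence every word can be read from \<open>B\<close>, so every coset belongs
  to a vertex. Conversely let an \<open>s\<close>-edge at \<open>v\<close> be sought. If some
  \<open>t\<close> fails to commute with \<open>s\<close>, two of the infinitely many powers of
  \<open>s t\<close> read behind \<open>addr v\<close> fall into one coset, and this yields a
  reduced loop at \<open>v\<close> whose first edge is labeled \<open>s\<close>. If \<open>s\<close>
  commutes with all other letters, an \<open>s\<close>-edge exists somewhere because the completion
  is resolved, and it is carried to \<open>v\<close>.\<close>

lemma finite_index:
  assumes "resolved \<Gamma> X"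
  shows "finite (rcosets\<^bsub>racg \<Gamma>\<^esub> G) \<longleftrightarrow> finite (cubes X) \<and> full_valence \<Gamma> X"
proof
  let ?c = "\<lambda>w. G #>\<^bsub>racg \<Gamma>\<^esub> word_elem \<Gamma> w"
  assume a: "finite (cubes X) \<and> full_valence \<Gamma> X"
  have ex: "\<exists>v. walk X u w v" if "w \<in> words" "u \<in> vertices X" for w u
    using that
  proof (induction w arbitrary: u)
    case (Cons s w)
    then have "\<exists>e\<in>edges X. labels X e = {s} \<and> edge_start X e = u" using a by (simp add: full_valence_def)
    then obtain e where "e \<in> edges X" "labels X e = {s}" "edge_start X e = u" by blast
    then have "edge_step X u s (edge_end X e)" "edge_end X e \<in> vertices X"
      using edge_rev_props by (auto simp: edge_step_def)
    moreover have "w \<in> words" using Cons by simp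
    ultimately show ?case using Cons.IH unfolding walk_Cons by blast
  qed auto
  have "rcosets\<^bsub>racg \<Gamma>\<^esub> G \<subseteq> (\<lambda>v. ?c (addr v)) ` vertices X"
    unfolding rcosets_words
  proof (rule image_subsetI)
    fix w assume w: "w \<in> words"
    then obtain v where v: "walk X B w v" using ex B_vertex by blast
    then have "v \<in> vertices X" using walk_in by blast
    then have "w @ rev (addr v) \<in> GW" using same_end_iff[OF v addr] by blast
    then have "?c w = ?c (addr v)"
      using rcoset_eq_iff[of w "addr v"] w walk_in[OF addr[OF \<open>v \<in> vertices X\<close>]] by blast
    then show "?c w \<in> (\<lambda>v. ?c (addr v)) ` vertices X" using \<open>v \<in> vertices X\<close> by blast
  qed
  moreover have "finite (vertices X)" using a by (simp add: vertices_def)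
  ultimately show "finite (rcosets\<^bsub>racg \<Gamma>\<^esub> G)" by (metis finite_imageI finite_subset)
next
  let ?c = "\<lambda>w. G #>\<^bsub>racg \<Gamma>\<^esub> word_elem \<Gamma> w"
  assume fin: "finite (rcosets\<^bsub>racg \<Gamma>\<^esub> G)"
  have "inj_on (\<lambda>v. ?c (addr v)) (vertices X)"
  proof (rule inj_onI)
    fix u v assume uv: "u \<in> vertices X" "v \<in> vertices X" "?c (addr u) = ?c (addr v)"
    then have "addr u @ rev (addr v) \<in> GW"
      using rcoset_eq_iff[of "addr u" "addr v"] walk_in addr by blast
    then show "u = v" using same_end_iff addr uv by blast
  qed
  moreover have "(\<lambda>v. ?c (addr v)) ` vertices X \<subseteq> rcosets\<^bsub>racg \<Gamma>\<^esub> G"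
    unfolding rcosets_words using walk_in addr by blast
  ultimately have "finite (vertices X)" using fin by (meson finite_imageD finite_subset)
  then have "finite (cubes X)" by (rule finite_cubes)
  moreover have "\<exists>z. edge_step X v s z" if v: "v \<in> vertices X" and s: "s \<in> pverts \<Gamma>" for v s
  proof (cases "star \<Gamma> s = pverts \<Gamma>")
    case False
    have "star \<Gamma> s \<subseteq> pverts \<Gamma>" using s adj_in by (auto simp: star_def)
    with False obtain t where t: "t \<in> pverts \<Gamma>" "t \<noteq> s" "\<not> adj s t" by (auto simp: star_def)
    let ?x = "addr v"
    have x: "?x \<in> words" "walk X B ?x v" using addr[OF v] walk_in by auto
    have st: "[s, t] \<in> words" using s t by simp
    have "range (\<lambda>n. ?c (?x @ wpow [s, t] n)) \<subseteq> rcosets\<^bsub>racg \<Gamma>\<^esub> G"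
      unfolding rcosets_words using x st by auto
    then have "finite (range (\<lambda>n. ?c (?x @ wpow [s, t] n)))" using fin by (rule finite_subset)
    then have "\<not> inj (\<lambda>n. ?c (?x @ wpow [s, t] n))" using finite_imageD infinite_UNIV_nat by blast
    then obtain i j where "i < j" and ij: "?c (?x @ wpow [s, t] j) = ?c (?x @ wpow [s, t] i)"
      by (metis (mono_tags, lifting) injI linorder_neqE_nat)
    define k where "k = j - i"
    have j: "j = k + i" "k > 0" using \<open>i < j\<close> by (auto simp: k_def)
    have "(?x @ wpow [s, t] j) @ rev (?x @ wpow [s, t] i) \<in> GW"
      using ij rcoset_eq_iff x st by simp
    moreover have "(?x @ wpow [s, t] j) @ rev (?x @ wpow [s, t] i) \<approx> ?x @ wpow [s, t] k @ rev ?x"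
    proof -
      have "(?x @ wpow [s, t] k) @ (wpow [s, t] i @ rev (wpow [s, t] i)) @ rev ?x
          \<approx> (?x @ wpow [s, t] k) @ [] @ rev ?x"
        using x st by (intro eq_context rev_right wpow_in) auto
      then show ?thesis by (simp add: j wpow_add)
    qed
    ultimately have "?x @ wpow [s, t] k @ rev ?x \<in> GW" by (rule eq_GW)
    \<comment> \<open>The only front letter of \<open>[s, t]\<close> is \<open>s\<close> and the
      only rear letter is \<open>t\<close>, because the two do not commute.\<close>
    moreover have "cred (wpow [s, t] k)" using t adj_sym[of t s] by (intro cred_wpow) auto
    ultimately have "walk X v (wpow [s, t] k) v" using walk_loop_at(2)[OF x(2)] st by simp
    then show ?thesis using j(2) by (cases k) auto
  next
    case True
    then obtain e where e: "e \<in> edges X" "labels X e = {s}" using assms s by (auto simp: resolved_def)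
    have com: "adj s t" if "t \<in> pverts \<Gamma>" "t \<noteq> s" for t using True that by (auto simp: star_def)
    define y where "y = edge_start X e"
    have y: "y \<in> vertices X" "edge_step X y s (edge_end X e)"
      using e edge_rev_props by (auto simp: y_def edge_step_def)
    define w where "w = nf (rev (addr v) @ addr y)"
    have "walk X v (rev (addr v) @ addr y) y" using walk_rev[OF addr[OF v]] addr[OF y(1)] by (auto simp: walk_append)
    then have w: "walk X v w y" unfolding w_def by (rule walk_nf)
    then have ww: "w \<in> words" using walk_in by blast
    show ?thesis
    \<comment> \<open>Here \<open>w\<close> is reduced and leads from \<open>v\<close> to an
      \<open>s\<close>-edge at \<open>y\<close>. Either \<open>w\<close> contains \<open>s\<close>,
      which can be shuffled to its front, or the \<open>s\<close>-edge is appended to the walk and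
      then shuffled to its front.\<close>
    proof (cases "s \<in> set w")
      case True
      then have "front s w" using front_nf_set[OF com ww] by blast
      then have "walk X v (s # remove1 s w) y" using walk_swap[OF front_swap] w by blast
      then show ?thesis by auto
    next
      case False
      then have "commutes s w" using com ww by (auto simp: commutes_def in_lists_conv_set)
      moreover have "walk X v (w @ [s]) (edge_end X e)" using w y edge_step_in[OF y(2)] by (auto simp: walk_append)
      ultimately have "walk X v (s # w) (edge_end X e)" using walk_swap[OF swap_sym[OF commutes_swap]] by blast
      then show ?thesis by auto
    qed
  qed
  then have "full_valence \<Gamma> X" by (fastforce simp: full_valence_def edge_step_def)
  ultimately show "finite (cubes X) \<and> full_valence \<Gamma> X" by simp
qed

section \<open>Torsion\<close>

lemma torsion_walk:
  "walk X v w v \<Longrightarrow> cred w \<Longrightarrow> w \<noteq> [] \<Longrightarrow> n > 0 \<Longrightarrow> wpow w n \<approx> [] \<Longrightarrow>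
    \<exists>v w. walk X v w v \<and> cred w \<and> w \<noteq> [] \<and> clique \<Gamma> (set w)"
proof (induction "length w" arbitrary: v w rule: less_induct)
  case less
  have w: "w \<in> words" using less.prems walk_in by blast
  show ?case
  proof (cases "\<exists>s w'. w \<sim> s # w' @ [s]")
    case True
    \<comment> \<open>The first and the last letter of the shuffled loop run along the same step in
      opposite directions. Removing them moves the base point to the neighbour \<open>z\<close>,
      conjugates the element and shortens the loop.\<close>
    then obtain s w' where sw: "w \<sim> s # w' @ [s]" by blast
    then have wk: "walk X v (s # w' @ [s]) v" using walk_swap less.prems by blast
    then obtain z z' where z: "edge_step X v s z" "walk X z w' z'" "edge_step X z' s v"
      by (auto simp: walk_append)
    then have "z' = z" using edge_step_det edge_step_sym by blast
    with z have wz: "walk X z w' z" by simp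
    have cr: "cred (s # w' @ [s])" using cred_cong[OF sw] less.prems by simp
    then have cr': "cred w'" by (simp add: cred_append)
    have s: "[s] \<in> words" "w' \<in> words" using edge_step_in[OF z(1)] walk_in[OF wz] by auto
    have e: "w \<approx> [s] @ w' @ rev [s]" using swap_imp_eq[OF sw w] by simp
    have "wpow ([s] @ w' @ rev [s]) n \<approx> []" using wpow_cong[OF e] less.prems by (blast intro: eq_sym eq_trans)
    then have "[s] @ wpow w' n @ rev [s] \<approx> []" using wpow_conj[OF s(2,1), of n] by (blast intro: eq_sym eq_trans)
    then have "wpow w' n \<approx> []" using conj_eq_Nil[of "wpow w' n" "[s]"] s by simp
    moreover have "w' \<noteq> []" using cr by auto
    moreover have "length w' < length w" using swap_length[OF sw] by simp
    ultimately show ?thesis using less.hyps wz cr' less.prems by blast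
  next
    case False
    \<comment> \<open>A loop that cannot be shortened in this way is cyclically reduced, and finite
      order forces its letters to commute.\<close>
    then have "\<forall>s\<in>set w. \<forall>t\<in>set w. s = t \<or> adj s t"
      using cyclically_reduced_finite_order[OF w] less.prems by blast
    then have "clique \<Gamma> (set w)" using w by (auto simp: clique_def in_lists_conv_set)
    then show ?thesis using less.prems by blast
  qed
qed

lemma torsion_clique_loop:
  assumes "has_torsion (racg \<Gamma>) G"
  shows "\<exists>v w. walk X v w v \<and> cred w \<and> w \<noteq> [] \<and> clique \<Gamma> (set w)"
proof -
  obtain w n where w: "w \<in> GW" "\<not> w \<approx> []" "n > 0" "wpow w n \<approx> []"
    using assms has_torsion_words by blast
  then have nf: "nf w \<approx> w" using nf_eq GW_words by blast
  have "walk X B (nf w) B" using w loop_walk[OF nf_GW cred_nf] by blast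
  moreover have "nf w \<noteq> []" using nf w(2) eq_sym by force
  moreover have "wpow (nf w) n \<approx> []" using wpow_cong[OF nf] w by (blast intro: eq_trans)
  ultimately show ?thesis using torsion_walk cred_nf w by blast
qed

text \<open>Conjugation by \<open>addr v\<close> carries the loop to \<open>B\<close>; it preserves
  finite order and nontriviality.\<close>

lemma loop_torsion:
  assumes "walk X v w v" "cred w" "w \<noteq> []"
    and "T \<subseteq> pverts \<Gamma>" "finite (special_subgroup \<Gamma> T)" "word_elem \<Gamma> w \<in> special_subgroup \<Gamma> T"
  shows "has_torsion (racg \<Gamma>) G"
proof -
  have w: "w \<in> words" "v \<in> vertices X" using assms walk_in by auto
  obtain n where n: "n > 0" "wpow w n \<approx> []" using finite_special_subgroup_order[OF assms(4,5) w(1) assms(6)] by blast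
  let ?x = "addr v"
  have x: "?x \<in> words" using addr[OF w(2)] walk_in by blast
  have g: "?x @ w @ rev ?x \<in> GW" using walk_loop_at(1)[OF addr[OF w(2)] w(1) assms(1)] .
  moreover have "\<not> ?x @ w @ rev ?x \<approx> []" using conj_eq_Nil[OF w(1) x] cred_Nil assms by blast
  moreover have "?x @ wpow w n @ rev ?x \<approx> []" using conj_eq_Nil[of "wpow w n" ?x] w x n by simp
  then have "wpow (?x @ w @ rev ?x) n \<approx> []" using wpow_conj[OF w(1) x] eq_trans by blast
  ultimately show ?thesis using has_torsion_words n by blast
qed

lemma has_torsion_iff:
  "has_torsion (racg \<Gamma>) G \<longleftrightarrow>
     (\<exists>v p. edge_loop X v p \<and> reduced \<Gamma> (path_label X p) \<and>
        word_elem \<Gamma> (path_label X p) \<noteq> \<one>\<^bsub>racg \<Gamma>\<^esub> \<and>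
        (\<exists>T\<subseteq>pverts \<Gamma>. finite (special_subgroup \<Gamma> T) \<and>
           word_elem \<Gamma> (path_label X p) \<in> special_subgroup \<Gamma> T))"
proof
  assume "has_torsion (racg \<Gamma>) G"
  then obtain v w where w: "walk X v w v" "cred w" "w \<noteq> []" "clique \<Gamma> (set w)"
    using torsion_clique_loop by blast
  then obtain p where p: "edge_loop X v p" "path_label X p = w" unfolding walk_def by blast
  have ww: "w \<in> words" using w walk_in by blast
  then have "reduced \<Gamma> w" "word_elem \<Gamma> w \<noteq> \<one>\<^bsub>racg \<Gamma>\<^esub>"
    using w cred_Nil by (auto simp: reduced_iff elem_one_iff)
  moreover have T: "set w \<subseteq> pverts \<Gamma>" using w by (simp add: clique_def)
  moreover have "word_elem \<Gamma> w \<in> special_subgroup \<Gamma> (set w)"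
    unfolding special_subgroup_words[OF T] by (rule imageI) (simp add: in_lists_conv_set)
  ultimately show "\<exists>v p. edge_loop X v p \<and> reduced \<Gamma> (path_label X p) \<and>
        word_elem \<Gamma> (path_label X p) \<noteq> \<one>\<^bsub>racg \<Gamma>\<^esub> \<and>
        (\<exists>T\<subseteq>pverts \<Gamma>. finite (special_subgroup \<Gamma> T) \<and>
           word_elem \<Gamma> (path_label X p) \<in> special_subgroup \<Gamma> T)"
    using p finite_special_subgroup[OF w(4)] by metis
next
  assume "\<exists>v p. edge_loop X v p \<and> reduced \<Gamma> (path_label X p) \<and>
        word_elem \<Gamma> (path_label X p) \<noteq> \<one>\<^bsub>racg \<Gamma>\<^esub> \<and>
        (\<exists>T\<subseteq>pverts \<Gamma>. finite (special_subgroup \<Gamma> T) \<and>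
           word_elem \<Gamma> (path_label X p) \<in> special_subgroup \<Gamma> T)"
  then obtain v p T where p: "edge_loop X v p" "reduced \<Gamma> (path_label X p)"
        "word_elem \<Gamma> (path_label X p) \<noteq> \<one>\<^bsub>racg \<Gamma>\<^esub>"
     and T: "T\<subseteq>pverts \<Gamma>" "finite (special_subgroup \<Gamma> T)"
           "word_elem \<Gamma> (path_label X p) \<in> special_subgroup \<Gamma> T" by blast
  have wk: "walk X v (path_label X p) v" unfolding walk_def using p(1) by blast
  have "path_label X p \<noteq> []" using p(3) one_elem by metis
  moreover have "cred (path_label X p)" using p(2) by (simp add: reduced_iff)
  ultimately show "has_torsion (racg \<Gamma>) G" using loop_torsion[OF wk _ _ T] by blast
qed

text \<open>The form in which torsion-freeness acts on cubes: two corners of a cube are joined by a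
  walk whose label has no repetitions and lies in a clique.\<close>

lemma no_clique_loop:
  assumes "\<not> has_torsion (racg \<Gamma>) G" "walk X v w v" "distinct w" "clique \<Gamma> (set w)"
  shows "w = []"
proof (rule ccontr)
  assume "w \<noteq> []"
  have T: "set w \<subseteq> pverts \<Gamma>" using assms by (simp add: clique_def)
  have "word_elem \<Gamma> w \<in> special_subgroup \<Gamma> (set w)"
    unfolding special_subgroup_words[OF T] by (rule imageI) (simp add: in_lists_conv_set)
  then show False
    using loop_torsion[OF assms(2) distinct_clique_cred[OF assms(3)] \<open>w \<noteq> []\<close> T finite_special_subgroup[OF assms(4)]] assms(1)
    by blast
qed

end


section \<open>Core graphs\<close>

lemma edge_path_edges: "edge_path X u p v \<Longrightarrow> set p \<subseteq> edges X"
  by (induction p arbitrary: u) auto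

context lcc
begin

lemma edge_path_ends: "edge_path X u p v \<Longrightarrow> u \<in> vertices X \<and> v \<in> vertices X"
  by (induction p arbitrary: u) (auto intro: edge_rev_props)

lemma edge_path_append_iff: "edge_path X u (p @ q) v \<longleftrightarrow> (\<exists>z. edge_path X u p z \<and> edge_path X z q v)"
  by (induction p arbitrary: u) (auto dest: edge_path_ends)

lemma edge_path_walk: "edge_path X u p v \<Longrightarrow> walk X u (path_label X p) v"
  by (auto simp: walk_def)

lemma path_label_simps [simp]:
  "path_label X [] = []" "path_label X (e # p) = edge_label X e # path_label X p"
  "path_label X (p @ q) = path_label X p @ path_label X q"
  by (simp_all add: path_label_def)

lemma faces_edge:
  assumes "e \<in> edges X" "c \<in> faces X e"
  shows "c = e \<or> c = edge_rev X e \<or> c = edge_start X e \<or> c = edge_end X e"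
proof -
  obtain s where s: "labels X e = {s}" using edge_labels[OF assms(1)] by simp
  then obtain L A where "c = face X L A e" "L = {} \<or> L = {s}" "A = {} \<or> A = {s}"
    using assms(2) by (auto simp: faces_def subset_singleton_iff)
  then show ?thesis
    using face_full[OF edge_cube[OF assms(1)]] s
    by (auto simp: edge_rev_def edge_start_def edge_end_def)
qed

lemma edge_faces:
  assumes "e \<in> edges X"
  shows "e \<in> faces X e" "edge_rev X e \<in> faces X e" "edge_start X e \<in> faces X e" "edge_end X e \<in> faces X e"
proof -
  have *: "face X L A e \<in> faces X e" if "L \<subseteq> labels X e" "A \<subseteq> labels X e" for L A
    using that by (auto simp: faces_def)
  show "e \<in> faces X e"
    using *[of "labels X e" "{}"] face_full[OF edge_cube[OF assms]] by simp
  show "edge_rev X e \<in> faces X e" "edge_start X e \<in> faces X e" "edge_end X e \<in> faces X e"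
    using * by (simp_all add: edge_rev_def edge_start_def edge_end_def)
qed

lemma vertex_not_edge: "v \<in> vertices X \<Longrightarrow> v \<notin> edges X"
  by (auto simp: vertices_def edges_def)

text \<open>The reduced loop is cut at the vertex or edge in question, and only labels and end
  points of the two parts are kept. In this form membership can be transferred to another base
  vertex that has the same reduced loop labels.\<close>

definition core_vertex :: "'c \<Rightarrow> 'c \<Rightarrow> bool" where
  "core_vertex v y \<longleftrightarrow> (\<exists>u w. cred (u @ w) \<and> walk X v u y \<and> walk X y w v)"

definition core_edge :: "'c \<Rightarrow> 'c \<Rightarrow> bool" where
  "core_edge v e \<longleftrightarrow> e \<in> edges X \<and> (\<exists>u w. cred (u @ edge_label X e # w) \<and>
     walk X v u (edge_start X e) \<and> walk X (edge_end X e) w v)"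

lemma core_vertex_in: "core_vertex u y \<Longrightarrow> y \<in> vertices X"
  unfolding core_vertex_def using walk_in by blast

lemma core_edge_in: "core_edge u e \<Longrightarrow> e \<in> edges X"
  by (simp add: core_edge_def)

lemma edge_step_edge: "e \<in> edges X \<Longrightarrow> edge_step X (edge_start X e) (edge_label X e) (edge_end X e)"
  unfolding edge_step_def by (rule bexI[of _ e]) (simp_all add: edge_labels[symmetric])

lemma core_edge_ends:
  assumes "core_edge v e"
  shows "core_vertex v (edge_start X e)" "core_vertex v (edge_end X e)" "core_edge v (edge_rev X e)"
proof -
  obtain u w where e: "e \<in> edges X" "cred (u @ edge_label X e # w)"
    "walk X v u (edge_start X e)" "walk X (edge_end X e) w v" using assms by (auto simp: core_edge_def)
  let ?s = "edge_label X e"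
  have st: "edge_step X (edge_start X e) ?s (edge_end X e)" using edge_step_edge e by blast
  then show "core_vertex v (edge_start X e)"
    using e unfolding core_vertex_def by (metis walk_Cons)
  have "walk X v (u @ [?s]) (edge_end X e)"
    unfolding walk_append using e(3) st walk_in[OF e(4)] by auto
  moreover have "cred ((u @ [?s]) @ w)" using e by simp
  ultimately show "core_vertex v (edge_end X e)" using e(4) unfolding core_vertex_def by blast
  have "cred (rev w @ ?s # rev u)" using cred_rev[of "u @ ?s # w"] e(2) by simp
  moreover have "edge_label X (edge_rev X e) = ?s" using e edge_rev_props by (simp add: edge_label_def)
  ultimately show "core_edge v (edge_rev X e)"
    unfolding core_edge_def using edge_rev_props[OF e(1)] walk_rev[OF e(3)] walk_rev[OF e(4)] by metis
qed

lemma core_cubes: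
  assumes "v \<in> vertices X"
  shows "c \<in> cubes (core_graph \<Gamma> X v) \<longleftrightarrow> core_vertex v c \<or> core_edge v c"
proof
  assume "c \<in> cubes (core_graph \<Gamma> X v)"
  then consider "c = v" | p e where "edge_loop X v p" "reduced \<Gamma> (path_label X p)" "e \<in> set p" "c \<in> faces X e"
    unfolding core_graph_def by auto
  then show "core_vertex v c \<or> core_edge v c"
  proof cases
    case 1
    have "core_vertex v v" unfolding core_vertex_def using assms by (intro exI[of _ "[]"]) simp
    with 1 show ?thesis by simp
  next
    case 2
    then obtain p1 p2 where p: "p = p1 @ e # p2" by (meson split_list)
    then have e: "e \<in> edges X" "edge_path X v p1 (edge_start X e)" "edge_path X (edge_end X e) p2 v"
      using 2 by (auto simp: edge_path_append_iff)
    have "cred (path_label X p1 @ edge_label X e # path_label X p2)"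
      using 2 p by (simp add: reduced_iff)
    then have ce: "core_edge v e" unfolding core_edge_def using e edge_path_walk by blast
    show ?thesis using faces_edge[OF e(1) 2(4)] core_edge_ends[OF ce] ce by blast
  qed
next
  have edge: "c \<in> cubes (core_graph \<Gamma> X v)"
    if "cred (path_label X p)" "edge_loop X v p" "e \<in> set p" "c \<in> faces X e" for p e c
  proof -
    have "path_label X p \<in> words" using walk_in[OF edge_path_walk[OF that(2)]] by blast
    then have "reduced \<Gamma> (path_label X p)" using that by (simp add: reduced_iff)
    then show ?thesis using that unfolding core_graph_def by auto
  qed
  assume "core_vertex v c \<or> core_edge v c"
  then show "c \<in> cubes (core_graph \<Gamma> X v)"
  proof
    assume "core_vertex v c"
    then obtain u w where "cred (u @ w)" "walk X v u c" "walk X c w v" by (auto simp: core_vertex_def)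
    then obtain p q where pq: "edge_path X v p c" "edge_path X c q v" "cred (path_label X (p @ q))"
      by (auto simp: walk_def)
    have loop: "edge_loop X v (p @ q)" using pq by (auto simp: edge_path_append_iff)
    show ?thesis
    proof (cases q)
      case (Cons e q')
      then have "e \<in> set (p @ q)" "e \<in> edges X" "edge_start X e = c" using pq by auto
      then show ?thesis using edge[OF pq(3) loop] edge_faces by metis
    next
      case Nil
      then have "c = v" using pq by simp
      then show ?thesis by (simp add: core_graph_def)
    qed
  next
    assume "core_edge v c"
    then obtain u w where c: "c \<in> edges X" and uw: "cred (u @ edge_label X c # w)"
      "walk X v u (edge_start X c)" "walk X (edge_end X c) w v" by (auto simp: core_edge_def)
    then obtain p q where pq: "edge_path X v p (edge_start X c)" "path_label X p = u"
      "edge_path X (edge_end X c) q v" "path_label X q = w" by (auto simp: walk_def)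
    have "edge_loop X v (p @ c # q)" using pq c by (auto simp: edge_path_append_iff)
    moreover have "cred (path_label X (p @ c # q))" using uw pq by simp
    ultimately show ?thesis using edge[of "p @ c # q" c c] edge_faces[OF c] by simp
  qed
qed

lemma core_graph_simps [simp]:
  "labels (core_graph \<Gamma> X v) = labels X" "face (core_graph \<Gamma> X v) = face X"
  by (simp_all add: core_graph_def)

end

context completion_of
begin

lemma conj_loop:
  assumes v: "walk X B x v" and w: "w \<in> words" "cred w"
  shows "walk X v w v \<longleftrightarrow> x @ w @ rev x \<in> GW"
  using walk_loop_at[OF v w(1)] w(2) by blast

text \<open>
  For a normal subgroup, the loops at \<open>v\<close> have the same labels as those at \<open>B\<close>, so reading labels from
  \<open>B\<close> and from \<open>v\<close> identifies the vertices of the two core graphs.  At a graph-loop the two orientations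
  have to be matched by a choice.
\<close>

context
  fixes x :: "'v list" and v :: 'c
  assumes xv: "walk X B x v" and norm: "G \<lhd> racg \<Gamma>"
begin

lemma xw: "x \<in> words" and v_vertex: "v \<in> vertices X"
  using walk_in[OF xv] by auto

lemma normal_loop: "w \<in> words \<Longrightarrow> cred w \<Longrightarrow> walk X v w v \<longleftrightarrow> walk X B w B"
  using conj_loop[OF xv, of w] conj_loop[of "[]" B w] B_vertex normal_conj[OF norm xw, of w] by simp

lemma transfer_walks:
  assumes "walk X B u y" "walk X v u z" "walk X B u' y'" "walk X v u' z'"
  shows "y = y' \<longleftrightarrow> z = z'"
proof -
  have w: "u \<in> words" "u' \<in> words" using assms walk_in by auto
  have "walk X B (x @ u) z" "walk X B (x @ u') z'" using xv assms by (auto simp: walk_append)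
  then have "z = z' \<longleftrightarrow> (x @ u) @ rev (x @ u') \<in> GW" by (rule same_end_iff)
  also have "\<dots> \<longleftrightarrow> x @ (u @ rev u') @ rev x \<in> GW" by simp
  also have "\<dots> \<longleftrightarrow> u @ rev u' \<in> GW" using w by (intro normal_conj[OF norm xw]) simp
  also have "\<dots> \<longleftrightarrow> y = y'" using same_end_iff assms by blast
  finally show ?thesis by simp
qed

lemma transfer_split:
  assumes "cred (u @ w)"
  shows "(\<exists>y. walk X B u y \<and> walk X y w B) \<longleftrightarrow> (\<exists>z. walk X v u z \<and> walk X z w v)"
  using normal_loop[OF _ assms] walk_in[of B "u @ w" B] walk_in[of v "u @ w" v] unfolding walk_append by blast

text \<open>The walk \<open>u\<close> is required to be the beginning of a loop at \<open>B\<close>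
  with reduced label: such loops can also be read from \<open>v\<close>, an arbitrary walk from
  \<open>B\<close> perhaps not. Independence of the choice of \<open>u\<close> is
  \<open>transfer_walks\<close>.\<close>

definition vmap :: "'c \<Rightarrow> 'c" where
  "vmap y = (THE z. \<exists>u w. cred (u @ w) \<and> walk X B u y \<and> walk X y w B \<and> walk X v u z)"

lemma vmap_eq:
  assumes "cred (u @ w)" "walk X B u y" "walk X y w B"
  shows "walk X v u (vmap y)" "walk X (vmap y) w v"
proof -
  obtain z where z: "walk X v u z" "walk X z w v" using transfer_split assms by blast
  have "vmap y = z" unfolding vmap_def
    by (rule the_equality) (use assms z transfer_walks in blast)+
  with z show "walk X v u (vmap y)" "walk X (vmap y) w v" by auto
qed

lemma vmap_core: "core_vertex B y \<Longrightarrow> core_vertex v (vmap y)"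
  unfolding core_vertex_def using vmap_eq by blast

lemma vmap_inj: "core_vertex B y \<Longrightarrow> core_vertex B y' \<Longrightarrow> vmap y = vmap y' \<Longrightarrow> y = y'"
  unfolding core_vertex_def using vmap_eq(1) transfer_walks by metis

lemma vmap_surj: "core_vertex v z \<Longrightarrow> \<exists>y. core_vertex B y \<and> vmap y = z"
proof -
  assume "core_vertex v z"
  then obtain u w where z: "cred (u @ w)" "walk X v u z" "walk X z w v" by (auto simp: core_vertex_def)
  then obtain y where y: "walk X B u y" "walk X y w B" using transfer_split by blast
  then have "vmap y = z" using vmap_eq(1)[OF z(1) y] z(2) walk_det by blast
  with y z(1) show ?thesis unfolding core_vertex_def by blast
qed

lemma vmap_B: "vmap B = v"
  using vmap_eq(1)[of "[]" "[]" B] B_vertex by simp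

text \<open>Both end points of the edge are cut points of one reduced loop through it, so their
  images lie on the loop with the same label at \<open>v\<close>, one step apart.\<close>

lemma core_edge_walks:
  "core_edge B e \<Longrightarrow> \<exists>u w. cred (u @ edge_label X e # w) \<and>
     walk X v u (vmap (edge_start X e)) \<and> walk X (vmap (edge_end X e)) w v \<and>
     edge_step X (vmap (edge_start X e)) (edge_label X e) (vmap (edge_end X e))"
proof -
  let ?s = "edge_label X e"
  assume "core_edge B e"
  then obtain u w where e: "e \<in> edges X" and u: "cred (u @ ?s # w)"
    "walk X B u (edge_start X e)" "walk X (edge_end X e) w B" by (auto simp: core_edge_def)
  have st: "edge_step X (edge_start X e) ?s (edge_end X e)" using edge_step_edge e by blast
  then have 1: "walk X (edge_start X e) (?s # w) B" using u by auto
  have 2: "walk X B (u @ [?s]) (edge_end X e)" using u st edge_step_in[OF st] by (auto simp: walk_append)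
  have 3: "cred ((u @ [?s]) @ w)" using u by simp
  note a = vmap_eq[OF u(1,2) 1] and b = vmap_eq[OF 3 2 u(3)]
  obtain z where z: "walk X v u z" "edge_step X z ?s (vmap (edge_end X e))"
    using b(1) by (auto simp: walk_append)
  then have "z = vmap (edge_start X e)" using a(1) walk_det by blast
  with z(2) a b u(1) show ?thesis by blast
qed

definition target :: "'c \<Rightarrow> 'c" where
  "target e = (SOME e'. e' \<in> edges X \<and> labels X e' = labels X e \<and> edge_start X e' = vmap (edge_start X e))"

text \<open>The choice is made from the unordered pair of orientations, hence an edge and its
  reverse agree on which of them is canonical.\<close>

definition canonical :: "'c \<Rightarrow> 'c" where
  "canonical e = (SOME c. c \<in> {e, edge_rev X e})"

definition core_map :: "'c \<Rightarrow> 'c" where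
  "core_map e = (if e \<in> vertices X then vmap e
     else if edge_start X e = edge_end X e \<and> e \<noteq> canonical e then edge_rev X (target e) else target e)"

lemma target:
  assumes "core_edge B e"
  shows "target e \<in> edges X" "labels X (target e) = labels X e" "edge_start X (target e) = vmap (edge_start X e)"
    "edge_end X (target e) = vmap (edge_end X e)"
proof -
  have e: "e \<in> edges X" using assms by (simp add: core_edge_def)
  obtain u w where st: "edge_step X (vmap (edge_start X e)) (edge_label X e) (vmap (edge_end X e))"
    using core_edge_walks[OF assms] by blast
  then have "\<exists>e'. e' \<in> edges X \<and> labels X e' = labels X e \<and> edge_start X e' = vmap (edge_start X e)"
    unfolding edge_step_def edge_labels[OF e] by blast
  then have "target e \<in> edges X \<and> labels X (target e) = labels X e \<and> edge_start X (target e) = vmap (edge_start X e)"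
    unfolding target_def by (rule someI_ex)
  then show t: "target e \<in> edges X" "labels X (target e) = labels X e" "edge_start X (target e) = vmap (edge_start X e)"
    by auto
  then have "edge_step X (vmap (edge_start X e)) (edge_label X e) (edge_end X (target e))"
    using edge_step_edge[of "target e"] by (simp add: edge_label_def)
  then show "edge_end X (target e) = vmap (edge_end X e)" using st edge_step_det by blast
qed

lemma canonical: "e \<in> edges X \<Longrightarrow> canonical (edge_rev X e) = canonical e"
  "canonical e = e \<or> canonical e = edge_rev X e"
proof -
  assume "e \<in> edges X"
  then show "canonical (edge_rev X e) = canonical e"
    using edge_rev_props(5) by (simp add: canonical_def insert_commute)
next
  have "canonical e \<in> {e, edge_rev X e}" unfolding canonical_def by (rule someI_ex) blast
  then show "canonical e = e \<or> canonical e = edge_rev X e" by simp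
qed

lemma core_map_edge:
  assumes ce: "core_edge B e"
  shows "core_map e \<in> edges X" "labels X (core_map e) = labels X e"
    "edge_start X (core_map e) = vmap (edge_start X e)" "edge_end X (core_map e) = vmap (edge_end X e)"
    "core_map (edge_rev X e) = edge_rev X (core_map e)" "core_edge v (core_map e)"
proof -
  have e: "e \<in> edges X" "e \<notin> vertices X" using ce vertex_not_edge by (auto simp: core_edge_def)
  note t = target[OF ce] and rt = edge_rev_props[OF target(1)[OF ce]] and re = edge_rev_props[OF e(1)]
  show m: "core_map e \<in> edges X" "labels X (core_map e) = labels X e"
    "edge_start X (core_map e) = vmap (edge_start X e)" "edge_end X (core_map e) = vmap (edge_end X e)"
    using e t rt by (auto simp: core_map_def)
  obtain u w where u: "cred (u @ edge_label X e # w)"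
     "walk X v u (vmap (edge_start X e))" "walk X (vmap (edge_end X e)) w v"
    using core_edge_walks[OF ce] by blast
  moreover have "edge_label X (core_map e) = edge_label X e" using m by (simp add: edge_label_def)
  ultimately show "core_edge v (core_map e)" unfolding core_edge_def using m by auto
  have r: "edge_rev X e \<notin> vertices X" using re(1) vertex_not_edge by auto
  have cr: "core_edge B (edge_rev X e)" using core_edge_ends[OF ce] by blast
  show "core_map (edge_rev X e) = edge_rev X (core_map e)"
  proof (cases "edge_start X e = edge_end X e")
    case True
    \<comment> \<open>\<open>target\<close> depends only on label and start, which the two
      orientations of a graph-loop share. It would send both to one oriented edge; the canonical
      choice tells them apart.\<close>
    have "target (edge_rev X e) = target e" using re True by (simp add: target_def)
    moreover have "core_map (edge_rev X e) =
        (if edge_rev X e = canonical e then target (edge_rev X e) else edge_rev X (target (edge_rev X e)))"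
      using True r re(3,4) canonical(1)[OF e(1)] unfolding core_map_def by simp
    moreover have "core_map e = (if e = canonical e then target e else edge_rev X (target e))"
      using True e unfolding core_map_def by simp
    moreover have "canonical e = e \<or> canonical e = edge_rev X e" by (rule canonical(2))
    ultimately show ?thesis using re(8) rt(5) by metis
  next
    case False
    note t' = target[OF cr]
    have "edge_label X e = edge_label X (target (edge_rev X e))" using t'(2) re(2) by (simp add: edge_label_def)
    have "target (edge_rev X e) = edge_rev X (target e) \<or> target (edge_rev X e) = edge_rev X (edge_rev X (target e))"
      using folded_edges[of "edge_rev X (target e)" "target (edge_rev X e)"] t t' rt re by simp
    \<comment> \<open>An edge that is the target of both orientations would start at the images of
      both ends of \<open>e\<close>, and \<open>vmap\<close> is injective on core vertices.\<close>
    moreover have "target (edge_rev X e) \<noteq> target e"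
    proof
      assume "target (edge_rev X e) = target e"
      then have "vmap (edge_end X e) = vmap (edge_start X e)" using t'(3) t(3) re by simp
      then show False using vmap_inj core_edge_ends[OF ce] False by metis
    qed
    ultimately show ?thesis using False e re r rt(5) by (auto simp: core_map_def)
  qed
qed

lemma core_map_vertex: "core_vertex B y \<Longrightarrow> core_map y = vmap y"
  using core_vertex_in by (simp add: core_map_def)

lemma core_map_iso: "labeled_iso core_map (core_graph \<Gamma> X B) (core_graph \<Gamma> X v)"
proof -
  note cB = core_cubes[OF B_vertex] and cv = core_cubes[OF v_vertex]
  have hom: "labeled_hom core_map (core_graph \<Gamma> X B) (core_graph \<Gamma> X v)"
    unfolding labeled_hom_def core_graph_simps
  proof (intro ballI conjI allI impI)
    fix c assume c: "c \<in> cubes (core_graph \<Gamma> X B)"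
    then show "core_map c \<in> cubes (core_graph \<Gamma> X v)"
      unfolding cB cv using vmap_core core_map_vertex core_map_edge(6) by metis
    from c consider "core_vertex B c" | "core_edge B c" unfolding cB by blast
    note cases = this
    show "labels X (core_map c) = labels X c"
    proof (rule cases)
      assume cvx: "core_vertex B c"
      then show ?thesis using core_vertex_in[OF cvx] core_vertex_in[OF vmap_core[OF cvx]] core_map_vertex
        by (simp add: vertices_def)
    qed (rule core_map_edge)
    fix L A assume L: "L \<subseteq> labels X c" "A \<subseteq> labels X c"
    show "core_map (face X L A c) = face X L A (core_map c)"
    proof (rule cases)
      assume cvx: "core_vertex B c"
      then have "L = {}" "A = {}" using L core_vertex_in[OF cvx] by (auto simp: vertices_def)
      then show ?thesis
        using core_map_vertex[OF cvx] vertex_face core_vertex_in[OF cvx] core_vertex_in[OF vmap_core[OF cvx]] by simp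
    next
      assume ce: "core_edge B c"
      note m = core_map_edge[OF ce] and ed = core_edge_in[OF ce]
      note ends = core_map_vertex[OF core_edge_ends(1)[OF ce]] core_map_vertex[OF core_edge_ends(2)[OF ce]]
      have "L = {} \<or> L = labels X c" "A = {} \<or> A = labels X c"
        using L edge_labels[OF ed] by (auto simp: subset_singleton_iff)
      then consider "L = {}" "A = {}" | "L = {}" "A = labels X c" | "L = labels X c" "A = {}"
        | "L = labels X c" "A = labels X c" by blast
      then show ?thesis
      proof cases
        case 1
        then show ?thesis using m(3) ends(1) by (simp add: edge_start_def)
      next
        case 2
        then show ?thesis using m(2,4) ends(2) by (simp add: edge_end_def)
      next
        case 3
        then show ?thesis using m(2) face_full[OF edge_cube[OF ed]] face_full[OF edge_cube[OF m(1)]] by simp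
      next
        case 4
        then show ?thesis using m(2,5) by (simp add: edge_rev_def)
      qed
    qed
  qed
  have "bij_betw core_map (cubes (core_graph \<Gamma> X B)) (cubes (core_graph \<Gamma> X v))"
  proof (rule bij_betw_imageI)
    show "inj_on core_map (cubes (core_graph \<Gamma> X B))"
    proof (rule inj_onI, unfold cB)
      fix c d assume c: "core_vertex B c \<or> core_edge B c" and d: "core_vertex B d \<or> core_edge B d"
        and eq: "core_map c = core_map d"
      have vv: "core_map y \<in> vertices X" if "core_vertex B y" for y
        using core_map_vertex[OF that] core_vertex_in[OF vmap_core[OF that]] by simp
      from c d consider "core_vertex B c" "core_vertex B d" | "core_edge B c" "core_edge B d"
        using eq vv core_map_edge(1) vertex_not_edge by metis
      then show "c = d"
      proof cases
        case 1
        then show ?thesis using eq core_map_vertex vmap_inj by metis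
      next
        case 2
        note m = core_map_edge[OF 2(1)] core_map_edge[OF 2(2)]
        have "edge_start X c = edge_start X d" using eq m(3,9) vmap_inj core_edge_ends(1) 2 by metis
        then have "d = c \<or> d = edge_rev X c" using folded_edges core_edge_in 2 eq m(2,8) by metis
        moreover have "d \<noteq> edge_rev X c" using eq m(5) edge_rev_props(8)[OF m(1)] by metis
        ultimately show ?thesis by simp
      qed
    qed
    show "core_map ` cubes (core_graph \<Gamma> X B) = cubes (core_graph \<Gamma> X v)"
    proof
      show "core_map ` cubes (core_graph \<Gamma> X B) \<subseteq> cubes (core_graph \<Gamma> X v)"
        using hom unfolding labeled_hom_def by blast
      show "cubes (core_graph \<Gamma> X v) \<subseteq> core_map ` cubes (core_graph \<Gamma> X B)"
      proof
        fix d assume "d \<in> cubes (core_graph \<Gamma> X v)"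
        then consider "core_vertex v d" | "core_edge v d" unfolding cv by blast
        then show "d \<in> core_map ` cubes (core_graph \<Gamma> X B)"
        proof cases
          case 1
          then obtain y where "core_vertex B y" "vmap y = d" using vmap_surj by blast
          then show ?thesis using core_map_vertex cB by (metis image_eqI)
        next
          case 2
          let ?s = "edge_label X d"
          have d: "d \<in> edges X" using 2 by (rule core_edge_in)
          obtain u w where u: "cred (u @ ?s # w)" "walk X v u (edge_start X d)" "walk X (edge_end X d) w v"
            using 2 unfolding core_edge_def by blast
          have "walk X (edge_start X d) (?s # w) v" using u edge_step_edge[OF d] by auto
          then obtain y where y: "walk X B u y" "walk X y (?s # w) B" using transfer_split[OF u(1)] u(2) by blast
          then obtain e where e: "e \<in> edges X" "labels X e = {?s}" "edge_start X e = y" "walk X (edge_end X e) w B"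
            by (auto simp: edge_step_def)
          have el: "edge_label X e = ?s" using e by (simp add: edge_label_def)
          then have ce: "core_edge B e" unfolding core_edge_def using e u(1) y(1) by auto
          note m = core_map_edge[OF ce]
          have "vmap y = edge_start X d" using vmap_eq(1)[OF u(1) y] u(2) walk_det by blast
          \<comment> \<open>Folding leaves the orientation open. In the second case the reverse of
            \<open>e\<close>, which is a core edge as well, is mapped to \<open>d\<close>.\<close>
          then have "core_map e = d \<or> core_map e = edge_rev X d"
            using folded_edges[OF d m(1)] m(2,3) e edge_labels[OF d] by simp
          then have "core_map e = d \<or> core_map (edge_rev X e) = d" using m(5) edge_rev_props(5)[OF d] by auto
          then show ?thesis using cB ce core_edge_ends(3)[OF ce] by (metis image_eqI)
        qed
      qed
    qed
  qed
  with hom show ?thesis by (simp add: labeled_iso_def)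
qed

lemma core_map_B: "core_map B = v"
  using vmap_B B_vertex by (simp add: core_map_def)

end

section \<open>The criterion for normality\<close>

definition central :: "'v set" where
  "central = {s \<in> pverts \<Gamma>. \<forall>g\<in>G. word_elem \<Gamma> [s] \<otimes>\<^bsub>racg \<Gamma>\<^esub> g = g \<otimes>\<^bsub>racg \<Gamma>\<^esub> word_elem \<Gamma> [s]}"

lemma central_iff: "s \<in> central \<longleftrightarrow> s \<in> pverts \<Gamma> \<and> (\<forall>w\<in>GW. [s] @ w \<approx> w @ [s])"
proof -
  have *: "word_elem \<Gamma> [s] \<otimes>\<^bsub>racg \<Gamma>\<^esub> word_elem \<Gamma> w = word_elem \<Gamma> w \<otimes>\<^bsub>racg \<Gamma>\<^esub> word_elem \<Gamma> [s] \<longleftrightarrow> [s] @ w \<approx> w @ [s]"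
    if "s \<in> pverts \<Gamma>" "w \<in> GW" for w
    using that GW_words[of w] elem_eq_iff[of "[s] @ w"] by simp
  have "(\<forall>g\<in>G. P g) \<longleftrightarrow> (\<forall>w\<in>GW. P (word_elem \<Gamma> w))" for P
    using G_word by (auto simp: GW_def)
  then show ?thesis unfolding central_def using * by auto
qed

text \<open>Take a reduced \<open>w\<close> in \<open>GW\<close> that does not commute with
  \<open>s\<close>. If \<open>s\<close> is front or rear in \<open>w\<close>, the loop for
  \<open>w\<close> or its reverse can be shuffled to start with an \<open>s\<close>-edge. Otherwise
  \<open>s # w @ [s]\<close> is reduced, because \<open>s\<close> does not commute with all letters
  of \<open>w\<close>, and by normality it labels a loop at \<open>B\<close>.\<close>

lemma normal_imp_edge:
  assumes norm: "G \<lhd> racg \<Gamma>" and s: "s \<in> pverts \<Gamma> - central"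
  shows "\<exists>y. edge_step X B s y"
proof -
  obtain w0 where w0: "w0 \<in> GW" "\<not> [s] @ w0 \<approx> w0 @ [s]" using s central_iff by auto
  define w where "w = nf w0"
  have w: "w \<in> GW" "cred w" using w0 nf_GW cred_nf by (auto simp: w_def)
  have ww: "w \<in> words" using w GW_words by blast
  have "w \<approx> w0" using nf_eq GW_words w0 by (simp add: w_def)
  then have "\<not> [s] @ w \<approx> w @ [s]"
  proof -
    have 1: "[s] @ w \<approx> [s] @ w0" "w @ [s] \<approx> w0 @ [s]"
      using s eq_append[OF _ \<open>w \<approx> w0\<close>, of "[s]" "[s]"] eq_append[OF \<open>w \<approx> w0\<close>, of "[s]" "[s]"] by auto
    show ?thesis
    proof
      assume "[s] @ w \<approx> w @ [s]"
      then have "[s] @ w0 \<approx> w0 @ [s]" using 1 by (blast intro: eq_sym eq_trans)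
      then show False using w0 by simp
    qed
  qed
  have start: "\<exists>y. edge_step X B s y" if "u \<in> GW" "cred u" "front s u" for u
  proof -
    have "walk X B (s # remove1 s u) B" using walk_swap[OF front_swap[OF that(3)] loop_walk[OF that(1,2)]] .
    then show ?thesis by auto
  qed
  consider "front s w" | "rear s w" | "\<not> front s w" "\<not> rear s w" by blast
  then show ?thesis
  proof cases
    case 1
    then show ?thesis using start w by blast
  next
    case 2
    then show ?thesis using start[of "rev w"] w rev_GW cred_rev by blast
  next
    case 3
    have "\<not> commutes s w"
    proof
      assume "commutes s w"
      then have "s # w \<approx> w @ [s]" using swap_imp_eq[OF commutes_swap] s ww by simp
      then show False using \<open>\<not> [s] @ w \<approx> w @ [s]\<close> by simp
    qed
    then have "cred (s # w @ [s])" using 3 w by (auto simp: cred_append front_append)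
    moreover have "s # w @ [s] \<in> GW" using normal_words norm s w by auto
    ultimately show ?thesis using start[of "s # w @ [s]"] by simp
  qed
qed

lemma edge_path_hom:
  assumes "labeled_hom f X' Y'" "labels X' = labels X" "face X' = face X" "labels Y' = labels X" "face Y' = face X"
    "cubes Y' \<subseteq> cubes X" "edge_path X y p z" "set p \<subseteq> cubes X'" "z \<in> cubes X'"
  shows "edge_path X (f y) (map f p) (f z) \<and> path_label X (map f p) = path_label X p"
  using assms(7,8)
proof (induction p arbitrary: y)
  case Nil
  then have "f z \<in> cubes X" "labels X (f z) = labels X z"
    using assms unfolding labeled_hom_def by auto
  with Nil show ?case by (auto simp: vertices_def)
next
  case (Cons e p)
  then have e: "e \<in> edges X" "edge_start X e = y" "e \<in> cubes X'" by auto
  have fe: "f e \<in> cubes X" "labels X (f e) = labels X e"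
    using assms(1,2,4,6) e unfolding labeled_hom_def by auto
  have ff: "f (face X L A e) = face X L A (f e)" if "L \<subseteq> labels X e" "A \<subseteq> labels X e" for L A
    using assms(1-5) e that unfolding labeled_hom_def by metis
  have "f e \<in> edges X" "edge_start X (f e) = f y" "edge_end X (f e) = f (edge_end X e)"
    "edge_label X (f e) = edge_label X e"
    using fe ff[of "{}" "{}"] ff[of "{}" "labels X e"] e
    by (auto simp: edges_def edge_start_def edge_end_def edge_label_def)
  then show ?case using Cons by auto
qed

lemma core_hom_walk:
  assumes "labeled_hom f (core_graph \<Gamma> X B) (core_graph \<Gamma> X v)" "v \<in> vertices X" "walk X B w B" "cred w"
  shows "walk X (f B) w (f B)"
proof -
  obtain p where p: "edge_loop X B p" "path_label X p = w" using assms by (auto simp: walk_def)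
  have "reduced \<Gamma> w" using assms walk_in reduced_iff by blast
  have "set p \<subseteq> edges X" using p(1) by (rule edge_path_edges)
  have "set p \<subseteq> cubes (core_graph \<Gamma> X B)"
  proof
    fix e assume e: "e \<in> set p"
    then have "e \<in> faces X e" using edge_faces(1) \<open>set p \<subseteq> edges X\<close> by blast
    then show "e \<in> cubes (core_graph \<Gamma> X B)"
      using p \<open>reduced \<Gamma> w\<close> e unfolding core_graph_def by simp blast
  qed
  moreover have "B \<in> cubes (core_graph \<Gamma> X B)" by (simp add: core_graph_def)
  moreover have "cubes (core_graph \<Gamma> X v) \<subseteq> cubes X"
    using core_cubes[OF assms(2)] core_vertex_in core_edge_in by (auto simp: vertices_def edges_def)
  ultimately show ?thesis
    using edge_path_hom[OF assms(1) _ _ _ _ _ p(1)] p(2) by (auto simp: walk_def)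
qed

text \<open>For the converse, conjugation by a letter outside \<open>central\<close> is realized
  geometrically: the letter leads from \<open>B\<close> to a neighbour \<open>v\<close>, and the
  isomorphism of core graphs carries the loop of a reduced word at \<open>B\<close> to a loop at
  \<open>v\<close> with the same label. Letters in \<open>central\<close> conjugate
  trivially.\<close>

lemma normal_iff:
  "G \<lhd> racg \<Gamma> \<longleftrightarrow>
     (\<forall>s\<in>pverts \<Gamma> - central. \<exists>e\<in>edges X. labels X e = {s} \<and> edge_start X e = B) \<and>
     (\<forall>v\<in>vertices X. \<exists>f. labeled_iso f (core_graph \<Gamma> X B) (core_graph \<Gamma> X v) \<and> f B = v)"
proof
  assume norm: "G \<lhd> racg \<Gamma>"
  show "(\<forall>s\<in>pverts \<Gamma> - central. \<exists>e\<in>edges X. labels X e = {s} \<and> edge_start X e = B) \<and>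
     (\<forall>v\<in>vertices X. \<exists>f. labeled_iso f (core_graph \<Gamma> X B) (core_graph \<Gamma> X v) \<and> f B = v)"
    using normal_imp_edge[OF norm] core_map_iso[OF addr norm] core_map_B[OF addr norm]
    unfolding edge_step_def by blast
next
  assume a: "(\<forall>s\<in>pverts \<Gamma> - central. \<exists>e\<in>edges X. labels X e = {s} \<and> edge_start X e = B) \<and>
     (\<forall>v\<in>vertices X. \<exists>f. labeled_iso f (core_graph \<Gamma> X B) (core_graph \<Gamma> X v) \<and> f B = v)"
  show "G \<lhd> racg \<Gamma>"
    unfolding normal_words
  proof (intro ballI)
    fix s w assume s: "s \<in> pverts \<Gamma>" and w: "w \<in> GW"
    then have ww: "w \<in> words" "[s] \<in> words" using GW_words by auto
    show "[s] @ w @ [s] \<in> GW"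
    proof (cases "s \<in> central")
      case True
      then have "[s] @ w \<approx> w @ [s]" using w central_iff by blast
      then have "([s] @ w) @ [s] \<approx> (w @ [s]) @ [s]" using eq_append eq_refl[OF ww(2)] by blast
      also have "(w @ [s]) @ [s] \<approx> w" using word_eq.square[of w \<Gamma> "[]" s] s ww by simp
      finally have "[s] @ w @ [s] \<approx> w" by simp
      then show ?thesis using eq_GW[OF w] eq_sym by blast
    next
      case False
      then obtain e where e: "e \<in> edges X" "labels X e = {s}" "edge_start X e = B" using a s by blast
      define v where "v = edge_end X e"
      have st: "walk X B [s] v" "v \<in> vertices X" using e edge_rev_props[OF e(1)] by (auto simp: v_def edge_step_def)
      obtain f where "labeled_iso f (core_graph \<Gamma> X B) (core_graph \<Gamma> X v)" "f B = v" using a st by blast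
      moreover have "walk X B (nf w) B" using loop_walk nf_GW cred_nf w by blast
      ultimately have "walk X v (nf w) v"
        using core_hom_walk[of f v "nf w"] st cred_nf unfolding labeled_iso_def by metis
      then have "[s] @ nf w @ rev [s] \<in> GW" using walk_loop_at(1)[OF st(1) nf_in[OF ww(1)]] by blast
      moreover have "[s] @ nf w @ rev [s] \<approx> [s] @ w @ rev [s]" using ww by (intro eq_context nf_eq) auto
      ultimately show ?thesis using eq_GW by fastforce
    qed
  qed
qed

end


section \<open>Completions of torsion-free subgroups\<close>

locale torsion_free_completion = completion_of \<Gamma> G X B
  for \<Gamma> :: "'v pair_pre_digraph" and G and X :: "('v, 'c) labeled_complex" and B +
  assumes torsion_free: "\<not> has_torsion (racg \<Gamma>) G"
begin

text \<open>A walk between the two corners spells the letters of \<open>sym_diff A A'\<close>, each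
  once. If the corners coincide, it is a loop labeled by a clique and has to be empty.\<close>

lemma corner_inj:
  assumes c: "c \<in> cubes X" "A \<subseteq> labels X c" "A' \<subseteq> labels X c" and eq: "face X {} A c = face X {} A' c"
  shows "A = A'"
proof -
  let ?D = "sym_diff A A'"
  have D: "?D \<subseteq> labels X c" using c by blast
  then have "finite ?D" using finite_subset finite_labels[OF c(1)] by blast
  then obtain w where w: "set w = ?D" "distinct w" by (metis finite_distinct_list)
  have "walk X (face X {} A c) w (face X {} (sym_diff A (set w)) c)"
    using c w D by (intro cube_walk) simp_all
  moreover have "sym_diff A (set w) = A'" using w by blast
  ultimately have "walk X (face X {} A c) w (face X {} A c)" using eq by simp
  moreover have "clique \<Gamma> (set w)" using label_clique[OF c(1)] D w(1) unfolding clique_def by blast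
  ultimately have "w = []" using no_clique_loop[OF torsion_free] w by blast
  then show ?thesis using w(1) by auto
qed

lemma no_graph_loop: "e \<in> edges X \<Longrightarrow> edge_start X e \<noteq> edge_end X e"
  using corner_inj[of e "{}" "labels X e"] edge_labels[of e] edge_cube[of e]
  by (auto simp: edge_start_def edge_end_def)

text \<open>Without graph-loops an edge and its reverse have different starts, which removes the
  ambiguity left by folding.\<close>

lemma edge_det:
  "e \<in> edges X \<Longrightarrow> e' \<in> edges X \<Longrightarrow> labels X e = labels X e' \<Longrightarrow> edge_start X e = edge_start X e' \<Longrightarrow> e = e'"
  using folded_edges[of e e'] no_graph_loop[of e] edge_rev_props(3)[of e] by auto

text \<open>Induction over the label set. A common corner 0 makes all corners agree by determinism
  of walks, so all proper faces agree by induction, and foldedness makes the two cubes geometrically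
  equal. They are equal as parametrized cubes because a nontrivial reparametrization would move the
  corner 0 to a different vertex.\<close>

lemma cube_det:
  assumes "c \<in> cubes X" "d \<in> cubes X" "labels X c = labels X d" "face X {} {} c = face X {} {} d"
  shows "c = d"
proof -
  have "\<forall>c\<in>cubes X. \<forall>d\<in>cubes X. labels X c = K \<and> labels X d = K \<and> face X {} {} c = face X {} {} d \<longrightarrow> c = d"
    if "finite K" for K
    using that
  proof (induction K rule: finite_psubset_induct)
    case (psubset K)
    show ?case
    proof (intro ballI impI)
      fix c d
      assume c: "c \<in> cubes X" and d: "d \<in> cubes X"
        and "labels X c = K \<and> labels X d = K \<and> face X {} {} c = face X {} {} d"
      then have K: "labels X c = K" "labels X d = K" and eq: "face X {} {} c = face X {} {} d" by auto
      have corners: "face X {} A c = face X {} A d" if A: "A \<subseteq> K" for A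
      proof -
        obtain w where w: "set w = A" "distinct w"
          using finite_distinct_list[OF finite_subset[OF A psubset(1)]] by blast
        have "walk X (face X {} {} c) w (face X {} (sym_diff {} (set w)) c)"
          using c K w A by (intro cube_walk) simp_all
        moreover have "walk X (face X {} {} d) w (face X {} (sym_diff {} (set w)) d)"
          using d K w A by (intro cube_walk) simp_all
        ultimately show ?thesis using eq walk_det w(1) by simp
      qed
      have geo: "c = d" if g: "same_geometric_cube X c d"
      proof -
        obtain A where A: "A \<subseteq> K" "d = face X K A c" using g K by (auto simp: same_geometric_cube_def)
        then have "face X {} {} d = face X {} A c" using face_face[OF c, of K A "{}" "{}"] K by simp
        then have "face X {} {} c = face X {} A c" using eq by simp
        then have "{} = A" using corner_inj[OF c] A K by blast
        then show ?thesis using A face_full[OF c] K by simp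
      qed
      consider "K = {}" | s where "K = {s}" | "2 \<le> card K"
      proof -
        have "card K = 0 \<or> card K = 1 \<or> 2 \<le> card K" by linarith
        then show thesis using that psubset(1) by (auto simp: card_1_singleton_iff)
      qed
      then show "c = d"
      proof cases
        case 1
        then show ?thesis using face_full[OF c] face_full[OF d] K eq by simp
      next
        case 2
        then show ?thesis using edge_det[of c d] edgeI[OF c] edgeI[OF d] K eq by (simp add: edge_start_def)
      next
        case 3
        have "face X L A c = face X L A d" if L: "L \<subset> K" and A: "A \<subseteq> K" for L A
        proof -
          have l: "L \<subseteq> labels X c" "L \<subseteq> labels X d" "A \<subseteq> labels X c" "A \<subseteq> labels X d" using L A K by auto
          have "face X {} {} (face X L A c) = face X {} {} (face X L A d)"
            using face_face[OF c l(1,3), of "{}" "{}"] face_face[OF d l(2,4), of "{}" "{}"] corners[OF A] by simp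
          then show ?thesis
            using psubset(2)[OF L] face_cube[OF c l(1,3)] face_cube[OF d l(2,4)]
              face_labels[OF c l(1,3)] face_labels[OF d l(2,4)] by blast
        qed
        then have "same_boundary X c d" using K by (simp add: same_boundary_def)
        then have "same_geometric_cube X c d" using folded c d K 3 unfolding folded_def by blast
        then show ?thesis by (rule geo)
      qed
    qed
  qed
  then show ?thesis using assms finite_labels by metis
qed

lemma card_simplex:
  assumes c: "c \<in> cubes X"
  shows "card (simplex_vertices X c) = card (labels X c)"
    and "\<And>e. e \<in> simplex_vertices X c \<Longrightarrow> e \<in> edges X \<and> labels X e \<subseteq> labels X c"
    and "labels X c = (\<Union>e\<in>simplex_vertices X c. labels X e)"
proof -
  have l: "labels X (face X {s} {} c) = {s}" if "s \<in> labels X c" for s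
    using that by (intro face_labels[OF c]) auto
  then have "inj_on (\<lambda>s. face X {s} {} c) (labels X c)" by (intro inj_onI) (metis singleton_inject)
  then show "card (simplex_vertices X c) = card (labels X c)"
    unfolding simplex_vertices_def by (rule card_image)
  show "e \<in> edges X \<and> labels X e \<subseteq> labels X c" if "e \<in> simplex_vertices X c" for e
    using that l cube_edge(1)[OF c, of "{}"] by (auto simp: simplex_vertices_def)
  show "labels X c = (\<Union>e\<in>simplex_vertices X c. labels X e)"
    using l by (auto simp: simplex_vertices_def)
qed

text \<open>The vertices of a simplex reveal its label set, and together with the vertex
  \<open>v\<close> this determines the cube. For flagness, the squares between the given edges show
  that their labels are distinct and form a clique, and cube-fullness supplies the cube.\<close>

lemma nonpositively_curved: "nonpositively_curved X"
  unfolding nonpositively_curved_def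
proof (intro ballI conjI)
  fix v assume v: "v \<in> vertices X"
  show "link_simplicial X v"
    unfolding link_simplicial_def
  proof (intro conjI ballI inj_onI)
    fix c assume "c \<in> link_simplices X v"
    then show "card (simplex_vertices X c) = card (labels X c)"
      using card_simplex(1) by (simp add: link_simplices_def)
  next
    fix c d assume "c \<in> link_simplices X v" "d \<in> link_simplices X v" "simplex_vertices X c = simplex_vertices X d"
    then show "c = d" using cube_det[of c d] card_simplex(3) by (simp add: link_simplices_def)
  qed
  show "link_flag X v"
    unfolding link_flag_def
  proof (intro allI impI)
    fix S
    assume S: "finite S \<and> S \<noteq> {} \<and> S \<subseteq> {e \<in> edges X. edge_start X e = v} \<and>
        (\<forall>e\<in>S. \<forall>e'\<in>S. e \<noteq> e' \<longrightarrow> {e, e'} \<in> simplex_vertices X ` link_simplices X v)"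
    have pair: "edge_label X e \<noteq> edge_label X e' \<and> adj (edge_label X e) (edge_label X e')"
      if ee: "e \<in> S" "e' \<in> S" "e \<noteq> e'" for e e'
    proof -
      have "{e, e'} \<in> simplex_vertices X ` link_simplices X v" using S ee by blast
      then obtain c where c: "c \<in> cubes X" "simplex_vertices X c = {e, e'}" by (auto simp: link_simplices_def)
      have e: "labels X e = {edge_label X e}" "labels X e' = {edge_label X e'}"
        using S ee(1,2) by (auto intro!: edge_labels)
      then have l: "labels X c = {edge_label X e, edge_label X e'}" using card_simplex(3)[OF c(1)] c(2) by auto
      have "card (labels X c) = 2" using card_simplex(1)[OF c(1)] c(2) ee by simp
      then have "edge_label X e \<noteq> edge_label X e'" using l by auto
      with l label_clique[OF c(1)] show ?thesis by (simp add: clique_def)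
    qed
    define K where "K = edge_label X ` S"
    define h where "h = inv_into S (edge_label X)"
    have inj: "inj_on (edge_label X) S" using pair by (meson inj_onI)
    have h: "h s \<in> S" "edge_label X (h s) = s" if "s \<in> K" for s
      using that unfolding K_def h_def by (auto simp: inv_into_into f_inv_into_f)
    have hS: "h ` K = S" unfolding K_def h_def using inj by (simp add: image_image inv_into_f_f cong: image_cong)
    have SE: "e \<in> edges X" "edge_start X e = v" if "e \<in> S" for e using S that by blast+
    have lab: "edge_label X e \<in> pverts \<Gamma>" if "e \<in> S" for e
      using edge_step_in[OF edge_step_edge[OF SE(1)[OF that]]] by blast
    have "clique \<Gamma> K" unfolding clique_def K_def using pair lab by blast
    moreover have "K \<noteq> {}" using S by (simp add: K_def)
    moreover have "h s \<in> edges X \<and> labels X (h s) = {s} \<and> edge_start X (h s) = v" if "s \<in> K" for s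
      using SE h[OF that] edge_labels by metis
    ultimately obtain c where c: "c \<in> cubes X" "labels X c = K" "\<And>s. s \<in> K \<Longrightarrow> h s \<in> faces X c"
      using cube_fullD[of K v h] v by metis
    have ex: "\<exists>A. A \<subseteq> K \<and> h s = face X {s} A c \<and> face X {} A c = v" if s: "s \<in> K" for s
    proof -
      have hs: "h s \<in> edges X" "labels X (h s) = {s}" "edge_start X (h s) = v"
        using SE h[OF s] edge_labels by metis+
      show ?thesis
        by (rule faces_at_edge[OF c(1) hs(1,2) c(3)[OF s]]) (use c(2) hs(3) in blast)
    qed
    obtain s0 where s0: "s0 \<in> K" using \<open>K \<noteq> {}\<close> by blast
    obtain A where A: "A \<subseteq> K" "face X {} A c = v" using ex[OF s0] by blast
    \<comment> \<open>Every edge leaves from some corner of \<open>c\<close> that lies at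
      \<open>v\<close>, and distinct corners are distinct vertices, so all of them leave from the
      same corner \<open>A\<close>.\<close>
    have hs: "h s = face X {s} A c" if s: "s \<in> K" for s
      using ex[OF s] corner_inj[OF c(1)] A c(2) by metis
    \<comment> \<open>Link simplices are parametrized with the corner 0 at \<open>v\<close>, so the
      corner \<open>A\<close> is moved there.\<close>
    define c' where "c' = face X K A c"
    have c': "c' \<in> cubes X" "labels X c' = K"
      unfolding c'_def using c A by (simp_all add: face_cube face_labels)
    have f: "face X L {} c' = face X L A c" if "L \<subseteq> K" for L
      unfolding c'_def using face_face[OF c(1), of K A L "{}"] c(2) A that by simp
    have "c' \<in> link_simplices X v" using c' f[of "{}"] A \<open>K \<noteq> {}\<close> by (simp add: link_simplices_def)
    moreover have "simplex_vertices X c' = S"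
      unfolding simplex_vertices_def c'(2) hS[symmetric] using f hs by (intro image_cong) auto
    ultimately show "S \<in> simplex_vertices X ` link_simplices X v" by blast
  qed
qed

section \<open>Homotopy of edge loops\<close>

lemma path_det:
  "edge_path X x p y \<Longrightarrow> edge_path X x q z \<Longrightarrow> path_label X p = path_label X q \<Longrightarrow> p = q"
proof (induction p arbitrary: x q)
  case Nil
  then show ?case by (cases q) auto
next
  case (Cons e p)
  then obtain e' q' where q: "q = e' # q'" by (cases q) auto
  have e: "e \<in> edges X" "e' \<in> edges X" "edge_start X e = edge_start X e'" "edge_label X e = edge_label X e'"
    using Cons.prems q by simp_all
  then have "e = e'" using edge_labels[OF e(1)] edge_labels[OF e(2)] by (intro edge_det[OF e(1,2)]) simp_all
  then show ?case using Cons q by auto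
qed

abbreviation hom_eq :: "'c list \<Rightarrow> 'c list \<Rightarrow> bool" where
  "hom_eq \<equiv> homotopic_loops X B"

lemma square_boundary_path:
  assumes "c \<in> cubes X" "labels X c = {s, t}" "s \<noteq> t"
  shows "edge_path X (face X {} {} c) (square_boundary X s t c) (face X {} {} c)"
    and "path_label X (square_boundary X s t c) = [s, t, s, t]"
proof -
  note e = cube_edge[OF assms(1)]
  have d: "sym_diff {s} {t} = {s, t}" "sym_diff {s, t} {s} = {t}" using assms(3) by auto
  show "edge_path X (face X {} {} c) (square_boundary X s t c) (face X {} {} c)"
    unfolding square_boundary_def using e[of "{}" s] e[of "{s}" t] e[of "{s, t}" s] e[of "{t}" t] assms d
      corner_vertex[OF assms(1), of "{}"] by simp
  show "path_label X (square_boundary X s t c) = [s, t, s, t]"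
    unfolding square_boundary_def using e[of "{}" s] e[of "{s}" t] e[of "{s, t}" s] e[of "{t}" t] assms
    by (simp add: edge_label_def)
qed

text \<open>A backtrack contributes a repeated letter \<open>s\<close>, the boundary of a square the
  word \<open>[s, t, s, t]\<close> with commuting letters; both are trivial in the group.\<close>

lemma homotopic_sound:
  "hom_eq p q \<Longrightarrow> edge_loop X B p \<and> edge_loop X B q \<and> path_label X p \<approx> path_label X q"
proof (induction rule: homotopic_loops.induct)
  case (refl p)
  then show ?case using walk_in[OF edge_path_walk] by blast
next
  case (backtrack p e q)
  then have e: "e \<in> edges X" "edge_path X B p (edge_start X e)" "edge_path X (edge_start X e) q B"
    using edge_rev_props by (auto simp: edge_path_append_iff)
  then have pq: "edge_loop X B (p @ q)" by (auto simp: edge_path_append_iff)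
  have "edge_label X (edge_rev X e) = edge_label X e" using edge_rev_props(2)[OF e(1)] by (simp add: edge_label_def)
  moreover have "edge_label X e \<in> pverts \<Gamma>" using edge_step_in[OF edge_step_edge[OF e(1)]] by blast
  ultimately have "path_label X (p @ [e, edge_rev X e] @ q) \<approx> path_label X (p @ q)"
    using walk_in[OF edge_path_walk[OF e(2)]] walk_in[OF edge_path_walk[OF e(3)]]
      word_eq.square[of "path_label X p" \<Gamma> "path_label X q"] by simp
  then show ?case using backtrack pq by blast
next
  case (square c s t p q)
  note sb = square_boundary_path[OF square(1-3)]
  from square(4) obtain y z where yz: "edge_path X B p y" "edge_path X y (square_boundary X s t c) z" "edge_path X z q B"
    by (auto simp: edge_path_append_iff)
  have "y = face X {} {} c"
    using yz(2) cube_edge(3)[OF square(1), of "{}" s] square(2) by (simp add: square_boundary_def)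
  then have "z = y" using walk_det edge_path_walk[OF yz(2)] edge_path_walk[OF sb(1)] by blast
  then have pq: "edge_loop X B (p @ q)" using yz by (auto simp: edge_path_append_iff)
  have w: "path_label X p \<in> words" "path_label X q \<in> words"
    using walk_in[OF edge_path_walk[OF yz(1)]] walk_in[OF edge_path_walk[OF yz(3)]] by auto
  have st: "adj s t" "s \<in> pverts \<Gamma>" "t \<in> pverts \<Gamma>"
    using label_clique[OF square(1)] square(2,3) by (auto simp: clique_def)
  have "[s, t, s, t] \<approx> []"
  proof -
    have "[] @ [s, t] @ [s, t] \<approx> [] @ [t, s] @ [s, t]" using st by (intro word_eq.swap) auto
    also have "[] @ [t, s] @ [s, t] = rev [s, t] @ [s, t]" by simp
    also have "rev [s, t] @ [s, t] \<approx> []" using st by (intro rev_left) auto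
    finally show ?thesis by simp
  qed
  then have "path_label X p @ [s, t, s, t] @ path_label X q \<approx> path_label X p @ [] @ path_label X q"
    using w by (intro eq_context)
  then show ?case using pq square(4) sb(2) by simp
qed (auto intro: eq_sym eq_trans)

lemma square_cube:
  assumes "e \<in> edges X" "labels X e = {s}" "f \<in> edges X" "labels X f = {t}" "edge_end X e = edge_start X f" "adj s t"
  shows "\<exists>c\<in>cubes X. labels X c = {s, t} \<and> e = face X {s} {} c \<and> f = face X {t} {s} c"
proof -
  have st: "s \<noteq> t" using assms(6) by auto
  let ?y = "edge_start X f"
  let ?e = "edge_rev X e"
  note re = edge_rev_props[OF assms(1)]
  define h where "h r = (if r = s then ?e else f)" for r
  obtain c where c: "c \<in> cubes X" "labels X c = {s, t}" "\<And>r. r \<in> {s, t} \<Longrightarrow> h r \<in> faces X c"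
    by (rule cube_fullD[of "{s, t}" ?y h])
      (use assms re st adj_clique[OF assms(6)] edge_rev_props(6)[OF assms(3)] in \<open>auto simp: h_def\<close>)
  have "?e \<in> faces X c" "f \<in> faces X c" using c(3)[of s] c(3)[of t] st by (simp_all add: h_def)
  then obtain A A' where A: "A \<subseteq> {s, t}" "?e = face X {s} A c" "face X {} A c = ?y"
      "A' \<subseteq> {s, t}" "f = face X {t} A' c" "face X {} A' c = ?y"
    using faces_at_edge[OF c(1) re(1), of s] faces_at_edge[OF c(1) assms(3,4)] c(2) re assms by metis
  have "A = A'" by (rule corner_inj[OF c(1)]) (use A c(2) in auto)
  \<comment> \<open>\<open>A\<close> is the corner at the middle vertex, from which the reversed
    \<open>e\<close> and \<open>f\<close> leave. Flipping \<open>s\<close> gives the corner where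
    \<open>e\<close> starts, and this corner is made the corner 0 of \<open>c'\<close>.\<close>
  let ?C = "sym_diff A {s}"
  have C: "?C \<subseteq> {s, t}" using A(1) by auto
  define c' where "c' = face X {s, t} ?C c"
  have c': "c' \<in> cubes X" "labels X c' = {s, t}"
    unfolding c'_def using C c by (simp_all add: face_cube face_labels)
  have ff: "face X L D c' = face X L (sym_diff ?C D) c" if "L \<subseteq> {s, t}" "D \<subseteq> {s, t}" for L D
    unfolding c'_def using c C that by (intro face_face) simp_all
  have "edge_rev X ?e = face X {s} ?C c" using cube_edge(5)[OF c(1), of A s] A c(2) by simp
  then have "e = face X {s} {} c'" using re(5) ff[of "{s}" "{}"] by simp
  moreover have "sym_diff ?C {s} = A" by auto
  then have "f = face X {t} {s} c'" using A(5) \<open>A = A'\<close> ff[of "{t}" "{s}"] by simp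
  ultimately show ?thesis using c' by blast
qed

text \<open>One half of the boundary of a square is traded for the other. Backtracks along
  \<open>a\<close> and \<open>b\<close> are inserted behind \<open>[e, f]\<close>, after which the
  full boundary \<open>[e, f, a, b]\<close> stands in the loop and is deleted.\<close>

lemma hom_eq_swap:
  assumes loop: "edge_loop X B (p @ [e, f] @ q)" and adj: "adj (edge_label X e) (edge_label X f)"
  shows "\<exists>f' e'. hom_eq (p @ [e, f] @ q) (p @ [f', e'] @ q) \<and> edge_label X f' = edge_label X f \<and> edge_label X e' = edge_label X e"
proof -
  let ?s = "edge_label X e" and ?t = "edge_label X f"
  have st: "?s \<noteq> ?t" using adj by auto
  have ef: "e \<in> edges X" "f \<in> edges X" "edge_end X e = edge_start X f"
    "edge_path X B p (edge_start X e)" "edge_path X (edge_end X f) q B"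
    using loop by (auto simp: edge_path_append_iff)
  obtain c where c: "c \<in> cubes X" "labels X c = {?s, ?t}" "e = face X {?s} {} c" "f = face X {?t} {?s} c"
    using square_cube[OF ef(1) edge_labels[OF ef(1)] ef(2) edge_labels[OF ef(2)] ef(3) adj] by blast
  define a b where "a = face X {?s} {?s, ?t} c" and "b = face X {?t} {?t} c"
  have sb: "square_boundary X ?s ?t c = [e, f, a, b]" using c by (simp add: square_boundary_def a_def b_def)
  note path = square_boundary_path[OF c(1,2) st, unfolded sb]
  have ab: "a \<in> edges X" "b \<in> edges X" "edge_start X a = edge_end X f" "edge_start X b = edge_end X a"
    "edge_end X b = edge_start X e" "edge_label X a = ?s" "edge_label X b = ?t"
    using path by auto
  note ra = edge_rev_props[OF ab(1)] and rb = edge_rev_props[OF ab(2)]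
  have 1: "hom_eq ((p @ [e, f]) @ [a, edge_rev X a] @ q) ((p @ [e, f]) @ q)"
    by (rule homotopic_loops.backtrack) (use ef ab ra in \<open>auto simp: edge_path_append_iff\<close>)
  have 2: "hom_eq ((p @ [e, f, a]) @ [b, edge_rev X b] @ ([edge_rev X a] @ q)) ((p @ [e, f, a]) @ ([edge_rev X a] @ q))"
    by (rule homotopic_loops.backtrack) (use ef ab ra rb in \<open>auto simp: edge_path_append_iff\<close>)
  have 3: "hom_eq (p @ square_boundary X ?s ?t c @ ([edge_rev X b, edge_rev X a] @ q)) (p @ ([edge_rev X b, edge_rev X a] @ q))"
    by (rule homotopic_loops.square[OF c(1,2) st], unfold sb)
      (use ef ab ra rb in \<open>auto simp: edge_path_append_iff\<close>)
  have "hom_eq (p @ [e, f] @ q) (p @ [edge_rev X b, edge_rev X a] @ q)"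
    using 1 2 3 unfolding sb
    by (simp only: append_assoc append.simps) (blast intro: homotopic_loops.sym homotopic_loops.trans)
  moreover have "edge_label X (edge_rev X b) = ?t" "edge_label X (edge_rev X a) = ?s"
    using ra(2) rb(2) ab(6,7) by (simp_all add: edge_label_def)
  ultimately show ?thesis by blast
qed

text \<open>Homotopies relate whole loops at \<open>B\<close>. The fixed prefix \<open>p1\<close>
  makes it possible to rewrite only the tail, as the recursion in \<open>hom_eq_nf\<close>
  requires.\<close>

lemma hom_eq_swap_eq:
  "path_label X p2 \<sim> w \<Longrightarrow> edge_loop X B (p1 @ p2) \<Longrightarrow> \<exists>q. hom_eq (p1 @ p2) (p1 @ q) \<and> path_label X q = w"
proof (induction "path_label X p2" w rule: swap_eq.induct)
  case refl
  then show ?case by (blast intro: homotopic_loops.refl)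
next
  case (step a s t b)
  then obtain q where q: "hom_eq (p1 @ p2) (p1 @ q)" "path_label X q = a @ [s, t] @ b" by blast
  then obtain qa e f qb where qq: "q = qa @ [e, f] @ qb" "path_label X qa = a" "edge_label X e = s" "edge_label X f = t"
      "path_label X qb = b"
    unfolding path_label_def by (auto simp: map_eq_append_conv map_eq_Cons_conv)
  have "edge_loop X B ((p1 @ qa) @ [e, f] @ qb)" using homotopic_sound[OF q(1)] qq(1) by simp
  then obtain f' e' where f': "hom_eq ((p1 @ qa) @ [e, f] @ qb) ((p1 @ qa) @ [f', e'] @ qb)"
    "edge_label X f' = t" "edge_label X e' = s"
    using hom_eq_swap[of "p1 @ qa" e f qb] qq step by blast
  have "hom_eq (p1 @ p2) (p1 @ (qa @ [f', e'] @ qb))"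
    using q(1) f'(1) qq(1) by (simp add: homotopic_loops.trans)
  moreover have "path_label X (qa @ [f', e'] @ qb) = a @ [t, s] @ b" using qq f' by simp
  ultimately show ?case by blast
qed

text \<open>The rewriting of \<open>walk_nf\<close>, repeated on the level of edges: once the
  matching letter is shuffled next to \<open>e\<close>, its edge must be the reverse of
  \<open>e\<close> because edges are determined by start and label.\<close>

lemma hom_eq_nf:
  "edge_loop X B (p1 @ p2) \<Longrightarrow> \<exists>q. hom_eq (p1 @ p2) (p1 @ q) \<and> path_label X q = nf (path_label X p2)"
proof (induction p2 arbitrary: p1)
  case Nil
  then show ?case by (intro exI[of _ "[]"]) (auto intro: homotopic_loops.refl)
next
  case (Cons e p2)
  let ?s = "edge_label X e"
  obtain q where q: "hom_eq (p1 @ e # p2) (p1 @ e # q)" "path_label X q = nf (path_label X p2)"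
    using Cons.IH[of "p1 @ [e]"] Cons.prems by auto
  show ?case
  proof (cases "front ?s (nf (path_label X p2))")
    case False
    then show ?thesis using q by (intro exI[of _ "e # q"]) (simp add: push_def)
  next
    case True
    let ?r = "remove1 ?s (nf (path_label X p2))"
    have l: "edge_loop X B ((p1 @ [e]) @ q)" using homotopic_sound[OF q(1)] by simp
    obtain q' where q': "hom_eq ((p1 @ [e]) @ q) ((p1 @ [e]) @ q')" "path_label X q' = ?s # ?r"
      using hom_eq_swap_eq[OF _ l] front_swap[OF True] q(2) by metis
    then obtain e' r where r: "q' = e' # r" "edge_label X e' = ?s" "path_label X r = ?r" by (cases q') auto
    have "edge_loop X B ((p1 @ [e]) @ q')" using homotopic_sound[OF q'(1)] by blast
    then have e: "e \<in> edges X" "e' \<in> edges X" "edge_start X e' = edge_end X e"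
      unfolding r by (auto simp: edge_path_append_iff)
    have "labels X e' = labels X (edge_rev X e)"
      using r(2) edge_rev_props(2)[OF e(1)] edge_labels[OF e(1)] edge_labels[OF e(2)] by simp
    then have "e' = edge_rev X e"
      using e(3) edge_rev_props(3)[OF e(1)] by (intro edge_det[OF e(2) edge_rev_props(1)[OF e(1)]]) simp_all
    then have "hom_eq (p1 @ [e, edge_rev X e] @ r) (p1 @ r)"
      using \<open>edge_loop X B ((p1 @ [e]) @ q')\<close> r(1) by (intro homotopic_loops.backtrack) simp
    then have "hom_eq (p1 @ e # p2) (p1 @ r)"
      using q(1) q'(1) r(1) \<open>e' = edge_rev X e\<close> by (simp) (blast intro: homotopic_loops.trans)
    then show ?thesis using r(3) True by (auto simp: push_def)
  qed
qed

text \<open>Two loops with equal group elements are homotopic to loops with one and the same reduced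
  label, and a path is determined by its start and label.\<close>

lemma homotopic_iff:
  "hom_eq p q \<longleftrightarrow> edge_loop X B p \<and> edge_loop X B q \<and> path_label X p \<approx> path_label X q"
proof
  assume a: "edge_loop X B p \<and> edge_loop X B q \<and> path_label X p \<approx> path_label X q"
  obtain p' where p': "hom_eq p p'" "path_label X p' = nf (path_label X p)"
    using hom_eq_nf[of "[]" p] a by auto
  obtain q' where q': "hom_eq q q'" "path_label X q' = nf (path_label X q)"
    using hom_eq_nf[of "[]" q] a by auto
  have "path_label X p' \<sim> nf (path_label X q)" using p'(2) a eq_imp_nf by metis
  moreover have "edge_loop X B ([] @ p')" using homotopic_sound[OF p'(1)] by simp
  ultimately obtain p'' where p'': "hom_eq p' p''" "path_label X p'' = nf (path_label X q)"
    using hom_eq_swap_eq[of p' _ "[]"] by auto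
  have "edge_loop X B p''" "edge_loop X B q'" using homotopic_sound p''(1) q'(1) by blast+
  then have "p'' = q'" using path_det p''(2) q'(2) by metis
  then show "hom_eq p q" using p'(1) p''(1) q'(1) by (blast intro: homotopic_loops.sym homotopic_loops.trans)
qed (rule homotopic_sound)

text \<open>The isomorphism reads off the label of any loop in the class. It is onto because the
  reduced words for elements of the subgroup occur as labels of loops at \<open>B\<close>.\<close>

lemma fundamental_group_iso: "fundamental_group X B \<cong> racg \<Gamma>\<lparr>carrier := G\<rparr>"
proof -
  let ?F = "fundamental_group X B"
  define \<phi> where "\<phi> C = word_elem \<Gamma> (path_label X (SOME p. p \<in> C))" for C
  have w: "path_label X p \<in> GW" if "edge_loop X B p" for p
    using walk_loop[OF edge_path_walk[OF that]] .
  have cls: "q \<in> loop_class X B p \<longleftrightarrow> edge_loop X B q \<and> path_label X p \<approx> path_label X q" if "edge_loop X B p" for p q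
    using that homotopic_iff by (auto simp: loop_class_def)
  have \<phi>: "\<phi> (loop_class X B p) = word_elem \<Gamma> (path_label X p)" if p: "edge_loop X B p" for p
  proof -
    have "p \<in> loop_class X B p" using cls[OF p] p w[OF p] GW_words by auto
    then have "(SOME q. q \<in> loop_class X B p) \<in> loop_class X B p" by (rule someI)
    then have "path_label X p \<approx> path_label X (SOME q. q \<in> loop_class X B p)" using cls[OF p] by blast
    then show ?thesis unfolding \<phi>_def using elem_eq_iff w[OF p] GW_words by metis
  qed
  have car: "carrier ?F = loop_class X B ` {p. edge_loop X B p}" by (simp add: fundamental_group_def)
  have cls_eq: "loop_class X B p = loop_class X B q" if "edge_loop X B p" "edge_loop X B q" "path_label X p \<approx> path_label X q" for p q
    using cls[OF that(1)] cls[OF that(2)] that(3) unfolding set_eq_iff by (metis eq_sym eq_trans)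
  have mult: "loop_class X B p \<otimes>\<^bsub>?F\<^esub> loop_class X B q = loop_class X B (p @ q)"
    if p: "edge_loop X B p" and q: "edge_loop X B q" for p q
  proof -
    have pq: "edge_loop X B (p @ q)" using p q by (auto simp: edge_path_append_iff)
    have "loop_class X B (p' @ q') = loop_class X B (p @ q)"
      if "p' \<in> loop_class X B p" "q' \<in> loop_class X B q" for p' q'
    proof -
      have a: "edge_loop X B p'" "edge_loop X B q'" "path_label X p \<approx> path_label X p'" "path_label X q \<approx> path_label X q'"
        using that cls p q by blast+
      then have "edge_loop X B (p' @ q')" by (auto simp: edge_path_append_iff)
      moreover have "path_label X (p' @ q') \<approx> path_label X (p @ q)" using eq_append[OF a(3,4)] by (simp add: eq_sym)
      ultimately show ?thesis using cls_eq pq by blast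
    qed
    moreover have "p \<in> loop_class X B p" "q \<in> loop_class X B q" using cls p q w GW_words by auto
    ultimately have "(\<Union>p'\<in>loop_class X B p. \<Union>q'\<in>loop_class X B q. loop_class X B (p' @ q')) = loop_class X B (p @ q)"
      by blast
    then show ?thesis by (simp add: fundamental_group_def)
  qed
  have "\<phi> \<in> hom ?F (racg \<Gamma>\<lparr>carrier := G\<rparr>)"
  proof (rule homI)
    fix x assume "x \<in> carrier ?F"
    then obtain p where "edge_loop X B p" "x = loop_class X B p" using car by auto
    then show "\<phi> x \<in> carrier (racg \<Gamma>\<lparr>carrier := G\<rparr>)" using \<phi> w by (simp add: GW_def)
  next
    fix x y assume "x \<in> carrier ?F" "y \<in> carrier ?F"
    then obtain p q where p: "edge_loop X B p" "x = loop_class X B p" and q: "edge_loop X B q" "y = loop_class X B q"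
      using car by auto
    have "edge_loop X B (p @ q)" using p q by (auto simp: edge_path_append_iff)
    then show "\<phi> (x \<otimes>\<^bsub>?F\<^esub> y) = \<phi> x \<otimes>\<^bsub>racg \<Gamma>\<lparr>carrier := G\<rparr>\<^esub> \<phi> y"
      using p q mult \<phi> w[of p] w[of q] GW_words by simp
  qed
  moreover have "bij_betw \<phi> (carrier ?F) (carrier (racg \<Gamma>\<lparr>carrier := G\<rparr>))"
  proof (rule bij_betw_imageI)
    show "inj_on \<phi> (carrier ?F)"
    proof (rule inj_onI)
      fix x y assume "x \<in> carrier ?F" "y \<in> carrier ?F" and eq: "\<phi> x = \<phi> y"
      then obtain p q where p: "edge_loop X B p" "x = loop_class X B p" and q: "edge_loop X B q" "y = loop_class X B q"
        using car by auto
      then have "path_label X p \<approx> path_label X q" using eq \<phi> w[OF p(1)] GW_words elem_eq_iff by metis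
      then show "x = y" using cls_eq p q by blast
    qed
    have "\<phi> ` carrier ?F = (\<lambda>p. word_elem \<Gamma> (path_label X p)) ` {p. edge_loop X B p}"
      unfolding car image_image using \<phi> by (intro image_cong) auto
    also have "\<dots> = G"
    proof
      show "(\<lambda>p. word_elem \<Gamma> (path_label X p)) ` {p. edge_loop X B p} \<subseteq> G" using w by (auto simp: GW_def)
      show "G \<subseteq> (\<lambda>p. word_elem \<Gamma> (path_label X p)) ` {p. edge_loop X B p}"
      proof
        fix g assume "g \<in> G"
        then obtain u where u: "u \<in> GW" "g = word_elem \<Gamma> u" using G_word by blast
        have "walk X B (nf u) B" using loop_walk[OF nf_GW cred_nf] u by blast
        then obtain p where p: "edge_loop X B p" "path_label X p = nf u" by (auto simp: walk_def)
        have "word_elem \<Gamma> (nf u) = g" using u nf_eq nf_in GW_words elem_eq_iff by metis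
        then show "g \<in> (\<lambda>p. word_elem \<Gamma> (path_label X p)) ` {p. edge_loop X B p}" using p by (intro image_eqI[of _ _ p]) auto
      qed
    qed
    finally show "\<phi> ` carrier ?F = carrier (racg \<Gamma>\<lparr>carrier := G\<rparr>)" by simp
  qed
  ultimately have "\<phi> \<in> iso ?F (racg \<Gamma>\<lparr>carrier := G\<rparr>)" by (rule isoI)
  then show ?thesis by (rule is_isoI)
qed

end


section \<open>Quasiconvexity in terms of words\<close>

context right_angled
begin

abbreviation cdist :: "'v list set \<Rightarrow> 'v list set \<Rightarrow> nat" where
  "cdist \<equiv> cayley_dist (racg \<Gamma>) (gens \<Gamma> (pverts \<Gamma>))"

abbreviation cpath :: "'v list set list \<Rightarrow> bool" where
  "cpath \<equiv> cayley_path (racg \<Gamma>) (gens \<Gamma> (pverts \<Gamma>))"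

text \<open>An edge of the Cayley graph is a right multiplication by a letter in either direction,
  since letters are involutions. A path thus consists of the prefixes of a word read behind its
  starting point.\<close>

lemma cpath_word:
  "cpath p \<Longrightarrow> u \<in> words \<Longrightarrow> hd p = word_elem \<Gamma> u \<Longrightarrow>
    \<exists>w\<in>words. length p = Suc (length w) \<and> (\<forall>i\<le>length w. p ! i = word_elem \<Gamma> (u @ take i w))"
proof (induction p arbitrary: u)
  case Nil
  then show ?case by (simp add: cayley_path_def)
next
  case (Cons x p)
  show ?case
  proof (cases p)
    case Nil
    then show ?thesis using Cons.prems by (intro bexI[of _ "[]"]) simp_all
  next
    case (Cons y p')
    have x: "x = word_elem \<Gamma> u" using Cons.prems by simp
    have p: "cpath p" and "y \<in> carrier (racg \<Gamma>)"
      and st: "\<exists>s\<in>gens \<Gamma> (pverts \<Gamma>). y = x \<otimes>\<^bsub>racg \<Gamma>\<^esub> s \<or> x = y \<otimes>\<^bsub>racg \<Gamma>\<^esub> s"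
      using Cons.prems(1) Cons by (auto simp: cayley_path_def)
    then obtain v where v: "v \<in> words" "y = word_elem \<Gamma> v" using carrier_racg by auto
    obtain s where s: "s \<in> pverts \<Gamma>" "y = x \<otimes>\<^bsub>racg \<Gamma>\<^esub> word_elem \<Gamma> [s] \<or> x = y \<otimes>\<^bsub>racg \<Gamma>\<^esub> word_elem \<Gamma> [s]"
      using st by (auto simp: gens_def)
    have "v \<approx> u @ [s]"
    proof (cases "y = x \<otimes>\<^bsub>racg \<Gamma>\<^esub> word_elem \<Gamma> [s]")
      case True
      then show ?thesis using x v s Cons.prems(2) elem_eq_iff[of v "u @ [s]"] by simp
    next
      case False
      then have "x = y \<otimes>\<^bsub>racg \<Gamma>\<^esub> word_elem \<Gamma> [s]" using s(2) by blast
      then have "u \<approx> v @ [s]" using x v s(1) Cons.prems(2) elem_eq_iff[of u "v @ [s]"] by simp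
      then show ?thesis using eq_move_right[of "[s]" u v] s v Cons.prems(2) eq_sym by simp
    qed
    then have "y = word_elem \<Gamma> (u @ [s])" using v elem_eq_iff by simp
    then obtain w where w: "w \<in> words" "length p = Suc (length w)"
      "\<forall>i\<le>length w. p ! i = word_elem \<Gamma> ((u @ [s]) @ take i w)"
      using Cons.IH[OF p, of "u @ [s]"] Cons.prems(2) s(1) Cons by auto
    have "(x # p) ! i = word_elem \<Gamma> (u @ take i (s # w))" if "i \<le> length (s # w)" for i
      using that w(3) x by (cases i) auto
    then show ?thesis using w(1,2) s(1) by (intro bexI[of _ "s # w"]) auto
  qed
qed

definition word_path :: "'v list \<Rightarrow> 'v list \<Rightarrow> 'v list set list" where
  "word_path u w = map (\<lambda>i. word_elem \<Gamma> (u @ take i w)) [0..<Suc (length w)]"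

lemma word_path_props:
  assumes "u \<in> words" "w \<in> words"
  shows "cpath (word_path u w)" "hd (word_path u w) = word_elem \<Gamma> u" "last (word_path u w) = word_elem \<Gamma> (u @ w)"
    "length (word_path u w) = Suc (length w)"
proof -
  have t: "take i w \<in> words" for i using assms(2) by (meson in_listsD in_listsI in_set_takeD)
  have "successively (\<lambda>g h. \<exists>s\<in>gens \<Gamma> (pverts \<Gamma>). h = g \<otimes>\<^bsub>racg \<Gamma>\<^esub> s \<or> g = h \<otimes>\<^bsub>racg \<Gamma>\<^esub> s) (word_path u w)"
    unfolding successively_conv_nth
  proof (intro allI impI)
    fix i assume "Suc i < length (word_path u w)"
    then have i: "i < length w" by (simp add: word_path_def)
    have s: "w ! i \<in> pverts \<Gamma>" using assms(2) i by (simp add: in_lists_conv_set)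
    have "word_path u w ! Suc i = word_path u w ! i \<otimes>\<^bsub>racg \<Gamma>\<^esub> word_elem \<Gamma> [w ! i]"
      using i assms t s by (simp add: word_path_def take_Suc_conv_app_nth del: upt_Suc)
    then show "\<exists>s\<in>gens \<Gamma> (pverts \<Gamma>). word_path u w ! Suc i = word_path u w ! i \<otimes>\<^bsub>racg \<Gamma>\<^esub> s \<or>
        word_path u w ! i = word_path u w ! Suc i \<otimes>\<^bsub>racg \<Gamma>\<^esub> s"
      using s unfolding gens_def by blast
  qed
  then show "cpath (word_path u w)"
    using assms t by (auto simp: cayley_path_def word_path_def)
  show "hd (word_path u w) = word_elem \<Gamma> u" "last (word_path u w) = word_elem \<Gamma> (u @ w)"
    "length (word_path u w) = Suc (length w)"
    by (simp_all add: word_path_def hd_map last_map del: upt_Suc)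
qed

lemma cdist_eq:
  assumes "u \<in> words" "w \<in> words" "cred w"
  shows "cdist (word_elem \<Gamma> u) (word_elem \<Gamma> (u @ w)) = length w"
  unfolding cayley_dist_def
proof (rule Least_equality)
  show "\<exists>p. cpath p \<and> hd p = word_elem \<Gamma> u \<and> last p = word_elem \<Gamma> (u @ w) \<and> length p = Suc (length w)"
    using word_path_props[OF assms(1,2)] by blast
next
  fix n assume "\<exists>p. cpath p \<and> hd p = word_elem \<Gamma> u \<and> last p = word_elem \<Gamma> (u @ w) \<and> length p = Suc n"
  then obtain p where p: "cpath p" "hd p = word_elem \<Gamma> u" "last p = word_elem \<Gamma> (u @ w)" "length p = Suc n" by blast
  obtain w' where w': "w' \<in> words" "length p = Suc (length w')" "\<forall>i\<le>length w'. p ! i = word_elem \<Gamma> (u @ take i w')"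
    using cpath_word[OF p(1) assms(1) p(2)] by blast
  have "last p = p ! length w'" using w'(2) by (metis diff_Suc_1 last_conv_nth list.size(3) nat.distinct(1))
  then have "word_elem \<Gamma> (u @ w') = word_elem \<Gamma> (u @ w)" using w'(3) p(3) by simp
  then have "w' \<approx> w" using elem_eq_iff[of "u @ w'" "u @ w"] eq_cancel_left assms w' by simp
  then show "length w \<le> n" using cred_length_le[OF assms(3)] w'(2) p(4) by simp
qed

lemma cdist_le:
  assumes "u \<in> words" "w \<in> words"
  shows "cdist (word_elem \<Gamma> u) (word_elem \<Gamma> (u @ w)) \<le> length w"
proof -
  have "u @ nf w \<approx> u @ w" using assms nf_eq by (intro eq_append) auto
  then have "word_elem \<Gamma> (u @ w) = word_elem \<Gamma> (u @ nf w)" using elem_eq_iff eq_in by metis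
  then show ?thesis using cdist_eq[of u "nf w"] assms nf_in cred_nf length_nf by metis
qed

end

context racg_subgroup
begin

definition near :: "nat \<Rightarrow> 'v list \<Rightarrow> bool" where
  "near M x \<longleftrightarrow> (\<exists>q\<in>words. length q \<le> M \<and> x @ q \<in> GW)"

text \<open>Only geodesics that start at the identity are considered; those between two elements of
  the subgroup are translates of them by an element of the subgroup.\<close>

definition qconvex :: "nat \<Rightarrow> bool" where
  "qconvex M \<longleftrightarrow> (\<forall>u w. u @ w \<in> GW \<and> cred (u @ w) \<longrightarrow> near M u)"

lemma near_cong: "near M x \<Longrightarrow> x \<approx> y \<Longrightarrow> near M y"
  unfolding near_def using eq_GW eq_append eq_refl by meson

lemma near_step: "near M x \<Longrightarrow> x \<in> words \<Longrightarrow> s \<in> pverts \<Gamma> \<Longrightarrow> near (Suc M) (x @ [s])"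
proof -
  assume "near M x" and x: "x \<in> words" and s: "s \<in> pverts \<Gamma>"
  then obtain q where q: "q \<in> words" "length q \<le> M" "x @ q \<in> GW" by (auto simp: near_def)
  have "x @ q \<approx> (x @ [s]) @ ([s] @ q)" using word_eq.square[of x \<Gamma> q s] x s q eq_sym by simp
  then have "(x @ [s]) @ ([s] @ q) \<in> GW" using eq_GW q by blast
  then show ?thesis unfolding near_def using q s by (intro bexI[of _ "[s] @ q"]) auto
qed

lemma quasiconvex_words:
  "quasiconvex (racg \<Gamma>) (gens \<Gamma> (pverts \<Gamma>)) G \<longleftrightarrow> (\<exists>M. qconvex M)"
proof
  assume "quasiconvex (racg \<Gamma>) (gens \<Gamma> (pverts \<Gamma>)) G"
  then obtain M where M: "\<And>p x. cayley_geodesic (racg \<Gamma>) (gens \<Gamma> (pverts \<Gamma>)) p \<Longrightarrow> hd p \<in> G \<Longrightarrow> last p \<in> G \<Longrightarrow>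
        x \<in> set p \<Longrightarrow> \<exists>g\<in>G. cdist x g \<le> M"
    unfolding quasiconvex_def by blast
  have "near M u" if uw: "u @ w \<in> GW" "cred (u @ w)" for u w
  proof -
    have w: "u @ w \<in> words" using GW_words uw by blast
    then have uw': "u \<in> words" "w \<in> words" by auto
    let ?p = "word_path [] (u @ w)"
    note p = word_path_props[OF _ w, of "[]", simplified]
    have "cayley_geodesic (racg \<Gamma>) (gens \<Gamma> (pverts \<Gamma>)) ?p"
      unfolding cayley_geodesic_def using p cdist_eq[of "[]" "u @ w"] w uw by simp
    moreover have "hd ?p \<in> G" "last ?p \<in> G" using p Nil_GW uw unfolding GW_def by auto
    moreover have "word_elem \<Gamma> u \<in> set ?p" unfolding word_path_def
      by (auto intro!: image_eqI[of _ _ "length u"])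
    ultimately obtain g where g: "g \<in> G" "cdist (word_elem \<Gamma> u) g \<le> M" using M by blast
    then obtain v where v: "v \<in> GW" "g = word_elem \<Gamma> v" using G_word by blast
    have vw: "v \<in> words" using v GW_words by blast
    let ?q = "nf (rev u @ v)"
    have q: "?q \<in> words" using nf_in uw' vw by simp
    have "?q \<approx> rev u @ v" using nf_eq uw' vw by simp
    then have "v \<approx> u @ ?q" using eq_move_left[of u v ?q] uw' vw q by (blast intro: eq_sym)
    then have "u @ ?q \<in> GW" "word_elem \<Gamma> v = word_elem \<Gamma> (u @ ?q)"
      using eq_GW v elem_eq_iff[OF vw] by auto
    moreover from this have "cdist (word_elem \<Gamma> u) g = length ?q"
      using v(2) cdist_eq[OF uw'(1) q cred_nf] by simp
    ultimately have "u @ ?q \<in> GW" "cdist (word_elem \<Gamma> u) g = length ?q" by auto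
    then show ?thesis unfolding near_def using g q by auto
  qed
  then show "\<exists>M. qconvex M" unfolding qconvex_def by blast
next
  assume "\<exists>M. qconvex M"
  then obtain M where M: "qconvex M" by blast
  show "quasiconvex (racg \<Gamma>) (gens \<Gamma> (pverts \<Gamma>)) G"
    unfolding quasiconvex_def
  proof (intro exI[of _ M] allI impI ballI)
    fix p x
    assume p: "cayley_geodesic (racg \<Gamma>) (gens \<Gamma> (pverts \<Gamma>)) p \<and> hd p \<in> G \<and> last p \<in> G" and x: "x \<in> set p"
    obtain u where u: "u \<in> GW" "hd p = word_elem \<Gamma> u" using p G_word by blast
    have uw: "u \<in> words" using u GW_words by blast
    have cp: "cpath p" "length p = Suc (cdist (hd p) (last p))" using p by (auto simp: cayley_geodesic_def)
    obtain w where w: "w \<in> words" "length p = Suc (length w)" "\<forall>i\<le>length w. p ! i = word_elem \<Gamma> (u @ take i w)"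
      using cpath_word[OF cp(1) uw u(2)] by blast
    have "last p = p ! length w" using w(2) by (metis diff_Suc_1 last_conv_nth list.size(3) nat.distinct(1))
    then have l: "last p = word_elem \<Gamma> (u @ w)" using w by simp
    have "cred w"
    proof (rule ccontr)
      assume "\<not> cred w"
      then have "length (nf w) < length w" by (rule not_cred_shorter)
      moreover have "u @ nf w \<approx> u @ w" using uw w nf_eq by (intro eq_append) auto
      then have "last p = word_elem \<Gamma> (u @ nf w)" using l elem_eq_iff eq_in by metis
      then have "cdist (hd p) (last p) \<le> length (nf w)" using cdist_le[OF uw nf_in] w u by metis
      ultimately show False using cp(2) w(2) by simp
    qed
    have "u @ w \<in> GW" using l p uw w by (auto simp: GW_def)
    then have wG: "w \<in> GW" using append_GW_iff u w by blast
    obtain i where i: "i \<le> length w" "x = word_elem \<Gamma> (u @ take i w)"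
      using x w(2,3) by (metis in_set_conv_nth less_Suc_eq_le)
    have t: "take i w \<in> words" using w(1) by (meson in_listsD in_listsI in_set_takeD)
    obtain q where q: "q \<in> words" "length q \<le> M" "take i w @ q \<in> GW"
      using M wG \<open>cred w\<close> unfolding qconvex_def near_def by (metis append_take_drop_id)
    have "u @ (take i w @ q) \<in> GW" using append_GW u q by blast
    moreover have "cdist x (word_elem \<Gamma> ((u @ take i w) @ q)) \<le> M"
      using cdist_le[of "u @ take i w" q] q t uw i by simp
    ultimately show "\<exists>g\<in>G. cdist x g \<le> M" by (auto simp: GW_def)
  qed
qed

text \<open>From every prefix of a reduced word for an element there is a way \<open>q\<close> of
  length at most \<open>M\<close> back to the subgroup. Two successive return points differ by
  \<open>rev q' @ [w ! i] @ q\<close>, of length at most \<open>2 * M + 1\<close>, so words of this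
  length generate. The induction runs over all return ways \<open>q\<close> of a prefix, the final
  one being \<open>[]\<close>.\<close>

lemma qconvex_finitely_generated:
  assumes M: "qconvex M"
  shows "finitely_generated (racg \<Gamma>) G"
proof -
  define S where "S = {w \<in> GW. length w \<le> 2 * M + 1}"
  let ?S = "word_elem \<Gamma> ` S"
  have "S \<subseteq> {w. set w \<subseteq> pverts \<Gamma> \<and> length w \<le> 2 * M + 1}"
    using GW_words by (auto simp: S_def in_lists_conv_set)
  then have fin: "finite ?S" using finite_lists_length_le[OF finite_pverts] by (meson finite_imageI finite_subset)
  have SG: "?S \<subseteq> G" by (auto simp: S_def GW_def)
  then have 1: "generate (racg \<Gamma>) ?S \<subseteq> G"
    using group.generate_subgroup_incl[OF group_racg] subgroup by blast
  have step: "word_elem \<Gamma> (take i w @ q) \<in> generate (racg \<Gamma>) ?S"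
    if "w \<in> GW" "cred w" "i \<le> length w" "q \<in> words" "length q \<le> M" "take i w @ q \<in> GW" for w i q
    using that(3-6)
  proof (induction i arbitrary: q)
    case 0
    then have "q \<in> S" by (simp add: S_def)
    then show ?case by (simp add: generate.incl)
  next
    case (Suc i)
    have w: "w \<in> words" using that GW_words by blast
    have i: "i < length w" and s: "w ! i \<in> pverts \<Gamma>" using Suc.prems(1) w by (auto simp: in_lists_conv_set)
    have t: "take i w \<in> words" using w by (meson in_listsD in_listsI in_set_takeD)
    have "near M (take i w)" using M that(1,2) unfolding qconvex_def by (metis append_take_drop_id)
    then obtain q' where q': "q' \<in> words" "length q' \<le> M" "take i w @ q' \<in> GW" by (auto simp: near_def)
    let ?x = "take i w @ q'" and ?y = "rev q' @ [w ! i] @ q"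
    have e: "?x @ ?y \<approx> take (Suc i) w @ q"
    proof -
      have "take i w @ (q' @ rev q') @ ([w ! i] @ q) \<approx> take i w @ [] @ ([w ! i] @ q)"
        using t s q' Suc.prems by (intro eq_context rev_right) auto
      then show ?thesis using i by (simp add: take_Suc_conv_app_nth)
    qed
    then have "?x @ ?y \<in> GW" using eq_GW Suc.prems eq_sym by blast
    then have "?y \<in> GW" using append_GW_iff[OF q'(3)] q' s Suc.prems by simp
    then have "?y \<in> S" using q' Suc.prems by (simp add: S_def)
    then have "word_elem \<Gamma> ?y \<in> generate (racg \<Gamma>) ?S" by (simp add: generate.incl)
    moreover have "word_elem \<Gamma> ?x \<in> generate (racg \<Gamma>) ?S" using Suc.IH[of q'] q' i by simp
    ultimately have "word_elem \<Gamma> ?x \<otimes>\<^bsub>racg \<Gamma>\<^esub> word_elem \<Gamma> ?y \<in> generate (racg \<Gamma>) ?S" by (rule generate.eng[rotated])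
    moreover have "word_elem \<Gamma> ?x \<otimes>\<^bsub>racg \<Gamma>\<^esub> word_elem \<Gamma> ?y = word_elem \<Gamma> (?x @ ?y)"
      using \<open>?y \<in> GW\<close> q' GW_words by (intro mult_elem) auto
    moreover have "word_elem \<Gamma> (?x @ ?y) = word_elem \<Gamma> (take (Suc i) w @ q)" using e elem_eq_iff eq_in by metis
    ultimately show ?case by simp
  qed
  have "G \<subseteq> generate (racg \<Gamma>) ?S"
  proof
    fix g assume "g \<in> G"
    then obtain w where w: "w \<in> GW" "g = word_elem \<Gamma> w" using G_word by blast
    have "word_elem \<Gamma> (take (length (nf w)) (nf w) @ []) \<in> generate (racg \<Gamma>) ?S"
      using nf_GW[OF w(1)] cred_nf by (intro step) auto
    then have "word_elem \<Gamma> (nf w) \<in> generate (racg \<Gamma>) ?S" by simp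
    moreover have "word_elem \<Gamma> (nf w) = g" using w nf_eq nf_in GW_words elem_eq_iff by metis
    ultimately show "g \<in> generate (racg \<Gamma>) ?S" by simp
  qed
  with 1 have "generate (racg \<Gamma>) ?S = G" by blast
  then show ?thesis unfolding finitely_generated_def
    using fin SG subgroup.subset[OF subgroup] by blast
qed

end

context completion_of
begin

text \<open>A prefix of a reduced loop ends at some vertex, and the reversed address of this vertex
  leads back to \<open>B\<close>. The constant is the greatest length of an address.\<close>

lemma finite_imp_qconvex:
  assumes "finite (vertices X)"
  shows "\<exists>M. qconvex M"
proof -
  define M where "M = Max ((\<lambda>v. length (addr v)) ` vertices X)"
  have "near M u" if uw: "u @ w \<in> GW" "cred (u @ w)" for u w
  proof -
    obtain v where v: "walk X B u v" using loop_walk[OF uw] by (auto simp: walk_append)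
    then have vv: "v \<in> vertices X" using walk_in by blast
    then have a: "walk X B (addr v) v" by (rule addr)
    then have "walk X B (u @ rev (addr v)) B" using v walk_rev by (auto simp: walk_append)
    then have "u @ rev (addr v) \<in> GW" by (rule walk_loop)
    moreover have "length (addr v) \<le> M" unfolding M_def using assms vv by (intro Max_ge) auto
    ultimately show ?thesis unfolding near_def using walk_in[OF a] by (intro bexI[of _ "rev (addr v)"]) auto
  qed
  then show ?thesis unfolding qconvex_def by blast
qed

end


section \<open>Walls and hulls\<close>

context right_angled
begin

text \<open>
  \<open>crosses w r\<close>: a path labeled \<open>w\<close> starting at the identity crosses the wall of the reflection
  \<open>r\<close> an odd number of times.
\<close>

fun crosses :: "'v list \<Rightarrow> 'v list \<Rightarrow> bool" where
  "crosses [] r \<longleftrightarrow> False"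
| "crosses (s # w) r \<longleftrightarrow> (r \<approx> [s]) \<noteq> crosses w (s # r @ [s])"

lemma conj_move: "s \<in> pverts \<Gamma> \<Longrightarrow> r \<in> words \<Longrightarrow> x \<in> words \<Longrightarrow> s # r @ [s] \<approx> x \<longleftrightarrow> r \<approx> s # x @ [s]"
proof -
  assume a: "s \<in> pverts \<Gamma>" "r \<in> words" "x \<in> words"
  have "rev [s] @ (r @ [s]) \<approx> x \<longleftrightarrow> r @ [s] \<approx> [s] @ x" using a by (intro eq_move_left) auto
  also have "\<dots> \<longleftrightarrow> r @ rev [s] \<approx> [s] @ x" by simp
  also have "\<dots> \<longleftrightarrow> r \<approx> ([s] @ x) @ [s]" using a by (intro eq_move_right) auto
  finally show ?thesis by simp
qed

lemma conj_cong: "s \<in> pverts \<Gamma> \<Longrightarrow> r \<approx> r' \<Longrightarrow> s # r @ [s] \<approx> s # r' @ [s]"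
  using eq_context[of r r' "[s]" "[s]"] by simp

lemma square_Nil: "s \<in> pverts \<Gamma> \<Longrightarrow> [s, s] \<approx> []"
  using word_eq.square[of "[]" \<Gamma> "[]" s] by simp

lemma conj_self: "s \<in> pverts \<Gamma> \<Longrightarrow> [s, s, s] \<approx> [s]"
  using word_eq.square[of "[]" \<Gamma> "[s]" s] by simp

lemma conj_adj: "adj s t \<Longrightarrow> [s, t, s] \<approx> [t]"
proof -
  assume a: "adj s t"
  have "[s, t, s] \<approx> [t, s, s]" using word_eq.swap[of "[]" \<Gamma> "[s]" s t] a adj_in[OF a] by simp
  also have "[t, s, s] \<approx> [t]" using word_eq.square[of "[t]" \<Gamma> "[]" s] adj_in[OF a] by simp
  finally show ?thesis .
qed

lemma crosses_cong_wall: "w \<in> words \<Longrightarrow> r \<approx> r' \<Longrightarrow> crosses w r = crosses w r'"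
proof (induction w arbitrary: r r' rule: list.induct)
  case (Cons s w)
  have "crosses w (s # r @ [s]) = crosses w (s # r' @ [s])"
    using Cons.prems by (intro Cons.IH conj_cong) auto
  moreover have "r \<approx> [s] \<longleftrightarrow> r' \<approx> [s]" using Cons.prems(2) by (meson eq_sym eq_trans)
  ultimately show ?case by simp
qed simp

lemma crosses_append: "crosses (x @ y) r = (crosses x r \<noteq> crosses y (rev x @ r @ x))"
  by (induction x arbitrary: r) auto

text \<open>Parity makes the crossing of a wall a function of the group element:
  \<open>[s, s]\<close> crosses one wall twice, and \<open>[s, t]\<close> and \<open>[t, s]\<close>
  with commuting letters cross the same two walls.\<close>

lemma crosses_cong:
  assumes "u \<approx> w" "r \<in> words"
  shows "crosses u r = crosses w r"
  using assms
proof (induction arbitrary: r rule: word_eq.induct)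
  case (square u w s)
  let ?r = "rev u @ r @ u"
  have r: "?r \<in> words" "[s] \<in> words" using square by auto
  have "s # ?r @ [s] \<approx> [s] \<longleftrightarrow> ?r \<approx> [s, s, s]" using conj_move[of s ?r "[s]"] square(3) r by simp
  also have "\<dots> \<longleftrightarrow> ?r \<approx> [s]" using conj_self[OF square(3)] by (meson eq_sym eq_trans)
  finally have 1: "s # ?r @ [s] \<approx> [s] \<longleftrightarrow> ?r \<approx> [s]" .
  have "s # (s # ?r @ [s]) @ [s] \<approx> ?r"
    using conj_move[of s "s # ?r @ [s]" ?r] square(3) r by simp
  then have "crosses w (s # (s # ?r @ [s]) @ [s]) = crosses w ?r" by (rule crosses_cong_wall[OF square(2)])
  then have "crosses ([s, s] @ w) ?r = crosses w ?r" using 1 by auto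
  then show ?case unfolding crosses_append[of u] by simp
next
  case (swap u w s t)
  let ?r = "rev u @ r @ u"
  have st: "s \<in> pverts \<Gamma>" "t \<in> pverts \<Gamma>" "adj t s" using swap adj_in adj_sym by blast+
  have r: "?r \<in> words" using swap by auto
  have 1: "s # ?r @ [s] \<approx> [t] \<longleftrightarrow> ?r \<approx> [t]"
    using conj_move[of s ?r "[t]"] conj_adj[OF swap(3)] st r by (auto intro: eq_sym eq_trans)
  have 2: "t # ?r @ [t] \<approx> [s] \<longleftrightarrow> ?r \<approx> [s]"
    using conj_move[of t ?r "[s]"] conj_adj[OF st(3)] st r by (auto intro: eq_sym eq_trans)
  have 3: "t # (s # ?r @ [s]) @ [t] \<approx> s # (t # ?r @ [t]) @ [s]"
  proof -
    have "[t, s] \<approx> [s, t]" "[s, t] \<approx> [t, s]"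
      using word_eq.swap[of "[]" \<Gamma> "[]" t s] word_eq.swap[of "[]" \<Gamma> "[]" s t] st swap by auto
    then have "[t, s] @ ?r @ [s, t] \<approx> [s, t] @ ?r @ [t, s]" using r by (intro eq_append eq_refl)
    then show ?thesis by simp
  qed
  have "crosses ([s, t] @ w) ?r = crosses ([t, s] @ w) ?r"
    using 1 2 crosses_cong_wall[OF swap(2) 3] by auto
  then show ?case unfolding crosses_append[of u] by simp
qed auto

lemma crosses_prefix:
  "crosses w r \<Longrightarrow> w \<in> words \<Longrightarrow> r \<in> words \<Longrightarrow> \<exists>p a q. w = p @ a # q \<and> r \<approx> p @ [a] @ rev p"
proof (induction w arbitrary: r)
  case (Cons s w)
  have s: "s \<in> pverts \<Gamma>" "w \<in> words" using Cons.prems by auto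
  show ?case
  proof (cases "r \<approx> [s]")
    case True
    then show ?thesis by (intro exI[of _ "[]"]) auto
  next
    case False
    then have "crosses w (s # r @ [s])" using Cons.prems by simp
    then obtain p a q where p: "w = p @ a # q" "s # r @ [s] \<approx> p @ [a] @ rev p"
      using Cons.IH[of "s # r @ [s]"] s Cons.prems by auto
    then have "r \<approx> s # (p @ [a] @ rev p) @ [s]"
      using conj_move[of s r "p @ [a] @ rev p"] s Cons.prems by simp
    then show ?thesis using p(1) by (intro exI[of _ "s # p"]) auto
  qed
qed simp

text \<open>The deletion condition: two edges with the same wall can be deleted from the word
  leading from the one to the other without changing the element.\<close>

lemma wall_move:
  assumes "p \<in> words" "a \<in> pverts \<Gamma>" "q \<in> words" "b \<in> pverts \<Gamma>" "p @ [a] @ rev p \<approx> q @ [b] @ rev q"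
  shows "[a] @ (rev p @ q) @ [b] \<approx> rev p @ q"
proof -
  have "p @ ([a] @ rev p) \<approx> q @ [b] @ rev q \<longleftrightarrow> [a] @ rev p \<approx> rev p @ (q @ [b] @ rev q)"
    using assms eq_move_left[of "rev p" "[a] @ rev p" "q @ [b] @ rev q"] by simp
  then have "[a] @ rev p \<approx> (rev p @ q @ [b]) @ rev q" using assms by simp
  then have "(rev p @ q @ [b]) @ rev q \<approx> [a] @ rev p" by (rule eq_sym)
  then have "rev p @ q @ [b] \<approx> ([a] @ rev p) @ q"
    using eq_move_right[of q "rev p @ q @ [b]" "[a] @ rev p"] assms by simp
  then have "([a] @ rev p @ q) \<approx> (rev p @ q) @ [b]" using eq_sym by simp
  then show ?thesis using eq_move_right[of "[b]" "[a] @ rev p @ q" "rev p @ q"] assms by simp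
qed

text \<open>A reduced word crosses no wall twice.\<close>

lemma cred_walls_distinct:
  assumes "cred (p @ a # q @ b # x)" "p @ a # q @ b # x \<in> words"
  shows "\<not> p @ [a] @ rev p \<approx> (p @ a # q) @ [b] @ rev (p @ a # q)"
proof
  assume "p @ [a] @ rev p \<approx> (p @ a # q) @ [b] @ rev (p @ a # q)"
  then have "[a] @ (rev p @ p @ a # q) @ [b] \<approx> rev p @ p @ a # q"
    using assms(2) by (intro wall_move) auto
  moreover have e: "rev p @ p @ a # q \<approx> a # q"
    using eq_append[OF rev_left[of p] eq_refl[of "a # q"]] assms(2) by simp
  then have "[a] @ (rev p @ p @ a # q) @ [b] \<approx> [a] @ (a # q) @ [b]"
    using assms(2) by (intro eq_context) auto
  moreover have "[a] @ (a # q) @ [b] \<approx> q @ [b]"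
    using word_eq.square[of "[]" \<Gamma> "q @ [b]" a] assms(2) by simp
  ultimately have "a # q \<approx> q @ [b]" using e by (meson eq_sym eq_trans)
  then have "(a # q) @ rev [b] \<approx> q"
    using eq_move_right[of "[b]" "a # q" q] assms(2) by simp
  moreover have "cred (a # q @ [b])"
    using assms(1) cred_append[of p] cred_append[of "a # q @ [b]" x] by simp
  ultimately have "length (a # q @ [b]) \<le> length q" using cred_length_le[of "a # q @ [b]" q] eq_sym by fastforce
  then show False by simp
qed

text \<open>The wall of the marked edge is crossed at that edge and, the word being reduced, neither
  before nor after it. A single crossing is an odd number.\<close>

lemma cred_crosses:
  assumes "cred (p @ a # q)" "p @ a # q \<in> words"
  shows "crosses (p @ a # q) (p @ [a] @ rev p)"
proof -
  let ?r = "p @ [a] @ rev p"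
  have w: "p \<in> words" "a \<in> pverts \<Gamma>" "q \<in> words" using assms(2) by auto
  have "\<not> crosses p ?r"
  proof
    assume "crosses p ?r"
    then obtain p1 b p2 where "p = p1 @ b # p2" "?r \<approx> p1 @ [b] @ rev p1"
      using crosses_prefix[of p ?r] w by auto
    then show False using cred_walls_distinct[of p1 b p2 a q] assms eq_sym by auto
  qed
  moreover have "rev p @ ?r @ p \<approx> [a]"
    using eq_append[OF rev_left[OF w(1)] eq_append[OF eq_refl rev_left[OF w(1)]], of "[a]"] w by simp
  then have "crosses (a # q) (rev p @ ?r @ p) = crosses (a # q) [a]"
    using w by (intro crosses_cong_wall) auto
  \<comment> \<open>\<open>[a, a, a]\<close> is the conjugate of \<open>[a]\<close> by
    \<open>a\<close>, as it arises when the recursion of \<open>crosses\<close> has passed the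
    marked edge.\<close>
  moreover have "\<not> crosses q [a, a, a]"
  proof
    assume "crosses q [a, a, a]"
    then obtain q1 b q2 where q: "q = q1 @ b # q2" "[a, a, a] \<approx> q1 @ [b] @ rev q1"
      using crosses_prefix[of q "[a, a, a]"] w by auto
    have "[a] \<approx> [a] @ [a, a, a] @ [a]"
    proof -
      have "[a, a, a] @ [a, a] \<approx> [a] @ []" using conj_self[OF w(2)] square_Nil[OF w(2)] by (rule eq_append)
      then show ?thesis using eq_sym by simp
    qed
    also have "[a] @ [a, a, a] @ [a] \<approx> [a] @ (q1 @ [b] @ rev q1) @ [a]" using q(2) w by (intro eq_context) auto
    finally have "[] @ [a] @ rev [] \<approx> ([] @ a # q1) @ [b] @ rev ([] @ a # q1)" by simp
    moreover have "cred ([] @ a # q1 @ b # q2)" using assms(1) q(1) by (simp add: cred_append)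
    ultimately show False using cred_walls_distinct[of "[]" a q1 b q2] q(1) w by auto
  qed
  ultimately show ?thesis using w by (simp add: crosses_append)
qed

text \<open>The walls along a reduced word are distinct, one for each letter. A wall that is also
  crossed by a word of length at most \<open>M\<close> is the reflection
  \<open>p @ [a] @ rev p\<close> for a prefix of that word, which has at most
  \<open>2 * M + 1\<close> letters. The number of such words bounds the number of walls, hence the
  length.\<close>

lemma wall_count:
  assumes u: "u \<in> words" "cred u"
    and M: "\<And>r. r \<in> words \<Longrightarrow> crosses u r \<Longrightarrow> \<exists>m\<in>words. length m \<le> M \<and> crosses m r"
  shows "length u \<le> card {v. set v \<subseteq> pverts \<Gamma> \<and> length v \<le> 2 * M + 1}" (is "_ \<le> card ?F")
proof -
  define wall where "wall i = take i u @ [u ! i] @ rev (take i u)" for i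
  have dec: "u = take i u @ u ! i # drop (Suc i) u" if "i < length u" for i
    using that by (rule id_take_nth_drop)
  have ww: "wall i \<in> words" if "i < length u" for i
    using u(1) dec[OF that] unfolding wall_def by (metis Cons_in_lists_iff append_in_lists_conv lists.Nil rev_in)
  have "\<exists>v. v \<in> ?F \<and> wall i \<approx> v" if i: "i < length u" for i
  proof -
    have "crosses u (wall i)" using cred_crosses[of "take i u" "u ! i" "drop (Suc i) u"] dec[OF i] u by (simp add: wall_def)
    then obtain m where m: "m \<in> words" "length m \<le> M" "crosses m (wall i)" using M ww[OF i] by blast
    then obtain p a q where p: "m = p @ a # q" "wall i \<approx> p @ [a] @ rev p" using crosses_prefix ww[OF i] by blast
    have "p @ [a] @ rev p \<in> words" using eq_in[OF p(2)] by blast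
    moreover have "length (p @ [a] @ rev p) \<le> 2 * M + 1" using m(2) p(1) by simp
    ultimately show ?thesis using p(2) by (intro exI[of _ "p @ [a] @ rev p"]) (auto simp: in_lists_conv_set)
  qed
  then have "\<forall>i\<in>{..<length u}. \<exists>v. v \<in> ?F \<and> wall i \<approx> v" by simp
  from bchoice[OF this] obtain f where "\<forall>i\<in>{..<length u}. f i \<in> ?F \<and> wall i \<approx> f i" by (rule exE)
  then have f: "f i \<in> ?F" "wall i \<approx> f i" if "i < length u" for i using that by simp_all
  have neq: "\<not> wall i \<approx> wall j" if ij: "i < j" "j < length u" for i j
  proof -
    obtain q where t: "take j u = take i u @ u ! i # q"
    proof
      have "take j u = take i (take j u) @ take j u ! i # drop (Suc i) (take j u)"
        using ij by (intro id_take_nth_drop) simp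
      moreover have "take i (take j u) = take i u" "take j u ! i = u ! i" using ij by simp_all
      ultimately show "take j u = take i u @ u ! i # drop (Suc i) (take j u)" by metis
    qed
    then have "u = take i u @ u ! i # q @ u ! j # drop (Suc j) u"
      using dec[OF ij(2)] by (metis append_Cons append_assoc)
    then have "\<not> take i u @ [u ! i] @ rev (take i u) \<approx> (take i u @ u ! i # q) @ [u ! j] @ rev (take i u @ u ! i # q)"
      using u by (intro cred_walls_distinct[of _ _ _ _ "drop (Suc j) u"]) simp_all
    then show ?thesis unfolding wall_def t .
  qed
  have "inj_on f {..<length u}"
  proof (rule inj_onI)
    fix i j assume ij: "i \<in> {..<length u}" "j \<in> {..<length u}" "f i = f j"
    then have "wall i \<approx> f i" "wall j \<approx> f i" using f(2)[of i] f(2)[of j] by simp_all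
    then have "wall i \<approx> wall j" "wall j \<approx> wall i" by (blast intro: eq_sym eq_trans)+
    then show "i = j" using neq[of i j] neq[of j i] ij by (metis lessThan_iff linorder_neqE_nat)
  qed
  moreover have "finite ?F" by (intro finite_lists_length_le) simp
  moreover have "f ` {..<length u} \<subseteq> ?F" using f(1) by blast
  ultimately have "card {..<length u} \<le> card ?F" by (intro card_inj_on_le)
  then show ?thesis by simp
qed

text \<open>\<open>m\<close> leads from the identity to the median of the identity, \<open>u\<close>
  and \<open>v\<close>. Common front letters are split off one at a time; when there are none left,
  nothing cancels in \<open>rev u @ v\<close>.\<close>

lemma median:
  assumes "cred u" "cred v"
  shows "\<exists>m u' v'. u \<sim> m @ u' \<and> v \<sim> m @ v' \<and> cred (rev u' @ v')"
  using assms
proof (induction "length u" arbitrary: u v rule: less_induct)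
  case less
  show ?case
  proof (cases "\<exists>s. front s u \<and> front s v")
    case True
    then obtain s where s: "front s u" "front s v" by blast
    obtain u1 where u1: "u \<sim> s # u1" "cred u1" "length u = Suc (length u1)" using front_split[OF s(1)] less.prems by blast
    obtain v1 where v1: "v \<sim> s # v1" "cred v1" using front_split[OF s(2)] less.prems by blast
    obtain m u' v' where m: "u1 \<sim> m @ u'" "v1 \<sim> m @ v'" "cred (rev u' @ v')"
      using less.hyps[of u1 v1] u1 v1 by auto
    have "u \<sim> (s # m) @ u'" using swap_trans[OF u1(1) swap_Cons[OF m(1)]] by simp
    moreover have "v \<sim> (s # m) @ v'" using swap_trans[OF v1(1) swap_Cons[OF m(2)]] by simp
    ultimately show ?thesis using m(3) by blast
  next
    case False
    then have "cred (rev u @ v)" using less.prems by (auto simp: cred_append cred_rev)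
    then show ?thesis by (metis append_Nil swap_eq.refl)
  qed
qed

text \<open>A wall that separates the starting point from both other points, but is not crossed on
  the way to the median, would be crossed on both remaining branches and thus twice by the reduced
  word \<open>rev u @ v\<close>.\<close>

lemma median_crosses:
  assumes "m \<in> words" "u \<in> words" "v \<in> words" "cred (rev u @ v)" "r \<in> words"
    and "crosses (m @ u) r" "crosses (m @ v) r"
  shows "crosses m r"
proof (rule ccontr)
  assume n: "\<not> crosses m r"
  let ?r = "rev m @ r @ m"
  have r: "?r \<in> words" using assms by auto
  have "crosses u ?r" "crosses v ?r" using n assms(6,7) by (auto simp: crosses_append)
  then obtain p a q p' a' q' where p: "u = p @ a # q" "?r \<approx> p @ [a] @ rev p" "v = p' @ a' # q'" "?r \<approx> p' @ [a'] @ rev p'"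
    using crosses_prefix r assms(2,3) by metis
  then have "p @ [a] @ rev p \<approx> p' @ [a'] @ rev p'" by (blast intro: eq_sym eq_trans)
  then have "[a] @ (rev p @ p') @ [a'] \<approx> rev p @ p'" using p assms(2,3) by (intro wall_move) auto
  moreover have "cred ([a] @ (rev p @ p') @ [a'])"
    using assms(4) p(1,3) cred_append[of "rev q" "[a] @ rev p @ p' @ a' # q'"]
      cred_append[of "[a] @ (rev p @ p') @ [a']" q'] by simp
  ultimately have "length ([a] @ (rev p @ p') @ [a']) \<le> length (rev p @ p')"
    using cred_length_le eq_sym by blast
  then show False by simp
qed

text \<open>The intersection of all half-spaces that contain \<open>Y\<close>: if \<open>Y\<close>
  lies on one side of a wall, so does \<open>z\<close>. By \<open>crosses_prefix\<close> a word
  \<open>r\<close> that is not a reflection is crossed by no word, so it only demands that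
  \<open>Y\<close> is nonempty.\<close>

definition wall_hull :: "'v list set \<Rightarrow> 'v list set" where
  "wall_hull Y = {z \<in> words. \<forall>r\<in>words. \<exists>y\<in>Y. crosses z r = crosses y r}"

lemma wall_hull_base: "Y \<subseteq> words \<Longrightarrow> Y \<subseteq> wall_hull Y"
  by (auto simp: wall_hull_def)

lemma wall_hull_cong: "z \<in> wall_hull Y \<Longrightarrow> z \<approx> z' \<Longrightarrow> z' \<in> wall_hull Y"
  using crosses_cong[of z z'] eq_in[of z z'] by (simp add: wall_hull_def)

text \<open>Translation by \<open>g\<close> moves walls to walls: \<open>r\<close> as seen from
  \<open>g\<close> is \<open>rev g @ r @ g\<close>.\<close>

lemma wall_hull_left:
  assumes "g \<in> words" "\<And>y. y \<in> Y \<Longrightarrow> g @ y \<in> Y" "z \<in> wall_hull Y"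
  shows "g @ z \<in> wall_hull Y"
  unfolding wall_hull_def
proof (intro CollectI conjI ballI)
  show "g @ z \<in> words" using assms by (auto simp: wall_hull_def)
  fix r assume r: "r \<in> words"
  then have "rev g @ r @ g \<in> words" using assms by auto
  then obtain y where "y \<in> Y" "crosses z (rev g @ r @ g) = crosses y (rev g @ r @ g)"
    using assms(3) unfolding wall_hull_def by blast
  then show "\<exists>y\<in>Y. crosses (g @ z) r = crosses y r"
    using assms(2) by (intro bexI[of _ "g @ y"]) (auto simp: crosses_append)
qed

lemma singleton_eq: "s \<in> pverts \<Gamma> \<Longrightarrow> [s] \<approx> [t] \<longleftrightarrow> s = t"
  using cred_eq_swap[of "[s]" "[t]"] swap_set[of "[s]" "[t]"] by auto

lemma clique_crosses:
  "distinct w \<Longrightarrow> clique \<Gamma> (set w) \<Longrightarrow> r \<in> words \<Longrightarrow> crosses w r \<longleftrightarrow> (\<exists>a\<in>set w. r \<approx> [a])"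
proof (induction w arbitrary: r)
  case (Cons s w)
  have s: "s \<in> pverts \<Gamma>" "clique \<Gamma> (set w)" using Cons.prems by (auto simp: clique_def)
  have "s # r @ [s] \<approx> [a] \<longleftrightarrow> r \<approx> [a]" if a: "a \<in> set w" for a
  proof -
    have "adj s a" using Cons.prems a by (auto simp: clique_def)
    then show ?thesis using conj_move[of s r "[a]"] conj_adj[of s a] s Cons.prems(3) adj_in[of s a]
      by (auto intro: eq_sym eq_trans)
  qed
  then have "crosses w (s # r @ [s]) \<longleftrightarrow> (\<exists>a\<in>set w. r \<approx> [a])"
    using Cons.IH[of "s # r @ [s]"] Cons.prems s by auto
  moreover have "\<not> (r \<approx> [s] \<and> r \<approx> [a])" if "a \<in> set w" for a
  proof
    assume "r \<approx> [s] \<and> r \<approx> [a]"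
    then have "[s] \<approx> [a]" by (blast intro: eq_sym eq_trans)
    then show False using singleton_eq[OF s(1)] Cons.prems that by auto
  qed
  ultimately show ?case by auto
qed simp

text \<open>This keeps the hull stable under cube attachment. A wall crossed between
  \<open>z\<close> and \<open>z @ w\<close> is crossed between \<open>z\<close> and a single
  \<open>z @ [a]\<close>, so with respect to every wall \<open>z @ w\<close> lies on the side of
  \<open>z\<close> or of some \<open>z @ [a]\<close>.\<close>

lemma wall_hull_cube:
  assumes z: "z \<in> wall_hull Y" and A: "distinct w" "clique \<Gamma> (set w)" and za: "\<And>a. a \<in> set w \<Longrightarrow> z @ [a] \<in> wall_hull Y"
  shows "z @ w \<in> wall_hull Y"
  unfolding wall_hull_def
proof (intro CollectI conjI ballI)
  have w: "w \<in> words" using A by (auto simp: clique_def in_lists_conv_set)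
  have zw: "z \<in> words" using z by (simp add: wall_hull_def)
  show "z @ w \<in> words" using zw w by simp
  fix r assume r: "r \<in> words"
  let ?r = "rev z @ r @ z"
  have rw: "?r \<in> words" using r zw by simp
  show "\<exists>y\<in>Y. crosses (z @ w) r = crosses y r"
  proof (cases "\<exists>a\<in>set w. ?r \<approx> [a]")
    case True
    then obtain a where a: "a \<in> set w" "?r \<approx> [a]" by blast
    then have "crosses (z @ w) r = crosses (z @ [a]) r"
      using clique_crosses[OF A rw] by (auto simp: crosses_append)
    then show ?thesis using za[OF a(1)] r by (simp add: wall_hull_def)
  next
    case False
    then have "crosses (z @ w) r = crosses z r" using clique_crosses[OF A rw] by (auto simp: crosses_append)
    then show ?thesis using z r by (simp add: wall_hull_def)
  qed
qed

end

section \<open>The hull of finitely many cosets of a quasiconvex subgroup\<close>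

context racg_subgroup
begin

definition geodesics_near :: "nat \<Rightarrow> 'v list \<Rightarrow> 'v list \<Rightarrow> bool" where
  "geodesics_near M a b \<longleftrightarrow> a \<in> words \<and> b \<in> words \<and> (\<forall>u w. cred (u @ w) \<and> a @ u @ w \<approx> b \<longrightarrow> near M (a @ u))"

lemma geodesics_near_sym: "geodesics_near M a b \<Longrightarrow> geodesics_near M b a"
  unfolding geodesics_near_def
proof (intro conjI allI impI)
  fix u w
  assume n: "a \<in> words \<and> b \<in> words \<and> (\<forall>u w. cred (u @ w) \<and> a @ u @ w \<approx> b \<longrightarrow> near M (a @ u))"
    and uw: "cred (u @ w) \<and> b @ u @ w \<approx> a"
  have w: "u \<in> words" "w \<in> words" using uw eq_in[of "b @ u @ w" a] by auto
  have "(b @ u) @ rev (rev w) \<approx> a" using uw by simp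
  then have 1: "b @ u \<approx> a @ rev w" using eq_move_right[of "rev w" "b @ u" a] n w by simp
  then have "b @ rev (rev u) \<approx> a @ rev w" by simp
  then have "b \<approx> a @ rev w @ rev u" using eq_move_right[of "rev u" b "a @ rev w"] n w by simp
  then have "near M (a @ rev w)" using n uw cred_rev[of "u @ w"] eq_sym by (metis rev_append)
  then show "near M (b @ u)" using near_cong 1 eq_sym by blast
qed auto

text \<open>Let a geodesic from \<open>a @ [t]\<close> be given. If \<open>t\<close> does not cancel
  against it, \<open>t\<close> in front makes it a geodesic from \<open>a\<close>. If
  \<open>t\<close> cancels within \<open>u\<close>, the point reached also lies on a geodesic from
  \<open>a\<close>. If \<open>t\<close> passes through \<open>u\<close> and cancels in
  \<open>w\<close>, the point reached is one letter \<open>t\<close> away from a point on a geodesic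
  from \<open>a\<close>; this is where the constant grows.\<close>

lemma geodesics_near_step:
  assumes n: "geodesics_near M a b" and t: "t \<in> pverts \<Gamma>"
  shows "geodesics_near (Suc M) (a @ [t]) b"
  unfolding geodesics_near_def
proof (intro conjI allI impI)
  have ab: "a \<in> words" "b \<in> words" using n by (auto simp: geodesics_near_def)
  then show "a @ [t] \<in> words" "b \<in> words" using t by auto
  fix u w assume a: "cred (u @ w) \<and> (a @ [t]) @ u @ w \<approx> b"
  have w: "u \<in> words" "w \<in> words" using a eq_in[of "(a @ [t]) @ u @ w" b] by auto
  have mono: "near M x \<Longrightarrow> near (Suc M) x" for x unfolding near_def using le_SucI by blast
  have N: "near M (a @ x)" if "cred (x @ y)" "a @ x @ y \<approx> b" for x y
    using n that by (auto simp: geodesics_near_def)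
  have tt: "(a @ [t]) @ [t] @ x \<approx> a @ x" if "x \<in> words" for x
    using word_eq.square[of a \<Gamma> x t] ab t that by simp
  consider "\<not> front t (u @ w)" | "front t u" | "\<not> front t u" "commutes t u" "front t w"
    by (auto simp: front_append)
  then show "near (Suc M) ((a @ [t]) @ u)"
  proof cases
    case 1
    then have "near M (a @ (t # u))" using N[of "t # u" w] a by simp
    then show ?thesis using mono by simp
  next
    case 2
    obtain u' where u': "u \<sim> t # u'" using front_swap[OF 2] by blast
    then have "cred ((t # u') @ w)" using cred_cong[OF swap_append[OF u' swap_eq.refl[of w]]] a by simp
    then have c: "cred (u' @ w)" by simp
    have uu: "u \<approx> [t] @ u'" using swap_imp_eq[OF u' w(1)] by simp
    then have u'w: "u' \<in> words" using eq_in by fastforce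
    have e: "(a @ [t]) @ u \<approx> a @ u'"
    proof -
      have "(a @ [t]) @ u \<approx> (a @ [t]) @ ([t] @ u')" using uu ab t by (intro eq_append eq_refl) auto
      then show ?thesis using tt[OF u'w] eq_trans by blast
    qed
    have "((a @ [t]) @ u) @ w \<approx> (a @ u') @ w" using eq_append[OF e eq_refl[OF w(2)]] .
    then have "a @ u' @ w \<approx> b" using a by (auto intro: eq_sym eq_trans)
    then have "near M (a @ u')" using N c by blast
    then show ?thesis using mono near_cong e eq_sym by blast
  next
    case 3
    obtain w' where w': "w \<sim> t # w'" using front_swap[OF 3(3)] by blast
    have ww': "w \<approx> [t] @ w'" using swap_imp_eq[OF w' w(2)] by simp
    then have w'w: "w' \<in> words" using eq_in by fastforce
    have tu: "t # u \<sim> u @ [t]" using commutes_swap[OF 3(2)] .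
    have "u @ w \<sim> u @ [t] @ w'" using swap_append[OF swap_eq.refl w'] by simp
    also have "u @ [t] @ w' \<sim> t # u @ w'" using swap_append[OF swap_sym[OF tu] swap_eq.refl[of w']] by simp
    finally have s: "u @ w \<sim> t # (u @ w')" .
    then have c: "cred (u @ w')" using cred_cong[OF s] a by simp
    have "u @ w \<approx> [t] @ (u @ w')" using swap_imp_eq[OF s] w by simp
    then have "(a @ [t]) @ (u @ w) \<approx> (a @ [t]) @ ([t] @ (u @ w'))"
      using ab t eq_append[OF eq_refl[of "a @ [t]"]] by simp
    also have "(a @ [t]) @ ([t] @ (u @ w')) \<approx> a @ (u @ w')" using tt w w'w by auto
    finally have "a @ u @ w' \<approx> b" using a by (auto intro: eq_sym eq_trans)
    then have "near M (a @ u)" using N c by blast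
    then have "near (Suc M) ((a @ u) @ [t])" using near_step[of M "a @ u" t] ab w t by simp
    moreover have "a @ (t # u) \<approx> a @ (u @ [t])"
      using swap_imp_eq[OF tu] w t ab by (intro eq_append eq_refl) auto
    then have "(a @ u) @ [t] \<approx> (a @ [t]) @ u" using eq_sym by simp
    ultimately show ?thesis by (rule near_cong)
  qed
qed

lemma geodesics_near_append:
  "geodesics_near M a b \<Longrightarrow> p \<in> words \<Longrightarrow> geodesics_near (M + length p) (a @ p) b"
proof (induction p rule: rev_induct)
  case (snoc t p)
  then have "geodesics_near (Suc (M + length p)) ((a @ p) @ [t]) b" by (intro geodesics_near_step) auto
  then show ?case by simp
qed simp

lemma qconvex_geodesics_near:
  assumes M: "qconvex M" and g: "g \<in> GW" "g' \<in> GW"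
  shows "geodesics_near M g g'"
  unfolding geodesics_near_def
proof (intro conjI allI impI)
  show "g \<in> words" "g' \<in> words" using g GW_words by auto
  fix u w assume a: "cred (u @ w) \<and> g @ u @ w \<approx> g'"
  then have w: "u \<in> words" "w \<in> words" using eq_in[of "g @ u @ w" g'] by auto
  have "g @ (u @ w) \<in> GW" using eq_GW[OF g(2)] a eq_sym by blast
  then have "u @ w \<in> GW" using append_GW_iff g w by simp
  then obtain q where "q \<in> words" "length q \<le> M" "u @ q \<in> GW" using M a unfolding qconvex_def near_def by blast
  then show "near M (g @ u)" unfolding near_def using append_GW[OF g(1)] by auto
qed

text \<open>The bound is \<open>C + L\<close>: at most \<open>C\<close> walls separate a point of
  the hull from the closest point \<open>g @ p\<close> of the cosets, and the word \<open>p\<close>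
  accounts for the remaining distance to the subgroup.\<close>

lemma wall_hull_near:
  assumes M: "qconvex M" and P: "P \<subseteq> words" "[] \<in> P" "\<And>p. p \<in> P \<Longrightarrow> length p \<le> L"
  shows "\<exists>D. \<forall>z\<in>wall_hull {g @ p | g p. g \<in> GW \<and> p \<in> P}. near D z"
proof -
  let ?Y = "{g @ p | g p. g \<in> GW \<and> p \<in> P}"
  \<comment> \<open>Geodesics between two points \<open>g @ p\<close> and \<open>g' @ p'\<close> are
    near the subgroup up to this constant: each of the two displacements costs at most
    \<open>L\<close>.\<close>
  define M' where "M' = M + L + L"
  define C where "C = card {v. set v \<subseteq> pverts \<Gamma> \<and> length v \<le> 2 * M' + 1}"
  have Yw: "?Y \<subseteq> words" using GW_words P(1) by auto
  have "near (C + L) z" if z: "z \<in> wall_hull ?Y" for z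
  proof -
    have zw: "z \<in> words" using z by (simp add: wall_hull_def)
    \<comment> \<open>The least \<open>n\<close> with \<open>Q n\<close> is the distance from
      \<open>z\<close> to \<open>?Y\<close>; a word that attains it starts at the closest point
      \<open>y\<close>.\<close>
    define Q where "Q n \<longleftrightarrow> (\<exists>y u. y \<in> ?Y \<and> u \<in> words \<and> y @ u \<approx> z \<and> length u = n)" for n
    have "[] \<in> ?Y" using P(2) Nil_GW by blast
    then have "Q (length z)" unfolding Q_def using zw by (intro exI[of _ "[]"] exI[of _ z]) auto
    then have "Q (LEAST n. Q n)" by (rule LeastI)
    then obtain y u0 where y: "y \<in> ?Y" "u0 \<in> words" "y @ u0 \<approx> z" "length u0 = (LEAST n. Q n)"
      unfolding Q_def by blast
    have least: "length u0 \<le> length u" if "y' \<in> ?Y" "u \<in> words" "y' @ u \<approx> z" for y' u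
      using that y(4) Least_le[of Q "length u"] unfolding Q_def by auto
    define u where "u = nf u0"
    have yw: "y \<in> words" using y(1) Yw by blast
    have u: "u \<in> words" "cred u" using nf_in y(2) cred_nf by (auto simp: u_def)
    have "y @ u \<approx> y @ u0" unfolding u_def using yw y(2) nf_eq by (intro eq_append eq_refl) auto
    then have yu: "y @ u \<approx> z" using y(3) eq_trans by blast
    have uleast: "length u \<le> length u'" if "y' \<in> ?Y" "u' \<in> words" "y' @ u' \<approx> z" for y' u'
      using least[OF that] length_nf[of u0] by (simp add: u_def)
    obtain g p where gp: "y = g @ p" "g \<in> GW" "p \<in> P" using y(1) by blast
    have "\<exists>m\<in>words. length m \<le> M' \<and> crosses m r" if r: "r \<in> words" and cr: "crosses u r" for r
    proof -
      \<comment> \<open>The wall is \<open>r\<close> when seen from \<open>y\<close> and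
        \<open>R\<close> when seen from the identity.\<close>
      define R where "R = y @ r @ rev y"
      have R: "R \<in> words" using yw r by (simp add: R_def)
      have undo: "rev y @ R @ y \<approx> r"
        using eq_append[OF rev_left[OF yw] eq_append[OF eq_refl[OF r] rev_left[OF yw]]] by (simp add: R_def)
      have conj: "crosses (y @ x) R = (crosses y R \<noteq> crosses x r)" if "x \<in> words" for x
        using crosses_cong_wall[OF that undo] by (simp add: crosses_append)
      \<comment> \<open>The wall separates \<open>y\<close> from \<open>z\<close>. As
        \<open>z\<close> lies in the hull, some \<open>y'\<close> lies on the side of
        \<open>z\<close>, and the reduced word \<open>v\<close> from \<open>y\<close> to
        \<open>y'\<close> crosses the wall as well.\<close>
      have "crosses z R \<noteq> crosses y R" using crosses_cong[OF yu R] conj[OF u(1)] cr by simp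
      moreover have "\<exists>y'\<in>?Y. crosses z R = crosses y' R" using z R unfolding wall_hull_def by blast
      ultimately obtain y' where y': "y' \<in> ?Y" "crosses y' R \<noteq> crosses y R" by blast
      then obtain g' p' where gp': "y' = g' @ p'" "g' \<in> GW" "p' \<in> P" by blast
      have y'w: "y' \<in> words" using y' Yw by blast
      define v where "v = nf (rev y @ y')"
      have v: "v \<in> words" "cred v" using nf_in yw y'w cred_nf by (auto simp: v_def)
      have "v \<approx> rev y @ y'" unfolding v_def using nf_eq yw y'w by simp
      then have yv: "y @ v \<approx> y'" using eq_move_left[of y y' v] yw y'w v(1) eq_sym by blast
      then have cv: "crosses v r" using crosses_cong[OF yv R] conj[OF v(1)] y'(2) by auto
      obtain m u' v' where m: "u \<sim> m @ u'" "v \<sim> m @ v'" "cred (rev u' @ v')" using median[OF u(2) v(2)] by blast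
      have me: "u \<approx> m @ u'" "v \<approx> m @ v'" using swap_imp_eq m(1,2) u(1) v(1) by auto
      then have mw: "m \<in> words" "u' \<in> words" "v' \<in> words" using eq_in by fastforce+
      have "crosses m r"
        using median_crosses[OF mw m(3) r] crosses_cong[OF me(1) r] crosses_cong[OF me(2) r] cr cv by simp
      moreover have "length m \<le> M'"
      proof -
        have pw: "p \<in> words" "p' \<in> words" using gp(3) gp'(3) P(1) by auto
        have "geodesics_near (M + length p) y g'"
          using geodesics_near_append[OF qconvex_geodesics_near[OF M gp(2) gp'(2)] pw(1)] gp(1) by simp
        then have "geodesics_near (M + length p + length p') y' y"
          using geodesics_near_append[OF geodesics_near_sym pw(2)] gp'(1) by simp
        then have "geodesics_near (M + length p + length p') y y'" by (rule geodesics_near_sym)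
        moreover have "cred (m @ v')" using cred_cong[OF m(2)] v(2) by simp
        moreover have "y @ m @ v' \<approx> y'"
          using eq_append[OF eq_refl[OF yw] me(2)] yv by (blast intro: eq_sym eq_trans)
        ultimately have "near (M + length p + length p') (y @ m)" by (auto simp: geodesics_near_def)
        then obtain q where q: "q \<in> words" "length q \<le> M'" "(y @ m) @ q \<in> GW"
          using P(3)[OF gp(3)] P(3)[OF gp'(3)] unfolding near_def M'_def by fastforce
        \<comment> \<open>The median \<open>y @ m\<close> lies on a geodesic from \<open>y\<close>
          to \<open>y'\<close>, so a word \<open>q\<close> of length at most \<open>M'\<close> leads
          from it into the subgroup, hence into \<open>?Y\<close>. As \<open>y\<close> is closest to
          \<open>z\<close>, replacing it by this new point gains nothing, which bounds
          \<open>m\<close> by the length of \<open>q\<close>.\<close>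
        have "((y @ m) @ q) @ [] \<in> ?Y" using q(3) P(2) by blast
        moreover have "((y @ m) @ q) @ (rev q @ u') \<approx> z"
        proof -
          have "(y @ m) @ (q @ rev q) @ u' \<approx> (y @ m) @ [] @ u'"
            using yw mw q by (intro eq_context rev_right) auto
          also have "(y @ m) @ [] @ u' = y @ (m @ u')" by simp
          also have "y @ (m @ u') \<approx> y @ u" using eq_append[OF eq_refl[OF yw] eq_sym[OF me(1)]] .
          also note yu
          finally show ?thesis by simp
        qed
        ultimately have "length u \<le> length (rev q @ u')"
          using uleast[of "((y @ m) @ q) @ []" "rev q @ u'"] q(1) mw by simp
        moreover have "length u = length m + length u'" using swap_length[OF m(1)] by simp
        ultimately show ?thesis using q(2) by simp
      qed
      ultimately show ?thesis using mw by blast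
    qed
    then have "length u \<le> C" unfolding C_def using u by (intro wall_count)
    have pw: "p \<in> words" using gp(3) P(1) by auto
    have "z @ (rev u @ rev p) \<approx> g"
    proof -
      have zy: "z @ rev u \<approx> y" using eq_move_right[of u z y] zw u(1) yw yu eq_sym by blast
      have "(z @ rev u) @ rev p \<approx> (g @ p) @ rev p" using eq_append[OF zy eq_refl[of "rev p"]] gp(1) pw by simp
      also have "(g @ p) @ rev p \<approx> g" using eq_append[OF eq_refl rev_right[OF pw], of g] gp(2) GW_words by simp
      finally show ?thesis by simp
    qed
    then have "z @ (rev u @ rev p) \<in> GW" using eq_GW[OF gp(2)] eq_sym by blast
    moreover have "length (rev u @ rev p) \<le> C + L" using \<open>length u \<le> C\<close> P(3)[OF gp(3)] by simp
    ultimately show ?thesis unfolding near_def using u(1) pw by (intro bexI[of _ "rev u @ rev p"]) auto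
  qed
  then show ?thesis by blast
qed

end

context completion_of
begin

text \<open>If \<open>z @ q\<close> spells an element of the subgroup, then \<open>z\<close> and
  \<open>rev q\<close> lie in the same coset. The vertex is therefore reached from \<open>B\<close>
  by a word of length at most \<open>D\<close>, and a word leads to at most one vertex.\<close>

lemma near_finite_vertices:
  assumes "\<And>v. v \<in> vertices X \<Longrightarrow> \<exists>z. walk X B z v \<and> near D z"
  shows "finite (vertices X)"
proof -
  let ?F = "{w. set w \<subseteq> pverts \<Gamma> \<and> length w \<le> D}"
  have "\<exists>w\<in>?F. walk X B w v" if v: "v \<in> vertices X" for v
  proof -
    obtain z q where z: "walk X B z v" "q \<in> words" "length q \<le> D" "z @ q \<in> GW"
      using assms[OF v] by (auto simp: near_def)
    have zw: "z \<in> words" using z walk_in by blast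
    have "walk X B (nf (rev (z @ q) @ z)) v" using GW_walk[OF rev_GW[OF z(4)] z(1)] .
    moreover have "rev (z @ q) @ z \<approx> rev q"
      using eq_append[OF eq_refl rev_left[OF zw], of "rev q"] z(2) by simp
    then have "nf (rev (z @ q) @ z) \<sim> nf (rev q)" by (rule eq_imp_nf)
    then have "length (nf (rev (z @ q) @ z)) \<le> D" using swap_length length_nf[of "rev q"] z(3) by fastforce
    moreover have "nf (rev (z @ q) @ z) \<in> words" using nf_in zw z(2) by simp
    ultimately show ?thesis by (auto simp: in_lists_conv_set)
  qed
  then have "\<forall>v\<in>vertices X. \<exists>w. w \<in> ?F \<and> walk X B w v" by blast
  from bchoice[OF this] obtain f where f: "\<forall>v\<in>vertices X. f v \<in> ?F \<and> walk X B (f v) v" by (rule exE)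
  have "inj_on f (vertices X)"
  proof (rule inj_onI)
    fix u v assume "u \<in> vertices X" "v \<in> vertices X" "f u = f v"
    then have "walk X B (f u) u" "walk X B (f u) v" using f by metis+
    then show "u = v" by (rule walk_det)
  qed
  moreover have "finite ?F" by (intro finite_lists_length_le) simp
  moreover have "f ` vertices X \<subseteq> ?F" using f by blast
  ultimately show ?thesis by (meson finite_imageD finite_subset)
qed

end


section \<open>Standard completions\<close>

lemma hom_cube: "labeled_hom f X Y \<Longrightarrow> c \<in> cubes X \<Longrightarrow> f c \<in> cubes Y"
  and hom_labels: "labeled_hom f X Y \<Longrightarrow> c \<in> cubes X \<Longrightarrow> labels Y (f c) = labels X c"
  and hom_face: "labeled_hom f X Y \<Longrightarrow> c \<in> cubes X \<Longrightarrow> L \<subseteq> labels X c \<Longrightarrow> A \<subseteq> labels X c \<Longrightarrow>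
    f (face X L A c) = face Y L A (f c)"
  by (simp_all add: labeled_hom_def)

lemma hom_vertex: "labeled_hom f X Y \<Longrightarrow> v \<in> vertices X \<Longrightarrow> f v \<in> vertices Y"
  by (simp add: vertices_def hom_cube hom_labels)

lemma hom_edge:
  assumes "labeled_hom f X Y" "e \<in> edges X"
  shows "f e \<in> edges Y" "edge_start Y (f e) = f (edge_start X e)" "edge_end Y (f e) = f (edge_end X e)"
    "edge_rev Y (f e) = f (edge_rev X e)"
  using assms hom_face[OF assms(1), of e] by (auto simp: edges_def hom_cube hom_labels edge_start_def edge_end_def edge_rev_def)

lemma hom_comp: "labeled_hom f X Y \<Longrightarrow> labeled_hom g Y Z \<Longrightarrow> labeled_hom (g \<circ> f) X Z"
  by (simp add: labeled_hom_def)

lemma hom_id: "labeled_hom id X X"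
  by (simp add: labeled_hom_def)

context right_angled
begin

lemma clique_perm:
  "distinct u \<Longrightarrow> distinct w \<Longrightarrow> set u = set w \<Longrightarrow> clique \<Gamma> (set u) \<Longrightarrow> u \<sim> w"
proof (induction u arbitrary: w)
  case Nil
  then show ?case by (auto intro: swap_eq.refl)
next
  case (Cons s u)
  have "front s w"
  proof -
    have "front s x" if "s \<in> set x" "clique \<Gamma> (insert s (set x))" for x
      using that by (induction x) (auto simp: clique_def)
    then show ?thesis using Cons.prems by (metis insert_absorb list.set_intros(1))
  qed
  then have w: "w \<sim> s # remove1 s w" by (rule front_swap)
  have "u \<sim> remove1 s w"
    using Cons.prems by (intro Cons.IH) (auto simp: clique_def)
  then have "s # u \<sim> s # remove1 s w" by (rule swap_Cons)
  then show ?case using w swap_sym swap_trans by blast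
qed

end

context racg_subgroup
begin

text \<open>
  A coloring is a label-preserving map from the 1-skeleton to the Schreier graph of \<open>G\<close>, whose vertices
  are the right cosets of \<open>G\<close>, given here by sets of words.
\<close>

definition coset :: "'v list \<Rightarrow> 'v list set" where
  "coset w = {u \<in> words. u @ rev w \<in> GW}"

definition coloring :: "('v, 'c) labeled_complex \<Rightarrow> ('c \<Rightarrow> 'v list set) \<Rightarrow> bool" where
  "coloring X \<phi> \<longleftrightarrow> (\<forall>x\<in>vertices X. \<phi> x \<in> coset ` words) \<and>
     (\<forall>e\<in>edges X. \<forall>w\<in>words. \<phi> (edge_start X e) = coset w \<longrightarrow> \<phi> (edge_end X e) = coset (w @ [edge_label X e]))"

lemma coset_eq_iff:
  assumes "u \<in> words" "w \<in> words"
  shows "coset u = coset w \<longleftrightarrow> u @ rev w \<in> GW"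
proof
  assume "coset u = coset w"
  moreover have "u \<in> coset u" using assms eq_GW[OF Nil_GW] rev_right[of u] eq_sym by (auto simp: coset_def)
  ultimately show "u @ rev w \<in> GW" by (simp add: coset_def)
next
  have *: "coset u \<subseteq> coset w" if "u @ rev w \<in> GW" "u \<in> words" "w \<in> words" for u w
  proof
    fix x assume "x \<in> coset u"
    then have x: "x \<in> words" "x @ rev u \<in> GW" by (auto simp: coset_def)
    have "x @ (rev u @ u) @ rev w \<approx> x @ [] @ rev w" using x that by (intro eq_context rev_left) auto
    moreover have "(x @ rev u) @ (u @ rev w) \<in> GW" using x(2) that(1) by (rule append_GW)
    ultimately have "x @ rev w \<in> GW" using eq_GW by fastforce
    then show "x \<in> coset w" using x by (simp add: coset_def)
  qed
  assume "u @ rev w \<in> GW"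
  moreover from rev_GW[OF this] have "w @ rev u \<in> GW" by simp
  ultimately show "coset u = coset w" using *[of u w] *[of w u] assms by blast
qed

lemma coset_append:
  assumes "u \<in> words" "w \<in> words" "x \<in> words" "coset u = coset w"
  shows "coset (u @ x) = coset (w @ x)"
proof -
  have "u @ (x @ rev x) @ rev w \<approx> u @ [] @ rev w" using assms by (intro eq_context rev_right) auto
  moreover have "u @ rev w \<in> GW" using assms coset_eq_iff by blast
  ultimately have "u @ (x @ rev x) @ rev w \<in> GW" using eq_GW eq_sym by fastforce
  then show ?thesis using coset_eq_iff[of "u @ x" "w @ x"] assms by simp
qed

lemma coset_cong: "u \<approx> w \<Longrightarrow> coset u = coset w"
proof -
  assume e: "u \<approx> w"
  then have w: "u \<in> words" "w \<in> words" using eq_in by auto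
  have "u @ rev w \<approx> w @ rev w" using eq_append[OF e eq_refl] w by simp
  then have "u @ rev w \<in> GW" using eq_GW[OF Nil_GW] rev_right[OF w(2)] by (meson eq_sym eq_trans)
  then show ?thesis using coset_eq_iff w by blast
qed

lemma coloring_edge:
  "coloring X \<phi> \<Longrightarrow> e \<in> edges X \<Longrightarrow> w \<in> words \<Longrightarrow> \<phi> (edge_start X e) = coset w \<Longrightarrow>
    \<phi> (edge_end X e) = coset (w @ [edge_label X e])"
  by (simp add: coloring_def)

text \<open>The purpose of colorings: a loop at a vertex of color \<open>coset []\<close> has a
  label that fixes this coset, so it spells an element of the subgroup.\<close>

lemma coloring_walk:
  assumes "lcc \<Gamma> X" "coloring X \<phi>"
  shows "walk X x u y \<Longrightarrow> w \<in> words \<Longrightarrow> \<phi> x = coset w \<Longrightarrow> \<phi> y = coset (w @ u)"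
proof (induction u arbitrary: x w)
  case (Cons s u)
  interpret lcc \<Gamma> X by fact
  obtain z where z: "edge_step X x s z" "walk X z u y" using Cons.prems by auto
  obtain e where e: "e \<in> edges X" "labels X e = {s}" "edge_start X e = x" "edge_end X e = z"
    using z(1) by (auto simp: edge_step_def)
  have "edge_label X e = s" using e(2) by (simp add: edge_label_def)
  then have "\<phi> z = coset (w @ [s])" using coloring_edge[OF assms(2) e(1) Cons.prems(2)] e Cons.prems by simp
  moreover have "w @ [s] \<in> words" using Cons.prems edge_step_in[OF z(1)] by simp
  ultimately show ?case using Cons.IH[OF z(2), of "w @ [s]"] by simp
qed simp

text \<open>Treats folds and identifications together: a coloring descends along a surjection that
  identifies only vertices of equal color, since each edge of the image has a preimage with the same
  label.\<close>

lemma coloring_image: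
  assumes "lcc \<Gamma> X" and hom: "labeled_hom f X Y" and onto: "f ` cubes X = cubes Y" and col: "coloring X \<phi>"
    and inj: "\<And>x y. x \<in> vertices X \<Longrightarrow> y \<in> vertices X \<Longrightarrow> f x = f y \<Longrightarrow> \<phi> x = \<phi> y"
  shows "\<exists>\<phi>'. coloring Y \<phi>' \<and> (\<forall>x\<in>vertices X. \<phi>' (f x) = \<phi> x)"
proof -
  interpret lcc \<Gamma> X by fact
  define \<phi>' where "\<phi>' y = \<phi> (SOME x. x \<in> vertices X \<and> f x = y)" for y
  have 1: "\<phi>' (f x) = \<phi> x" if x: "x \<in> vertices X" for x
  proof -
    have "(SOME x'. x' \<in> vertices X \<and> f x' = f x) \<in> vertices X \<and> f (SOME x'. x' \<in> vertices X \<and> f x' = f x) = f x"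
      by (rule someI[of _ x]) (use x in simp)
    then show ?thesis unfolding \<phi>'_def using inj x by blast
  qed
  have pre: "\<exists>x\<in>cubes X. f x = y \<and> labels X x = labels Y y" if "y \<in> cubes Y" for y
    using that onto hom_labels[OF hom] by (metis imageE)
  have "coloring Y \<phi>'"
    unfolding coloring_def
  proof (intro conjI ballI impI)
    fix y assume "y \<in> vertices Y"
    then obtain x where "x \<in> vertices X" "f x = y" using pre by (fastforce simp: vertices_def)
    then show "\<phi>' y \<in> coset ` words" using 1 col by (auto simp: coloring_def)
  next
    fix e' w assume e': "e' \<in> edges Y" and w: "w \<in> words" and eq: "\<phi>' (edge_start Y e') = coset w"
    obtain e where e: "e \<in> edges X" "f e = e'" "labels X e = labels Y e'" using e' pre by (fastforce simp: edges_def)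
    have "\<phi> (edge_start X e) = coset w"
      using eq 1[OF edge_rev_props(6)[OF e(1)]] hom_edge(2)[OF hom e(1)] e(2) by simp
    then have "\<phi> (edge_end X e) = coset (w @ [edge_label X e])" using coloring_edge[OF col e(1) w] by blast
    then show "\<phi>' (edge_end Y e') = coset (w @ [edge_label Y e'])"
      using 1[OF edge_rev_props(7)[OF e(1)]] hom_edge(3)[OF hom e(1)] e(2,3) by (simp add: edge_label_def)
  qed
  with 1 show ?thesis by blast
qed

text \<open>The corner \<open>A\<close> of the new cube receives the color of \<open>v\<close>
  multiplied by the letters of \<open>A\<close>. These letters commute, so their order does not
  matter, and on the glued edges the old colors result.\<close>

lemma coloring_attachment:
  assumes X: "lcc \<Gamma> X" and Y: "lcc \<Gamma> Y" and att: "cube_attachment \<Gamma> f X Y" and col: "coloring X \<phi>"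
  shows "\<exists>\<phi>'. coloring Y \<phi>' \<and> (\<forall>x\<in>vertices X. \<phi>' (f x) = \<phi> x)"
proof -
  interpret X: lcc \<Gamma> X by fact
  interpret Y: lcc \<Gamma> Y by fact
  from att[unfolded cube_attachment_def Let_def] obtain v K e c where hom: "labeled_hom f X Y" and inj: "inj_on f (cubes X)"
    and v: "v \<in> vertices X" and c: "c \<in> cubes Y" and K: "clique \<Gamma> K" "2 \<le> card K"
    and e: "\<forall>s\<in>K. e s \<in> edges X \<and> labels X (e s) = {s} \<and> edge_start X (e s) = v"
    and cK: "labels Y c = K" and ce: "\<forall>s\<in>K. face Y {s} {} c = f (e s)"
    and N: "inj_on (\<lambda>(L, A). face Y L A c) {(L, A). L \<subseteq> K \<and> A \<subseteq> K \<and> \<not> (\<exists>s\<in>K. L \<union> A \<subseteq> {s})}"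
      "(\<lambda>(L, A). face Y L A c) ` {(L, A). L \<subseteq> K \<and> A \<subseteq> K \<and> \<not> (\<exists>s\<in>K. L \<union> A \<subseteq> {s})} \<inter> f ` cubes X = {}"
      "cubes Y = f ` cubes X \<union> (\<lambda>(L, A). face Y L A c) ` {(L, A). L \<subseteq> K \<and> A \<subseteq> K \<and> \<not> (\<exists>s\<in>K. L \<union> A \<subseteq> {s})}"
    by (elim conjE bexE exE) (rule that; assumption)
  let ?N = "{(L, A). L \<subseteq> K \<and> A \<subseteq> K \<and> \<not> (\<exists>s\<in>K. L \<union> A \<subseteq> {s})}"
  obtain w0 where w0: "w0 \<in> words" "\<phi> v = coset w0" using col v by (auto simp: coloring_def)
  \<comment> \<open>An arbitrary enumeration of \<open>A\<close>; by \<open>l_eq\<close> all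
    enumerations spell the same element.\<close>
  define l where "l A = (SOME w. distinct w \<and> set w = A)" for A :: "'v set"
  have finK: "finite K" using K(2) by (metis card.infinite not_numeral_le_zero)
  have l: "distinct (l A) \<and> set (l A) = A" if "A \<subseteq> K" for A
    unfolding l_def by (rule someI_ex) (use finite_distinct_list[OF finite_subset[OF that finK]] in blast)
  have lw: "l A \<in> words" if "A \<subseteq> K" for A
    using l[OF that] that K(1) by (auto simp: in_lists_conv_set clique_def)
  have l_eq: "u \<approx> w" if "distinct u" "distinct w" "set u = set w" "set u \<subseteq> K" for u w
  proof -
    have "clique \<Gamma> (set u)" using K(1) that(4) unfolding clique_def by blast
    moreover from this have "u \<in> words" by (auto simp: in_lists_conv_set clique_def)
    ultimately show ?thesis using clique_perm swap_imp_eq that by blast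
  qed
  \<comment> \<open>Flipping the coordinate \<open>s\<close> is right multiplication by
    \<open>s\<close> in both directions: a letter already present is cancelled.\<close>
  have l_step: "l (sym_diff A {s}) \<approx> l A @ [s]" if A: "A \<subseteq> K" and s: "s \<in> K" for A s
  proof (cases "s \<in> A")
    case False
    have A': "insert s A \<subseteq> K" using A s by simp
    have "sym_diff A {s} = insert s A" using False by auto
    moreover have "l (insert s A) \<approx> l A @ [s]" using l[OF A'] l[OF A] False A' by (intro l_eq) auto
    ultimately show ?thesis by simp
  next
    case True
    have A': "A - {s} \<subseteq> K" using A by auto
    have sv: "s \<in> pverts \<Gamma>" using s K(1) by (auto simp: clique_def)
    have "l A \<approx> l (A - {s}) @ [s]" using l[OF A'] l[OF A] True A by (intro l_eq) auto
    then have "l A @ [s] \<approx> (l (A - {s}) @ [s]) @ [s]" using sv by (intro eq_append eq_refl) auto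
    also have "(l (A - {s}) @ [s]) @ [s] \<approx> l (A - {s})" using word_eq.square[of "l (A - {s})" \<Gamma> "[]" s] lw[OF A'] sv by simp
    finally have "l A @ [s] \<approx> l (A - {s})" .
    moreover have "sym_diff A {s} = A - {s}" using True by auto
    ultimately show ?thesis using eq_sym by simp
  qed
  \<comment> \<open>Old cells keep their color. A new corner is recognized by its coordinates, which
    are unique because the new faces are pairwise distinct.\<close>
  define \<phi>' where "\<phi>' y = (if y \<in> f ` cubes X then \<phi> (inv_into (cubes X) f y)
    else coset (w0 @ l (SOME A. ({}, A) \<in> ?N \<and> y = face Y {} A c)))" for y
  have old: "\<phi>' (f x) = \<phi> x" if "x \<in> vertices X" for x
    using that inj by (simp add: \<phi>'_def vertices_def inv_into_f_f)
  obtain s0 where s0: "s0 \<in> K" using K(2) by fastforce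
  \<comment> \<open>The formula covers the glued corners as well, so edges of the cube need no
    distinction between old and new ends.\<close>
  have corner: "\<phi>' (face Y {} A c) = coset (w0 @ l A)" if A: "A \<subseteq> K" for A
  proof (cases "({}, A) \<in> ?N")
    case True
    have "face Y {} A c \<in> (\<lambda>(L, A). face Y L A c) ` ?N"
      using True by (intro image_eqI[of _ _ "({}, A)"]) simp_all
    then have "face Y {} A c \<notin> f ` cubes X" using N(2) by blast
    moreover have "(SOME A'. ({}, A') \<in> ?N \<and> face Y {} A c = face Y {} A' c) = A"
    proof (rule some_equality)
      fix A' assume a: "({}, A') \<in> ?N \<and> face Y {} A c = face Y {} A' c"
      then have "({}, A') = ({}, A)" using inj_onD[OF N(1), of "({}, A')" "({}, A)"] True by auto
      then show "A' = A" by simp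
    qed (use True in auto)
    ultimately show ?thesis by (simp add: \<phi>'_def)
  next
    case False
    then obtain s where s: "s \<in> K" "A \<subseteq> {s}" using A by auto
    have es: "e s \<in> edges X" "labels X (e s) = {s}" "edge_start X (e s) = v" using e s by auto
    have fe: "edge_start Y (f (e s)) = f v" "edge_end Y (f (e s)) = f (edge_end X (e s))"
      using hom_edge[OF hom es(1)] es(3) by auto
    show ?thesis
    proof (cases "A = {}")
      case True
      have "face Y {} {} c = f v" using fe(1) Y.cube_edge(3)[OF c, of "{}" s] cK s ce by simp
      moreover have "l {} = []" using l[of "{}"] by auto
      ultimately show ?thesis using True old[OF v] w0 by simp
    next
      case False
      then have A: "A = {s}" using s by auto
      have "face Y {} {s} c = f (edge_end X (e s))" using fe(2) Y.cube_edge(4)[OF c, of "{}" s] cK s ce by simp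
      moreover have "\<phi> (edge_end X (e s)) = coset (w0 @ [s])"
        using coloring_edge[OF col es(1) w0(1)] es w0 by (simp add: edge_label_def)
      moreover have "l {s} = [s]"
        using l[of "{s}"] s by (metis card.empty card_insert_disjoint distinct_card empty_iff empty_subsetI finite.emptyI insert_subset
          length_0_conv length_Suc_conv list.set_intros(1) singletonD)
      ultimately show ?thesis using A old[OF X.edge_rev_props(7)[OF es(1)]] by simp
    qed
  qed
  have "coloring Y \<phi>'"
    unfolding coloring_def
  proof (intro conjI ballI impI)
    fix y assume y: "y \<in> vertices Y"
    then have "y \<in> f ` cubes X \<or> y \<in> (\<lambda>(L, A). face Y L A c) ` ?N" using N(3) by (auto simp: vertices_def)
    then show "\<phi>' y \<in> coset ` words"
    proof
      assume "y \<in> f ` cubes X"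
      then obtain x where x: "x \<in> cubes X" "y = f x" by blast
      then have "x \<in> vertices X" using y hom_labels[OF hom x(1)] by (simp add: vertices_def)
      then show ?thesis using old x(2) col by (auto simp: coloring_def)
    next
      assume "y \<in> (\<lambda>(L, A). face Y L A c) ` ?N"
      then obtain L A where LA: "L \<subseteq> K" "A \<subseteq> K" "y = face Y L A c" by clarsimp
      then have "L = {}" using y Y.face_labels[OF c] cK by (simp add: vertices_def)
      then show ?thesis using corner LA lw[of A] w0(1) by auto
    qed
  next
    fix e' w assume e': "e' \<in> edges Y" and w: "w \<in> words" and eq: "\<phi>' (edge_start Y e') = coset w"
    then have "e' \<in> f ` cubes X \<or> e' \<in> (\<lambda>(L, A). face Y L A c) ` ?N" using N(3) by (auto simp: edges_def)
    then show "\<phi>' (edge_end Y e') = coset (w @ [edge_label Y e'])"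
    proof
      assume "e' \<in> f ` cubes X"
      then obtain x where x: "x \<in> cubes X" "e' = f x" by blast
      then have xe: "x \<in> edges X" using e' hom_labels[OF hom x(1)] by (simp add: edges_def)
      have "\<phi> (edge_start X x) = coset w"
        using eq x(2) hom_edge(2)[OF hom xe] old[OF X.edge_rev_props(6)[OF xe]] by simp
      then have "\<phi> (edge_end X x) = coset (w @ [edge_label X x])" using coloring_edge[OF col xe w] by blast
      then show ?thesis
        using x hom_edge(3)[OF hom xe] old[OF X.edge_rev_props(7)[OF xe]] hom_labels[OF hom x(1)]
        by (simp add: edge_label_def)
    next
      assume "e' \<in> (\<lambda>(L, A). face Y L A c) ` ?N"
      then obtain L A where LA: "L \<subseteq> K" "A \<subseteq> K" "e' = face Y L A c" by clarsimp
      obtain s where "labels Y e' = {s}" using e' by (auto simp: edges_def)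
      then have L: "L = {s}" using LA Y.face_labels[OF c] cK by simp
      then have s: "s \<in> K" using LA by simp
      have sv: "s \<in> pverts \<Gamma>" using s K(1) by (auto simp: clique_def)
      have es: "e' = face Y {s} A c" using LA L by simp
      note ed = Y.cube_edge[OF c, of A s, unfolded cK, OF LA(2) s, folded es]
      have "coset (w0 @ l A) = coset w" using eq corner LA(2) ed(3) by simp
      then have "coset ((w0 @ l A) @ [s]) = coset (w @ [s])"
        using w0 lw[OF LA(2)] w sv by (intro coset_append) auto
      moreover have "coset (w0 @ l (sym_diff A {s})) = coset ((w0 @ l A) @ [s])"
        using eq_append[OF eq_refl[OF w0(1)] l_step[OF LA(2) s]] by (intro coset_cong) simp
      moreover have "sym_diff A {s} \<subseteq> K" using LA(2) s by auto
      then have "\<phi>' (edge_end Y e') = coset (w0 @ l (sym_diff A {s}))" using corner ed(4) by simp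
      moreover have "edge_label Y e' = s" using ed(2) by (simp add: edge_label_def)
      ultimately show ?thesis by simp
    qed
  qed
  with old show ?thesis by blast
qed

text \<open>The ends identified by a fold have the same color because start and label agree. A cube
  identification identifies only cells with at least two labels, so no distinct vertices.\<close>

lemma coloring_operation:
  assumes X: "lcc \<Gamma> X" and Y: "lcc \<Gamma> Y" and op: "operation \<Gamma> f X Y" and col: "coloring X \<phi>"
  shows "\<exists>\<phi>'. coloring Y \<phi>' \<and> (\<forall>x\<in>vertices X. \<phi>' (f x) = \<phi> x)"
proof -
  interpret lcc \<Gamma> X by fact
  consider "fold_operation f X Y" | "cube_identification f X Y" | "cube_attachment \<Gamma> f X Y"
    using op by (auto simp: operation_def)
  then show ?thesis
  proof cases
    case 1
    from this[unfolded fold_operation_def] obtain e1 e2 where hom: "labeled_hom f X Y" "f ` cubes X = cubes Y"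
      and e: "e1 \<in> edges X" "e2 \<in> edges X" "labels X e1 = labels X e2" "edge_start X e1 = edge_start X e2"
      and id: "\<forall>x\<in>cubes X. \<forall>y\<in>cubes X. f x = f y \<longleftrightarrow>
           x = y \<or> {x, y} = {e1, e2} \<or> {x, y} = {edge_rev X e1, edge_rev X e2} \<or>
           {x, y} = {edge_end X e1, edge_end X e2}"
      by (elim conjE bexE exE) (rule that; assumption)
    obtain w where w: "w \<in> words" "\<phi> (edge_start X e1) = coset w"
      using col edge_rev_props(6)[OF e(1)] by (auto simp: coloring_def)
    have ends: "\<phi> (edge_end X e1) = \<phi> (edge_end X e2)"
      using coloring_edge[OF col e(1) w] coloring_edge[OF col e(2) w(1)] w e(3,4) by (simp add: edge_label_def)
    have "\<phi> x = \<phi> y" if xy: "x \<in> vertices X" "y \<in> vertices X" "f x = f y" for x y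
    proof -
      have "x = y \<or> {x, y} = {e1, e2} \<or> {x, y} = {edge_rev X e1, edge_rev X e2} \<or>
           {x, y} = {edge_end X e1, edge_end X e2}" using xy id by (simp add: vertices_def)
      moreover have "x \<notin> edges X" using vertex_not_edge xy by blast
      then have "x \<noteq> e1" "x \<noteq> e2" "x \<noteq> edge_rev X e1" "x \<noteq> edge_rev X e2"
        using e(1,2) edge_rev_props(1) by blast+
      ultimately show ?thesis using ends by (auto simp: doubleton_eq_iff)
    qed
    then show ?thesis using coloring_image[OF X hom col] by blast
  next
    case 2
    from this[unfolded cube_identification_def] obtain P K where hom: "labeled_hom f X Y" "f ` cubes X = cubes Y" and P: "P \<subseteq> cubes X" "2 \<le> card K" "\<forall>p\<in>P. labels X p = K"
      and id: "\<forall>x\<in>cubes X. \<forall>y\<in>cubes X. f x = f y \<longleftrightarrow>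
           x = y \<or> (\<exists>p\<in>P. \<exists>q\<in>P. \<exists>A\<subseteq>K. x = face X K A p \<and> y = face X K A q)"
      by (elim conjE bexE exE) (rule that; assumption)
    have "\<phi> x = \<phi> y" if xy: "x \<in> vertices X" "y \<in> vertices X" "f x = f y" for x y
    proof -
      have "x = y \<or> (\<exists>p\<in>P. \<exists>q\<in>P. \<exists>A\<subseteq>K. x = face X K A p \<and> y = face X K A q)"
        using xy id by (simp add: vertices_def)
      moreover have "x \<noteq> face X K A p" if "p \<in> P" "A \<subseteq> K" for A p
      proof
        assume "x = face X K A p"
        moreover have "p \<in> cubes X" "labels X p = K" using P(1,3) that by auto
        ultimately have "labels X x = K" using face_labels[of p K A] that by simp
        then show False using xy(1) P(2) by (simp add: vertices_def)
      qed
      ultimately show ?thesis by blast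
    qed
    then show ?thesis using coloring_image[OF X hom col] by blast
  next
    case 3
    then show ?thesis using coloring_attachment[OF X Y _ col] by blast
  qed
qed

end

section \<open>Sequences of operations and their limits\<close>

locale operation_limit = right_angled \<Gamma> for \<Gamma> :: "'v pair_pre_digraph" +
  fixes Xs :: "nat \<Rightarrow> ('v, 'c) labeled_complex" and f :: "nat \<Rightarrow> 'c \<Rightarrow> 'c"
    and L :: "('v, 'c) labeled_complex" and g :: "nat \<Rightarrow> 'c \<Rightarrow> 'c"
  assumes seq: "operation_sequence \<Gamma> Xs f" and lim: "direct_limit Xs f L g"
begin

lemma lcc_stage: "lcc \<Gamma> (Xs n)"
  using seq by unfold_locales (auto simp: operation_sequence_def)

lemma stage: "operation \<Gamma> (f n) (Xs n) (Xs (Suc n)) \<or> Xs (Suc n) = Xs n \<and> f n = id"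
  using seq by (simp add: operation_sequence_def)

lemma stage_hom: "labeled_hom (f n) (Xs n) (Xs (Suc n))"
  using stage[of n] hom_id
  by (auto simp: operation_def fold_operation_def cube_identification_def cube_attachment_def)

lemma composite_hom: "labeled_hom (composite f n k) (Xs n) (Xs (n + k))"
proof (induction k)
  case (Suc k)
  show ?case using hom_comp[OF Suc stage_hom[of "n + k"]] by (simp only: composite.simps add_Suc_right)
qed (use hom_id in \<open>simp only: composite.simps add_0_right\<close>)

lemma limit_hom: "labeled_hom (g n) (Xs n) L"
  using lim by (simp add: direct_limit_def)

lemma limit_step: "x \<in> cubes (Xs n) \<Longrightarrow> g (Suc n) (f n x) = g n x"
  using lim by (simp add: direct_limit_def)

lemma limit_composite: "x \<in> cubes (Xs n) \<Longrightarrow> g (n + k) (composite f n k x) = g n x"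
proof (induction k)
  case (Suc k)
  then show ?case using limit_step[OF hom_cube[OF composite_hom, of x n k]] by simp
qed simp

lemma limit_onto: "c \<in> cubes L \<Longrightarrow> \<exists>n. \<exists>x\<in>cubes (Xs n). c = g n x \<and> labels (Xs n) x = labels L c"
proof -
  assume "c \<in> cubes L"
  then obtain n x where "x \<in> cubes (Xs n)" "c = g n x" using lim by (auto simp: direct_limit_def)
  then show ?thesis using hom_labels[OF limit_hom] by metis
qed

lemma limit_eq: "x \<in> cubes (Xs n) \<Longrightarrow> y \<in> cubes (Xs n) \<Longrightarrow> g n x = g n y \<Longrightarrow> \<exists>k. composite f n k x = composite f n k y"
  using lim by (simp add: direct_limit_def)

text \<open>Folds and identifications create no vertices. An attachment adds corners of a cube whose
  corner 0 and its neighbours are old. The property is stated for the images in the limit, where it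
  is not affected by later steps.\<close>

lemma limit_vertex_induct:
  assumes base: "\<And>x. x \<in> vertices (Xs 0) \<Longrightarrow> P (g 0 x)"
    and cube: "\<And>c A. c \<in> cubes L \<Longrightarrow> P (face L {} {} c) \<Longrightarrow> (\<And>s. s \<in> labels L c \<Longrightarrow> P (face L {} {s} c)) \<Longrightarrow>
      A \<subseteq> labels L c \<Longrightarrow> P (face L {} A c)"
    and v: "v \<in> vertices L"
  shows "P v"
proof -
  have "\<forall>x\<in>vertices (Xs n). P (g n x)" for n
  proof (induction n)
    case 0
    then show ?case using base by blast
  next
    case (Suc n)
    have onto: "\<forall>x\<in>vertices (Xs (Suc n)). P (g (Suc n) x)" if "f n ` cubes (Xs n) = cubes (Xs (Suc n))"
    proof
      fix x assume x: "x \<in> vertices (Xs (Suc n))"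
      then have "x \<in> f n ` cubes (Xs n)" using that by (simp add: vertices_def)
      then obtain y where y: "y \<in> cubes (Xs n)" "x = f n y" by blast
      then have "y \<in> vertices (Xs n)" using x hom_labels[OF stage_hom y(1)] by (simp add: vertices_def)
      then show "P (g (Suc n) x)" using Suc y limit_step by simp
    qed
    consider "fold_operation (f n) (Xs n) (Xs (Suc n))" | "cube_identification (f n) (Xs n) (Xs (Suc n))"
      | "cube_attachment \<Gamma> (f n) (Xs n) (Xs (Suc n))" | "Xs (Suc n) = Xs n \<and> f n = id"
      using stage[of n] by (auto simp: operation_def)
    then show ?case
    proof cases
      case 1
      then show ?thesis using onto by (simp add: fold_operation_def)
    next
      case 2
      then show ?thesis using onto by (simp add: cube_identification_def)
    next
      case 4
      then show ?thesis using onto by simp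
    next
      case 3
      let ?X = "Xs n" and ?Y = "Xs (Suc n)" and ?g = "g (Suc n)"
      interpret Y: lcc \<Gamma> ?Y by (rule lcc_stage)
      from 3[unfolded cube_attachment_def Let_def] obtain v K e c where v: "v \<in> vertices ?X" and c: "c \<in> cubes ?Y" and K: "2 \<le> card K"
        and e: "\<forall>s\<in>K. e s \<in> edges ?X \<and> labels ?X (e s) = {s} \<and> edge_start ?X (e s) = v"
        and cK: "labels ?Y c = K" and ce: "\<forall>s\<in>K. face ?Y {s} {} c = f n (e s)"
        and N: "cubes ?Y = f n ` cubes ?X \<union> (\<lambda>(L, A). face ?Y L A c) ` {(L, A). L \<subseteq> K \<and> A \<subseteq> K \<and> \<not> (\<exists>s\<in>K. L \<union> A \<subseteq> {s})}"
        by (elim conjE bexE exE) (rule that; assumption)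
      have old: "P (?g (f n x))" if "x \<in> vertices ?X" for x
        using that Suc limit_step by (simp add: vertices_def)
      have gf: "face L {} A (?g c) = ?g (face ?Y {} A c)" if "A \<subseteq> K" for A
        using hom_face[OF limit_hom c] that cK by simp
      have ends: "face ?Y {} {} c = f n v" "face ?Y {} {s} c = f n (edge_end ?X (e s))" "edge_end ?X (e s) \<in> vertices ?X"
        if s: "s \<in> K" for s
      proof -
        have es: "e s \<in> edges ?X" "edge_start ?X (e s) = v" "face ?Y {s} {} c = f n (e s)" using e s ce by auto
        show "face ?Y {} {} c = f n v" "face ?Y {} {s} c = f n (edge_end ?X (e s))"
          using Y.cube_edge(3,4)[OF c, of "{}" s] s cK es hom_edge(2,3)[OF stage_hom es(1)] by simp_all
        show "edge_end ?X (e s) \<in> vertices ?X" using lcc.edge_rev_props(7)[OF lcc_stage es(1)] .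
      qed
      obtain s0 where s0: "s0 \<in> K" using K by fastforce
      have gc: "?g c \<in> cubes L" "labels L (?g c) = K" using hom_cube[OF limit_hom c] hom_labels[OF limit_hom c] cK by auto
      have corner: "P (face L {} A (?g c))" if "A \<subseteq> K" for A
      proof (rule cube[OF gc(1)])
        show "P (face L {} {} (?g c))" using gf[of "{}"] ends(1)[OF s0] old[OF v] by simp
        show "P (face L {} {s} (?g c))" if "s \<in> labels L (?g c)" for s
          using gf[of "{s}"] ends(2,3)[of s] old that gc(2) by simp
        show "A \<subseteq> labels L (?g c)" using that gc(2) by simp
      qed
      show ?thesis
      proof
        fix x assume x: "x \<in> vertices ?Y"
        then have "x \<in> f n ` cubes ?X \<or> x \<in> (\<lambda>(L, A). face ?Y L A c) ` {(L, A). L \<subseteq> K \<and> A \<subseteq> K \<and> \<not> (\<exists>s\<in>K. L \<union> A \<subseteq> {s})}"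
          using N by (auto simp: vertices_def)
        then show "P (?g x)"
        proof
          assume "x \<in> f n ` cubes ?X"
          then obtain y where y: "y \<in> cubes ?X" "x = f n y" by blast
          then have "y \<in> vertices ?X" using x hom_labels[OF stage_hom y(1)] by (simp add: vertices_def)
          then show ?thesis using old y(2) by simp
        next
          assume "x \<in> (\<lambda>(L, A). face ?Y L A c) ` {(L, A). L \<subseteq> K \<and> A \<subseteq> K \<and> \<not> (\<exists>s\<in>K. L \<union> A \<subseteq> {s})}"
          then obtain L' A where LA: "L' \<subseteq> K" "A \<subseteq> K" "x = face ?Y L' A c" by clarsimp
          then have "L' = {}" using x Y.face_labels[OF c] cK by (simp add: vertices_def)
          then show ?thesis using corner[OF LA(2)] gf[OF LA(2)] LA(3) by simp
        qed
      qed
    qed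
  qed
  moreover have "v \<in> cubes L" using v by (simp add: vertices_def)
  then obtain n x where x: "x \<in> cubes (Xs n)" "v = g n x" "labels (Xs n) x = labels L v"
    using limit_onto by blast
  ultimately show ?thesis using v by (auto simp: vertices_def)
qed

end

locale operation_limit_subgroup = operation_limit \<Gamma> Xs f L g + racg_subgroup \<Gamma> G
  for \<Gamma> :: "'v pair_pre_digraph" and Xs :: "nat \<Rightarrow> ('v, 'c) labeled_complex" and f L g G
begin

text \<open>Colorings of the stages are chosen one after the other, each extending the previous one
  along the map of the operation; such a compatible family defines a coloring of the limit.\<close>

lemma limit_coloring:
  assumes col: "coloring (Xs 0) \<phi>0"
  shows "\<exists>\<psi>. coloring L \<psi> \<and> (\<forall>x\<in>vertices (Xs 0). \<psi> (g 0 x) = \<phi>0 x)"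
proof -
  have step: "\<exists>\<phi>'. coloring (Xs (Suc n)) \<phi>' \<and> (\<forall>x\<in>vertices (Xs n). \<phi>' (f n x) = \<phi> x)" if "coloring (Xs n) \<phi>" for n \<phi>
    using stage[of n] coloring_operation[OF lcc_stage lcc_stage _ that] that by fastforce
  have "\<exists>\<Phi>. \<forall>n. (coloring (Xs n) (\<Phi> n) \<and> (n = 0 \<longrightarrow> \<Phi> n = \<phi>0)) \<and> (\<forall>x\<in>vertices (Xs n). \<Phi> (Suc n) (f n x) = \<Phi> n x)"
    by (rule dependent_nat_choice) (use col step in auto)
  then obtain \<Phi> where \<Phi>: "\<And>n. coloring (Xs n) (\<Phi> n) \<and> (n = 0 \<longrightarrow> \<Phi> n = \<phi>0)"
    "\<And>n. \<forall>x\<in>vertices (Xs n). \<Phi> (Suc n) (f n x) = \<Phi> n x" by blast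
  have comp: "\<Phi> (n + k) (composite f n k x) = \<Phi> n x" if "x \<in> vertices (Xs n)" for n k x
  proof (induction k)
    case (Suc k)
    have "composite f n k x \<in> vertices (Xs (n + k))" using hom_vertex[OF composite_hom that] .
    then show ?case using \<Phi>(2) Suc by simp
  qed simp
  \<comment> \<open>The two cells are compared at the common stage \<open>n + m\<close>, and from
    there at a later one at which they have become equal.\<close>
  have well: "\<Phi> n x = \<Phi> m y" if x: "x \<in> vertices (Xs n)" and y: "y \<in> vertices (Xs m)" and eq: "g n x = g m y" for n m x y
  proof -
    let ?x = "composite f n m x" and ?y = "composite f m n y"
    have xy: "x \<in> cubes (Xs n)" "y \<in> cubes (Xs m)" using x y by (auto simp: vertices_def)
    have v: "?x \<in> vertices (Xs (n + m))" "?y \<in> vertices (Xs (n + m))"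
      using hom_vertex[OF composite_hom x] hom_vertex[OF composite_hom[of m n] y] by (simp_all add: add.commute)
    have "g (n + m) ?x = g (n + m) ?y"
      using limit_composite[OF xy(1), of m] limit_composite[OF xy(2), of n] eq by (simp add: add.commute)
    moreover have "?x \<in> cubes (Xs (n + m))" "?y \<in> cubes (Xs (n + m))" using v by (simp_all add: vertices_def)
    ultimately obtain k where "composite f (n + m) k ?x = composite f (n + m) k ?y" using limit_eq by blast
    then have "\<Phi> (n + m) ?x = \<Phi> (n + m) ?y" using comp[OF v(1), of k] comp[OF v(2), of k] by simp
    then show ?thesis using comp[OF x, of m] comp[OF y, of n] by (simp add: add.commute)
  qed
  define \<psi> where "\<psi> v = (let (n, x) = (SOME (n, x). x \<in> vertices (Xs n) \<and> g n x = v) in \<Phi> n x)" for v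
  have \<psi>: "\<psi> (g n x) = \<Phi> n x" if x: "x \<in> vertices (Xs n)" for n x
  proof -
    obtain m y where my: "(SOME (m, y). y \<in> vertices (Xs m) \<and> g m y = g n x) = (m, y)" by fastforce
    have "case (SOME (m, y). y \<in> vertices (Xs m) \<and> g m y = g n x) of (m, y) \<Rightarrow> y \<in> vertices (Xs m) \<and> g m y = g n x"
      by (rule someI[of _ "(n, x)"]) (use x in simp)
    then have "y \<in> vertices (Xs m)" "g m y = g n x" using my by auto
    then have "\<Phi> m y = \<Phi> n x" using well x by blast
    then show ?thesis by (simp add: \<psi>_def my)
  qed
  have "coloring L \<psi>"
    unfolding coloring_def
  proof (intro conjI ballI impI)
    fix v assume v: "v \<in> vertices L"
    then have "v \<in> cubes L" by (simp add: vertices_def)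
    then obtain n x where "x \<in> cubes (Xs n)" "v = g n x" "labels (Xs n) x = labels L v"
      using limit_onto by blast
    then have x: "x \<in> vertices (Xs n)" "v = g n x" using v by (auto simp: vertices_def)
    then show "\<psi> v \<in> coset ` words" using \<psi> \<Phi>(1)[of n] by (simp add: coloring_def)
  next
    fix e w assume e: "e \<in> edges L" and w: "w \<in> words" and eq: "\<psi> (edge_start L e) = coset w"
    have "e \<in> cubes L" using e by (simp add: edges_def)
    then obtain n x where x: "x \<in> cubes (Xs n)" "e = g n x" "labels (Xs n) x = labels L e"
      using limit_onto by blast
    then have xe: "x \<in> edges (Xs n)" using e by (simp add: edges_def)
    note h = hom_edge[OF limit_hom xe] and ends = lcc.edge_rev_props(6,7)[OF lcc_stage xe]
    have "\<Phi> n (edge_start (Xs n) x) = coset w" using eq h(2) x(2) \<psi>[OF ends(1)] by simp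
    then have "\<Phi> n (edge_end (Xs n) x) = coset (w @ [edge_label (Xs n) x])"
      using coloring_edge[OF _ xe w] \<Phi>(1) by blast
    then show "\<psi> (edge_end L e) = coset (w @ [edge_label L e])"
      using h(3) x(2,3) \<psi>[OF ends(2)] by (simp add: edge_label_def)
  qed
  moreover have "\<psi> (g 0 x) = \<phi>0 x" if "x \<in> vertices (Xs 0)" for x using \<psi>[OF that] \<Phi>(1)[of 0] by simp
  ultimately show ?thesis by blast
qed

end

section \<open>Roses and their standard completions\<close>

lemma rose_simps:
  "labels (rose S) = rose_labels" "face (rose S) = rose_face"
  "c \<in> cubes (rose S) \<longleftrightarrow> c = Hub \<or> (\<exists>w i. c = Knot w i \<and> w \<in> S \<and> 0 < i \<and> i < length w) \<or>
     (\<exists>w i r. c = Seg w i r \<and> w \<in> S \<and> i < length w)"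
  by (auto simp: rose_def)

lemma rose_vertices: "v \<in> vertices (rose S) \<Longrightarrow> v = Hub \<or> (\<exists>w\<in>S. \<exists>i\<le>length w. v = rose_vertex w i)"
proof -
  assume "v \<in> vertices (rose S)"
  then consider "v = Hub" | w i where "v = Knot w i" "w \<in> S" "0 < i" "i < length w"
    by (auto simp: vertices_def rose_simps)
  then show ?thesis
  proof cases
    case 2
    then show ?thesis by (intro disjI2 bexI[of _ w] exI[of _ i]) (simp_all add: rose_vertex_def)
  qed simp
qed

lemma rose_edges:
  assumes "e \<in> edges (rose S)"
  obtains w i r where "e = Seg w i r" "w \<in> S" "i < length w"
  using assms by (auto simp: edges_def rose_simps)

lemma rose_edge:
  assumes "w \<in> S" "i < length w"
  shows "Seg w i r \<in> edges (rose S)" "edge_label (rose S) (Seg w i r) = w ! i"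
    "edge_start (rose S) (Seg w i r) = rose_vertex w (if r then Suc i else i)"
    "edge_end (rose S) (Seg w i r) = rose_vertex w (if r then i else Suc i)"
  using assms by (auto simp: edges_def rose_simps edge_label_def edge_start_def edge_end_def)

lemma Hub_vertex: "Hub \<in> vertices (rose S)"
  by (simp add: vertices_def rose_simps)

context right_angled
begin

lemma rose_walk:
  assumes L: "lcc \<Gamma> L" and hom: "labeled_hom h (rose S) L" and w: "w \<in> S"
  shows "i \<le> length w \<Longrightarrow> walk L (h Hub) (take i w) (h (rose_vertex w i))"
proof (induction i)
  case 0
  then show ?case using hom_vertex[OF hom Hub_vertex] by (simp add: rose_vertex_def)
next
  case (Suc i)
  interpret lcc \<Gamma> L by fact
  let ?e = "Seg w i False"
  note r = rose_edge[OF w, of i False] and h = hom_edge[OF hom, of ?e]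
  have e: "h ?e \<in> edges L" "edge_start L (h ?e) = h (rose_vertex w i)" "edge_end L (h ?e) = h (rose_vertex w (Suc i))"
    using r h Suc.prems by simp_all
  have "labels L (h ?e) = {w ! i}"
    using hom_labels[OF hom edge_cube[OF r(1)]] Suc.prems by (simp add: rose_simps)
  then have st: "edge_step L (h (rose_vertex w i)) (w ! i) (h (rose_vertex w (Suc i)))"
    using e by (auto simp: edge_step_def)
  have "walk L (h Hub) (take i w @ [w ! i]) (h (rose_vertex w (Suc i)))"
    using Suc st edge_step_in[OF st] by (auto simp: walk_append)
  then show ?case using Suc.prems by (simp add: take_Suc_conv_app_nth)
qed

end

context racg_subgroup
begin

text \<open>The vertices of a petal are colored by the prefixes of its word. The petal closes up at
  the hub since the whole word lies in \<open>GW\<close>.\<close>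

lemma rose_coloring:
  assumes "S \<subseteq> GW"
  shows "\<exists>\<phi>. coloring (rose S) \<phi> \<and> \<phi> Hub = coset []"
proof -
  define \<phi> where "\<phi> c = (case c of Knot w i \<Rightarrow> coset (take i w) | _ \<Rightarrow> coset [])" for c :: "'v rose_cell"
  have v: "\<phi> (rose_vertex w i) = coset (take i w)" if "w \<in> S" "i \<le> length w" for w i
  proof -
    have "coset w = coset []" using coset_eq_iff[of w "[]"] that assms GW_words by auto
    then show ?thesis using that by (simp add: \<phi>_def rose_vertex_def)
  qed
  have t: "take i w \<in> words" if "w \<in> S" for w i
    using assms GW_words that by (meson in_listsD in_listsI in_set_takeD subsetD)
  have "coloring (rose S) \<phi>"
    unfolding coloring_def
  proof (intro conjI ballI impI)
    fix x assume "x \<in> vertices (rose S)"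
    then consider "x = Hub" | w i where "w \<in> S" "i \<le> length w" "x = rose_vertex w i" using rose_vertices by blast
    then show "\<phi> x \<in> coset ` words"
    proof cases
      case 1
      then show ?thesis by (simp add: \<phi>_def)
    next
      case 2
      then show ?thesis using v t by simp
    qed
  next
    fix e u assume e: "e \<in> edges (rose S)" and u: "u \<in> words" and eq: "\<phi> (edge_start (rose S) e) = coset u"
    obtain w i r where w: "e = Seg w i r" "w \<in> S" "i < length w" using rose_edges[OF e] .
    have s: "w ! i \<in> pverts \<Gamma>" using w assms GW_words[of w] by (auto simp: in_lists_conv_set)
    have S1: "take (Suc i) w = take i w @ [w ! i]" using w(3) by (rule take_Suc_conv_app_nth)
    have c1: "coset (take i w @ [w ! i] @ [w ! i]) = coset (take i w)"
      using word_eq.square[of "take i w" \<Gamma> "[]" "w ! i"] t[OF w(2)] s by (intro coset_cong) simp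
    note ed = rose_edge[OF w(2,3), of r, folded w(1)]
    show "\<phi> (edge_end (rose S) e) = coset (u @ [edge_label (rose S) e])"
    proof (cases r)
      case False
      then have "coset (take i w) = coset u" using eq ed(3) v[OF w(2), of i] w(3) by simp
      then have "coset (take i w @ [w ! i]) = coset (u @ [w ! i])" using t[OF w(2)] u s by (intro coset_append) auto
      then show ?thesis using ed(2,4) v[OF w(2), of "Suc i"] w(3) S1 False by simp
    next
      case True
      then have "coset (take i w @ [w ! i]) = coset u" using eq ed(3) v[OF w(2), of "Suc i"] w(3) S1 by simp
      then have "coset ((take i w @ [w ! i]) @ [w ! i]) = coset (u @ [w ! i])" using t[OF w(2)] u s by (intro coset_append) auto
      then show ?thesis using ed(2,4) v[OF w(2), of i] w(3) c1 True by simp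
    qed
  qed
  moreover have "\<phi> Hub = coset []" by (simp add: \<phi>_def)
  ultimately show ?thesis by blast
qed

lemma standard_completionE:
  assumes "standard_completion \<Gamma> G (\<Omega> :: ('v, 'c) labeled_complex) B"
  obtains S Xs f g i where "finite S" "S \<subseteq> GW" "generate (racg \<Gamma>) (word_elem \<Gamma> ` S) = G"
    "full_complex \<Gamma> \<Omega>" "operation_limit_subgroup \<Gamma> Xs f \<Omega> g G" "labeled_iso i (rose S) (Xs 0)"
    "lcc \<Gamma> (rose S)" "B = g 0 (i Hub)"
proof -
  from assms obtain S h where S: "finite S" "S \<subseteq> words" "generate (racg \<Gamma>) (word_elem \<Gamma> ` S) = G"
    and h: "completion_of_complex \<Gamma> (rose S) \<Omega> h" "B = h Hub"
    unfolding standard_completion_def by blast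
  from h(1) obtain Xs f g i where seq: "operation_sequence \<Gamma> Xs f" "labeled_iso i (rose S) (Xs 0)"
      "direct_limit Xs f \<Omega> g" "h = g 0 \<circ> i"
    and c: "labeled_cube_complex \<Gamma> (rose S)" "labeled_cube_complex \<Gamma> \<Omega>" "folded \<Omega>" "cube_full \<Gamma> \<Omega>"
    unfolding completion_of_complex_def by blast
  have "S \<subseteq> GW"
  proof
    fix w assume w: "w \<in> S"
    then have "word_elem \<Gamma> w \<in> G" unfolding S(3)[symmetric] by (intro generate.incl imageI)
    then show "w \<in> GW" using w S(2) by (auto simp: GW_def)
  qed
  moreover have "full_complex \<Gamma> \<Omega>" using c graph by unfold_locales
  moreover have "operation_limit_subgroup \<Gamma> Xs f \<Omega> g G" using seq graph subgroup by unfold_locales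
  moreover have "lcc \<Gamma> (rose S)" using c graph by unfold_locales
  ultimately show thesis using that[of S Xs f g i] S seq h(2) by simp
qed

text \<open>Loop labels lie in the subgroup by the coloring. Conversely an element is a product of
  generators and inverses, hence spelled by a concatenation of petals and reversed petals. In a
  folded, cube-full complex this loop can be reduced to any reduced word for the element.
  Connectedness follows from the vertex induction, as corners of a cube are joined inside
  it.\<close>

lemma standard_completion_is_completion:
  assumes "standard_completion \<Gamma> G (\<Omega> :: ('v, 'c) labeled_complex) B"
  shows "completion \<Gamma> G \<Omega> B"
proof -
  obtain S Xs f g i where S: "finite S" "S \<subseteq> GW" "generate (racg \<Gamma>) (word_elem \<Gamma> ` S) = G"
    and \<Omega>: "full_complex \<Gamma> \<Omega>" and lim: "operation_limit_subgroup \<Gamma> Xs f \<Omega> g G"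
    and i: "labeled_iso i (rose S) (Xs 0)" and rose: "lcc \<Gamma> (rose S)" and B: "B = g 0 (i Hub)"
    using standard_completionE[OF assms] .
  interpret full_complex \<Gamma> \<Omega> by fact
  interpret operation_limit_subgroup \<Gamma> Xs f \<Omega> g G by fact
  have ih: "labeled_hom i (rose S) (Xs 0)" and ib: "bij_betw i (cubes (rose S)) (cubes (Xs 0))"
    using i by (auto simp: labeled_iso_def)
  have hom: "labeled_hom (g 0 \<circ> i) (rose S) \<Omega>" using hom_comp[OF ih limit_hom] .
  have Bv: "B \<in> vertices \<Omega>" using hom_vertex[OF hom Hub_vertex] B by simp
  have rw: "walk \<Omega> B (take j w) ((g 0 \<circ> i) (rose_vertex w j))" if "w \<in> S" "j \<le> length w" for w j
    using rose_walk[OF lcc_axioms hom that] B by simp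
  have reach: "\<exists>z. walk \<Omega> B z v" if v: "v \<in> vertices \<Omega>" for v
  proof (rule limit_vertex_induct[OF _ _ v])
    fix x assume x: "x \<in> vertices (Xs 0)"
    then obtain y where y: "y \<in> cubes (rose S)" "x = i y"
      using ib unfolding vertices_def bij_betw_def by blast
    then have "y \<in> vertices (rose S)" using x hom_labels[OF ih y(1)] by (simp add: vertices_def)
    then consider "y = Hub" | w j where "w \<in> S" "j \<le> length w" "y = rose_vertex w j" using rose_vertices by blast
    then show "\<exists>z. walk \<Omega> B z (g 0 x)"
    proof cases
      case 1
      then show ?thesis using Bv B y(2) by (intro exI[of _ "[]"]) simp
    next
      case 2
      then show ?thesis using rw y(2) by auto
    qed
  next
    fix c A assume c: "c \<in> cubes \<Omega>" "\<exists>z. walk \<Omega> B z (face \<Omega> {} {} c)" "A \<subseteq> labels \<Omega> c"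
    obtain w where w: "set w = A" "distinct w"
      using finite_distinct_list[OF finite_subset[OF c(3) finite_labels[OF c(1)]]] by blast
    have "walk \<Omega> (face \<Omega> {} {} c) w (face \<Omega> {} (sym_diff {} (set w)) c)"
      using c w by (intro cube_walk) auto
    moreover obtain z where "walk \<Omega> B z (face \<Omega> {} {} c)" using c(2) by blast
    ultimately have "walk \<Omega> B (z @ w) (face \<Omega> {} A c)" unfolding walk_append using w(1) by auto
    then show "\<exists>z. walk \<Omega> B z (face \<Omega> {} A c)" by blast
  qed
  have loop: "w \<in> GW" if "walk \<Omega> B w B" for w
  proof -
    obtain \<phi> where \<phi>: "coloring (rose S) \<phi>" "\<phi> Hub = coset []" using rose_coloring[OF S(2)] by blast
    have "\<exists>\<phi>'. coloring (Xs 0) \<phi>' \<and> (\<forall>x\<in>vertices (rose S). \<phi>' (i x) = \<phi> x)"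
      by (rule coloring_image[OF rose ih _ \<phi>(1)]) (use ib in \<open>auto simp: bij_betw_def vertices_def inj_on_def\<close>)
    then obtain \<phi>' where \<phi>': "coloring (Xs 0) \<phi>'" "\<phi>' (i Hub) = coset []" using \<phi>(2) Hub_vertex by metis
    obtain \<psi> where \<psi>: "coloring \<Omega> \<psi>" "\<psi> B = coset []"
      using limit_coloring[OF \<phi>'(1)] \<phi>'(2) hom_vertex[OF ih Hub_vertex] B by metis
    have "coset [] = coset ([] @ w)" using coloring_walk[OF lcc_axioms \<psi>(1) that _ \<psi>(2)] \<psi>(2) by simp
    then have "[] @ rev w \<in> GW" using coset_eq_iff[of "[]" w] walk_in[OF that] by simp
    then show "w \<in> GW" using rev_GW by fastforce
  qed
  have gen: "walk \<Omega> B w B" if "w \<in> S" for w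
    using rw[OF that, of "length w"] B by (simp add: rose_vertex_def)
  have full: "walk \<Omega> B w B" if w: "w \<in> GW" "cred w" for w
  proof -
    have "word_elem \<Gamma> w \<in> word_elem \<Gamma> ` concat ` lists (S \<union> rev ` S)"
    proof -
      have "S \<subseteq> words" using S(2) GW_words by blast
      moreover have "word_elem \<Gamma> w \<in> G" using w(1) by (simp add: GW_def)
      ultimately show ?thesis using generate_words[of S] S(3) by simp
    qed
    then obtain ws where ws: "ws \<in> lists (S \<union> rev ` S)" "word_elem \<Gamma> w = word_elem \<Gamma> (concat ws)" by auto
    have "walk \<Omega> B (concat ws) B" using ws(1)
    proof (induction ws)
      case (Cons u ws)
      then have "walk \<Omega> B u B" using gen walk_rev by auto
      then show ?case using Cons by (auto simp: walk_append)
    qed (simp add: Bv)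
    moreover have "concat ws \<approx> w" using ws(2) elem_eq_iff GW_words[OF w(1)] eq_sym by metis
    ultimately show ?thesis using walk_reduced w(2) by blast
  qed
  have "path_connected_complex \<Omega>"
    unfolding path_connected_complex_def
  proof (intro conjI ballI)
    show "vertices \<Omega> \<noteq> {}" using Bv by blast
    fix u v assume "u \<in> vertices \<Omega>" "v \<in> vertices \<Omega>"
    then obtain x y where "walk \<Omega> B x u" "walk \<Omega> B y v" using reach by blast
    then have "walk \<Omega> u (rev x @ y) v" using walk_rev by (auto simp: walk_append)
    then show "\<exists>p. edge_path \<Omega> u p v" by (auto simp: walk_def)
  qed
  moreover have "word_elem \<Gamma> (path_label \<Omega> p) \<in> G" if "edge_loop \<Omega> B p" for p
    using loop[of "path_label \<Omega> p"] that by (auto simp: walk_def GW_def)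
  moreover have "\<exists>p. edge_loop \<Omega> B p \<and> path_label \<Omega> p = w" if "reduced \<Gamma> w" "word_elem \<Gamma> w \<in> G" for w
    using full[of w] that by (simp add: walk_def GW_def reduced_iff)
  ultimately show ?thesis unfolding completion_def using lcc folded cube_full Bv by blast
qed

text \<open>Every vertex is reached from \<open>B\<close> by a word in the hull of finitely many
  cosets: this holds for the rose and is preserved when cubes are attached. As the hull is near the
  subgroup, there are finitely many vertices, and then finitely many cubes.\<close>

lemma qconvex_imp_finite:
  assumes M: "qconvex M" and std: "standard_completion \<Gamma> G (\<Omega> :: ('v, 'c) labeled_complex) B"
  shows "finite (cubes \<Omega>)"
proof -
  obtain S Xs f g i where S: "finite S" "S \<subseteq> GW" "generate (racg \<Gamma>) (word_elem \<Gamma> ` S) = G"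
    and \<Omega>: "full_complex \<Gamma> \<Omega>" and lim: "operation_limit_subgroup \<Gamma> Xs f \<Omega> g G"
    and i: "labeled_iso i (rose S) (Xs 0)" and rose: "lcc \<Gamma> (rose S)" and B: "B = g 0 (i Hub)"
    using standard_completionE[OF std] .
  interpret completion_of \<Gamma> G \<Omega> B
    using standard_completion_is_completion[OF std] by unfold_locales
  interpret operation_limit_subgroup \<Gamma> Xs f \<Omega> g G by fact
  have ih: "labeled_hom i (rose S) (Xs 0)" and ib: "bij_betw i (cubes (rose S)) (cubes (Xs 0))"
    using i by (auto simp: labeled_iso_def)
  have hom: "labeled_hom (g 0 \<circ> i) (rose S) \<Omega>" using hom_comp[OF ih limit_hom] .
  have rw: "walk \<Omega> B (take j w) ((g 0 \<circ> i) (rose_vertex w j))" if "w \<in> S" "j \<le> length w" for w j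
    using rose_walk[OF lcc_axioms hom that] B by simp
  \<comment> \<open>The labels of the initial parts of the petals; \<open>[]\<close> for the hub is
    added explicitly, since there may be no generators.\<close>
  define P where "P = insert [] (\<Union>w\<in>S. (\<lambda>j. take j w) ` {..length w})"
  have Pw: "P \<subseteq> words"
  proof
    fix p assume "p \<in> P"
    then consider "p = []" | w j where "w \<in> S" "p = take j w" by (auto simp: P_def)
    then show "p \<in> words"
    proof cases
      case 2
      then have "w \<in> words" using S(2) GW_words by blast
      then show ?thesis using 2(2) by (meson in_listsD in_listsI in_set_takeD)
    qed simp
  qed
  have "finite P" unfolding P_def using S(1) by simp
  define Y where "Y = {g @ p | g p. g \<in> GW \<and> p \<in> P}"
  have Yw: "Y \<subseteq> words" unfolding Y_def using Pw GW_words by auto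
  have PY: "P \<subseteq> wall_hull Y"
  proof -
    have "P \<subseteq> Y" unfolding Y_def using Nil_GW by (metis (mono_tags, lifting) append_Nil mem_Collect_eq subsetI)
    then show ?thesis using wall_hull_base[OF Yw] by blast
  qed
  have left: "u @ z \<in> wall_hull Y" if "u \<in> GW" "z \<in> wall_hull Y" for u z
  proof (rule wall_hull_left[OF GW_words[OF that(1)] _ that(2)])
    fix y assume "y \<in> Y"
    then obtain g' p where "y = g' @ p" "g' \<in> GW" "p \<in> P" by (auto simp: Y_def)
    moreover from this have "u @ g' \<in> GW" using append_GW that(1) by blast
    ultimately show "u @ y \<in> Y" unfolding Y_def by (metis (mono_tags, lifting) append_assoc mem_Collect_eq)
  qed
  obtain D where D: "\<forall>z\<in>wall_hull Y. near D z"
  proof -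
    have "length p \<le> Max (length ` P)" if "p \<in> P" for p using that \<open>finite P\<close> by (intro Max_ge) auto
    moreover have "[] \<in> P" by (simp add: P_def)
    ultimately show thesis using wall_hull_near[OF M Pw, of "Max (length ` P)"] that unfolding Y_def by blast
  qed
  have reach: "\<exists>z\<in>wall_hull Y. walk \<Omega> B z v" if v: "v \<in> vertices \<Omega>" for v
  proof (rule limit_vertex_induct[OF _ _ v])
    fix x assume x: "x \<in> vertices (Xs 0)"
    then obtain y where y: "y \<in> cubes (rose S)" "x = i y"
      using ib unfolding vertices_def bij_betw_def by blast
    then have "y \<in> vertices (rose S)" using x hom_labels[OF ih y(1)] by (simp add: vertices_def)
    then consider "y = Hub" | w j where "w \<in> S" "j \<le> length w" "y = rose_vertex w j" using rose_vertices by blast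
    then show "\<exists>z\<in>wall_hull Y. walk \<Omega> B z (g 0 x)"
    proof cases
      case 1
      have "[] \<in> P" by (simp add: P_def)
      then show ?thesis using B_vertex B y(2) 1 PY by (intro bexI[of _ "[]"]) auto
    next
      case 2
      then have "take j w \<in> P" unfolding P_def by auto
      then show ?thesis using rw[OF 2(1,2)] y(2) 2(3) PY by (intro bexI[of _ "take j w"]) auto
    qed
  next
    fix c A assume c: "c \<in> cubes \<Omega>" "\<exists>z\<in>wall_hull Y. walk \<Omega> B z (face \<Omega> {} {} c)"
      "\<And>s. s \<in> labels \<Omega> c \<Longrightarrow> \<exists>z\<in>wall_hull Y. walk \<Omega> B z (face \<Omega> {} {s} c)" "A \<subseteq> labels \<Omega> c"
    obtain z where z: "z \<in> wall_hull Y" "walk \<Omega> B z (face \<Omega> {} {} c)" using c(2) by blast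
    have zw: "z \<in> words" using z walk_in by blast
    obtain w where w: "set w = A" "distinct w"
      using finite_distinct_list[OF finite_subset[OF c(4) finite_labels[OF c(1)]]] by blast
    have "z @ [s] \<in> wall_hull Y" if "s \<in> set w" for s
    proof -
      have s: "s \<in> labels \<Omega> c" using that w(1) c(4) by blast
      obtain x where x: "x \<in> wall_hull Y" "walk \<Omega> B x (face \<Omega> {} {s} c)" using c(3)[OF s] by blast
      have xw: "x \<in> words" using x walk_in by blast
      have "walk \<Omega> (face \<Omega> {} {} c) [s] (face \<Omega> {} (sym_diff {} (set [s])) c)"
        using c(1) s by (intro cube_walk) auto
      then have "walk \<Omega> B (z @ [s]) (face \<Omega> {} {s} c)" unfolding walk_append using z(2) by auto
      \<comment> \<open>\<open>z @ [s]\<close> and the word \<open>x\<close> from the hull lead to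
        the same vertex, so they differ by an element of the subgroup on the left, and the hull is
        invariant under it.\<close>
      then have "(z @ [s]) @ rev x \<in> GW" using same_end_iff[OF _ x(2)] by blast
      then have "((z @ [s]) @ rev x) @ x \<in> wall_hull Y" using left x(1) by blast
      moreover have "((z @ [s]) @ rev x) @ x \<approx> z @ [s]"
        using eq_append[OF eq_refl rev_left[OF xw], of "z @ [s]"] zw s label_clique[OF c(1)] by (auto simp: clique_def)
      ultimately show ?thesis by (rule wall_hull_cong)
    qed
    moreover have "clique \<Gamma> (set w)" using label_clique[OF c(1)] c(4) w(1) unfolding clique_def by blast
    ultimately have "z @ w \<in> wall_hull Y" using wall_hull_cube[OF z(1) w(2)] by blast
    moreover have "walk \<Omega> (face \<Omega> {} {} c) w (face \<Omega> {} (sym_diff {} (set w)) c)"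
      using c w by (intro cube_walk) auto
    then have "walk \<Omega> B (z @ w) (face \<Omega> {} A c)" unfolding walk_append using z(2) w(1) by auto
    ultimately show "\<exists>z\<in>wall_hull Y. walk \<Omega> B z (face \<Omega> {} A c)" by blast
  qed
  have "finite (vertices \<Omega>)" by (rule near_finite_vertices[of D]) (use reach D in blast)
  then show ?thesis by (rule finite_cubes)
qed

end


section \<open>Existence of standard completions\<close>

lemma infinite_inj_exists:
  assumes "finite A" "infinite (B :: 'b set)"
  shows "\<exists>f. inj_on f A \<and> f ` A \<subseteq> B"
proof -
  obtain C where "finite C" "card C = card A" "C \<subseteq> B"
    using infinite_arbitrarily_large[OF assms(2)] by blast
  then obtain f where "bij_betw f A C" using finite_same_card_bij[OF assms(1)] by metis
  then show ?thesis using \<open>C \<subseteq> B\<close> by (auto simp: bij_betw_def)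
qed

context right_angled
begin

lemma lccI:
  assumes "\<And>c. c \<in> cubes X \<Longrightarrow> clique \<Gamma> (labels X c)"
    and "\<And>c L A. c \<in> cubes X \<Longrightarrow> L \<subseteq> labels X c \<Longrightarrow> A \<subseteq> labels X c \<Longrightarrow> face X L A c \<in> cubes X \<and> labels X (face X L A c) = L"
    and "\<And>c. c \<in> cubes X \<Longrightarrow> face X (labels X c) {} c = c"
    and "\<And>c L A M C. c \<in> cubes X \<Longrightarrow> L \<subseteq> labels X c \<Longrightarrow> A \<subseteq> labels X c \<Longrightarrow> M \<subseteq> L \<Longrightarrow> C \<subseteq> L \<Longrightarrow>
      face X M C (face X L A c) = face X M (sym_diff A C) c"
    and "\<And>c A. c \<in> cubes X \<Longrightarrow> A \<subseteq> labels X c \<Longrightarrow> face X (labels X c) A c = c \<Longrightarrow> A = {}"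
  shows "lcc \<Gamma> X"
proof unfold_locales
  show "labeled_cube_complex \<Gamma> X"
    unfolding labeled_cube_complex_def
    by (intro ballI conjI allI impI) (use assms in \<open>simp_all\<close>)
qed

subsection \<open>Single operations\<close>

text \<open>The quotient lives on representatives selected by a retraction \<open>q\<close>, so that
  its cells stay in the same type.\<close>

definition quotient_complex :: "('v, 'd) labeled_complex \<Rightarrow> ('d \<Rightarrow> 'd) \<Rightarrow> ('v, 'd) labeled_complex" where
  "quotient_complex X q = \<lparr>cubes = q ` cubes X, labels = labels X, face = (\<lambda>L A c. q (face X L A c))\<rparr>"

lemma quotient_complex:
  assumes X: "lcc \<Gamma> X"
    and q: "\<And>x. x \<in> cubes X \<Longrightarrow> q x \<in> cubes X \<and> q (q x) = q x \<and> labels X (q x) = labels X x"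
    and cong: "\<And>x L A. x \<in> cubes X \<Longrightarrow> L \<subseteq> labels X x \<Longrightarrow> A \<subseteq> labels X x \<Longrightarrow> q (face X L A (q x)) = q (face X L A x)"
    and free: "\<And>x A. x \<in> cubes X \<Longrightarrow> A \<subseteq> labels X x \<Longrightarrow> q (face X (labels X x) A x) = q x \<Longrightarrow> A = {}"
  shows "lcc \<Gamma> (quotient_complex X q)" "labeled_hom q X (quotient_complex X q)"
    "q ` cubes X = cubes (quotient_complex X q)"
proof -
  interpret lcc \<Gamma> X by fact
  let ?Y = "quotient_complex X q"
  have Y: "cubes ?Y = q ` cubes X" "labels ?Y = labels X" "face ?Y = (\<lambda>L A c. q (face X L A c))"
    by (simp_all add: quotient_complex_def)
  have c: "c \<in> cubes X \<and> q c = c" if "c \<in> cubes ?Y" for c using that q Y(1) by auto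
  show "lcc \<Gamma> ?Y"
  proof (rule lccI, unfold Y(2,3))
    fix c assume cy: "c \<in> cubes ?Y"
    note cx = c[OF cy, THEN conjunct1] and cq = c[OF cy, THEN conjunct2]
    show "clique \<Gamma> (labels X c)" using label_clique cx .
    show "q (face X (labels X c) {} c) = c" using face_full[OF cx] cq by simp
    show "A = {}" if "A \<subseteq> labels X c" "q (face X (labels X c) A c) = c" for A
      using free[OF cx that(1)] that(2) cq by simp
    fix L A assume LA: "L \<subseteq> labels X c" "A \<subseteq> labels X c"
    show "q (face X L A c) \<in> cubes ?Y \<and> labels X (q (face X L A c)) = L"
      using q[OF face_cube[OF cx LA]] face_labels[OF cx LA] face_cube[OF cx LA] Y(1) by simp
    fix M C assume MC: "M \<subseteq> L" "C \<subseteq> L"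
    have "q (face X M C (q (face X L A c))) = q (face X M C (face X L A c))"
      using MC face_labels[OF cx LA] by (intro cong[OF face_cube[OF cx LA]]) simp_all
    then show "q (face X M C (q (face X L A c))) = q (face X M (sym_diff A C) c)"
      using face_face[OF cx LA MC] by simp
  qed
  show "labeled_hom q X ?Y" unfolding labeled_hom_def Y using q cong by simp
  show "q ` cubes X = cubes ?Y" by (simp add: Y)
qed

lemma fold_exists:
  assumes X: "lcc \<Gamma> X" and e: "e1 \<in> edges X" "e2 \<in> edges X" "labels X e1 = labels X e2"
    "edge_start X e1 = edge_start X e2" and ng: "\<not> same_geometric_cube X e1 e2"
  shows "\<exists>q Y. fold_operation q X Y \<and> lcc \<Gamma> Y"
proof -
  interpret lcc \<Gamma> X by fact
  \<comment> \<open>All cells on the side of \<open>e2\<close> are moved: the edge, its reverse and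
    its end vertex. If \<open>e2\<close> is a graph-loop, that vertex is the common start of both
    edges, and it moves to the end of \<open>e1\<close>.\<close>
  define q where "q x = (if x = e2 then e1 else if x = edge_rev X e2 then edge_rev X e1
     else if x = edge_end X e2 then edge_end X e1 else x)" for x
  note r1 = edge_rev_props[OF e(1)] and r2 = edge_rev_props[OF e(2)]
  note cu = edge_cube[OF e(1)] edge_cube[OF e(2)] edge_cube[OF r1(1)] edge_cube[OF r2(1)]
  have geo: "same_geometric_cube X e1 e1" "same_geometric_cube X e1 (edge_rev X e1)"
    using face_full[OF cu(1)] unfolding same_geometric_cube_def edge_rev_def by (metis empty_subsetI) blast
  have ne: "e1 \<noteq> e2" "edge_rev X e1 \<noteq> e2" "e1 \<noteq> edge_rev X e2" "edge_rev X e1 \<noteq> edge_rev X e2"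
    using geo ng r1(5) r2(5) by metis+
  have ends: "edge_end X e1 \<in> vertices X" "edge_end X e2 \<in> vertices X" using r1 r2 by auto
  have nv: "x \<notin> {e1, e2, edge_rev X e1, edge_rev X e2}" if "x \<in> vertices X" for x
    using vertex_not_edge[OF that] e r1(1) r2(1) by auto
  have ker: "q x = q y \<longleftrightarrow> x = y \<or> {x, y} = {e1, e2} \<or> {x, y} = {edge_rev X e1, edge_rev X e2} \<or>
           {x, y} = {edge_end X e1, edge_end X e2}" for x y
    using ne r1(8) r2(8) nv[OF ends(1)] nv[OF ends(2)] unfolding q_def doubleton_eq_iff by auto
  have q1: "q e1 = e1" "q e2 = e1" "q (edge_rev X e1) = edge_rev X e1" "q (edge_rev X e2) = edge_rev X e1"
    "q (edge_end X e1) = edge_end X e1" "q (edge_end X e2) = edge_end X e1"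
    using ne r1(8) r2(8) nv[OF ends(1)] nv[OF ends(2)] unfolding q_def by auto
  have qx: "q x = x" if "x \<noteq> e2" "x \<noteq> edge_rev X e2" "x \<noteq> edge_end X e2" for x using that by (simp add: q_def)
  have cases: "P x" if "P e2" "P (edge_rev X e2)" "P (edge_end X e2)" "q x = x \<Longrightarrow> P x" for P x
    using that qx by metis
  obtain s where s: "labels X e1 = {s}" "labels X e2 = {s}" using e by (auto simp: edges_def)
  have vl: "labels X v = {}" "v \<in> cubes X" if "v \<in> vertices X" for v using that by (auto simp: vertices_def)
  have 1: "q x \<in> cubes X \<and> q (q x) = q x \<and> labels X (q x) = labels X x" if "x \<in> cubes X" for x
    by (rule cases[of _ x]) (use that q1 cu r1(2) r2(2) e(3) vl[OF ends(1)] vl[OF ends(2)] in auto)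
  have fe: "face X {} {} x = edge_start X x" "face X {} {s} x = edge_end X x" "face X {s} {} x = x" "face X {s} {s} x = edge_rev X x"
    if "x \<in> edges X" "labels X x = {s}" for x
    using face_full[OF edge_cube[OF that(1)]] that(2) by (simp_all add: edge_start_def edge_end_def edge_rev_def)
  have congr: "q (face X L A (q x)) = q (face X L A x)"
    if x: "x \<in> cubes X" and LA: "L \<subseteq> labels X x" "A \<subseteq> labels X x" for x L A
  proof -
    have "L \<subseteq> labels X x \<longrightarrow> A \<subseteq> labels X x \<longrightarrow> q (face X L A (q x)) = q (face X L A x)"
    proof (rule cases[of _ x])
      show "L \<subseteq> labels X e2 \<longrightarrow> A \<subseteq> labels X e2 \<longrightarrow> q (face X L A (q e2)) = q (face X L A e2)"
        unfolding s(2) subset_singleton_iff using fe[OF e(1) s(1)] fe[OF e(2) s(2)] q1 e(4) by auto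
      have l: "labels X (edge_rev X e2) = {s}" "labels X (edge_rev X e1) = {s}" using r1(2) r2(2) s by auto
      show "L \<subseteq> labels X (edge_rev X e2) \<longrightarrow> A \<subseteq> labels X (edge_rev X e2) \<longrightarrow>
          q (face X L A (q (edge_rev X e2))) = q (face X L A (edge_rev X e2))"
        unfolding l subset_singleton_iff using fe[OF r1(1) l(2)] fe[OF r2(1) l(1)] q1 r1 r2 e(4) by auto
      show "L \<subseteq> labels X (edge_end X e2) \<longrightarrow> A \<subseteq> labels X (edge_end X e2) \<longrightarrow>
          q (face X L A (q (edge_end X e2))) = q (face X L A (edge_end X e2))"
        using vl[OF ends(2)] vertex_face[OF ends(1)] vertex_face[OF ends(2)] q1 by auto
    qed simp
    then show ?thesis using LA by simp
  qed
  \<comment> \<open>The identified cells of positive dimension are \<open>e1\<close> with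
    \<open>e2\<close> and their reverses. An edge identified with its own reverse would make
    \<open>e1\<close> the reverse of \<open>e2\<close>, but they are different geometric
    edges.\<close>
  have free: "A = {}" if x: "x \<in> cubes X" and A: "A \<subseteq> labels X x" and eq: "q (face X (labels X x) A x) = q x" for x A
  proof (rule ccontr)
    assume ne: "A \<noteq> {}"
    then have "face X (labels X x) A x \<noteq> x" using face_free[OF x A] by blast
    then have k: "{face X (labels X x) A x, x} = {e1, e2} \<or> {face X (labels X x) A x, x} = {edge_rev X e1, edge_rev X e2} \<or>
           {face X (labels X x) A x, x} = {edge_end X e1, edge_end X e2}" using eq ker by blast
    have "labels X x \<noteq> {}" using A ne by blast
    then have "x \<notin> vertices X" by (simp add: vertices_def)
    then have xc: "x \<in> {e1, e2, edge_rev X e1, edge_rev X e2}" and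
      k': "{face X (labels X x) A x, x} = {e1, e2} \<or> {face X (labels X x) A x, x} = {edge_rev X e1, edge_rev X e2}"
      using k ends by (auto simp: doubleton_eq_iff)
    have "labels X x = {s}" using xc s r1(2) r2(2) by auto
    then have "A = labels X x" using A ne by auto
    then have "face X (labels X x) A x = edge_rev X x" by (simp add: edge_rev_def)
    then consider "edge_rev X x = e1" "x = e2" | "edge_rev X x = e2" "x = e1"
      | "edge_rev X x = edge_rev X e1" "x = edge_rev X e2" | "edge_rev X x = edge_rev X e2" "x = edge_rev X e1"
      using k' unfolding doubleton_eq_iff by metis
    then show False
    proof cases
      case 1
      then show ?thesis using \<open>e1 \<noteq> edge_rev X e2\<close> by blast
    next
      case 2
      then show ?thesis using \<open>edge_rev X e1 \<noteq> e2\<close> by blast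
    next
      case 3
      then have "edge_rev X e1 = e2" using r2(5) by argo
      then show ?thesis using \<open>edge_rev X e1 \<noteq> e2\<close> by blast
    next
      case 4
      then have "e1 = edge_rev X e2" using r1(5) by argo
      then show ?thesis using \<open>e1 \<noteq> edge_rev X e2\<close> by blast
    qed
  qed
  have quo: "lcc \<Gamma> (quotient_complex X q)" "labeled_hom q X (quotient_complex X q)"
    "q ` cubes X = cubes (quotient_complex X q)"
    by (rule quotient_complex[of X q], rule X, erule 1, erule (2) congr, erule (2) free)+
  have "fold_operation q X (quotient_complex X q)"
    unfolding fold_operation_def
    by (intro conjI bexI[OF _ e(1)] bexI[OF _ e(2)] ballI quo(2,3) e(3,4) ng) (rule ker)
  then show ?thesis using quo(1) by blast
qed

text \<open>Two cubes are identified at a time, which is enough to remove all violations one by one.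
  Each parametrization of \<open>d\<close> is replaced by the corresponding one of \<open>c\<close>;
  proper faces already agree.\<close>

lemma identification_exists:
  assumes X: "lcc \<Gamma> X" and c: "c \<in> cubes X" and d: "d \<in> cubes X" and K: "labels X c = K" "2 \<le> card K"
    and sb: "same_boundary X c d" and ng: "\<not> same_geometric_cube X c d"
  shows "\<exists>q Y. cube_identification q X Y \<and> lcc \<Gamma> Y"
proof -
  interpret lcc \<Gamma> X by fact
  have Kd: "labels X d = K" using sb K by (simp add: same_boundary_def)
  have bd: "face X L A c = face X L A d" if "L \<subset> K" "A \<subseteq> K" for L A
    using sb that K by (simp add: same_boundary_def)
  have F: "face X K A p \<in> cubes X" "labels X (face X K A p) = K" if "p \<in> {c, d}" "A \<subseteq> K" for p A
    using that c d K Kd face_cube[of p K A] face_labels[of p K A] by auto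
  have ff: "face X L E (face X K A p) = face X L (sym_diff A E) p" if "p \<in> {c, d}" "A \<subseteq> K" "L \<subseteq> K" "E \<subseteq> K" for p L A E
    using that c d K Kd face_face[of p K A L E] by auto
  have back2: "face X K A (face X K A p) = p" if "p \<in> {c, d}" "A \<subseteq> K" for p A
    using ff[OF that order_refl that(2)] face_full[of p] that c d K Kd by auto
  have inj: "A = E" if "p \<in> {c, d}" "A \<subseteq> K" "E \<subseteq> K" "face X K A p = face X K E p" for p A E
  proof -
    have "face X K (sym_diff A E) p = face X K E (face X K A p)" using ff[of p A K E] that by simp
    also have "\<dots> = p" using that back2 by simp
    finally have "face X K (sym_diff A E) p = p" .
    moreover have "p \<in> cubes X" "labels X p = K" "sym_diff A E \<subseteq> K" using that c d K Kd by auto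
    ultimately have "sym_diff A E = {}" using face_free[of p "sym_diff A E"] by simp
    then show ?thesis by blast
  qed
  have ncd: "face X K A c \<noteq> face X K E d" if "A \<subseteq> K" "E \<subseteq> K" for A E
  proof
    assume eq: "face X K A c = face X K E d"
    have "d = face X K E (face X K A c)" using back2[of d E] that eq by simp
    then have "d = face X K (sym_diff A E) c" using ff[of c A K E] that by simp
    moreover have "sym_diff A E \<subseteq> K" using that by auto
    ultimately show False using ng K unfolding same_geometric_cube_def by blast
  qed
  \<comment> \<open>The chosen \<open>A\<close> is unique because distinct parametrizations of a
    cube are distinct, see \<open>inj\<close>.\<close>
  define q where "q x = (if \<exists>A\<subseteq>K. x = face X K A d then face X K (SOME A. A \<subseteq> K \<and> x = face X K A d) c else x)" for x
  have qd: "q (face X K A d) = face X K A c" if A: "A \<subseteq> K" for A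
  proof -
    have "(SOME E. E \<subseteq> K \<and> face X K A d = face X K E d) = A"
      by (rule some_equality) (use A inj[of d] in auto)
    then show ?thesis using A unfolding q_def by auto
  qed
  have qx: "q x = x" if "\<And>A. A \<subseteq> K \<Longrightarrow> x \<noteq> face X K A d" for x using that unfolding q_def by auto
  have qc: "q (face X K A c) = face X K A c" if "A \<subseteq> K" for A using that ncd by (intro qx) blast
  have cases: thesis if "\<And>A. A \<subseteq> K \<Longrightarrow> x = face X K A d \<Longrightarrow> thesis" "q x = x \<Longrightarrow> (\<And>A. A \<subseteq> K \<Longrightarrow> x \<noteq> face X K A d) \<Longrightarrow> thesis" for x thesis
    using that qx by metis
  have 1: "q x \<in> cubes X \<and> q (q x) = q x \<and> labels X (q x) = labels X x" if x: "x \<in> cubes X" for x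
    by (rule cases[of x]) (use x F qd qc in auto)
  have congr: "q (face X L A (q x)) = q (face X L A x)"
    if x: "x \<in> cubes X" and LA: "L \<subseteq> labels X x" "A \<subseteq> labels X x" for x L A
  proof (rule cases[of x])
    fix E assume E: "E \<subseteq> K" "x = face X K E d"
    then have LA': "L \<subseteq> K" "A \<subseteq> K" using LA F(2)[of d E] by auto
    have S: "sym_diff E A \<subseteq> K" using E LA' by auto
    have 1: "face X L A x = face X L (sym_diff E A) d" "face X L A (q x) = face X L (sym_diff E A) c"
      using ff[of d E L A] ff[of c E L A] E LA' qd[OF E(1)] by simp_all
    show ?thesis
    proof (cases "L = K")
      case True
      then show ?thesis using 1 qd[OF S] qc[OF S] by simp
    next
      case False
      then have "face X L A x = face X L A (q x)" using 1 bd[OF _ S, of L] LA' by auto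
      then show ?thesis by simp
    qed
  qed simp
  have ker: "q x = q y \<longleftrightarrow> x = y \<or> (\<exists>p\<in>{c, d}. \<exists>p'\<in>{c, d}. \<exists>A\<subseteq>K. x = face X K A p \<and> y = face X K A p')" for x y
  proof
    assume eq: "q x = q y"
    show "x = y \<or> (\<exists>p\<in>{c, d}. \<exists>p'\<in>{c, d}. \<exists>A\<subseteq>K. x = face X K A p \<and> y = face X K A p')"
    proof (rule cases[of x]; rule cases[of y])
      fix A E assume "A \<subseteq> K" "x = face X K A d" "E \<subseteq> K" "y = face X K E d"
      then have "A = E" using eq qd inj[of c A E] by simp
      then show ?thesis using \<open>x = face X K A d\<close> \<open>y = face X K E d\<close> by simp
    next
      fix A assume "A \<subseteq> K" "x = face X K A d" "q y = y"
      then have "x = face X K A d \<and> y = face X K A c" using eq qd[of A] by simp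
      then show ?thesis using \<open>A \<subseteq> K\<close> by blast
    next
      fix A assume "q x = x" "A \<subseteq> K" "y = face X K A d"
      then have "x = face X K A c \<and> y = face X K A d" using eq qd[of A] by simp
      then show ?thesis using \<open>A \<subseteq> K\<close> by blast
    next
      assume "q x = x" "q y = y"
      then have "x = y" using eq by metis
      then show ?thesis by (rule disjI1)
    qed
  next
    assume "x = y \<or> (\<exists>p\<in>{c, d}. \<exists>p'\<in>{c, d}. \<exists>A\<subseteq>K. x = face X K A p \<and> y = face X K A p')"
    then show "q x = q y" using qd qc by auto
  qed
  have free: "A = {}" if x: "x \<in> cubes X" and A: "A \<subseteq> labels X x" and eq: "q (face X (labels X x) A x) = q x" for x A
  proof (rule ccontr)
    assume "A \<noteq> {}"
    then have ne: "face X (labels X x) A x \<noteq> x" using face_free[OF x A] by blast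
    then have "\<exists>p\<in>{c, d}. \<exists>p'\<in>{c, d}. \<exists>E\<subseteq>K. face X (labels X x) A x = face X K E p \<and> x = face X K E p'"
      using eq ker by metis
    then obtain p p' E where p: "p \<in> {c, d}" "p' \<in> {c, d}" "E \<subseteq> K" "face X (labels X x) A x = face X K E p" "x = face X K E p'"
      by blast
    then have l: "labels X x = K" using F by simp
    then have AK: "A \<subseteq> K" using A by simp
    have S: "sym_diff E A \<subseteq> K" using AK p(3) by auto
    have e: "face X K (sym_diff E A) p' = face X K E p" using ff[of p' E K A] p l AK by simp
    have "p = p'" using p(1,2) e ncd[OF S p(3)] ncd[OF p(3) S] by auto
    then show False using ne p l by simp
  qed
  have quo: "lcc \<Gamma> (quotient_complex X q)" "labeled_hom q X (quotient_complex X q)"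
    "q ` cubes X = cubes (quotient_complex X q)"
    by (rule quotient_complex[of X q], rule X, erule 1, erule (2) congr, erule (2) free)+
  have cd: "c \<noteq> d" using ncd[of "{}" "{}"] by auto
  have sym: "same_boundary X d c \<and> \<not> same_geometric_cube X d c"
  proof
    show "same_boundary X d c" using sb by (simp add: same_boundary_def)
    show "\<not> same_geometric_cube X d c"
      using ncd[of "{}"] face_full[OF c] K(1) Kd unfolding same_geometric_cube_def by auto
  qed
  have "cube_identification q X (quotient_complex X q)"
    unfolding cube_identification_def
  proof (intro conjI exI[of _ "{c, d}"] exI[of _ K])
    show "\<forall>p\<in>{c, d}. \<forall>q\<in>{c, d}. p \<noteq> q \<longrightarrow> same_boundary X p q \<and> \<not> same_geometric_cube X p q"
      using sb ng sym by auto
    show "\<forall>x\<in>cubes X. \<forall>y\<in>cubes X. q x = q y \<longleftrightarrow>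
           x = y \<or> (\<exists>p\<in>{c, d}. \<exists>q\<in>{c, d}. \<exists>A\<subseteq>K. x = face X K A p \<and> y = face X K A q)"
      using ker by blast
  qed (use quo(2,3) c d K Kd cd in auto)
  then show ?thesis using quo(1) by blast
qed

text \<open>The new faces are named by elements of the type that are not yet cells, which exist
  because the complex is finite and the type infinite.\<close>

lemma attachment_exists:
  fixes X :: "('v, 'd :: infinite) labeled_complex"
  assumes X: "lcc \<Gamma> X" and fin: "finite (cubes X)" and K: "clique \<Gamma> K" "2 \<le> card K" and v: "v \<in> vertices X"
    and e: "\<forall>s\<in>K. e s \<in> edges X \<and> labels X (e s) = {s} \<and> edge_start X (e s) = v"
  shows "\<exists>Y. cube_attachment \<Gamma> id X Y \<and> lcc \<Gamma> Y \<and> finite (cubes Y) \<and>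
    (\<exists>c\<in>cubes Y. labels Y c = K \<and> e ` K \<subseteq> faces Y c)"
proof -
  interpret lcc \<Gamma> X by fact
  have finK: "finite K" using K(2) by (metis card.infinite not_numeral_le_zero)
  define N where "N = {(L, A). L \<subseteq> K \<and> A \<subseteq> K \<and> \<not> (\<exists>s\<in>K. L \<union> A \<subseteq> {s})}"
  have "N \<subseteq> Pow K \<times> Pow K" by (auto simp: N_def)
  then have finN: "finite N" using finK finite_subset by fastforce
  have "infinite (UNIV - cubes X)" using fin infinite_UNIV by (intro Diff_infinite_finite)
  then obtain nw where nw: "inj_on nw N" "nw ` N \<subseteq> UNIV - cubes X" using infinite_inj_exists[OF finN] by blast
  \<comment> \<open>The complete table of faces of the new cube: a new name on \<open>N\<close>, the
    vertex \<open>v\<close> for the corner 0, and otherwise a face of the glued edge whose label is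
    the only element of \<open>M \<union> C\<close>.\<close>
  define cell where "cell M C = (if (M, C) \<in> N then nw (M, C)
    else if M \<union> C = {} then v else face X M C (e (the_elem (M \<union> C))))" for M C
  \<comment> \<open>A new cell \<open>nw (L, A)\<close> is the face \<open>(L, A)\<close> of the
    cube, so its own faces are found in the table after adding the reflections
    \<open>A\<close>.\<close>
  define Y where "Y = \<lparr>cubes = cubes X \<union> nw ` N,
    labels = (\<lambda>x. if x \<in> cubes X then labels X x else fst (inv_into N nw x)),
    face = (\<lambda>M C x. if x \<in> cubes X then face X M C x
       else cell M (sym_diff (snd (inv_into N nw x)) C))\<rparr>"
  have Yc: "cubes Y = cubes X \<union> nw ` N" by (simp add: Y_def)
  have old: "labels Y x = labels X x" "face Y M C x = face X M C x" if "x \<in> cubes X" for x M C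
    using that by (simp_all add: Y_def)
  have new: "nw (L, A) \<notin> cubes X" "labels Y (nw (L, A)) = L" "face Y M C (nw (L, A)) = cell M (sym_diff A C)"
    if "(L, A) \<in> N" for L A M C
    using that nw by (auto simp: Y_def)
  have es: "e s \<in> cubes X" "labels X (e s) = {s}" "face X {} {} (e s) = v" "e s \<in> edges X" if "s \<in> K" for s
    using e that by (auto simp: edge_start_def intro: edge_cube)
  have oldcell: "cell M C = face X M C (e s)" if "s \<in> K" "M \<subseteq> {s}" "C \<subseteq> {s}" for M C s
  proof -
    have nN: "(M, C) \<notin> N" using that by (auto simp: N_def)
    show ?thesis
    proof (cases "M \<union> C = {}")
      case True
      then have "M = {}" "C = {}" by auto
      then show ?thesis using nN es(3)[OF that(1)] by (simp add: cell_def)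
    next
      case False
      then have "M \<union> C = {s}" using that by auto
      then show ?thesis using nN by (simp add: cell_def)
    qed
  qed
  have cell_cases: thesis if "M \<subseteq> K" "C \<subseteq> K" "(M, C) \<in> N \<Longrightarrow> thesis"
    "\<And>s. s \<in> K \<Longrightarrow> M \<subseteq> {s} \<Longrightarrow> C \<subseteq> {s} \<Longrightarrow> thesis" for M C thesis
  proof (cases "(M, C) \<in> N")
    case False
    with that(1,2) obtain s where "s \<in> K" "M \<union> C \<subseteq> {s}" unfolding N_def by blast
    then show thesis using that(4)[of s] by simp
  qed (use that in blast)
  have cell: "cell M C \<in> cubes Y \<and> labels Y (cell M C) = M \<and>
      (\<forall>M'\<subseteq>M. \<forall>C'\<subseteq>M. face Y M' C' (cell M C) = cell M' (sym_diff C C'))" if MC: "M \<subseteq> K" "C \<subseteq> K" for M C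
  proof (rule cell_cases[OF MC])
    assume N: "(M, C) \<in> N"
    then have "cell M C = nw (M, C)" by (simp add: cell_def)
    then show ?thesis using N new[OF N] Yc by simp
  next
    fix s assume s: "s \<in> K" "M \<subseteq> {s}" "C \<subseteq> {s}"
    then have c: "cell M C = face X M C (e s)" by (rule oldcell)
    have f: "face X M C (e s) \<in> cubes X" "labels X (face X M C (e s)) = M"
      using s es[OF s(1)] by (simp_all add: face_cube face_labels)
    have "face Y M' C' (cell M C) = cell M' (sym_diff C C')" if "M' \<subseteq> M" "C' \<subseteq> M" for M' C'
    proof -
      have "face Y M' C' (cell M C) = face X M' C' (face X M C (e s))" using c old(2)[OF f(1)] by simp
      also have "\<dots> = face X M' (sym_diff C C') (e s)" using s es[OF s(1)] that by (intro face_face) auto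
      also have "\<dots> = cell M' (sym_diff C C')" using s that by (intro oldcell[symmetric]) auto
      finally show ?thesis .
    qed
    then show ?thesis using c f old(1)[OF f(1)] Yc by simp
  qed
  have Ycases: thesis if "x \<in> cubes Y" "x \<in> cubes X \<Longrightarrow> thesis"
    "\<And>L A. (L, A) \<in> N \<Longrightarrow> x = nw (L, A) \<Longrightarrow> L \<subseteq> K \<Longrightarrow> A \<subseteq> K \<Longrightarrow> thesis" for x thesis
    using that unfolding Yc N_def by auto
  have cnw: "cell L A = nw (L, A)" if "(L, A) \<in> N" for L A using that by (simp add: cell_def)
  have lccY: "lcc \<Gamma> Y"
  proof (rule lccI)
    fix x assume x: "x \<in> cubes Y"
    show "clique \<Gamma> (labels Y x)"
    proof (rule Ycases[OF x])
      fix L A assume "(L, A) \<in> N" "x = nw (L, A)" "L \<subseteq> K"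
      then show ?thesis using new(2) K(1) unfolding clique_def by blast
    qed (use label_clique old(1) in simp)
    show "face Y (labels Y x) {} x = x"
      by (rule Ycases[OF x]) (use face_full old new cnw in simp_all)
    show "A = {}" if A: "A \<subseteq> labels Y x" and eq: "face Y (labels Y x) A x = x" for A
    proof (rule Ycases[OF x])
      assume xx: "x \<in> cubes X"
      then show ?thesis using A eq face_free[OF xx] old[OF xx] by simp
    next
      fix L E assume LE: "(L, E) \<in> N" "x = nw (L, E)" "L \<subseteq> K" "E \<subseteq> K"
      then have A: "A \<subseteq> L" and c: "cell L (sym_diff E A) = nw (L, E)" using A eq new(2,3)[OF LE(1)] by simp_all
      have SK: "sym_diff E A \<subseteq> K" using A LE by auto
      show ?thesis
      proof (rule cell_cases[OF LE(3) SK])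
        assume n: "(L, sym_diff E A) \<in> N"
        then have "(L, sym_diff E A) = (L, E)" using c cnw[OF n] inj_onD[OF nw(1) _ n LE(1)] by simp
        then show ?thesis using A by auto
      next
        fix s assume s: "s \<in> K" "L \<subseteq> {s}" "sym_diff E A \<subseteq> {s}"
        then have "cell L (sym_diff E A) \<in> cubes X"
          using oldcell[OF s] es[OF s(1)] by (simp add: face_cube)
        then show ?thesis using c new(1)[OF LE(1)] by simp
      qed
    qed
    fix L A assume L: "L \<subseteq> labels Y x" "A \<subseteq> labels Y x"
    show "face Y L A x \<in> cubes Y \<and> labels Y (face Y L A x) = L"
    proof (rule Ycases[OF x])
      assume xx: "x \<in> cubes X"
      then show ?thesis using L old[OF xx] face_cube[OF xx] face_labels[OF xx] old(1) Yc by simp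
    next
      fix M E assume ME: "(M, E) \<in> N" "x = nw (M, E)" "M \<subseteq> K" "E \<subseteq> K"
      then have "L \<subseteq> K" "sym_diff E A \<subseteq> K" using L new(2)[OF ME(1)] by auto
      then show ?thesis using cell new(3)[OF ME(1)] ME(2) by simp
    qed
    fix M C assume M: "M \<subseteq> L" "C \<subseteq> L"
    show "face Y M C (face Y L A x) = face Y M (sym_diff A C) x"
    proof (rule Ycases[OF x])
      assume xx: "x \<in> cubes X"
      then show ?thesis using L M old[OF xx] face_cube[OF xx] face_face[OF xx] old(2) by simp
    next
      fix M' E assume ME: "(M', E) \<in> N" "x = nw (M', E)" "M' \<subseteq> K" "E \<subseteq> K"
      then have "L \<subseteq> K" "sym_diff E A \<subseteq> K" using L new(2)[OF ME(1)] by auto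
      then have "face Y M C (cell L (sym_diff E A)) = cell M (sym_diff (sym_diff E A) C)" using cell M by blast
      moreover have "sym_diff (sym_diff E A) C = sym_diff E (sym_diff A C)" by auto
      ultimately show ?thesis using new(3)[OF ME(1)] ME(2) by simp
    qed
  qed
  define c where "c = nw (K, {})"
  have KN: "(K, {}) \<in> N"
  proof -
    have "\<not> K \<subseteq> {s}" for s
    proof
      assume "K \<subseteq> {s}"
      then have "card K \<le> card {s}" by (intro card_mono) auto
      then show False using K(2) by simp
    qed
    then show ?thesis by (auto simp: N_def)
  qed
  have cY: "c \<in> cubes Y" "labels Y c = K" using KN new(2) Yc by (auto simp: c_def)
  have cf: "face Y L A c = cell L A" for L A using new(3)[OF KN] by (simp add: c_def)
  have ce: "face Y {s} {} c = e s" if "s \<in> K" for s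
    using cf oldcell[OF that, of "{s}" "{}"] face_full[OF es(1)[OF that]] es(2)[OF that] by simp
  have img: "(\<lambda>(L, A). face Y L A c) ` N = nw ` N" using cf cnw by (intro image_cong) auto
  have "labeled_hom id X Y" unfolding labeled_hom_def using old Yc by simp
  moreover have "inj_on (\<lambda>(L, A). face Y L A c) N"
    using nw(1) by (subst inj_on_cong[where g = nw]) (auto simp: cf cnw)
  moreover have "(\<lambda>(L, A). face Y L A c) ` N \<inter> id ` cubes X = {}" unfolding img using nw(2) by auto
  moreover have "cubes Y = id ` cubes X \<union> (\<lambda>(L, A). face Y L A c) ` N" unfolding img Yc by simp
  moreover have "\<forall>s\<in>K. face Y {s} {} c = id (e s)" using ce by simp
  ultimately have "cube_attachment \<Gamma> id X Y"
    unfolding cube_attachment_def Let_def N_def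
    by (intro conjI bexI[OF _ v] exI[of _ K] exI[of _ e] bexI[OF _ cY(1)] K e cY(2) inj_on_id) assumption+
  moreover have "finite (cubes Y)" using Yc fin finN by simp
  moreover have "e ` K \<subseteq> faces Y c"
  proof
    fix x assume "x \<in> e ` K"
    then obtain s where "s \<in> K" "x = face Y {s} {} c" using ce by auto
    then show "x \<in> faces Y c" using cY(2) by (auto simp: faces_def)
  qed
  ultimately show ?thesis using lccY cY by blast
qed

end


section \<open>Foldedness and cube-fullness of limits\<close>

lemma composite_add: "composite f n (k + j) x = composite f (n + k) j (composite f n k x)"
  by (induction j) (simp_all add: add.assoc)

text \<open>A task for cube-fullness, given as a set of edges rather than as a family indexed by
  labels: it can then be moved along a map by taking images, and its labels are recovered as a union
  in \<open>spans_cube\<close>.\<close>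

definition corner_edges :: "'v pair_pre_digraph \<Rightarrow> ('v, 'c) labeled_complex \<Rightarrow> 'c set \<Rightarrow> bool" where
  "corner_edges \<Gamma> X E \<longleftrightarrow> (\<exists>v\<in>vertices X. \<exists>K e. K \<noteq> {} \<and> clique \<Gamma> K \<and> E = e ` K \<and>
     (\<forall>s\<in>K. e s \<in> edges X \<and> labels X (e s) = {s} \<and> edge_start X (e s) = v))"

definition spans_cube :: "('v, 'c) labeled_complex \<Rightarrow> 'c set \<Rightarrow> bool" where
  "spans_cube X E \<longleftrightarrow> (\<exists>c\<in>cubes X. labels X c = (\<Union>e\<in>E. labels X e) \<and> E \<subseteq> faces X c)"

lemma hom_faces: "labeled_hom f X Y \<Longrightarrow> c \<in> cubes X \<Longrightarrow> x \<in> faces X c \<Longrightarrow> f x \<in> faces Y (f c)"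
proof -
  assume hom: "labeled_hom f X Y" and c: "c \<in> cubes X" and "x \<in> faces X c"
  then obtain L A where x: "x = face X L A c" "L \<subseteq> labels X c" "A \<subseteq> labels X c" by (auto simp: faces_def)
  have "f x = face Y L A (f c)" using hom_face[OF hom c x(2,3)] x(1) by simp
  then show ?thesis unfolding faces_def hom_labels[OF hom c] using x(2,3) by blast
qed

lemma hom_same_geometric:
  "labeled_hom f X Y \<Longrightarrow> c \<in> cubes X \<Longrightarrow> same_geometric_cube X c d \<Longrightarrow> same_geometric_cube Y (f c) (f d)"
  unfolding same_geometric_cube_def by (auto simp: hom_labels hom_face)

lemma hom_corner_edges: "labeled_hom f X Y \<Longrightarrow> corner_edges \<Gamma> X E \<Longrightarrow> corner_edges \<Gamma> Y (f ` E)"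
proof -
  assume hom: "labeled_hom f X Y" and "corner_edges \<Gamma> X E"
  then obtain v K e where v: "v \<in> vertices X" "K \<noteq> {}" "clique \<Gamma> K" "E = e ` K"
    and e: "\<And>s. s \<in> K \<Longrightarrow> e s \<in> edges X \<and> labels X (e s) = {s} \<and> edge_start X (e s) = v"
    unfolding corner_edges_def by blast
  have "f (e s) \<in> edges Y \<and> labels Y (f (e s)) = {s} \<and> edge_start Y (f (e s)) = f v" if "s \<in> K" for s
    using e[OF that] hom_edge[OF hom, of "e s"] hom_labels[OF hom edge_cube, of "e s"] by simp
  then show ?thesis unfolding corner_edges_def
    using v hom_vertex[OF hom v(1)]
    by (intro bexI[of _ "f v"] exI[of _ K] exI[of _ "f \<circ> e"]) (auto simp: image_comp)
qed

lemma hom_spans_cube: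
  assumes hom: "labeled_hom f X Y" and E: "E \<subseteq> cubes X" "spans_cube X E"
  shows "spans_cube Y (f ` E)"
proof -
  obtain c where c: "c \<in> cubes X" "labels X c = (\<Union>e\<in>E. labels X e)" "E \<subseteq> faces X c"
    using E by (auto simp: spans_cube_def)
  have "(\<Union>e\<in>f ` E. labels Y e) = (\<Union>e\<in>E. labels X e)"
    using E(1) hom_labels[OF hom] by auto
  then show ?thesis unfolding spans_cube_def
    using c hom_cube[OF hom c(1)] hom_labels[OF hom c(1)] hom_faces[OF hom c(1)]
    by (intro bexI[of _ "f c"]) auto
qed

lemma corner_edges_cubes: "corner_edges \<Gamma> X E \<Longrightarrow> E \<subseteq> cubes X"
  by (auto simp: corner_edges_def dest: edge_cube)

lemma cube_full_if:
  assumes "\<And>E. corner_edges \<Gamma> X E \<Longrightarrow> spans_cube X E"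
  shows "cube_full \<Gamma> X"
  unfolding cube_full_def
proof (intro ballI allI impI)
  fix v K e
  assume v: "v \<in> vertices X" and K: "K \<noteq> {} \<and> clique \<Gamma> K \<and>
      (\<forall>s\<in>K. e s \<in> edges X \<and> labels X (e s) = {s} \<and> edge_start X (e s) = v)"
  have "corner_edges \<Gamma> X (e ` K)" unfolding corner_edges_def using v K by blast
  from assms[OF this, unfolded spans_cube_def]
  obtain c where "c \<in> cubes X" "labels X c = (\<Union>x\<in>e ` K. labels X x)" "e ` K \<subseteq> faces X c"
    by (elim bexE conjE) (rule that)
  moreover have "(\<Union>x\<in>e ` K. labels X x) = K" using K by simp
  ultimately show "\<exists>c\<in>cubes X. labels X c = K \<and> (\<forall>s\<in>K. e s \<in> faces X c)"
    by (intro bexI[of _ c]) auto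
qed

context operation_limit
begin

lemma limit_lcc: "lcc \<Gamma> L"
proof (rule lccI)
  fix c assume "c \<in> cubes L"
  then obtain n x where x: "x \<in> cubes (Xs n)" "c = g n x" "labels (Xs n) x = labels L c" using limit_onto by blast
  interpret X: lcc \<Gamma> "Xs n" by (rule lcc_stage)
  note hom = limit_hom[of n]
  show "clique \<Gamma> (labels L c)" using X.label_clique[OF x(1)] x(3) by simp
  show "face L (labels L c) {} c = c"
    using hom_face[OF hom x(1), of "labels L c" "{}"] X.face_full[OF x(1)] x by simp
  show "A = {}" if A: "A \<subseteq> labels L c" "face L (labels L c) A c = c" for A
  proof -
    \<comment> \<open>A coincidence of parametrizations in the limit is present at some finite
      stage, where parametrizations are known to be distinct.\<close>
    have "g n (face (Xs n) (labels L c) A x) = g n x"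
      using hom_face[OF hom x(1), of "labels L c" A] A x by simp
    moreover have "face (Xs n) (labels L c) A x \<in> cubes (Xs n)" using X.face_cube[OF x(1)] A x by simp
    ultimately obtain k where k: "composite f n k (face (Xs n) (labels L c) A x) = composite f n k x"
      using limit_eq x(1) by blast
    interpret Y: lcc \<Gamma> "Xs (n + k)" by (rule lcc_stage)
    note ch = composite_hom[of n k]
    have "face (Xs (n + k)) (labels L c) A (composite f n k x) = composite f n k x"
      using k hom_face[OF ch x(1), of "labels L c" A] A x by simp
    then show ?thesis using Y.face_free[OF hom_cube[OF ch x(1)], of A] hom_labels[OF ch x(1)] A x by simp
  qed
  fix B A assume BA: "B \<subseteq> labels L c" "A \<subseteq> labels L c"
  then have BA': "B \<subseteq> labels (Xs n) x" "A \<subseteq> labels (Xs n) x" using x by auto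
  have e: "face L B A c = g n (face (Xs n) B A x)" using hom_face[OF hom x(1) BA'] x by simp
  note y = X.face_cube[OF x(1) BA'] X.face_labels[OF x(1) BA']
  show "face L B A c \<in> cubes L \<and> labels L (face L B A c) = B"
    unfolding e using hom_cube[OF hom y(1)] hom_labels[OF hom y(1)] y(2) by simp
  fix M C assume MC: "M \<subseteq> B" "C \<subseteq> B"
  have S: "sym_diff A C \<subseteq> labels (Xs n) x" "M \<subseteq> labels (Xs n) x" using MC BA' by auto
  have "face L M C (face L B A c) = g n (face (Xs n) M C (face (Xs n) B A x))"
    unfolding e using hom_face[OF hom y(1)] y(2) MC by simp
  also have "\<dots> = g n (face (Xs n) M (sym_diff A C) x)" using X.face_face[OF x(1) BA' MC] by simp
  also have "\<dots> = face L M (sym_diff A C) c" using hom_face[OF hom x(1) S(2,1)] x by simp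
  finally show "face L M C (face L B A c) = face L M (sym_diff A C) c" .
qed

lemma common_stage:
  "finite F \<Longrightarrow> F \<subseteq> cubes L \<Longrightarrow> \<exists>n. \<forall>c\<in>F. \<exists>x\<in>cubes (Xs n). g n x = c"
proof (induction F rule: finite_induct)
  case (insert c F)
  then obtain n where n: "\<forall>c\<in>F. \<exists>x\<in>cubes (Xs n). g n x = c" by auto
  have "c \<in> cubes L" using insert by simp
  then obtain m y where y: "y \<in> cubes (Xs m)" "c = g m y" using limit_onto by blast
  have "\<exists>x\<in>cubes (Xs (n + m)). g (n + m) x = d" if "d \<in> F" for d
  proof -
    from n that obtain x where x: "x \<in> cubes (Xs n)" "g n x = d" by blast
    show ?thesis using hom_cube[OF composite_hom x(1), of m] limit_composite[OF x(1), of m] x(2) by blast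
  qed
  moreover have "\<exists>x\<in>cubes (Xs (n + m)). g (n + m) x = c"
    using hom_cube[OF composite_hom y(1), of n] limit_composite[OF y(1), of n] y(2) by (metis add.commute)
  ultimately show ?case by blast
qed simp

lemma common_eq:
  "finite R \<Longrightarrow> (\<And>x y. (x, y) \<in> R \<Longrightarrow> x \<in> cubes (Xs n) \<and> y \<in> cubes (Xs n) \<and> g n x = g n y) \<Longrightarrow>
    \<exists>k. \<forall>(x, y)\<in>R. composite f n k x = composite f n k y"
proof (induction R rule: finite_induct)
  case (insert p R)
  obtain x y where p: "p = (x, y)" by (cases p)
  obtain k where k: "\<forall>(x, y)\<in>R. composite f n k x = composite f n k y" using insert by auto
  obtain j where j: "composite f n j x = composite f n j y" using limit_eq[of x n y] insert.prems[of x y] p by blast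
  have "composite f n (k + j) a = composite f n (k + j) b" if "(a, b) \<in> R" for a b
    using k that by (auto simp: composite_add)
  moreover have "composite f n (j + k) x = composite f n (j + k) y" using j by (simp only: composite_add)
  ultimately have "\<forall>(x, y)\<in>insert p R. composite f n (k + j) x = composite f n (k + j) y"
    using p by (auto simp: add.commute)
  then show ?case by blast
qed simp

text \<open>Foldedness concerns two cells and finitely many equations between their faces. These
  hold from some stage on, and beyond it there is a folded stage.\<close>

lemma limit_folded:
  assumes fold: "\<And>n. \<exists>m\<ge>n. folded (Xs m)"
  shows "folded L"
proof -
  interpret L: lcc \<Gamma> L by (rule limit_lcc)
  \<comment> \<open>Both clauses of foldedness at once: \<open>I\<close> lists the faces that are
    compared, the start for edges and all proper faces for cubes.\<close>
  have main: "same_geometric_cube L c d"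
    if cd: "c \<in> cubes L" "d \<in> cubes L" and fin: "finite I" "I \<subseteq> Pow (labels L c) \<times> Pow (labels L c)"
      and lab: "labels L d = labels L c"
      and eq: "\<And>B A. (B, A) \<in> I \<Longrightarrow> face L B A c = face L B A d"
      and geo: "\<And>m x y. folded (Xs m) \<Longrightarrow> x \<in> cubes (Xs m) \<Longrightarrow> y \<in> cubes (Xs m) \<Longrightarrow>
        labels (Xs m) x = labels L c \<Longrightarrow> labels (Xs m) y = labels L c \<Longrightarrow>
        (\<And>B A. (B, A) \<in> I \<Longrightarrow> face (Xs m) B A x = face (Xs m) B A y) \<Longrightarrow> same_geometric_cube (Xs m) x y"
    for c d I
  proof -
    obtain n where "\<forall>c\<in>{c, d}. \<exists>x\<in>cubes (Xs n). g n x = c" using common_stage[of "{c, d}"] cd by auto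
    then obtain x y where x: "x \<in> cubes (Xs n)" "g n x = c" and y: "y \<in> cubes (Xs n)" "g n y = d" by auto
    have l: "labels (Xs n) x = labels L c" "labels (Xs n) y = labels L c"
      using hom_labels[OF limit_hom x(1)] hom_labels[OF limit_hom y(1)] x y lab by auto
    interpret X: lcc \<Gamma> "Xs n" by (rule lcc_stage)
    let ?R = "(\<lambda>(B, A). (face (Xs n) B A x, face (Xs n) B A y)) ` I"
    have "\<exists>k. \<forall>(x, y)\<in>?R. composite f n k x = composite f n k y"
    proof (rule common_eq)
      show "finite ?R" using fin by simp
      fix a b assume "(a, b) \<in> ?R"
      then obtain B A where BA: "(B, A) \<in> I" "a = face (Xs n) B A x" "b = face (Xs n) B A y" by auto
      then have s: "B \<subseteq> labels L c" "A \<subseteq> labels L c" using fin(2) by auto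
      then show "a \<in> cubes (Xs n) \<and> b \<in> cubes (Xs n) \<and> g n a = g n b"
        using BA eq[OF BA(1)] X.face_cube x y l hom_face[OF limit_hom x(1), of B A] hom_face[OF limit_hom y(1), of B A] by simp
    qed
    then obtain k where k: "\<forall>(x, y)\<in>?R. composite f n k x = composite f n k y" by blast
    obtain m where m: "m \<ge> n + k" "folded (Xs m)" using fold by blast
    define j where "j = m - (n + k)"
    have mj: "m = n + (k + j)" using m by (simp add: j_def)
    note ch = composite_hom[of n "k + j", folded mj]
    let ?x = "composite f n (k + j) x" and ?y = "composite f n (k + j) y"
    have "same_geometric_cube (Xs m) ?x ?y"
    proof (rule geo[OF m(2)])
      show "?x \<in> cubes (Xs m)" "?y \<in> cubes (Xs m)" "labels (Xs m) ?x = labels L c" "labels (Xs m) ?y = labels L c"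
        using hom_cube[OF ch] hom_labels[OF ch] x y l by simp_all
      fix B A assume BA: "(B, A) \<in> I"
      then have s: "B \<subseteq> labels L c" "A \<subseteq> labels L c" using fin(2) by auto
      have "composite f n k (face (Xs n) B A x) = composite f n k (face (Xs n) B A y)" using k BA by auto
      then have "composite f n (k + j) (face (Xs n) B A x) = composite f n (k + j) (face (Xs n) B A y)"
        by (simp add: composite_add)
      then show "face (Xs m) B A ?x = face (Xs m) B A ?y"
        using hom_face[OF ch x(1), of B A] hom_face[OF ch y(1), of B A] s l by simp
    qed
    then have "same_geometric_cube L (g m ?x) (g m ?y)"
      using hom_same_geometric[OF limit_hom] hom_cube[OF ch x(1)] by blast
    then show ?thesis using limit_composite[OF x(1), of "k + j"] limit_composite[OF y(1), of "k + j"] mj x y by simp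
  qed
  show ?thesis
    unfolding folded_def
  proof (intro conjI ballI impI)
    fix e e' assume e: "e \<in> edges L" "e' \<in> edges L" "labels L e = labels L e' \<and> edge_start L e = edge_start L e'"
    show "same_geometric_cube L e e'"
    proof (rule main[of e e' "{({}, {})}"])
      fix m x y
      assume a: "folded (Xs m)" "x \<in> cubes (Xs m)" "y \<in> cubes (Xs m)"
        "labels (Xs m) x = labels L e" "labels (Xs m) y = labels L e"
        "\<And>B A. (B, A) \<in> {({}, {})} \<Longrightarrow> face (Xs m) B A x = face (Xs m) B A y"
      have "x \<in> edges (Xs m)" "y \<in> edges (Xs m)" using a e(1) by (auto simp: edges_def)
      moreover have "edge_start (Xs m) x = edge_start (Xs m) y" using a(6) by (simp add: edge_start_def)
      ultimately show "same_geometric_cube (Xs m) x y" using a by (simp add: folded_def)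
    qed (use e edge_cube in \<open>auto simp: edge_start_def\<close>)
  next
    fix c d assume cd: "c \<in> cubes L" "d \<in> cubes L" "2 \<le> card (labels L c) \<and> same_boundary L c d"
    let ?K = "labels L c"
    let ?I = "{B. B \<subset> ?K} \<times> Pow ?K"
    show "same_geometric_cube L c d"
    proof (rule main[of c d ?I])
      show "finite ?I"
      proof -
        have "?I \<subseteq> Pow ?K \<times> Pow ?K" by auto
        then show ?thesis using L.finite_labels[OF cd(1)] finite_subset by fastforce
      qed
      show "labels L d = ?K" using cd(3) by (simp add: same_boundary_def)
      show "face L B A c = face L B A d" if "(B, A) \<in> ?I" for B A
        using cd(3) that by (simp add: same_boundary_def)
      fix m x y
      assume a: "folded (Xs m)" "x \<in> cubes (Xs m)" "y \<in> cubes (Xs m)"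
        "labels (Xs m) x = ?K" "labels (Xs m) y = ?K"
        "\<And>B A. (B, A) \<in> ?I \<Longrightarrow> face (Xs m) B A x = face (Xs m) B A y"
      have "same_boundary (Xs m) x y" using a(4-6) by (simp add: same_boundary_def)
      then show "same_geometric_cube (Xs m) x y" using a cd(3) by (simp add: folded_def)
    qed (use cd in auto)
  qed
qed

lemma limit_cube_full:
  assumes task: "\<And>n E. corner_edges \<Gamma> (Xs n) E \<Longrightarrow> \<exists>k. spans_cube (Xs (n + k)) (composite f n k ` E)"
  shows "cube_full \<Gamma> L"
proof (rule cube_full_if)
  fix E assume "corner_edges \<Gamma> L E"
  then obtain v K e where v: "v \<in> vertices L" and K: "K \<noteq> {}" "clique \<Gamma> K" "E = e ` K"
    and e: "\<And>s. s \<in> K \<Longrightarrow> e s \<in> edges L \<and> labels L (e s) = {s} \<and> edge_start L (e s) = v"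
    unfolding corner_edges_def by blast
  have finK: "finite K" using K(2) finite_subset[OF _ finite_pverts] by (auto simp: clique_def)
  have "insert v (e ` K) \<subseteq> cubes L"
    using v edge_cube[OF e[THEN conjunct1]] by (auto simp: vertices_def)
  then obtain n where n: "\<forall>c\<in>insert v (e ` K). \<exists>x\<in>cubes (Xs n). g n x = c"
    using common_stage[of "insert v (e ` K)"] finK by auto
  then obtain u where u: "u \<in> cubes (Xs n)" "g n u = v" by auto
  have uv: "u \<in> vertices (Xs n)" using hom_labels[OF limit_hom u(1)] u v by (simp add: vertices_def)
  have "\<forall>s\<in>K. \<exists>x. x \<in> cubes (Xs n) \<and> g n x = e s" using n by blast
  from bchoice[OF this] obtain x where x: "\<forall>s\<in>K. x s \<in> cubes (Xs n) \<and> g n (x s) = e s" by (rule exE)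
  have xe: "x s \<in> edges (Xs n)" "labels (Xs n) (x s) = {s}" "g n (edge_start (Xs n) (x s)) = v" if s: "s \<in> K" for s
  proof -
    show l: "labels (Xs n) (x s) = {s}" using hom_labels[OF limit_hom, of "x s" n] x e s by simp
    then show xe: "x s \<in> edges (Xs n)" using x s by (auto simp: edges_def)
    show "g n (edge_start (Xs n) (x s)) = v" using hom_edge(2)[OF limit_hom xe] x e s by simp
  qed
  have starts: "edge_start (Xs n) (x s) \<in> cubes (Xs n)" if "s \<in> K" for s
    using lcc.edge_rev_props(6)[OF lcc_stage xe(1)[OF that]] by (simp add: vertices_def)
  \<comment> \<open>The edges lifted to stage \<open>n\<close> need not share their start yet; after
    \<open>k\<close> more steps they do, and form a task of that stage.\<close>
  have "\<exists>k. \<forall>(a, b)\<in>(\<lambda>s. (edge_start (Xs n) (x s), u)) ` K. composite f n k a = composite f n k b"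
    by (rule common_eq) (use finK xe starts u in auto)
  then obtain k where k: "\<And>s. s \<in> K \<Longrightarrow> composite f n k (edge_start (Xs n) (x s)) = composite f n k u" by auto
  let ?c = "composite f n k"
  note ch = composite_hom[of n k]
  have "corner_edges \<Gamma> (Xs (n + k)) ((\<lambda>s. ?c (x s)) ` K)"
    unfolding corner_edges_def
  proof (intro bexI[OF _ hom_vertex[OF ch uv]] exI conjI ballI)
    fix s assume s: "s \<in> K"
    show "?c (x s) \<in> edges (Xs (n + k))" "labels (Xs (n + k)) (?c (x s)) = {s}"
      "edge_start (Xs (n + k)) (?c (x s)) = ?c u"
      using hom_edge[OF ch xe(1)[OF s]] hom_labels[OF ch edge_cube[OF xe(1)[OF s]]] xe(2)[OF s] k[OF s] by auto
  qed (use K in auto)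
  then obtain j where j: "spans_cube (Xs (n + k + j)) (composite f (n + k) j ` (\<lambda>s. ?c (x s)) ` K)" using task by blast
  let ?E = "composite f (n + k) j ` (\<lambda>s. ?c (x s)) ` K"
  have "?E \<subseteq> cubes (Xs (n + k + j))"
    using x hom_cube[OF ch] hom_cube[OF composite_hom[of "n + k" j]] by auto
  then have "spans_cube L (g (n + k + j) ` ?E)" using hom_spans_cube[OF limit_hom] j by blast
  moreover have "g (n + k + j) ` ?E = E"
  proof -
    have "g (n + k + j) (composite f (n + k) j (?c (x s))) = e s" if "s \<in> K" for s
      using limit_composite[of "?c (x s)" "n + k" j] limit_composite[of "x s" n k] hom_cube[OF ch, of "x s"] x that by simp
    then show ?thesis unfolding K(3) image_image by (intro image_cong) auto
  qed
  ultimately show "spans_cube L E" by simp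
qed

end

context right_angled
begin

subsection \<open>Direct limits\<close>

text \<open>The cells of the limit are classes of pairs of a stage and a cell. All stages are
  finite, so there are countably many classes, and these are injected into the infinite
  type.\<close>

lemma direct_limit_exists:
  fixes Xs :: "nat \<Rightarrow> ('v, 'd :: infinite) labeled_complex"
  assumes hom: "\<And>n. labeled_hom (f n) (Xs n) (Xs (Suc n))" and fin: "\<And>n. finite (cubes (Xs n))"
    and lccs: "\<And>n. lcc \<Gamma> (Xs n)"
  shows "\<exists>L g. direct_limit Xs f L g"
proof -
  define E where "E = Sigma UNIV (\<lambda>n. cubes (Xs n))"
  \<comment> \<open>Two cells belong to one class when they become equal at a common later stage
    \<open>n + k = m + l\<close>.\<close>
  define cls where "cls n x = {(m, y) \<in> E. \<exists>k l. n + k = m + l \<and> composite f n k x = composite f m l y}" for n x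
  have chom: "labeled_hom (composite f n k) (Xs n) (Xs (n + k))" for n k
  proof (induction k)
    case (Suc k)
    show ?case using hom_comp[OF Suc hom[of "n + k"]] by (simp only: composite.simps add_Suc_right)
  qed (use hom_id in \<open>simp only: composite.simps add_0_right\<close>)
  have eq1: "\<exists>k l. n + k = m + l \<and> composite f n k x = composite f m l y"
    if "cls n x = cls m y" "x \<in> cubes (Xs n)" "y \<in> cubes (Xs m)" for n x m y
  proof -
    have "(m, y) \<in> cls m y" using that(3) unfolding cls_def E_def by auto
    then have "(m, y) \<in> cls n x" using that(1) by simp
    then show ?thesis unfolding cls_def by auto
  qed
  have sub: "cls n x \<subseteq> cls m y"
    if kl: "n + k = m + l" "composite f n k x = composite f m l y" for n x m y k l
  proof
    fix p assume "p \<in> cls n x"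
    then obtain i z a b where p: "p = (i, z)" "(i, z) \<in> E" "n + a = i + b" "composite f n a x = composite f i b z"
      unfolding cls_def by auto
    have "composite f m (l + a) y = composite f (m + l) a (composite f n k x)" using kl by (simp add: composite_add)
    also have "\<dots> = composite f n (k + a) x" using kl by (simp add: composite_add)
    also have "\<dots> = composite f n (a + k) x" by (simp add: add.commute)
    also have "\<dots> = composite f i (b + k) z" using p(3,4) by (simp add: composite_add)
    finally have "composite f m (l + a) y = composite f i (b + k) z" .
    moreover have "m + (l + a) = i + (b + k)" using kl(1) p(3) by linarith
    ultimately show "p \<in> cls m y" unfolding cls_def using p(1,2) by blast
  qed
  have eq2: "cls n x = cls m y" if "n + k = m + l" "composite f n k x = composite f m l y" for n x m y k l
    using sub[OF that] sub[OF that(1)[symmetric] that(2)[symmetric]] by blast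
  let ?C = "(\<lambda>(n, x). cls n x) ` E"
  have "countable E" unfolding E_def using fin by (intro countable_SIGMA) (auto intro: countable_finite)
  then have "countable ?C" by simp
  then have "inj_on (to_nat_on ?C) ?C" by (rule inj_on_to_nat_on)
  moreover obtain h :: "nat \<Rightarrow> 'd" where "inj h" using infinite_countable_subset[OF infinite_UNIV] by blast
  ultimately have \<iota>: "inj_on (h \<circ> to_nat_on ?C) ?C" by (intro comp_inj_on) (auto intro: inj_on_subset)
  define g where "g n x = (h \<circ> to_nat_on ?C) (cls n x)" for n x
  have g_eq: "g n x = g m y \<longleftrightarrow> (\<exists>k l. n + k = m + l \<and> composite f n k x = composite f m l y)"
    if "x \<in> cubes (Xs n)" "y \<in> cubes (Xs m)" for n m x y
  proof
    assume eq: "g n x = g m y"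
    have C: "cls n x \<in> ?C" "cls m y \<in> ?C" using that by (auto simp: E_def)
    have "cls n x = cls m y" by (rule inj_onD[OF \<iota> eq[unfolded g_def] C])
    then show "\<exists>k l. n + k = m + l \<and> composite f n k x = composite f m l y" using eq1 that by blast
  next
    assume "\<exists>k l. n + k = m + l \<and> composite f n k x = composite f m l y"
    then have "cls n x = cls m y" using eq2 by blast
    then show "g n x = g m y" by (simp add: g_def)
  qed
  define rep where "rep c = (SOME p. p \<in> E \<and> g (fst p) (snd p) = c)" for c
  define L where "L = \<lparr>cubes = (\<Union>n. g n ` cubes (Xs n)),
    labels = (\<lambda>c. labels (Xs (fst (rep c))) (snd (rep c))),
    face = (\<lambda>B A c. g (fst (rep c)) (face (Xs (fst (rep c))) B A (snd (rep c))))\<rparr>"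
  have rep: "snd (rep (g n x)) \<in> cubes (Xs (fst (rep (g n x)))) \<and> g (fst (rep (g n x))) (snd (rep (g n x))) = g n x"
    if "x \<in> cubes (Xs n)" for n x
  proof -
    have "rep (g n x) \<in> E \<and> g (fst (rep (g n x))) (snd (rep (g n x))) = g n x"
      unfolding rep_def by (rule someI[of _ "(n, x)"]) (use that in \<open>simp add: E_def\<close>)
    then show ?thesis by (cases "rep (g n x)") (simp add: E_def)
  qed
  have well: "labels (Xs n) x = labels (Xs m) y \<and>
      (\<forall>B\<subseteq>labels (Xs n) x. \<forall>A\<subseteq>labels (Xs n) x. g n (face (Xs n) B A x) = g m (face (Xs m) B A y))"
    if x: "x \<in> cubes (Xs n)" and y: "y \<in> cubes (Xs m)" and eq: "g n x = g m y" for n m x y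
  proof -
    obtain k l where kl: "n + k = m + l" "composite f n k x = composite f m l y" using g_eq[OF x y] eq by blast
    have lab: "labels (Xs n) x = labels (Xs m) y"
      using hom_labels[OF chom x, of k] hom_labels[OF chom y, of l] kl by simp
    have "g n (face (Xs n) B A x) = g m (face (Xs m) B A y)" if BA: "B \<subseteq> labels (Xs n) x" "A \<subseteq> labels (Xs n) x" for B A
    proof -
      have "composite f n k (face (Xs n) B A x) = composite f m l (face (Xs m) B A y)"
        using hom_face[OF chom x BA, of k] hom_face[OF chom y, of B A l] BA lab kl by simp
      then show ?thesis
        using g_eq[OF lcc.face_cube[OF lccs x BA] lcc.face_cube[OF lccs y, of B A]] BA lab kl(1) by blast
    qed
    with lab show ?thesis by blast
  qed
  have "labeled_hom (g n) (Xs n) L" for n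
    unfolding labeled_hom_def
  proof (intro ballI conjI allI impI)
    fix x assume x: "x \<in> cubes (Xs n)"
    show "g n x \<in> cubes L" using x by (auto simp: L_def)
    note r = rep[OF x]
    note w = well[OF r[THEN conjunct1] x r[THEN conjunct2]]
    show lab: "labels L (g n x) = labels (Xs n) x" using w by (simp add: L_def)
    fix B A assume BA: "B \<subseteq> labels (Xs n) x" "A \<subseteq> labels (Xs n) x"
    show "g n (face (Xs n) B A x) = face L B A (g n x)"
      using w BA by (simp add: L_def)
  qed
  moreover have "g (Suc n) (f n x) = g n x" if "x \<in> cubes (Xs n)" for n x
  proof -
    have "f n x \<in> cubes (Xs (Suc n))" using hom_cube[OF hom that] .
    moreover have "Suc n + 0 = n + 1 \<and> composite f (Suc n) 0 (f n x) = composite f n 1 x" by simp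
    ultimately show ?thesis using g_eq that by blast
  qed
  moreover have "\<exists>k. composite f n k x = composite f n k y"
    if "x \<in> cubes (Xs n)" "y \<in> cubes (Xs n)" "g n x = g n y" for n x y
    using g_eq[OF that(1,2)] that(3) by auto
  moreover have "cubes L = (\<Union>n. g n ` cubes (Xs n))" by (simp add: L_def)
  ultimately have "direct_limit Xs f L g" unfolding direct_limit_def by blast
  then show ?thesis by blast
qed

subsection \<open>Completing a finite complex\<close>

text \<open>
  States carry a list of pending sets of edges to which a cube has to be attached.  The pair (length of
  the list, number of cells) decreases lexicographically until the complex is folded and the list is
  empty; then all sets of edges become pending.
\<close>

definition next_state :: "('v, 'd) labeled_complex \<times> 'd set list \<Rightarrow> ('d \<Rightarrow> 'd) \<Rightarrow> ('v, 'd) labeled_complex \<times> 'd set list \<Rightarrow> bool" where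
  "next_state S f T \<longleftrightarrow> (case (S, T) of ((X, ps), (Y, qs)) \<Rightarrow>
     (operation \<Gamma> f X Y \<or> Y = X \<and> f = id) \<and>
     (if \<not> folded X then qs = map (image f) ps \<and> card (cubes Y) < card (cubes X)
      else if ps \<noteq> [] then qs = map (image f) (tl ps) \<and> (corner_edges \<Gamma> X (hd ps) \<longrightarrow> spans_cube Y (f ` hd ps))
      else Y = X \<and> f = id \<and> set qs = Pow (edges X)))"

lemma next_state_exists:
  fixes X :: "('v, 'd :: infinite) labeled_complex"
  assumes X: "lcc \<Gamma> X" and fin: "finite (cubes X)"
  shows "\<exists>f Y qs. lcc \<Gamma> Y \<and> finite (cubes Y) \<and> next_state (X, ps) f (Y, qs)"
proof -
  interpret lcc \<Gamma> X by fact
  consider "\<not> folded X" | "folded X" "ps = []" | "folded X" "ps \<noteq> []" by blast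
  then show ?thesis
  proof cases
    case 1
    \<comment> \<open>A fold or identification is onto but not injective, so the finite number of
      cells drops.\<close>
    have "\<exists>q Y. operation \<Gamma> q X Y \<and> q ` cubes X = cubes Y \<and> \<not> inj_on q (cubes X) \<and> lcc \<Gamma> Y"
    proof (cases "\<forall>e\<in>edges X. \<forall>e'\<in>edges X. labels X e = labels X e' \<and> edge_start X e = edge_start X e' \<longrightarrow> same_geometric_cube X e e'")
      case False
      then obtain e1 e2 where e: "e1 \<in> edges X" "e2 \<in> edges X" "labels X e1 = labels X e2"
        "edge_start X e1 = edge_start X e2" "\<not> same_geometric_cube X e1 e2" by blast
      then obtain q Y where q: "fold_operation q X Y" "lcc \<Gamma> Y" using fold_exists[OF X] by blast
      from q(1)[unfolded fold_operation_def] obtain a b where ab: "q ` cubes X = cubes Y" "a \<in> edges X" "b \<in> edges X"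
        "\<not> same_geometric_cube X a b"
        "\<forall>x\<in>cubes X. \<forall>y\<in>cubes X. q x = q y \<longleftrightarrow>
           x = y \<or> {x, y} = {a, b} \<or> {x, y} = {edge_rev X a, edge_rev X b} \<or>
           {x, y} = {edge_end X a, edge_end X b}"
        by (elim conjE bexE exE) (rule that; assumption)
      have ac: "a \<in> cubes X" "b \<in> cubes X" using edge_cube[OF ab(2)] edge_cube[OF ab(3)] .
      then have "q a = q b" using ab(5)[rule_format, OF ac] by simp
      moreover have "same_geometric_cube X a a"
        unfolding same_geometric_cube_def using face_full[OF ac(1)] by (intro exI[of _ "{}"]) simp
      then have "a \<noteq> b" using ab(4) by blast
      ultimately have "\<not> inj_on q (cubes X)" using ac by (auto dest: inj_onD)
      then show ?thesis using q ab(1) by (auto simp: operation_def)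
    next
      case True
      have "\<not> (\<forall>c\<in>cubes X. \<forall>d\<in>cubes X. 2 \<le> card (labels X c) \<and> same_boundary X c d \<longrightarrow> same_geometric_cube X c d)"
        using 1 True unfolding folded_def by argo
      then obtain c d where cd: "c \<in> cubes X" "d \<in> cubes X" "2 \<le> card (labels X c)" "same_boundary X c d"
        "\<not> same_geometric_cube X c d" by blast
      then obtain q Y where q: "cube_identification q X Y" "lcc \<Gamma> Y" using identification_exists[OF X] by blast
      from q(1)[unfolded cube_identification_def] obtain P K p p' where ab: "q ` cubes X = cubes Y" "P \<subseteq> cubes X" "p \<in> P" "p' \<in> P"
        "p \<noteq> p'" "\<forall>p\<in>P. labels X p = K"
        "\<forall>x\<in>cubes X. \<forall>y\<in>cubes X. q x = q y \<longleftrightarrow>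
           x = y \<or> (\<exists>p\<in>P. \<exists>p'\<in>P. \<exists>A\<subseteq>K. x = face X K A p \<and> y = face X K A p')"
        by (elim conjE bexE exE) (rule that; assumption)
      have pc: "p \<in> cubes X" "p' \<in> cubes X" using ab by blast+
      have "p = face X K {} p" "p' = face X K {} p'" using face_full[OF pc(1)] face_full[OF pc(2)] ab(3,4,6) by simp_all
      then have "\<exists>x\<in>P. \<exists>y\<in>P. \<exists>A\<subseteq>K. p = face X K A x \<and> p' = face X K A y"
        using ab(3,4) by (intro bexI[of _ p] bexI[of _ p'] exI[of _ "{}"]) auto
      then have "q p = q p'" using ab(7)[rule_format, OF pc] by simp
      then have "\<not> inj_on q (cubes X)" using pc ab(5) by (auto dest: inj_onD)
      then show ?thesis using q ab(1) by (auto simp: operation_def)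
    qed
    then obtain q Y where q: "operation \<Gamma> q X Y" "q ` cubes X = cubes Y" "\<not> inj_on q (cubes X)" "lcc \<Gamma> Y" by blast
    have "card (cubes Y) \<le> card (cubes X)" using card_image_le[OF fin, of q] q(2) by simp
    moreover have "card (cubes Y) \<noteq> card (cubes X)" using eq_card_imp_inj_on[OF fin, of q] q(2,3) by auto
    ultimately have "card (cubes Y) < card (cubes X)" by simp
    moreover have "finite (cubes Y)" using q(2) fin by (metis finite_imageI)
    ultimately show ?thesis using 1 q unfolding next_state_def by auto
  next
    case 2
    have "finite (edges X)" using fin by (simp add: edges_def)
    then obtain qs where "set qs = Pow (edges X)" using finite_list[of "Pow (edges X)"] by auto
    then show ?thesis using 2 X fin unfolding next_state_def by auto
  next
    case 3
    have "\<exists>f Y. (operation \<Gamma> f X Y \<or> Y = X \<and> f = id) \<and> lcc \<Gamma> Y \<and> finite (cubes Y) \<and>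
      (corner_edges \<Gamma> X (hd ps) \<longrightarrow> spans_cube Y (f ` hd ps))"
    proof (cases "corner_edges \<Gamma> X (hd ps)")
      case False
      then show ?thesis using X fin by blast
    next
      case True
      then obtain v K e where v: "v \<in> vertices X" "K \<noteq> {}" "clique \<Gamma> K" and h: "hd ps = e ` K"
        and e: "\<forall>s\<in>K. e s \<in> edges X \<and> labels X (e s) = {s} \<and> edge_start X (e s) = v"
        unfolding corner_edges_def by blast
      have lab: "(\<Union>x\<in>hd ps. labels X x) = K" unfolding h using e by simp
      show ?thesis
      proof (cases "2 \<le> card K")
        case True
        then obtain Y c where Y: "cube_attachment \<Gamma> id X Y" "lcc \<Gamma> Y" "finite (cubes Y)"
          "c \<in> cubes Y" "labels Y c = K" "e ` K \<subseteq> faces Y c"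
          using attachment_exists[OF X fin v(3) True v(1) e] by blast
        have hom: "labeled_hom id X Y" using Y(1) by (simp add: cube_attachment_def)
        have "(\<Union>x\<in>hd ps. labels Y x) = (\<Union>x\<in>hd ps. labels X x)"
          using hom_labels[OF hom] e h edge_cube by (intro SUP_cong) fastforce+
        then have "spans_cube Y (id ` hd ps)" unfolding spans_cube_def using Y lab h by auto
        then show ?thesis using Y by (intro exI[of _ id] exI[of _ Y]) (simp add: operation_def)
      next
        case False
        \<comment> \<open>A single edge is a cube that is spanned by itself, and an identity step
          does.\<close>
        have "finite K" using v(3) finite_subset[OF _ finite_pverts] by (auto simp: clique_def)
        then have "card K = 1" using False v(2) by (metis One_nat_def Suc_1 card_eq_0_iff le_less_Suc_eq less_one linorder_not_le nat_less_le not_less_eq_eq)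
        then obtain s where s: "K = {s}" by (auto simp: card_1_singleton_iff)
        have es: "e s \<in> edges X" "labels X (e s) = {s}" using e s by auto
        have "spans_cube X (id ` hd ps)"
          unfolding spans_cube_def using es edge_cube[OF es(1)] edge_faces(1)[OF es(1)] h s by auto
        then show ?thesis using X fin by blast
      qed
    qed
    then show ?thesis using 3 unfolding next_state_def by auto
  qed
qed

text \<open>The list of pending tasks becomes empty infinitely often, each time at a folded stage. A
  task present at any stage survives to the next such time, is put on the list, and is done when the
  list is empty again.\<close>

lemma completion_exists:
  fixes X0 :: "('v, 'd :: infinite) labeled_complex"
  assumes X0: "lcc \<Gamma> X0" "finite (cubes X0)"
  shows "\<exists>Xs f L g. operation_sequence \<Gamma> Xs f \<and> Xs 0 = X0 \<and> direct_limit Xs f L g \<and>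
    lcc \<Gamma> L \<and> folded L \<and> cube_full \<Gamma> L"
proof -
  have "\<exists>F. \<forall>n. ((\<lambda>(X, ps, f). lcc \<Gamma> X \<and> finite (cubes X) \<and> (n = 0 \<longrightarrow> X = X0)) (F n)) \<and>
    (case (F n, F (Suc n)) of ((X, ps, _), (Y, qs, f)) \<Rightarrow> next_state (X, ps) f (Y, qs))"
  proof (rule dependent_nat_choice)
    show "\<exists>x :: ('v, 'd) labeled_complex \<times> 'd set list \<times> ('d \<Rightarrow> 'd). case x of (X, ps, f) \<Rightarrow> lcc \<Gamma> X \<and> finite (cubes X) \<and> (0 = 0 \<longrightarrow> X = X0)"
      using X0 by (intro exI[of _ "(X0, [], id)"]) simp
    fix S :: "('v, 'd) labeled_complex \<times> 'd set list \<times> ('d \<Rightarrow> 'd)" and n :: nat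
    assume S: "case S of (X, ps, f) \<Rightarrow> lcc \<Gamma> X \<and> finite (cubes X) \<and> (n = 0 \<longrightarrow> X = X0)"
    obtain X ps f0 where S': "S = (X, ps, f0)" by (rule prod_cases3)
    then have X: "lcc \<Gamma> X" "finite (cubes X)" using S by simp_all
    obtain f Y qs where "lcc \<Gamma> Y" "finite (cubes Y)" "next_state (X, ps) f (Y, qs)"
      using next_state_exists[OF X, of ps] by (elim exE conjE) (rule that)
    then show "\<exists>T. (case T of (X, ps, f) \<Rightarrow> lcc \<Gamma> X \<and> finite (cubes X) \<and> (Suc n = 0 \<longrightarrow> X = X0)) \<and>
        (case (S, T) of ((X, ps, _), (Y, qs, f)) \<Rightarrow> next_state (X, ps) f (Y, qs))"
      using S' by (intro exI[of _ "(Y, qs, f)"]) simp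
  qed
  then obtain F where F: "\<forall>n. ((\<lambda>(X, ps, f). lcc \<Gamma> X \<and> finite (cubes X) \<and> (n = 0 \<longrightarrow> X = X0)) (F n)) \<and>
    (case (F n, F (Suc n)) of ((X, ps, _), (Y, qs, f)) \<Rightarrow> next_state (X, ps) f (Y, qs))"
    by (rule exE)
  \<comment> \<open>A state carries the map by which it was reached, so the map \<open>f n\<close>
    out of stage \<open>n\<close> is stored in the state at \<open>Suc n\<close>.\<close>
  define Xs ps f where "Xs n = fst (F n)" and "ps n = fst (snd (F n))" and "f n = snd (snd (F (Suc n)))" for n
  have Xs: "lcc \<Gamma> (Xs n)" "finite (cubes (Xs n))" "Xs 0 = X0" for n
    using F[rule_format, of n] F[rule_format, of 0] by (simp_all add: Xs_def split_beta)
  have nxt: "next_state (Xs n, ps n) (f n) (Xs (Suc n), ps (Suc n))" for n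
    using F[rule_format, of n] by (simp add: Xs_def ps_def f_def split_beta)
  have op: "operation \<Gamma> (f n) (Xs n) (Xs (Suc n)) \<or> Xs (Suc n) = Xs n \<and> f n = id" for n
    using nxt[of n] by (simp add: next_state_def)
  have seq: "operation_sequence \<Gamma> Xs f"
    unfolding operation_sequence_def using op Xs(1) lcc.lcc by blast
  have hom: "labeled_hom (f n) (Xs n) (Xs (Suc n))" for n
    using op[of n] hom_id by (auto simp: operation_def fold_operation_def cube_identification_def cube_attachment_def)
  obtain L g where lim: "direct_limit Xs f L g" using direct_limit_exists[of f Xs, OF hom Xs(2,1)] by blast
  interpret operation_limit \<Gamma> Xs f L g using seq lim by unfold_locales
  have step_fold: "length (ps (Suc n)) = length (ps n) \<and> card (cubes (Xs (Suc n))) < card (cubes (Xs n))" if "\<not> folded (Xs n)" for n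
    using nxt[of n] that by (simp add: next_state_def)
  have fold1: "\<exists>m\<ge>n. folded (Xs m) \<and> length (ps m) = length (ps n)" for n
  proof (induction "card (cubes (Xs n))" arbitrary: n rule: less_induct)
    case less
    show ?case
    proof (cases "folded (Xs n)")
      case False
      then obtain m where "m \<ge> Suc n" "folded (Xs m)" "length (ps m) = length (ps (Suc n))"
        using less[of "Suc n"] step_fold by blast
      then show ?thesis using step_fold[OF False] by (intro exI[of _ m]) auto
    qed auto
  qed
  \<comment> \<open>An attachment may add cells, but it shortens the list; folding in between does
    not lengthen it.\<close>
  have rounds: "\<exists>m\<ge>n. folded (Xs m) \<and> ps m = []" for n
  proof (induction "length (ps n)" arbitrary: n rule: less_induct)
    case less
    obtain m where m: "m \<ge> n" "folded (Xs m)" "length (ps m) = length (ps n)" using fold1 by blast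
    show ?case
    proof (cases "ps m = []")
      case True
      then show ?thesis using m by blast
    next
      case False
      then have "ps (Suc m) = map (image (f m)) (tl (ps m))" using nxt[of m] m(2) by (simp add: next_state_def)
      then have "length (ps (Suc m)) < length (ps n)" using False m(3) by (cases "ps m") auto
      then obtain m' where "m' \<ge> Suc m" "folded (Xs m')" "ps m' = []" using less by blast
      then show ?thesis using m(1) by (intro exI[of _ m']) auto
    qed
  qed
  have "folded L" by (rule limit_folded) (use rounds in blast)
  moreover have "cube_full \<Gamma> L"
  proof (rule limit_cube_full)
    fix n E assume E: "corner_edges \<Gamma> (Xs n) E"
    obtain m where m: "m \<ge> n" "folded (Xs m)" "ps m = []" using rounds by blast
    define i where "i = m - n"
    have mi: "m = n + i" using m by (simp add: i_def)
    define E1 where "E1 = composite f n i ` E"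
    have E1: "corner_edges \<Gamma> (Xs m) E1" unfolding E1_def mi by (rule hom_corner_edges[OF composite_hom E])
    have n1: "Xs (Suc m) = Xs m" "f m = id" "set (ps (Suc m)) = Pow (edges (Xs m))"
      using nxt[of m] m by (auto simp: next_state_def)
    have start: "E1 \<in> set (ps (Suc m))" "corner_edges \<Gamma> (Xs (Suc m)) E1"
      using E1 n1 unfolding corner_edges_def by auto
    \<comment> \<open>After the list is refilled, the image of the task is either still pending or
      already spans a cube, and cubes persist under the maps. An empty list leaves only the second
      possibility.\<close>
    have inv: "composite f (Suc m) k ` E1 \<in> set (ps (Suc m + k)) \<or> spans_cube (Xs (Suc m + k)) (composite f (Suc m) k ` E1)" for k
    proof (induction k)
      case 0
      then show ?case using start by simp
    next
      case (Suc k)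
      let ?M = "Suc m + k" and ?E = "composite f (Suc m) k ` E1"
      have E': "corner_edges \<Gamma> (Xs ?M) ?E" by (rule hom_corner_edges[OF composite_hom start(2)])
      have img: "composite f (Suc m) (Suc k) ` E1 = f ?M ` ?E" by (simp add: image_comp)
      have "f ?M ` ?E \<in> set (ps (Suc ?M)) \<or> spans_cube (Xs (Suc ?M)) (f ?M ` ?E)"
        using Suc
      proof
        assume "spans_cube (Xs ?M) ?E"
        then show ?thesis using hom_spans_cube[OF hom corner_edges_cubes[OF E']] by blast
      next
        assume mem: "?E \<in> set (ps ?M)"
        show ?thesis
        proof (cases "folded (Xs ?M)")
          case False
          then have "ps (Suc ?M) = map (image (f ?M)) (ps ?M)" using nxt[of ?M] by (simp add: next_state_def)
          then show ?thesis using mem by simp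
        next
          case True
          then obtain E0 qs where c: "ps ?M = E0 # qs" using mem by (cases "ps ?M") auto
          then have "ps (Suc ?M) = map (image (f ?M)) qs \<and> (corner_edges \<Gamma> (Xs ?M) E0 \<longrightarrow> spans_cube (Xs (Suc ?M)) (f ?M ` E0))"
            using nxt[of ?M] True by (simp add: next_state_def)
          then show ?thesis using mem c E' by auto
        qed
      qed
      then show ?case unfolding img by simp
    qed
    obtain m' where m': "m' \<ge> Suc m" "ps m' = []" using rounds by blast
    define k where "k = m' - Suc m"
    have mk: "m' = Suc m + k" using m' by (simp add: k_def)
    have "spans_cube (Xs m') (composite f (Suc m) k ` E1)" using inv[of k] m'(2) unfolding mk by simp
    moreover have "composite f n (i + Suc k) x = composite f (Suc m) k (composite f n i x)" for x
    proof -
      have "composite f n (i + (1 + k)) x = composite f (n + i + 1) k (composite f (n + i) 1 (composite f n i x))"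
        unfolding composite_add by (simp add: add.assoc)
      then show ?thesis using n1(2) unfolding mi by simp
    qed
    then have "composite f n (i + Suc k) ` E = composite f (Suc m) k ` E1" unfolding E1_def image_image by simp
    moreover have "n + (i + Suc k) = m'" using mk mi by simp
    ultimately show "\<exists>k. spans_cube (Xs (n + k)) (composite f n k ` E)" by metis
  qed
  ultimately show ?thesis using seq lim Xs(3) limit_lcc by blast
qed

subsection \<open>Roses\<close>

lemma rose_finite: "finite S \<Longrightarrow> finite (cubes (rose S))"
proof -
  assume S: "finite S"
  let ?I = "SIGMA w:S. {..<length w}"
  have "cubes (rose S) \<subseteq> insert Hub ((\<lambda>(w, i). Knot w i) ` ?I \<union> (\<lambda>((w, i), r). Seg w i r) ` (?I \<times> UNIV))"
  proof
    fix c assume "c \<in> cubes (rose S)"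
    then consider "c = Hub" | w i where "c = Knot w i" "w \<in> S" "i < length w"
      | w i r where "c = Seg w i r" "w \<in> S" "i < length w" by (auto simp: rose_simps)
    then show "c \<in> insert Hub ((\<lambda>(w, i). Knot w i) ` ?I \<union> (\<lambda>((w, i), r). Seg w i r) ` (?I \<times> UNIV))"
    proof cases
      case 2
      then show ?thesis by (intro insertI2 UnI1 image_eqI[of _ _ "(w, i)"]) auto
    next
      case 3
      then show ?thesis by (intro insertI2 UnI2 image_eqI[of _ _ "((w, i), r)"]) auto
    qed simp
  qed
  moreover have "finite \<dots>" using S by simp
  ultimately show ?thesis by (rule finite_subset)
qed

lemma rose_lcc:
  assumes "S \<subseteq> words"
  shows "lcc \<Gamma> (rose S)"
proof (rule lccI, unfold rose_simps(1,2))
  fix c assume c: "c \<in> cubes (rose S)"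
  have s: "w ! i \<in> pverts \<Gamma>" if "c = Seg w i r" for w i r
    using c that assms by (auto simp: rose_simps in_lists_conv_set)
  show "clique \<Gamma> (rose_labels c)" using s by (cases c) (auto simp: clique_def)
  show "rose_face (rose_labels c) {} c = c" by (cases c) auto
  show "A = {}" if "A \<subseteq> rose_labels c" "rose_face (rose_labels c) A c = c" for A
    using that by (cases c) auto
  fix L A assume LA: "L \<subseteq> rose_labels c" "A \<subseteq> rose_labels c"
  have vert: "rose_vertex w j \<in> cubes (rose S) \<and> rose_labels (rose_vertex w j) = {} \<and>
      (\<forall>C. rose_face {} C (rose_vertex w j) = rose_vertex w j)"
    if "w \<in> S" "j \<le> length w" for w j
    using that by (auto simp: rose_vertex_def rose_simps)
  show "rose_face L A c \<in> cubes (rose S) \<and> rose_labels (rose_face L A c) = L"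
  proof (cases c)
    case (Seg w i r)
    then have w: "w \<in> S" "i < length w" using c by (auto simp: rose_simps)
    show ?thesis using LA Seg w vert[of w i] vert[of w "Suc i"] by (auto simp: rose_simps subset_singleton_iff)
  qed (use LA c in auto)
  fix M C assume MC: "M \<subseteq> L" "C \<subseteq> L"
  show "rose_face M C (rose_face L A c) = rose_face M (sym_diff A C) c"
  proof (cases c)
    case (Seg w i r)
    then have w: "w \<in> S" "i < length w" using c by (auto simp: rose_simps)
    have "L = {} \<or> L = {w ! i}" "A = {} \<or> A = {w ! i}" using LA Seg by auto
    moreover have "M = {} \<or> M = L" "C = {} \<or> C = L" using MC calculation by auto
    ultimately show ?thesis using Seg vert[of w i] vert[of w "Suc i"] w by (elim disjE) simp_all
  qed auto
qed

lemma rose_connected: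
  assumes "S \<subseteq> words"
  shows "path_connected_complex (rose S)"
  unfolding path_connected_complex_def
proof (intro conjI ballI)
  interpret lcc \<Gamma> "rose S" using assms by (rule rose_lcc)
  show "vertices (rose S) \<noteq> {}" using Hub_vertex by blast
  have reach: "\<exists>w. walk (rose S) Hub w v" if "v \<in> vertices (rose S)" for v
  proof -
    from rose_vertices[OF that] consider "v = Hub" | w i where "w \<in> S" "i \<le> length w" "v = rose_vertex w i" by blast
    then show ?thesis
    proof cases
      case 1
      then show ?thesis using Hub_vertex by (intro exI[of _ "[]"]) simp
    next
      case 2
      then show ?thesis using rose_walk[OF lcc_axioms hom_id 2(1,2)] by auto
    qed
  qed
  fix u v assume "u \<in> vertices (rose S)" "v \<in> vertices (rose S)"
  then obtain x y where "walk (rose S) Hub x u" "walk (rose S) Hub y v" using reach by blast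
  then have "walk (rose S) u (rev x @ y) v" using walk_rev by (auto simp: walk_append)
  then show "\<exists>p. edge_path (rose S) u p v" by (auto simp: walk_def)
qed

text \<open>The stages have to share one type of cells, so the rose is first moved into it.\<close>

lemma copy_exists:
  fixes X :: "('v, 'a) labeled_complex"
  assumes X: "lcc \<Gamma> X" and fin: "finite (cubes X)"
  shows "\<exists>(Y :: ('v, 'd :: infinite) labeled_complex) i. lcc \<Gamma> Y \<and> finite (cubes Y) \<and> labeled_iso i X Y"
proof -
  interpret lcc \<Gamma> X by fact
  obtain i :: "'a \<Rightarrow> 'd" where i: "inj_on i (cubes X)" using infinite_inj_exists[OF fin infinite_UNIV] by blast
  let ?j = "inv_into (cubes X) i"
  define Y where "Y = \<lparr>cubes = i ` cubes X, labels = (\<lambda>y. labels X (?j y)), face = (\<lambda>L A y. i (face X L A (?j y)))\<rparr>"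
  have Y: "cubes Y = i ` cubes X" "labels Y (i x) = labels X x" "face Y L A (i x) = i (face X L A x)" if "x \<in> cubes X" for x L A
    using that i by (simp_all add: Y_def inv_into_f_f)
  have Yc: "cubes Y = i ` cubes X" by (simp add: Y_def)
  have "lcc \<Gamma> Y"
  proof (rule lccI)
    fix c assume "c \<in> cubes Y"
    then obtain x where x: "x \<in> cubes X" "c = i x" using Yc by blast
    show "clique \<Gamma> (labels Y c)" using x Y(2) label_clique by simp
    show "face Y (labels Y c) {} c = c" using x Y(2,3)[OF x(1)] face_full by simp
    show "A = {}" if A: "A \<subseteq> labels Y c" "face Y (labels Y c) A c = c" for A
    proof -
      have A': "A \<subseteq> labels X x" "i (face X (labels X x) A x) = i x" using A x Y(2,3)[OF x(1)] by simp_all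
      then have "face X (labels X x) A x = x" using inj_onD[OF i] face_cube[OF x(1) order_refl A'(1)] x(1) by blast
      then show ?thesis using face_free[OF x(1)] A' by simp
    qed
    fix L A assume LA: "L \<subseteq> labels Y c" "A \<subseteq> labels Y c"
    then have LA': "L \<subseteq> labels X x" "A \<subseteq> labels X x" using x Y(2)[OF x(1)] by auto
    note f = face_cube[OF x(1) LA'] face_labels[OF x(1) LA']
    show "face Y L A c \<in> cubes Y \<and> labels Y (face Y L A c) = L"
      using x Y(3)[OF x(1)] f Y(2)[OF f(1)] Yc by simp
    fix M C assume "M \<subseteq> L" "C \<subseteq> L"
    then show "face Y M C (face Y L A c) = face Y M (sym_diff A C) c"
      using x Y(3)[OF x(1)] Y(3)[OF f(1)] face_face[OF x(1) LA'] by simp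
  qed
  moreover have "labeled_iso i X Y"
    unfolding labeled_iso_def labeled_hom_def bij_betw_def using Y i Yc by simp
  ultimately show ?thesis using fin Yc by auto
qed

end

context racg_subgroup
begin

text \<open>Gives content to the statement on all standard completions: finiteness of all of them
  yields a finite one, from which quasiconvexity is deduced.\<close>

lemma standard_completion_exists:
  assumes "finitely_generated (racg \<Gamma>) G"
  shows "\<exists>(\<Omega> :: ('v, 'd :: infinite) labeled_complex) B. standard_completion \<Gamma> G \<Omega> B"
proof -
  obtain S0 where S0: "finite S0" "S0 \<subseteq> carrier (racg \<Gamma>)" "generate (racg \<Gamma>) S0 = G"
    using assms by (auto simp: finitely_generated_def)
  obtain S where S: "S \<subseteq> words" "finite S" "S0 = word_elem \<Gamma> ` S"
    using finite_subset_image[OF S0(1), of "word_elem \<Gamma>" words] S0(2) carrier_racg by auto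
  note rl = rose_lcc[OF S(1)]
  obtain X0 :: "('v, 'd) labeled_complex" and i where X0: "lcc \<Gamma> X0" "finite (cubes X0)" "labeled_iso i (rose S) X0"
    using copy_exists[OF rl rose_finite[OF S(2)]] by blast
  obtain Xs f L g where L: "operation_sequence \<Gamma> Xs f" "Xs 0 = X0" "direct_limit Xs f L g"
    "lcc \<Gamma> L" "folded L" "cube_full \<Gamma> L" using completion_exists[OF X0(1,2)] by blast
  have "completion_of_complex \<Gamma> (rose S) L (g 0 \<circ> i)"
    unfolding completion_of_complex_def
    using L X0(3) lcc.lcc[OF rl] lcc.lcc[OF L(4)] rose_finite[OF S(2)] rose_connected[OF S(1)] by blast
  then have "standard_completion \<Gamma> G L ((g 0 \<circ> i) Hub)"
    unfolding standard_completion_def using S S0(3) by blast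
  then show ?thesis by blast
qed

lemma quasiconvex_imp:
  assumes "quasiconvex (racg \<Gamma>) (gens \<Gamma> (pverts \<Gamma>)) G"
  shows "finitely_generated (racg \<Gamma>) G" "standard_completion \<Gamma> G (\<Omega> :: ('v, 'd) labeled_complex) B \<Longrightarrow> finite (cubes \<Omega>)"
proof -
  obtain M where M: "qconvex M" using assms quasiconvex_words by blast
  show "finitely_generated (racg \<Gamma>) G" by (rule qconvex_finitely_generated[OF M])
  show "finite (cubes \<Omega>)" if "standard_completion \<Gamma> G \<Omega> B" by (rule qconvex_imp_finite[OF M that])
qed

lemma finite_standard_completion_imp:
  assumes "standard_completion \<Gamma> G (\<Omega> :: ('v, 'd) labeled_complex) B" "finite (cubes \<Omega>)"
  shows "quasiconvex (racg \<Gamma>) (gens \<Gamma> (pverts \<Gamma>)) G"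
proof -
  interpret completion_of \<Gamma> G \<Omega> B
    using standard_completion_is_completion[OF assms(1)] by unfold_locales
  have "finite (vertices \<Omega>)" using assms(2) by (simp add: vertices_def)
  then show ?thesis using finite_imp_qconvex quasiconvex_words by blast
qed

end

text \<open>The cells of standard completions are taken from an infinite type, where a finitely
  generated subgroup is sure to have one; the universal and the existential form are stated over
  this same type.\<close>

theorem theorem1:
  fixes \<Gamma> :: "'v pair_pre_digraph" and G :: "'v list set set"
  assumes "pair_graph \<Gamma>" and "subgroup G (racg \<Gamma>)"
  shows
    "(quasiconvex (racg \<Gamma>) (gens \<Gamma> (pverts \<Gamma>)) G \<longleftrightarrow>
        finitely_generated (racg \<Gamma>) G \<and>
        (\<forall>(\<Omega> :: ('v, 'd::infinite) labeled_complex) B.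
           standard_completion \<Gamma> G \<Omega> B \<longrightarrow> finite (cubes \<Omega>))) \<and>
     (quasiconvex (racg \<Gamma>) (gens \<Gamma> (pverts \<Gamma>)) G \<longleftrightarrow>
        finitely_generated (racg \<Gamma>) G \<and>
        (\<exists>(\<Omega> :: ('v, 'd) labeled_complex) B.
           standard_completion \<Gamma> G \<Omega> B \<and> finite (cubes \<Omega>))) \<and>
     (\<forall>(\<Omega> :: ('v, 'c) labeled_complex) B. completion \<Gamma> G \<Omega> B \<longrightarrow>
        (resolved \<Gamma> \<Omega> \<longrightarrow>
           (finite (rcosets\<^bsub>racg \<Gamma>\<^esub> G) \<longleftrightarrow> finite (cubes \<Omega>) \<and> full_valence \<Gamma> \<Omega>)) \<and>
        (has_torsion (racg \<Gamma>) G \<longleftrightarrow>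
           (\<exists>v p. edge_loop \<Omega> v p \<and> reduced \<Gamma> (path_label \<Omega> p) \<and>
              word_elem \<Gamma> (path_label \<Omega> p) \<noteq> \<one>\<^bsub>racg \<Gamma>\<^esub> \<and>
              (\<exists>T\<subseteq>pverts \<Gamma>. finite (special_subgroup \<Gamma> T) \<and>
                 word_elem \<Gamma> (path_label \<Omega> p) \<in> special_subgroup \<Gamma> T))) \<and>
        (let \<Delta> = {s \<in> pverts \<Gamma>. \<forall>g\<in>G.
                    word_elem \<Gamma> [s] \<otimes>\<^bsub>racg \<Gamma>\<^esub> g = g \<otimes>\<^bsub>racg \<Gamma>\<^esub> word_elem \<Gamma> [s]}
         in G \<lhd> racg \<Gamma> \<longleftrightarrow>
              (\<forall>s\<in>pverts \<Gamma> - \<Delta>. \<exists>e\<in>edges \<Omega>. labels \<Omega> e = {s} \<and> edge_start \<Omega> e = B) \<and>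
              (\<forall>v\<in>vertices \<Omega>. \<exists>f.
                 labeled_iso f (core_graph \<Gamma> \<Omega> B) (core_graph \<Gamma> \<Omega> v) \<and> f B = v)) \<and>
        (\<not> has_torsion (racg \<Gamma>) G \<longrightarrow>
           nonpositively_curved \<Omega> \<and>
           fundamental_group \<Omega> B \<cong> racg \<Gamma>\<lparr>carrier := G\<rparr>))"
proof -
  interpret racg_subgroup \<Gamma> G
    by (intro racg_subgroup.intro right_angled.intro racg_subgroup_axioms.intro assms)
  let ?qc = "quasiconvex (racg \<Gamma>) (gens \<Gamma> (pverts \<Gamma>)) G"
  have qc_all: "?qc \<longleftrightarrow> finitely_generated (racg \<Gamma>) G \<and>
        (\<forall>(\<Omega> :: ('v, 'd) labeled_complex) B. standard_completion \<Gamma> G \<Omega> B \<longrightarrow> finite (cubes \<Omega>))"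
    using quasiconvex_imp finite_standard_completion_imp standard_completion_exists by metis
  have qc_ex: "?qc \<longleftrightarrow> finitely_generated (racg \<Gamma>) G \<and>
        (\<exists>(\<Omega> :: ('v, 'd) labeled_complex) B. standard_completion \<Gamma> G \<Omega> B \<and> finite (cubes \<Omega>))"
    using quasiconvex_imp finite_standard_completion_imp standard_completion_exists by metis
  have completions: "(resolved \<Gamma> \<Omega> \<longrightarrow>
           (finite (rcosets\<^bsub>racg \<Gamma>\<^esub> G) \<longleftrightarrow> finite (cubes \<Omega>) \<and> full_valence \<Gamma> \<Omega>)) \<and>
        (has_torsion (racg \<Gamma>) G \<longleftrightarrow>
           (\<exists>v p. edge_loop \<Omega> v p \<and> reduced \<Gamma> (path_label \<Omega> p) \<and>
              word_elem \<Gamma> (path_label \<Omega> p) \<noteq> \<one>\<^bsub>racg \<Gamma>\<^esub> \<and>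
              (\<exists>T\<subseteq>pverts \<Gamma>. finite (special_subgroup \<Gamma> T) \<and>
                 word_elem \<Gamma> (path_label \<Omega> p) \<in> special_subgroup \<Gamma> T))) \<and>
        (let \<Delta> = {s \<in> pverts \<Gamma>. \<forall>g\<in>G.
                    word_elem \<Gamma> [s] \<otimes>\<^bsub>racg \<Gamma>\<^esub> g = g \<otimes>\<^bsub>racg \<Gamma>\<^esub> word_elem \<Gamma> [s]}
         in G \<lhd> racg \<Gamma> \<longleftrightarrow>
              (\<forall>s\<in>pverts \<Gamma> - \<Delta>. \<exists>e\<in>edges \<Omega>. labels \<Omega> e = {s} \<and> edge_start \<Omega> e = B) \<and>
              (\<forall>v\<in>vertices \<Omega>. \<exists>f.
                 labeled_iso f (core_graph \<Gamma> \<Omega> B) (core_graph \<Gamma> \<Omega> v) \<and> f B = v)) \<and>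
        (\<not> has_torsion (racg \<Gamma>) G \<longrightarrow>
           nonpositively_curved \<Omega> \<and>
           fundamental_group \<Omega> B \<cong> racg \<Gamma>\<lparr>carrier := G\<rparr>)"
    if c: "completion \<Gamma> G \<Omega> B" for \<Omega> :: "('v, 'c) labeled_complex" and B
  proof -
    interpret completion_of \<Gamma> G \<Omega> B using c by unfold_locales
    have 3: "nonpositively_curved \<Omega> \<and> fundamental_group \<Omega> B \<cong> racg \<Gamma>\<lparr>carrier := G\<rparr>"
      if "\<not> has_torsion (racg \<Gamma>) G"
    proof -
      interpret torsion_free_completion \<Gamma> G \<Omega> B using that by unfold_locales
      show ?thesis using nonpositively_curved fundamental_group_iso by blast
    qed
    show ?thesis
      unfolding Let_def
      by (rule conjI[OF impI[OF finite_index] conjI[OF has_torsion_iff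
          conjI[OF normal_iff[unfolded central_def] impI[OF 3]]]])
  qed
  show ?thesis
    by (rule conjI[OF qc_all conjI[OF qc_ex]]) (intro allI impI, rule completions, assumption)
qed

end
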